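(* Let $1\le p,q<\infty$ and let $w$ be a strictly positive submultiplicative polynomially moderate weight on $\mathbb R^{2d}$. Then the modulation space $\mathcal M_w^{p,q}(\mathbb R^d)$ has the metric approximation property. Consequently, the Wiener amalgam space $\mathcal W_w^{p,q}(\mathbb R^d)$ also has the metric approximation property.
   Context: A weight function on $\mathbb R^{2d}$ is a non-negative locally integrable function. A weight $v$ is submultiplicative if $v(x+y)\le v(x)v(y)$ for all $x,y\in\mathbb R^{2d}$. A weight $w$ is $v$-moderate if $w(x+y)\le v(x)w(y)$ for all $x,y\in\mathbb R^{2d}$. With $v_s(x,\xi)=(1+|x|^2+|\xi|^2)^{s/2}$, a weight is polynomially moderate if it is $v_s$-moderate for some $s$. For a fixed nonzero window $g\in\mathcal S(\mathbb R^d)$ and $f\in\mathcal S'(\mathbb R^d)$, the short-time Fourier transform is $V_gf(x,\xi)=\int_{\mathbb R^d}f(y)\overline{g(y-x)}e^{-iy\cdot\xi}\,dy$ (in the distributional sense). The modulation space $\mathcal M_w^{p,q}(\mathbb R^d)$ consists of the $f\in\mathcal S'(\mathbb R^d)$ with $$\|f\|_{\mathcal M_w^{p,q}}=\left(\int_{\mathbb R^d}\left(\int_{\mathbb R^d}|V_gf(x,\xi)|^pw(x,\xi)^p\,dx\right)^{q/p}d\xi\right)^{1/q}<\infty .$$ The Wiener amalgam space $\mathcal W_w^{p,q}(\mathbb R^d)$ consists of the $f\in\mathcal S'(\mathbb R^d)$ with $$\|f\|_{\mathcal W_w^{p,q}}=\left(\int_{\mathbb R^d}\left(\int_{\mathbb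 R^d}|V_gf(x,\xi)|^qw(x,\xi)^q\,d\xi\right)^{p/q}dx\right)^{1/p}<\infty .$$ Both are Banach spaces, and different nonzero windows give the same space with equivalent norms. A Banach space $\mathcal B$ has the metric approximation property if for every compact set $K\subset\mathcal B$ and every $\epsilon>0$ there exists a bounded finite rank linear operator $F:\mathcal B\to\mathcal B$ with $\|F\|\le1$ and $\|x-Fx\|<\epsilon$ for every $x\in K$. *)

theory Defs
  imports "HOL-Analysis.Analysis"
begin

section \<open>Banach spaces on a carrier, and the metric approximation property\<close>

text \<open>
  The modulation and amalgam spaces depend on parameters (exponents, weight, window), hence cannot
  be types. A Banach space is given by a carrier, which is a linear subspace of an ambient
  complex vector space, and a norm that is only meaningful on this carrier.

  The distance is cut off outside the carrier because \<^locale>\<open>Metric_space\<close> requires symmetry and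
  non-negativity on the whole type.
\<close>

definition norm_dist :: "'a::ab_group_add set \<Rightarrow> ('a \<Rightarrow> real) \<Rightarrow> 'a \<Rightarrow> 'a \<Rightarrow> real" where
  "norm_dist V N x y = (if x \<in> V \<and> y \<in> V then N (x - y) else 0)"

locale normed_space_on = vector_space smul
  for smul :: "complex \<Rightarrow> 'a::ab_group_add \<Rightarrow> 'a" +
  fixes V :: "'a set" and N :: "'a \<Rightarrow> real"
  assumes subspace_carrier: "subspace V"
    and norm_nonneg: "x \<in> V \<Longrightarrow> 0 \<le> N x"
    and norm_eq_zero_iff: "x \<in> V \<Longrightarrow> N x = 0 \<longleftrightarrow> x = 0"
    and norm_triangle: "x \<in> V \<Longrightarrow> y \<in> V \<Longrightarrow> N (x + y) \<le> N x + N y"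
    and norm_scale: "x \<in> V \<Longrightarrow> N (smul c x) = cmod c * N x"
begin

lemma norm_minus: "x \<in> V \<Longrightarrow> N (- x) = N x"
  using norm_scale[of x "-1"] by simp

sublocale Metric_space V "norm_dist V N"
proof
  fix x y z
  show "0 \<le> norm_dist V N x y"
    using norm_nonneg subspace_diff[OF subspace_carrier] by (simp add: norm_dist_def)
  show "norm_dist V N x y = norm_dist V N y x"
    using norm_minus[of "x - y"] subspace_diff[OF subspace_carrier] by (simp add: norm_dist_def)
  show "norm_dist V N x y = 0 \<longleftrightarrow> x = y" if "x \<in> V" "y \<in> V"
    using norm_eq_zero_iff[OF subspace_diff[OF subspace_carrier that]] that
    by (simp add: norm_dist_def)
  show "norm_dist V N x z \<le> norm_dist V N x y + norm_dist V N y z"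
    if "x \<in> V" "y \<in> V" "z \<in> V"
    using norm_triangle[of "x - y" "y - z"] subspace_diff[OF subspace_carrier] that
    by (simp add: norm_dist_def)
qed

text \<open>
  Linear operators from the carrier to itself. Such an operator is a function on the ambient type
  whose values outside the carrier are irrelevant.
\<close>

definition operator_on :: "('a \<Rightarrow> 'a) \<Rightarrow> bool" where
  "operator_on F \<longleftrightarrow> F ` V \<subseteq> V \<and>
     (\<forall>x\<in>V. \<forall>y\<in>V. F (x + y) = F x + F y) \<and> (\<forall>c. \<forall>x\<in>V. F (smul c x) = smul c (F x))"

definition bounded_operator_on :: "('a \<Rightarrow> 'a) \<Rightarrow> bool" where
  "bounded_operator_on F \<longleftrightarrow> operator_on F \<and> (\<exists>C. \<forall>x\<in>V. N (F x) \<le> C * N x)"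

text \<open>As in \<^const>\<open>onorm\<close>, the vector \<open>x = 0\<close> contributes \<open>0 / 0 = 0\<close> to the supremum.\<close>

definition operator_norm_on :: "('a \<Rightarrow> 'a) \<Rightarrow> real" where
  "operator_norm_on F = (SUP x\<in>V. N (F x) / N x)"

definition finite_rank_on :: "('a \<Rightarrow> 'a) \<Rightarrow> bool" where
  "finite_rank_on F \<longleftrightarrow> (\<exists>B. finite B \<and> B \<subseteq> V \<and> F ` V \<subseteq> span B)"

end

locale banach_space_on = normed_space_on +
  assumes complete: "mcomplete"

definition metric_approximation_property ::
    "(complex \<Rightarrow> 'a::ab_group_add \<Rightarrow> 'a) \<Rightarrow> 'a set \<Rightarrow> ('a \<Rightarrow> real) \<Rightarrow> bool" where
  "metric_approximation_property smul V N \<longleftrightarrow>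
     banach_space_on smul V N \<and>
     (\<forall>K \<epsilon>. compactin (Metric_space.mtopology V (norm_dist V N)) K \<and> \<epsilon> > 0 \<longrightarrow>
        (\<exists>F. normed_space_on.bounded_operator_on smul V N F \<and>
             normed_space_on.finite_rank_on smul V F \<and>
             normed_space_on.operator_norm_on V N F \<le> 1 \<and>
             (\<forall>x\<in>K. N (x - F x) < \<epsilon>)))"


section \<open>Schwartz functions and tempered distributions\<close>

definition partial_deriv :: "'n::finite \<Rightarrow> (real^'n \<Rightarrow> complex) \<Rightarrow> real^'n \<Rightarrow> complex" where
  "partial_deriv i f x = frechet_derivative f (at x) (axis i 1)"

text \<open>Multi-indices are given as lists of coordinates, one entry per differentiation.\<close>

definition iter_partial_deriv :: "'n::finite list \<Rightarrow> (real^'n \<Rightarrow> complex) \<Rightarrow> real^'n \<Rightarrow> complex" where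
  "iter_partial_deriv is f = foldr partial_deriv is f"

definition schwartz :: "(real^'n::finite \<Rightarrow> complex) set" where
  "schwartz = {f. \<forall>is.
     (\<forall>x. iter_partial_deriv is f differentiable (at x)) \<and>
     (\<forall>k::nat. bounded (range (\<lambda>x. (1 + norm x) ^ k *\<^sub>R iter_partial_deriv is f x)))}"

definition schwartz_seminorm :: "nat \<Rightarrow> 'n::finite list \<Rightarrow> (real^'n \<Rightarrow> complex) \<Rightarrow> real" where
  "schwartz_seminorm k is f = (SUP x. norm ((1 + norm x) ^ k *\<^sub>R iter_partial_deriv is f x))"

definition schwartz_topology :: "(real^'n::finite \<Rightarrow> complex) topology" where
  "schwartz_topology = topology_generated_by
     {{h \<in> schwartz. schwartz_seminorm k is (\<lambda>x. h x - f x) < e} |f k is e. f \<in> schwartz \<and> e > 0}"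

text \<open>
  A tempered distribution is a continuous linear functional on the Schwartz space. Requiring the
  value \<open>0\<close> at non-Schwartz arguments makes its representation as a total function unique.
\<close>

typedef 'n::finite tempered_distribution =
  "{T :: (real^'n \<Rightarrow> complex) \<Rightarrow> complex.
      (\<forall>f\<in>schwartz. \<forall>h\<in>schwartz. T (\<lambda>x. f x + h x) = T f + T h) \<and>
      (\<forall>c. \<forall>f\<in>schwartz. T (\<lambda>x. c * f x) = c * T f) \<and>
      continuous_map schwartz_topology euclidean T \<and>
      (\<forall>f. f \<notin> schwartz \<longrightarrow> T f = 0)}"
  morphisms apply_dist Abs_dist
  by (rule exI[of _ "\<lambda>_. 0"]) simp

setup_lifting type_definition_tempered_distribution

instantiation tempered_distribution :: (finite) ab_group_add
begin

lift_definition zero_tempered_distribution :: "'a tempered_distribution" is "\<lambda>_. 0"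
  by simp

lift_definition plus_tempered_distribution ::
    "'a tempered_distribution \<Rightarrow> 'a tempered_distribution \<Rightarrow> 'a tempered_distribution"
  is "\<lambda>S T f. S f + T f"
  by (auto simp: algebra_simps intro: continuous_map_add)

lift_definition uminus_tempered_distribution ::
    "'a tempered_distribution \<Rightarrow> 'a tempered_distribution"
  is "\<lambda>T f. - T f"
  by (auto intro: continuous_map_minus)

lift_definition minus_tempered_distribution ::
    "'a tempered_distribution \<Rightarrow> 'a tempered_distribution \<Rightarrow> 'a tempered_distribution"
  is "\<lambda>S T f. S f - T f"
  by (auto simp: algebra_simps intro: continuous_map_diff)

instance
  by standard (transfer; simp add: fun_eq_iff)+

end

lemma continuous_map_cmult:
  fixes T :: "'a \<Rightarrow> complex"
  assumes "continuous_map X euclidean T"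
  shows "continuous_map X euclidean (\<lambda>f. c * T f)"
proof -
  have "continuous_map euclidean euclidean (\<lambda>z. c * z)"
    by (simp add: continuous_on_mult_left)
  from continuous_map_compose[OF assms this] show ?thesis
    by (simp add: o_def)
qed

lift_definition scale_dist :: "complex \<Rightarrow> 'n::finite tempered_distribution \<Rightarrow> 'n tempered_distribution"
  is "\<lambda>c T f. c * T f"
  by (auto simp: distrib_left mult.left_commute intro: continuous_map_cmult)

global_interpretation dist: vector_space scale_dist
  by standard (transfer; simp add: algebra_simps)+


section \<open>Weights\<close>

definition weight :: "((real^'n::finite) \<times> (real^'n) \<Rightarrow> real) \<Rightarrow> bool" where
  "weight w \<longleftrightarrow> (\<forall>z. 0 \<le> w z) \<and> (\<forall>K. compact K \<longrightarrow> w absolutely_integrable_on K)"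

definition submultiplicative :: "((real^'n::finite) \<times> (real^'n) \<Rightarrow> real) \<Rightarrow> bool" where
  "submultiplicative v \<longleftrightarrow> (\<forall>x y. v (x + y) \<le> v x * v y)"

definition moderate ::
    "((real^'n::finite) \<times> (real^'n) \<Rightarrow> real) \<Rightarrow> ((real^'n) \<times> (real^'n) \<Rightarrow> real) \<Rightarrow> bool" where
  "moderate v w \<longleftrightarrow> (\<forall>x y. w (x + y) \<le> v x * w y)"

definition poly_weight :: "real \<Rightarrow> (real^'n::finite) \<times> (real^'n) \<Rightarrow> real" where
  "poly_weight s = (\<lambda>(x, \<xi>). (1 + (norm x)\<^sup>2 + (norm \<xi>)\<^sup>2) powr (s / 2))"

definition polynomially_moderate :: "((real^'n::finite) \<times> (real^'n) \<Rightarrow> real) \<Rightarrow> bool" where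
  "polynomially_moderate w \<longleftrightarrow> (\<exists>s. moderate (poly_weight s) w)"


section \<open>Modulation spaces and Wiener amalgam spaces\<close>

definition stft ::
    "(real^'n::finite \<Rightarrow> complex) \<Rightarrow> 'n tempered_distribution \<Rightarrow> real^'n \<Rightarrow> real^'n \<Rightarrow> complex" where
  "stft g f x \<xi> = apply_dist f (\<lambda>y. cnj (g (y - x)) * exp (- \<i> * complex_of_real (y \<bullet> \<xi>)))"

text \<open>Real powers of extended non-negative numbers; only used with positive exponents.\<close>

definition ennpowr :: "ennreal \<Rightarrow> real \<Rightarrow> ennreal" where
  "ennpowr a r = (if a = \<infinity> then \<infinity> else ennreal (enn2real a powr r))"

definition modulation_ennorm ::
    "(real^'n::finite \<Rightarrow> complex) \<Rightarrow> real \<Rightarrow> real \<Rightarrow> ((real^'n) \<times> (real^'n) \<Rightarrow> real)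
       \<Rightarrow> 'n tempered_distribution \<Rightarrow> ennreal" where
  "modulation_ennorm g p q w f =
     ennpowr (\<integral>\<^sup>+ \<xi>. ennpowr
       (\<integral>\<^sup>+ x. ennreal (cmod (stft g f x \<xi>) powr p * w (x, \<xi>) powr p) \<partial>lborel) (q / p)
     \<partial>lborel) (1 / q)"

definition modulation_space ::
    "(real^'n::finite \<Rightarrow> complex) \<Rightarrow> real \<Rightarrow> real \<Rightarrow> ((real^'n) \<times> (real^'n) \<Rightarrow> real)
       \<Rightarrow> 'n tempered_distribution set" where
  "modulation_space g p q w = {f. modulation_ennorm g p q w f < \<infinity>}"

definition modulation_norm ::
    "(real^'n::finite \<Rightarrow> complex) \<Rightarrow> real \<Rightarrow> real \<Rightarrow> ((real^'n) \<times> (real^'n) \<Rightarrow> real)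
       \<Rightarrow> 'n tempered_distribution \<Rightarrow> real" where
  "modulation_norm g p q w f = enn2real (modulation_ennorm g p q w f)"

definition amalgam_ennorm ::
    "(real^'n::finite \<Rightarrow> complex) \<Rightarrow> real \<Rightarrow> real \<Rightarrow> ((real^'n) \<times> (real^'n) \<Rightarrow> real)
       \<Rightarrow> 'n tempered_distribution \<Rightarrow> ennreal" where
  "amalgam_ennorm g p q w f =
     ennpowr (\<integral>\<^sup>+ x. ennpowr
       (\<integral>\<^sup>+ \<xi>. ennreal (cmod (stft g f x \<xi>) powr q * w (x, \<xi>) powr q) \<partial>lborel) (p / q)
     \<partial>lborel) (1 / p)"

definition amalgam_space ::
    "(real^'n::finite \<Rightarrow> complex) \<Rightarrow> real \<Rightarrow> real \<Rightarrow> ((real^'n) \<times> (real^'n) \<Rightarrow> real)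
       \<Rightarrow> 'n tempered_distribution set" where
  "amalgam_space g p q w = {f. amalgam_ennorm g p q w f < \<infinity>}"

definition amalgam_norm ::
    "(real^'n::finite \<Rightarrow> complex) \<Rightarrow> real \<Rightarrow> real \<Rightarrow> ((real^'n) \<times> (real^'n) \<Rightarrow> real)
       \<Rightarrow> 'n tempered_distribution \<Rightarrow> real" where
  "amalgam_norm g p q w f = enn2real (amalgam_ennorm g p q w f)"

end

theory Submission
  imports Defs "HOL-Probability.Probability" "HOL-Real_Asymp.Real_Asymp"
begin

text \<open>
  Averaging time-frequency shifts against a probability density concentrated near the origin gives
  an operator \<open>E\<close> of norm close to \<open>1\<close> on every space defined by a moderate weighted mixed norm of
  the short-time Fourier transform, whatever the window: shifts translate \<open>V\<^sub>g f\<close> up to a unimodular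
  factor, and the weight changes little under small translations. These operators tend strongly to
  the identity. With a Gaussian density, \<open>E\<close> is convolution by a Gaussian followed by
  multiplication by a Gaussian, so \<open>E\<^sup>2 f\<close> is an integral of rank-one operators which finite sums
  approximate in operator norm. Rescaling such a sum by a factor close to \<open>1\<close> makes it a
  contraction, and contractions close to the identity on a finite net are close to it on a compact
  set.

  Completeness of the spaces and the uniform approximation both rest on the estimate of
  \<open>\<bar>f(\<phi>)\<bar>\<close> by the norm of \<open>f\<close> times a Schwartz seminorm of \<open>\<phi>\<close>, which follows from a Fourier
  inversion regularised by Gaussians.
\<close>

section \<open>Weighted bounds and Schwartz functions\<close>

text \<open>Two points shape the argument. The operators must be contractions for the given norm
  itself, so nothing may pass through an equivalent norm or another window: the operator norm of
  \<open>smoothing \<delta>\<close> has to be 1 + O(\<delta>). This comes from the convexity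
  estimate \<open>pweight_scale_le\<close>, with the Gaussian moment \<open>pmoment S\<close> as
  constant. Moreover, one averaging is not enough for a rank-one representation:
  \<open>smoothing \<delta> f\<close> is a superposition of point masses, which need not lie in the
  space, whereas the intermediate variable of the square indexes the Gaussians
  \<open>gker \<delta> y\<close>, which do. Integrals with values in the space are avoided. Finite
  sums converge for each test function, hence for each value of the short-time Fourier transform,
  and norm bounds survive the limit by Fatou's lemma. The two kinds of spaces differ only in the
  order of the two integrations, so both are instances of one list of norm axioms.\<close>

lemma partial_deriv_eq:
  "(f has_derivative D) (at x) \<Longrightarrow> partial_deriv i f x = D (axis i 1)"
  unfolding partial_deriv_def using frechet_derivative_at by metis

lemma has_derivative_partial_deriv:
  fixes f :: "real^'n::finite \<Rightarrow> complex"
  assumes "f differentiable at x"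
  shows "(f has_derivative (\<lambda>v. \<Sum>i\<in>UNIV. (v $ i) *\<^sub>R partial_deriv i f x)) (at x)"
proof -
  let ?D = "frechet_derivative f (at x)"
  have D: "(f has_derivative ?D) (at x)"
    using assms frechet_derivative_works by blast
  then have lin: "linear ?D" by (rule has_derivative_linear)
  have "?D v = (\<Sum>i\<in>UNIV. (v $ i) *\<^sub>R partial_deriv i f x)" for v
  proof -
    have "?D v = ?D (\<Sum>i\<in>UNIV. (v $ i) *\<^sub>R axis i 1)"
      using basis_expansion[of v] by (simp add: scalar_mult_eq_scaleR)
    also have "\<dots> = (\<Sum>i\<in>UNIV. (v $ i) *\<^sub>R partial_deriv i f x)"
      by (simp add: linear_sum[OF lin] linear_cmul[OF lin] partial_deriv_def)
    finally show ?thesis .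
  qed
  then have "?D = (\<lambda>v. \<Sum>i\<in>UNIV. (v $ i) *\<^sub>R partial_deriv i f x)" by blast
  with D show ?thesis by simp
qed

lemma partial_deriv_add:
  assumes "\<And>x. f differentiable at x" "\<And>x. g differentiable at x"
  shows "partial_deriv i (\<lambda>x. f x + g x) = (\<lambda>x. partial_deriv i f x + partial_deriv i g x)"
  using has_derivative_add[OF frechet_derivative_works[THEN iffD1, OF assms(1)]
      frechet_derivative_works[THEN iffD1, OF assms(2)], THEN partial_deriv_eq]
  by (auto simp: partial_deriv_def)

lemma partial_deriv_cmult:
  assumes "\<And>x. f differentiable at x"
  shows "partial_deriv i (\<lambda>x. c * f x) = (\<lambda>x. c * partial_deriv i f x)"
  using has_derivative_mult_right[OF frechet_derivative_works[THEN iffD1, OF assms],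
      THEN partial_deriv_eq] by (auto simp: partial_deriv_def)

lemma partial_deriv_mult:
  assumes "\<And>x. f differentiable at x" "\<And>x. g differentiable at x"
  shows "partial_deriv i (\<lambda>x. f x * g x) =
    (\<lambda>x. f x * partial_deriv i g x + partial_deriv i f x * g x)"
  using has_derivative_mult[OF frechet_derivative_works[THEN iffD1, OF assms(1)]
      frechet_derivative_works[THEN iffD1, OF assms(2)], THEN partial_deriv_eq]
  by (auto simp: partial_deriv_def)

lemma partial_deriv_cnj:
  assumes "\<And>x. f differentiable at x"
  shows "partial_deriv i (\<lambda>x. cnj (f x)) = (\<lambda>x. cnj (partial_deriv i f x))"
  using has_derivative_cnj[OF frechet_derivative_works[THEN iffD1, OF assms],
      THEN partial_deriv_eq] by (auto simp: partial_deriv_def)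

lemma has_derivative_translate:
  assumes "(f has_derivative D) (at (y - x))"
  shows "((\<lambda>y. f (y - x)) has_derivative D) (at y)"
proof -
  have "((\<lambda>y. y - x) has_derivative (\<lambda>h. h)) (at y)"
    by (auto intro!: derivative_eq_intros)
  from has_derivative_compose[OF this assms] show ?thesis by simp
qed

lemma partial_deriv_translate:
  assumes "\<And>x. f differentiable at x"
  shows "partial_deriv i (\<lambda>y. f (y - x)) = (\<lambda>y. partial_deriv i f (y - x))"
  using has_derivative_translate[OF frechet_derivative_works[THEN iffD1, OF assms],
      THEN partial_deriv_eq] by (auto simp: partial_deriv_def)

lemma differentiable_translate:
  assumes "\<And>x. f differentiable at x"
  shows "(\<lambda>y. f (y - x)) differentiable at y"
  using has_derivative_translate[OF frechet_derivative_works[THEN iffD1, OF assms]]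
  by (auto simp: differentiable_def)

lemma differentiable_cnj:
  "f differentiable at x \<Longrightarrow> (\<lambda>x. cnj (f x)) differentiable at x"
  unfolding differentiable_def using has_derivative_cnj by blast

text \<open>
  The weighted \<open>C\<^sup>m\<close> bound behind the Schwartz seminorms; the weight is arbitrary so that the
  bounds for products, translates and modulates can be combined freely.
\<close>

primrec sbound :: "nat \<Rightarrow> (real^'n::finite \<Rightarrow> real) \<Rightarrow> real \<Rightarrow> (real^'n \<Rightarrow> complex) \<Rightarrow> bool" where
  "sbound 0 W B f \<longleftrightarrow> (\<forall>x. f differentiable at x) \<and> (\<forall>x. W x * cmod (f x) \<le> B)"
| "sbound (Suc m) W B f \<longleftrightarrow> (\<forall>x. f differentiable at x) \<and> (\<forall>x. W x * cmod (f x) \<le> B) \<and>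
     (\<forall>i. sbound m W B (partial_deriv i f))"

section \<open>Calculus of the weighted derivative bounds\<close>

lemma sbound_diffD: "sbound m W B f \<Longrightarrow> f differentiable at x"
  by (cases m) auto

lemma sbound_leD: "sbound m W B f \<Longrightarrow> W x * cmod (f x) \<le> B"
  by (cases m) auto

lemma sbound_SucD: "sbound (Suc m) W B f \<Longrightarrow> sbound m W B (partial_deriv i f)"
  by simp

lemma sbound_SucI:
  assumes "sbound 0 W B f" "\<And>i. sbound m W B (partial_deriv i f)"
  shows "sbound (Suc m) W B f"
  using assms by simp

lemma sbound_nonneg: "sbound m W B f \<Longrightarrow> (\<And>x. 0 \<le> W x) \<Longrightarrow> 0 \<le> B"
  using sbound_leD[of m W B f 0] by (meson mult_nonneg_nonneg norm_ge_zero order_trans)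

lemma sbound_mono:
  "sbound m W B f \<Longrightarrow> (\<And>x. W' x \<le> W x) \<Longrightarrow> B \<le> B' \<Longrightarrow> sbound m W' B' f"
proof (induction m arbitrary: f)
  case 0
  have "W' x * cmod (f x) \<le> B'" for x
    using mult_right_mono[OF 0(2), of "cmod (f x)" x] sbound_leD[OF 0(1), of x] 0(3) by simp
  with 0 show ?case by auto
next
  case (Suc m)
  have "W' x * cmod (f x) \<le> B'" for x
    using mult_right_mono[OF Suc(3), of "cmod (f x)" x] sbound_leD[OF Suc(2), of x] Suc(4) by simp
  with Suc show ?case by auto
qed

lemma sbound_monoB: "sbound m W B f \<Longrightarrow> B \<le> B' \<Longrightarrow> sbound m W B' f"
  using sbound_mono by blast

lemma sbound_less: "sbound (Suc m) W B f \<Longrightarrow> sbound m W B f"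
proof (induction m arbitrary: f)
  case 0
  then show ?case by simp
next
  case (Suc m)
  have "sbound m W B (partial_deriv i f)" for i
    using Suc.prems by (intro Suc.IH) simp
  with Suc.prems show ?case by simp
qed

lemma sbound_le: "sbound m W B f \<Longrightarrow> m' \<le> m \<Longrightarrow> sbound m' W B f"
  by (induction m) (auto simp: le_Suc_eq dest: sbound_less simp del: sbound.simps)

lemma sbound_cong: "sbound m W B f \<Longrightarrow> (\<And>x. f x = g x) \<Longrightarrow> sbound m W B g"
  by (metis ext)

lemma sbound_add:
  "sbound m W B f \<Longrightarrow> sbound m W C g \<Longrightarrow> (\<And>x. 0 \<le> W x) \<Longrightarrow> sbound m W (B + C) (\<lambda>x. f x + g x)"
proof (induction m arbitrary: f g)
  case 0
  have "W x * cmod (f x + g x) \<le> B + C" for x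
    using mult_left_mono[OF norm_triangle_ineq[of "f x" "g x"] 0(3)[of x]]
      sbound_leD[OF 0(1), of x] sbound_leD[OF 0(2), of x] by (simp add: distrib_left)
  with 0 show ?case by auto
next
  case (Suc m)
  have "W x * cmod (f x + g x) \<le> B + C" for x
    using mult_left_mono[OF norm_triangle_ineq[of "f x" "g x"] Suc.prems(3)[of x]]
      sbound_leD[OF Suc.prems(1), of x] sbound_leD[OF Suc.prems(2), of x]
    by (simp add: distrib_left)
  moreover have "sbound m W (B + C) (partial_deriv i (\<lambda>x. f x + g x))" for i
    using Suc by (subst partial_deriv_add) auto
  ultimately show ?case using Suc.prems by auto
qed

lemma sbound_cmult:
  "sbound m W B f \<Longrightarrow> sbound m W (cmod c * B) (\<lambda>x. c * f x)"
proof (induction m arbitrary: f)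
  case 0
  then show ?case
    by (auto simp: norm_mult mult.left_commute[of _ "cmod c"] intro!: mult_left_mono)
next
  case (Suc m)
  have "sbound m W (cmod c * B) (partial_deriv i (\<lambda>x. c * f x))" for i
    using Suc by (subst partial_deriv_cmult) auto
  then show ?case using Suc.prems
    by (auto simp: norm_mult mult.left_commute[of _ "cmod c"] intro!: mult_left_mono)
qed

lemma sbound_zero: "0 \<le> B \<Longrightarrow> sbound m W B (\<lambda>_. 0)"
proof (induction m)
  case (Suc m)
  have "partial_deriv i (\<lambda>_::real^'a. 0) = (\<lambda>_. 0)" for i
    by (rule ext, subst partial_deriv_eq[OF has_derivative_const]) simp
  with Suc show ?case by simp
qed simp

lemma sbound_const: "cmod c \<le> B \<Longrightarrow> sbound m (\<lambda>_. 1) B (\<lambda>_. c)"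
proof (cases m)
  case (Suc m)
  assume "cmod c \<le> B"
  then have "0 \<le> B" using norm_ge_zero order_trans by blast
  moreover have "partial_deriv i (\<lambda>_::real^'a. c) = (\<lambda>_. 0)" for i
    by (rule ext, subst partial_deriv_eq[OF has_derivative_const]) simp
  ultimately show ?thesis using Suc \<open>cmod c \<le> B\<close> by (simp add: sbound_zero)
qed simp

text \<open>By the Leibniz rule each derivative turns a product into a sum of two products of the
  same kind; this doubles the bound, hence the factor \<open>2 ^ m\<close>.\<close>

lemma sbound_mult:
  assumes "\<And>x. 0 \<le> W x" "\<And>x. 0 \<le> W' x"
  shows "sbound m W B f \<Longrightarrow> sbound m W' C g \<Longrightarrow>
    sbound m (\<lambda>x. W x * W' x) (2 ^ m * B * C) (\<lambda>x. f x * g x)"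
proof (induction m arbitrary: f g)
  case 0
  have "W x * W' x * cmod (f x * g x) \<le> B * C" for x
    using mult_mono[OF sbound_leD[OF 0(1), of x] sbound_leD[OF 0(2), of x]]
      sbound_nonneg[OF 0(1) assms(1)] assms by (simp add: norm_mult mult_ac)
  with 0 show ?case by auto
next
  case (Suc m)
  have B0: "0 \<le> B" and C0: "0 \<le> C"
    using sbound_nonneg[OF Suc.prems(1) assms(1)] sbound_nonneg[OF Suc.prems(2) assms(2)] by auto
  have "W x * W' x * cmod (f x * g x) \<le> B * C" for x
    using mult_mono[OF sbound_leD[OF Suc.prems(1), of x] sbound_leD[OF Suc.prems(2), of x]]
      B0 assms by (simp add: norm_mult mult_ac)
  also have "B * C \<le> 2 ^ Suc m * B * C"
    using B0 C0 mult_right_mono[of 1 "2 ^ Suc m" "B * C"] by (simp add: mult_ac del: power_Suc)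
  finally have 1: "W x * W' x * cmod (f x * g x) \<le> 2 ^ Suc m * B * C" for x .
  have "sbound m (\<lambda>x. W x * W' x) (2 ^ Suc m * B * C) (partial_deriv i (\<lambda>x. f x * g x))" for i
  proof -
    have "sbound m (\<lambda>x. W x * W' x) (2 ^ m * B * C) (\<lambda>x. f x * partial_deriv i g x)"
      using Suc.prems by (intro Suc.IH) (auto intro: sbound_less sbound_SucD simp del: sbound.simps)
    moreover have "sbound m (\<lambda>x. W x * W' x) (2 ^ m * B * C) (\<lambda>x. partial_deriv i f x * g x)"
      using Suc.prems by (intro Suc.IH) (auto intro: sbound_less sbound_SucD simp del: sbound.simps)
    ultimately have "sbound m (\<lambda>x. W x * W' x) (2 ^ m * B * C + 2 ^ m * B * C)
        (\<lambda>x. f x * partial_deriv i g x + partial_deriv i f x * g x)"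
      using assms by (intro sbound_add) auto
    moreover have "2 ^ m * B * C + 2 ^ m * B * C = 2 ^ Suc m * B * C" by simp
    ultimately show ?thesis
      using Suc.prems by (simp only: partial_deriv_mult[OF sbound_diffD sbound_diffD])
  qed
  with 1 Suc.prems show ?case by (auto simp del: power_Suc)
qed

lemma sbound_cnj: "sbound m W B f \<Longrightarrow> sbound m W B (\<lambda>x. cnj (f x))"
  by (induction m arbitrary: f) (auto simp: partial_deriv_cnj differentiable_cnj)

lemma sbound_translate:
  "sbound m W B f \<Longrightarrow> sbound m (\<lambda>y. W (y - x)) B (\<lambda>y. f (y - x))"
  by (induction m arbitrary: f) (auto simp: partial_deriv_translate differentiable_translate)

text \<open>The character with the sign opposite to that in \<open>stft\<close>; this is why
  frequencies enter later as \<open>- \<xi>\<close>.\<close>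

definition cexp :: "real^'n::finite \<Rightarrow> real^'n \<Rightarrow> complex" where
  "cexp \<xi> y = exp (\<i> * complex_of_real (y \<bullet> \<xi>))"

lemma cexp_add: "cexp (\<xi> + \<eta>) y = cexp \<xi> y * cexp \<eta> y"
  by (simp add: cexp_def inner_add_right distrib_left exp_add)

lemma cexp_add_right: "cexp \<xi> (y + z) = cexp \<xi> y * cexp \<xi> z"
  by (simp add: cexp_def inner_add_left distrib_left exp_add)

lemma cexp_0 [simp]: "cexp 0 y = 1" by (simp add: cexp_def)

lemma cexp_minus: "cexp (- \<xi>) y = cexp \<xi> (- y)" by (simp add: cexp_def)

lemma borel_measurable_cexp[measurable]: "cexp \<xi> \<in> borel_measurable borel"
  unfolding cexp_def by measurable

lemma has_derivative_cexp:
  "(cexp \<xi> has_derivative (\<lambda>h. \<i> * complex_of_real (h \<bullet> \<xi>) * cexp \<xi> y)) (at y)"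
proof -
  have "((\<lambda>y. \<i> * complex_of_real (y \<bullet> \<xi>)) has_derivative (\<lambda>h. \<i> * complex_of_real (h \<bullet> \<xi>))) (at y)"
    by (auto intro!: derivative_eq_intros)
  from has_derivative_compose[OF this DERIV_exp[unfolded has_field_derivative_def]]
  show ?thesis by (simp add: mult_ac cexp_def[abs_def])
qed

lemma partial_deriv_cexp: "partial_deriv i (cexp \<xi>) = (\<lambda>y. \<i> * complex_of_real (\<xi> $ i) * cexp \<xi> y)"
  by (rule ext, subst partial_deriv_eq[OF has_derivative_cexp]) (simp add: inner_axis')

lemma norm_cexp: "cmod (cexp \<xi> y) = 1"
  by (simp add: cexp_def norm_exp_eq_Re)

text \<open>A derivative only multiplies the character by \<i> times a component of \<xi>, of
  modulus at most \<open>1 + norm \<xi>\<close>.\<close>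

lemma sbound_cexp: "sbound m (\<lambda>_. 1) ((1 + norm \<xi>) ^ m) (cexp \<xi>)"
proof (induction m)
  case 0
  then show ?case using has_derivative_cexp by (auto simp: norm_cexp differentiable_def)
next
  case (Suc m)
  have "sbound m (\<lambda>_. 1) ((1 + norm \<xi>) ^ Suc m) (partial_deriv i (cexp \<xi>))" for i
  proof -
    have "sbound m (\<lambda>_. 1) (cmod (\<i> * complex_of_real (\<xi> $ i)) * (1 + norm \<xi>) ^ m)
        (\<lambda>y. \<i> * complex_of_real (\<xi> $ i) * cexp \<xi> y)"
      by (rule sbound_cmult[OF Suc])
    then show ?thesis unfolding partial_deriv_cexp
      by (rule sbound_monoB) (auto simp: norm_mult intro!: mult_right_mono
          intro: order_trans[OF component_le_norm_cart])
  qed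
  moreover have "1 \<le> (1 + norm \<xi>) ^ Suc m" by (intro one_le_power) auto
  ultimately show ?case
    using sbound_diffD[OF Suc] by (simp add: norm_cexp del: power_Suc)
qed

lemma cexp_minus_1_le: "cmod (cexp \<xi> y - 1) \<le> norm \<xi> * norm y"
proof -
  have "cmod (exp (\<i> * complex_of_real t) - 1) \<le> \<bar>t\<bar>" for t
    using iexp_approx1[of t 0] by simp
  from this[of "y \<bullet> \<xi>"] show ?thesis
    using Cauchy_Schwarz_ineq2[of y \<xi>] by (simp add: cexp_def mult.commute)
qed

text \<open>The factor \<open>norm \<xi>\<close> is the point: it makes modulation locally Lipschitz
  in the frequency. The price is one power of \<open>1 + norm y\<close>, since the increment of the
  phase grows with y.\<close>

lemma sbound_cexp_minus_1:
  "sbound m (\<lambda>y. 1 / (1 + norm y)) (norm \<xi> * (1 + norm \<xi>) ^ m) (\<lambda>y. cexp \<xi> y - 1)"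
proof -
  have 1: "1 \<le> (1 + norm \<xi>) ^ k" for k by (intro one_le_power) auto
  have 0: "1 / (1 + norm y) * cmod (cexp \<xi> y - 1) \<le> norm \<xi> * (1 + norm \<xi>) ^ m" for y :: "real^'a"
  proof -
    have "cmod (cexp \<xi> y - 1) \<le> norm \<xi> * 1 * (1 + norm y)"
      using cexp_minus_1_le[where \<xi>=\<xi> and y=y] norm_ge_zero[of \<xi>] unfolding distrib_left by linarith
    also have "\<dots> \<le> norm \<xi> * (1 + norm \<xi>) ^ m * (1 + norm y)"
      using 1[of m] by (intro mult_right_mono mult_left_mono) auto
    finally show ?thesis by (simp add: divide_le_eq add_pos_nonneg)
  qed
  have d: "(\<lambda>y. cexp \<xi> y - 1) differentiable at y" for y
    using sbound_diffD[OF sbound_cexp] by (intro differentiable_diff) auto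
  show ?thesis
  proof (cases m)
    case (Suc k)
    have eq: "partial_deriv i (\<lambda>y. cexp \<xi> y - 1) = partial_deriv i (cexp \<xi>)" for i
      by (rule ext, subst partial_deriv_eq[OF has_derivative_diff[OF has_derivative_cexp has_derivative_const]])
        (simp add: partial_deriv_cexp inner_axis')
    have "sbound k (\<lambda>y. 1 / (1 + norm y)) (norm \<xi> * (1 + norm \<xi>) ^ m) (partial_deriv i (cexp \<xi>))" for i
    proof -
      have "sbound k (\<lambda>_. 1) (cmod (\<i> * complex_of_real (\<xi> $ i)) * (1 + norm \<xi>) ^ k)
        (\<lambda>y. \<i> * complex_of_real (\<xi> $ i) * cexp \<xi> y)"
        by (rule sbound_cmult[OF sbound_cexp])
      then show ?thesis unfolding partial_deriv_cexp
      proof (rule sbound_mono)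
        have "(1 + norm \<xi>) ^ k \<le> (1 + norm \<xi>) ^ m" unfolding Suc by (rule power_increasing) auto
        then show "cmod (\<i> * complex_of_real (\<xi> $ i)) * (1 + norm \<xi>) ^ k \<le> norm \<xi> * (1 + norm \<xi>) ^ m"
          by (auto simp: norm_mult intro!: mult_mono component_le_norm_cart)
      qed (auto simp: add_pos_nonneg)
    qed
    then show ?thesis using 0 d Suc eq by auto
  qed (use 0 d in auto)
qed

text \<open>Polymorphic, because it serves on position space as the Schwartz weight and on phase
  space as the majorant of the moderateness weight.\<close>

definition pweight :: "nat \<Rightarrow> 'a::real_normed_vector \<Rightarrow> real" where
  "pweight k x = (1 + norm x) ^ k"

lemma pweight_ge1: "1 \<le> pweight k x" by (simp add: pweight_def)
lemma pweight_pos: "0 < pweight k x" by (simp add: pweight_def add_pos_nonneg)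
lemma pweight_nonneg [simp]: "0 \<le> pweight k x" by (simp add: pweight_def)
lemma pweight_mono: "k \<le> l \<Longrightarrow> pweight k x \<le> pweight l x"
  by (simp add: pweight_def power_increasing)
lemma pweight_add: "pweight (k + l) x = pweight k x * pweight l x"
  by (simp add: pweight_def power_add)
lemma pweight_minus [simp]: "pweight k (- x) = pweight k x"
  by (simp add: pweight_def)

lemma pweight_plus: "pweight k (x + y) \<le> pweight k x * pweight k y"
  unfolding pweight_def power_mult_distrib[symmetric]
  by (rule power_mono)
    (use norm_triangle_ineq[of x y] mult_nonneg_nonneg[of "norm x" "norm y"] in
      \<open>auto simp: algebra_simps simp del: mult_nonneg_nonneg intro: add_nonneg_nonneg\<close>)

text \<open>Peetre's inequality, in the form that moves a weight from one point to another at the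
  cost of their difference.\<close>

lemma pweight_diff: "pweight k x \<le> pweight k y * pweight k (x - y)"
  using pweight_plus[of k y "x - y"] by simp

text \<open>The recursion of \<open>sbound\<close> peels off the derivative that is applied first.
  In \<open>foldr\<close> this is the last entry of the list, so lists are taken apart at their
  end.\<close>

lemma sbound_iff_iter:
  "sbound m W B f \<longleftrightarrow> (\<forall>is. length is \<le> m \<longrightarrow>
     (\<forall>x. iter_partial_deriv is f differentiable at x \<and> W x * cmod (iter_partial_deriv is f x) \<le> B))"
proof (induction m arbitrary: f)
  case 0
  then show ?case by (auto simp: iter_partial_deriv_def)
next
  case (Suc m)
  have *: "iter_partial_deriv (is @ [i]) f = iter_partial_deriv is (partial_deriv i f)" for "is" i
    by (simp add: iter_partial_deriv_def)
  show ?case (is "?L \<longleftrightarrow> ?R")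
  proof
    assume L: ?L
    show ?R
    proof (intro allI impI)
      fix "is" :: "'a list" and x
      assume len: "length is \<le> Suc m"
      show "iter_partial_deriv is f differentiable at x \<and> W x * cmod (iter_partial_deriv is f x) \<le> B"
      proof (cases "is" rule: rev_cases)
        case Nil
        then show ?thesis using L by (auto simp: iter_partial_deriv_def)
      next
        case (snoc js j)
        then show ?thesis using L len Suc.IH[of "partial_deriv j f"] by (auto simp: *)
      qed
    qed
  next
    assume R: ?R
    have "sbound m W B (partial_deriv i f)" for i
      unfolding Suc.IH using R[rule_format, of "_ @ [i]"] by (auto simp: *)
    then show ?L using R[rule_format, of "[]"] by (auto simp: iter_partial_deriv_def)
  qed
qed

text \<open>Only finitely many multi-indices have length at most m, so the maximum of their separate
  bounds serves for all of them.\<close>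

lemma schwartz_iff: "f \<in> schwartz \<longleftrightarrow> (\<forall>m k. \<exists>B. sbound m (pweight k) B f)"
proof
  assume f: "f \<in> schwartz"
  show "\<forall>m k. \<exists>B. sbound m (pweight k) B f"
  proof (intro allI)
    fix m k
    have "\<exists>B. \<forall>x. pweight k x * cmod (iter_partial_deriv is f x) \<le> B" for "is"
      using f by (force simp: schwartz_def bounded_iff pweight_def power_abs abs_of_nonneg)
    then obtain b where b: "\<And>is x. pweight k x * cmod (iter_partial_deriv is f x) \<le> b is"
      by metis
    define S where "S = {is :: 'a list. set is \<subseteq> UNIV \<and> length is \<le> m}"
    have S: "finite S" unfolding S_def by (rule finite_lists_length_le) simp
    have "sbound m (pweight k) (Max (b ` S)) f"
      unfolding sbound_iff_iter
    proof (intro allI impI conjI)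
      fix "is" :: "'a list" and x
      assume "length is \<le> m"
      then have "is \<in> S" by (simp add: S_def)
      then show "pweight k x * cmod (iter_partial_deriv is f x) \<le> Max (b ` S)"
        using b[of x "is"] S by (meson Max_ge finite_imageI image_eqI order_trans)
    qed (use f in \<open>auto simp: schwartz_def\<close>)
    then show "\<exists>B. sbound m (pweight k) B f" ..
  qed
next
  assume *: "\<forall>m k. \<exists>B. sbound m (pweight k) B f"
  show "f \<in> schwartz"
    unfolding schwartz_def
  proof (intro CollectI allI conjI)
    fix "is" :: "'a list" and x
    show "iter_partial_deriv is f differentiable at x"
      using *[rule_format, of "length is" 0] by (auto simp: sbound_iff_iter)
  next
    fix "is" :: "'a list" and k
    obtain B where "sbound (length is) (pweight k) B f" using * by blast
    then show "bounded (range (\<lambda>x. (1 + norm x) ^ k *\<^sub>R iter_partial_deriv is f x))"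
      by (auto simp: sbound_iff_iter bounded_iff pweight_def power_abs intro!: exI[of _ B])
  qed
qed

lemma schwartzE:
  assumes "f \<in> schwartz"
  obtains B where "0 < B" "sbound m (pweight k) B f"
proof -
  obtain B where "sbound m (pweight k) B f" using assms schwartz_iff by blast
  then have "sbound m (pweight k) (max 1 B) f" by (rule sbound_monoB) simp
  then show thesis using that[of "max 1 B"] by simp
qed

section \<open>Closure properties of the Schwartz space\<close>

lemma schwartz_differentiable: "f \<in> schwartz \<Longrightarrow> f differentiable at x"
  using schwartzE sbound_diffD by metis

lemma schwartz_isCont: "f \<in> schwartz \<Longrightarrow> isCont f x"
  using schwartz_differentiable differentiable_imp_continuous_within by blast

lemma schwartz_measurable: "f \<in> schwartz \<Longrightarrow> f \<in> borel_measurable borel"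
  by (intro borel_measurable_continuous_onI continuous_at_imp_continuous_on ballI schwartz_isCont)

lemma schwartz_partial_deriv: "f \<in> schwartz \<Longrightarrow> partial_deriv i f \<in> schwartz"
  unfolding schwartz_iff by (metis sbound_SucD)

lemma schwartz_0: "(\<lambda>_. 0) \<in> schwartz"
  unfolding schwartz_iff using sbound_zero by blast

lemma schwartz_add:
  assumes "f \<in> schwartz" "g \<in> schwartz"
  shows "(\<lambda>x. f x + g x) \<in> schwartz"
  unfolding schwartz_iff
proof (intro allI)
  fix m k
  obtain B C where "sbound m (pweight k) B f" "sbound m (pweight k) C g"
    using assms schwartz_iff by meson
  then have "sbound m (pweight k) (B + C) (\<lambda>x. f x + g x)" by (rule sbound_add) simp
  then show "\<exists>B. sbound m (pweight k) B (\<lambda>x. f x + g x)" ..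
qed

lemma schwartz_cmult: "f \<in> schwartz \<Longrightarrow> (\<lambda>x. c * f x) \<in> schwartz"
  unfolding schwartz_iff using sbound_cmult by metis

lemma schwartz_diff: "f \<in> schwartz \<Longrightarrow> g \<in> schwartz \<Longrightarrow> (\<lambda>x. f x - g x) \<in> schwartz"
  using schwartz_add[OF _ schwartz_cmult[of g "-1"]] by simp

lemma schwartz_cnj: "f \<in> schwartz \<Longrightarrow> (\<lambda>x. cnj (f x)) \<in> schwartz"
  unfolding schwartz_iff using sbound_cnj by metis

lemma schwartz_sum: "(\<And>i. i \<in> I \<Longrightarrow> f i \<in> schwartz) \<Longrightarrow> (\<lambda>x. \<Sum>i\<in>I. f i x) \<in> schwartz"
  by (induction I rule: infinite_finite_induct) (auto intro: schwartz_0 schwartz_add)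

lemma sbound_mult_pweight:
  assumes "sbound m (pweight k) B f" "sbound m (\<lambda>_. 1) C g"
  shows "sbound m (pweight k) (2 ^ m * B * C) (\<lambda>x. f x * g x)"
  using sbound_mult[OF _ _ assms] by simp

lemma schwartz_mult_bounded:
  assumes "f \<in> schwartz" "\<And>m. \<exists>C. sbound m (\<lambda>_. 1) C g"
  shows "(\<lambda>x. f x * g x) \<in> schwartz"
  unfolding schwartz_iff using assms sbound_mult_pweight unfolding schwartz_iff by metis

lemma schwartz_mult: 
  assumes "f \<in> schwartz" "g \<in> schwartz"
  shows "(\<lambda>x. f x * g x) \<in> schwartz"
proof (rule schwartz_mult_bounded[OF assms(1)])
  fix m
  obtain B where "sbound m (pweight 0) B g" using assms(2) schwartz_iff by blast
  moreover have "pweight 0 = (\<lambda>_::real^'a. 1)" by (simp add: pweight_def fun_eq_iff)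
  ultimately show "\<exists>C. sbound m (\<lambda>_. 1) C g" by auto
qed

lemma sbound_rescale:
  "0 < c \<Longrightarrow> sbound m (\<lambda>x. c * W x) (c * B) f \<longleftrightarrow> sbound m W B f"
  by (induction m arbitrary: f) (auto simp: mult.assoc)

text \<open>The weight has moved along with the function; Peetre's inequality brings it back, and
  the factor \<open>1 / pweight k x\<close> is then transferred to the bound by
  \<open>sbound_rescale\<close>.\<close>

lemma sbound_translate_pweight:
  assumes "sbound m (pweight k) B f"
  shows "sbound m (pweight k) (pweight k x * B) (\<lambda>y. f (y - x))"
proof -
  have *: "pweight k y / pweight k x \<le> pweight k (y - x)" for y
    using pweight_diff[of k y x] pweight_pos[of k x] by (simp add: divide_le_eq mult.commute)
  have "sbound m (\<lambda>y. 1 / pweight k x * pweight k y) (1 / pweight k x * (pweight k x * B)) (\<lambda>y. f (y - x))"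
    using sbound_translate[OF assms] by (rule sbound_mono) (use * pweight_pos[of k x] in auto)
  then show ?thesis by (subst (asm) sbound_rescale) (simp_all add: pweight_pos)
qed

lemma schwartz_translate: "f \<in> schwartz \<Longrightarrow> (\<lambda>y. f (y - x)) \<in> schwartz"
  unfolding schwartz_iff using sbound_translate_pweight by metis

lemma schwartz_modulate: "f \<in> schwartz \<Longrightarrow> (\<lambda>y. cexp \<xi> y * f y) \<in> schwartz"
  using schwartz_mult_bounded[of f "cexp \<xi>"] sbound_cexp by (auto simp: mult.commute)

lemma sbound_modulate:
  assumes "sbound m (pweight k) B f"
  shows "sbound m (pweight k) (2 ^ m * (1 + norm \<xi>) ^ m * B) (\<lambda>y. cexp \<xi> y * f y)"
  using sbound_mult_pweight[OF assms sbound_cexp[of m \<xi>]] by (simp add: mult_ac)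

text \<open>The extra power of the weight in the hypothesis pays for the factor
  \<open>1 / (1 + norm y)\<close> of \<open>sbound_cexp_minus_1\<close>.\<close>

lemma sbound_modulate_diff:
  assumes "sbound m (pweight (Suc k)) B f"
  shows "sbound m (pweight k) (2 ^ m * norm \<xi> * (1 + norm \<xi>) ^ m * B) (\<lambda>y. cexp \<xi> y * f y - f y)"
proof -
  have "(\<lambda>x::real^'a. 1 / (1 + norm x) * pweight (Suc k) x) = pweight k"
    by (auto simp: pweight_def add_nonneg_eq_0_iff)
  with sbound_mult[OF _ _ sbound_cexp_minus_1[of m \<xi>] assms]
  show ?thesis by (simp only: mult.assoc left_diff_distrib mult_1_left) simp
qed

lemma norm_le_sum_partial_deriv:
  fixes f :: "real^'n::finite \<Rightarrow> complex" and M :: real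
  assumes "\<And>i. cmod (partial_deriv i f z) \<le> M"
  shows "onorm (\<lambda>v. \<Sum>i\<in>UNIV. (v $ i) *\<^sub>R partial_deriv i f z) \<le> CARD('n) * M"
proof (rule onorm_le)
  fix v :: "real^'n"
  have "cmod (\<Sum>i\<in>UNIV. (v $ i) *\<^sub>R partial_deriv i f z) \<le> (\<Sum>i\<in>(UNIV::'n set). norm v * M)"
    by (rule order_trans[OF norm_sum], rule sum_mono)
      (auto intro!: mult_mono assms component_le_norm_cart)
  then show "cmod (\<Sum>i\<in>UNIV. (v $ i) *\<^sub>R partial_deriv i f z) \<le> CARD('n) * M * norm v"
    by (simp add: mult_ac)
qed

text \<open>Mean value inequality along the segment from \<open>y\<close> to \<open>y - x\<close>.
  On it the weight differs from its value at \<open>y\<close> by a factor of at most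
  \<open>pweight k x\<close>.\<close>

lemma sbound_translate_diff_0:
  fixes f :: "real^'n::finite \<Rightarrow> complex"
  assumes "sbound (Suc 0) (pweight k) B f"
  shows "pweight k y * cmod (f (y - x) - f y) \<le> CARD('n) * norm x * pweight k x * B"
proof -
  have B0: "0 \<le> B" using sbound_nonneg[OF assms] by simp
  let ?M = "pweight k x * B / pweight k y"
  have "cmod (f (y - x) - f y) \<le> (CARD('n) * ?M) * norm ((y - x) - y)"
  proof (rule differentiable_bound[where S = "closed_segment y (y - x)"
        and f' = "\<lambda>z v. \<Sum>i\<in>UNIV. (v $ i) *\<^sub>R partial_deriv i f z"])
    fix z assume "z \<in> closed_segment y (y - x)"
    then obtain u where u: "0 \<le> u" "u \<le> 1" and z: "z = y - u *\<^sub>R x"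
      by (auto simp: closed_segment_def algebra_simps)
    show "(f has_derivative (\<lambda>v. \<Sum>i\<in>UNIV. (v $ i) *\<^sub>R partial_deriv i f z))
        (at z within closed_segment y (y - x))"
      using has_derivative_partial_deriv[OF sbound_diffD[OF assms]] has_derivative_at_withinI by blast
    have "pweight k (u *\<^sub>R x) \<le> pweight k x"
      using u by (auto simp: pweight_def mult_left_le_one_le intro!: power_mono)
    then have "pweight k y \<le> pweight k z * pweight k x"
      using pweight_diff[of k y z] mult_left_mono[OF _ pweight_nonneg[of k z], of "pweight k (u *\<^sub>R x)" "pweight k x"]
      by (simp add: z)
    moreover have "pweight k z * cmod (partial_deriv i f z) \<le> B" for i
      using sbound_leD[OF sbound_SucD[OF assms]] .
    ultimately have "pweight k y * cmod (partial_deriv i f z) \<le> pweight k x * B" for i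
      using mult_right_mono[of "pweight k y" "pweight k z * pweight k x" "cmod (partial_deriv i f z)"]
        mult_left_mono[of "pweight k z * cmod (partial_deriv i f z)" B "pweight k x"]
      by (fastforce simp: mult_ac)
    then have "cmod (partial_deriv i f z) \<le> ?M" for i
      using pweight_pos[of k y] by (simp add: pos_le_divide_eq mult.commute)
    from norm_le_sum_partial_deriv[OF this]
    show "onorm (\<lambda>v. \<Sum>i\<in>UNIV. (v $ i) *\<^sub>R partial_deriv i f z) \<le> CARD('n) * ?M" by simp
  qed auto
  then show ?thesis
    using pweight_pos[of k y] by (simp add: pos_le_divide_eq mult_ac)
qed

text \<open>Derivatives commute with translation, so the pointwise estimate applies to every
  derivative; one order of differentiability is spent.\<close>

lemma sbound_translate_diff:
  fixes f :: "real^'n::finite \<Rightarrow> complex"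
  shows "sbound (Suc m) (pweight k) B f \<Longrightarrow>
    sbound m (pweight k) (CARD('n) * norm x * pweight k x * B) (\<lambda>y. f (y - x) - f y)"
proof (induction m arbitrary: f)
  case 0
  have "pweight k y * cmod (f (y - x) - f y) \<le> CARD('n) * norm x * pweight k x * B" for y
    by (rule sbound_translate_diff_0[OF 0])
  then show ?case
    using sbound_diffD[OF 0] differentiable_translate[of f x]
    by (auto intro!: differentiable_diff)
next
  case (Suc m)
  let ?C = "CARD('n) * norm x * pweight k x * B"
  have d: "\<And>x. f differentiable at x" using sbound_diffD[OF Suc.prems] .
  have "partial_deriv i (\<lambda>y. f (y - x) - f y) = (\<lambda>y. partial_deriv i f (y - x) - partial_deriv i f y)" for i
  proof -
    have "partial_deriv i (\<lambda>y. f (y - x) + (-1) * f y) = (\<lambda>y. partial_deriv i f (y - x) + (-1) * partial_deriv i f y)"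
      using d by (subst partial_deriv_add) (auto simp del: mult_minus1 simp: partial_deriv_translate partial_deriv_cmult[where f = f and c = "-1", simplified]
          differentiable_translate)
    then show ?thesis by simp
  qed
  moreover have "sbound m (pweight k) ?C (\<lambda>y. partial_deriv i f (y - x) - partial_deriv i f y)" for i
    using Suc.prems by (intro Suc.IH sbound_SucD)
  moreover have "pweight k y * cmod (f (y - x) - f y) \<le> ?C" for y
    using Suc.prems by (intro sbound_translate_diff_0 sbound_le[where m' = "Suc 0", OF Suc.prems]) simp
  then have "sbound 0 (pweight k) ?C (\<lambda>y. f (y - x) - f y)"
    using d differentiable_translate[of f x] by (auto intro!: differentiable_diff)
  ultimately show ?case by (intro sbound_SucI) auto
qed

section \<open>Gaussians as Schwartz functions\<close>

definition gauss :: "'a::real_inner \<Rightarrow> real" where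
  "gauss x = exp (- (norm x)\<^sup>2 / 2)"

lemma gauss_nonneg [simp]: "0 \<le> gauss x" by (simp add: gauss_def)
lemma gauss_le_1: "gauss x \<le> 1" by (simp add: gauss_def)
lemma gauss_minus [simp]: "gauss (- x) = gauss x" by (simp add: gauss_def)

lemma pweight_gauss_bounded: "\<exists>B. \<forall>x. pweight k x * gauss (c *\<^sub>R x) \<le> B" if "c \<noteq> 0"
proof -
  have "((\<lambda>t::real. (1 + t) ^ k * exp (- (c * t)\<^sup>2 / 2)) \<longlongrightarrow> 0) at_top"
    using that by real_asymp
  then have "\<forall>\<^sub>F t in at_top. (1 + t) ^ k * exp (- (c * t)\<^sup>2 / 2) < 1"
    by (rule order_tendstoD) simp
  then obtain T where T: "\<And>t. t \<ge> T \<Longrightarrow> (1 + t) ^ k * exp (- (c * t)\<^sup>2 / 2) < 1"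
    by (auto simp: eventually_at_top_linorder)
  have "(1 + t) ^ k * exp (- (c * t)\<^sup>2 / 2) \<le> max 1 ((1 + T) ^ k)" if "t \<ge> 0" for t
  proof (cases "t \<ge> T")
    case False
    have "(1 + t) ^ k * exp (- (c * t)\<^sup>2 / 2) \<le> (1 + T) ^ k * 1"
      using False that by (intro mult_mono power_mono) auto
    then show ?thesis by simp
  qed (use T[of t] in auto)
  then have "pweight k x * gauss (c *\<^sub>R x) \<le> max 1 ((1 + T) ^ k)" for x :: 'a
    by (simp add: pweight_def gauss_def power_mult_distrib)
  then show ?thesis by blast
qed

lemma has_derivative_gauss:
  fixes y :: "real^'n::finite"
  shows "((\<lambda>y. complex_of_real (gauss (c *\<^sub>R y))) has_derivative
    (\<lambda>h. - (complex_of_real (c\<^sup>2 * (h \<bullet> y)) * complex_of_real (gauss (c *\<^sub>R y))))) (at y)"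
proof -
  have g: "gauss (c *\<^sub>R y) = exp (- (c\<^sup>2 * (y \<bullet> y)) / 2)" for y :: "real^'n"
    by (simp add: gauss_def power_mult_distrib power2_norm_eq_inner)
  show ?thesis unfolding g
    by (auto intro!: derivative_eq_intros simp: inner_commute algebra_simps)
qed

lemma sbound_component:
  fixes i :: "'n::finite"
  shows "sbound m (\<lambda>y. 1 / (1 + norm y)) 1 (\<lambda>y::real^'n. complex_of_real (y $ i))"
proof -
  have d: "((\<lambda>y::real^'n. complex_of_real (y $ i)) has_derivative (\<lambda>h. complex_of_real (h $ i))) (at y)" for y
    by (intro has_derivative_of_real bounded_linear_imp_has_derivative bounded_linear_vec_nth)
  have 0: "sbound 0 (\<lambda>y. 1 / (1 + norm y)) 1 (\<lambda>y::real^'n. complex_of_real (y $ i))"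
    using d component_le_norm_cart[of _ i]
    by (auto simp: differentiable_def divide_le_eq add_pos_nonneg intro: add_increasing)
  show ?thesis
  proof (cases m)
    case (Suc k)
    have "partial_deriv j (\<lambda>y::real^'n. complex_of_real (y $ i)) = (\<lambda>_. if i = j then 1 else 0)" for j
      by (rule ext, subst partial_deriv_eq[OF d]) (simp add: axis_def)
    moreover have "sbound k (\<lambda>y::real^'n. 1 / (1 + norm y)) 1 (\<lambda>_. if i = j then 1 else 0)" for j
      by (rule sbound_mono[OF sbound_const[of _ 1]]) (auto simp: add_pos_nonneg)
    ultimately show ?thesis using 0 Suc by auto
  qed (use 0 in simp)
qed

text \<open>A derivative of the Gaussian is a coordinate times the Gaussian, so the induction on the
  order must allow every power of the weight: order m with power \<open>Suc k\<close> yields order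
  \<open>Suc m\<close> with power k.\<close>

lemma schwartz_gauss:
  assumes "c \<noteq> 0"
  shows "(\<lambda>y::real^'n::finite. complex_of_real (gauss (c *\<^sub>R y))) \<in> schwartz"
proof -
  let ?g = "\<lambda>y::real^'n. complex_of_real (gauss (c *\<^sub>R y))"
  have "\<exists>B. sbound m (pweight k) B ?g" for m k
  proof (induction m arbitrary: k)
    case (0 k)
    show ?case using pweight_gauss_bounded[OF assms, of k] has_derivative_gauss
      by (auto simp: differentiable_def)
  next
    case (Suc m k)
    obtain B0 where B0: "\<And>x::real^'n. pweight k x * gauss (c *\<^sub>R x) \<le> B0"
      using pweight_gauss_bounded[OF assms] by blast
    obtain B where B: "sbound m (pweight (Suc k)) B ?g" using Suc.IH by blast
    have pd: "partial_deriv i ?g = (\<lambda>y. (- complex_of_real (c\<^sup>2)) * (complex_of_real (y $ i) * ?g y))" for i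
      by (rule ext, subst partial_deriv_eq[OF has_derivative_gauss]) (simp add: inner_axis')
    have w: "(\<lambda>x::real^'n. 1 / (1 + norm x) * pweight (Suc k) x) = pweight k"
      by (auto simp: pweight_def add_nonneg_eq_0_iff)
    have H: "sbound m (pweight k) (2 ^ m * 1 * B) (\<lambda>y. complex_of_real (y $ i) * ?g y)" for i
      using sbound_mult[OF _ _ sbound_component[of m i] B] unfolding w by simp
    have *: "sbound m (pweight k) (c\<^sup>2 * (2 ^ m * B)) (partial_deriv i ?g)" for i
      unfolding pd using sbound_cmult[OF H[of i], of "- complex_of_real (c\<^sup>2)"]
      by (simp only: norm_minus_cancel norm_of_real abs_power2 mult_1_right)
    let ?B = "max B0 (c\<^sup>2 * (2 ^ m * B))"
    have "sbound 0 (pweight k) ?B ?g"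
      using B0 has_derivative_gauss by (auto simp: differentiable_def le_max_iff_disj)
    moreover have "sbound m (pweight k) ?B (partial_deriv i ?g)" for i
      using * by (rule sbound_monoB) simp
    ultimately show ?case by (blast intro: sbound_SucI)
  qed
  then show ?thesis by (simp add: schwartz_iff)
qed

section \<open>Bounds for tempered distributions\<close>

lemma schwartz_iter_differentiable: "f \<in> schwartz \<Longrightarrow> iter_partial_deriv is f differentiable at x"
  by (simp add: schwartz_def)

lemma iter_partial_deriv_add:
  assumes "f \<in> schwartz" "g \<in> schwartz"
  shows "iter_partial_deriv is (\<lambda>x. f x + g x) = (\<lambda>x. iter_partial_deriv is f x + iter_partial_deriv is g x)"
proof (induction "is")
  case (Cons i js)
  have "iter_partial_deriv (i # js) (\<lambda>x. f x + g x) = partial_deriv i (iter_partial_deriv js (\<lambda>x. f x + g x))"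
    by (simp add: iter_partial_deriv_def)
  also have "\<dots> = (\<lambda>x. partial_deriv i (iter_partial_deriv js f) x + partial_deriv i (iter_partial_deriv js g) x)"
    unfolding Cons by (rule partial_deriv_add) (auto intro: schwartz_iter_differentiable assms)
  finally show ?case by (simp add: iter_partial_deriv_def)
qed (simp add: iter_partial_deriv_def)

lemma le_schwartz_seminorm:
  assumes "f \<in> schwartz"
  shows "pweight k x * cmod (iter_partial_deriv is f x) \<le> schwartz_seminorm k is f"
proof -
  have "bounded (range (\<lambda>x. (1 + norm x) ^ k *\<^sub>R iter_partial_deriv is f x))"
    using assms by (simp add: schwartz_def)
  then have "bdd_above (range (\<lambda>x. norm ((1 + norm x) ^ k *\<^sub>R iter_partial_deriv is f x)))"
    by (intro bounded_imp_bdd_above) (simp only: bounded_norm_comp)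
  then have "norm ((1 + norm x) ^ k *\<^sub>R iter_partial_deriv is f x) \<le> schwartz_seminorm k is f"
    unfolding schwartz_seminorm_def by (intro cSUP_upper) auto
  then show ?thesis by (simp add: pweight_def power_abs)
qed

lemma schwartz_seminorm_le:
  assumes "\<And>x. pweight k x * cmod (iter_partial_deriv is f x) \<le> B"
  shows "schwartz_seminorm k is f \<le> B"
  unfolding schwartz_seminorm_def
  by (rule cSUP_least) (use assms in \<open>auto simp: pweight_def power_abs\<close>)

text \<open>Neighbourhoods can be tested with one integer for both derivatives and weight. This
  holds for subbasic sets and passes to finite intersections, by taking the maximum of the integers,
  and to unions.\<close>

lemma schwartz_neighbourhood:
  fixes U :: "(real^'n::finite \<Rightarrow> complex) set"
  assumes "openin schwartz_topology U" "a \<in> U"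
  shows "\<exists>N e. 0 < e \<and> (\<forall>h\<in>schwartz. sbound N (pweight N) e (\<lambda>x. h x - a x) \<longrightarrow> h \<in> U)"
proof -
  have "generate_topology_on {{h \<in> schwartz. schwartz_seminorm k is (\<lambda>x. h x - f x) < e} |f k is e. f \<in> schwartz \<and> e > 0} U"
    using assms(1) unfolding schwartz_topology_def openin_topology_generated_by_iff .
  then show ?thesis using assms(2)
  proof (induction arbitrary: a)
    case Empty
    then show ?case by simp
  next
    case (Int U V)
    obtain N e where 1: "0 < e" "\<forall>h\<in>schwartz. sbound N (pweight N) e (\<lambda>x. h x - a x) \<longrightarrow> h \<in> U"
      using Int.IH(1)[of a] Int.prems by blast
    obtain M d where 2: "0 < d" "\<forall>h\<in>schwartz. sbound M (pweight M) d (\<lambda>x. h x - a x) \<longrightarrow> h \<in> V"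
      using Int.IH(2)[of a] Int.prems by blast
    have "\<forall>h\<in>schwartz. sbound (max N M) (pweight (max N M)) (min e d) (\<lambda>x. h x - a x) \<longrightarrow> h \<in> U \<inter> V"
    proof (intro ballI impI)
      fix h :: "real^'n \<Rightarrow> complex" assume h: "h \<in> schwartz"
        and s: "sbound (max N M) (pweight (max N M)) (min e d) (\<lambda>x. h x - a x)"
      have "sbound N (pweight N) e (\<lambda>x. h x - a x)"
        by (rule sbound_mono[OF sbound_le[OF s]]) (auto intro: pweight_mono)
      moreover have "sbound M (pweight M) d (\<lambda>x. h x - a x)"
        by (rule sbound_mono[OF sbound_le[OF s]]) (auto intro: pweight_mono)
      ultimately show "h \<in> U \<inter> V" using 1 2 h by blast
    qed
    then show ?case using 1 2 by (intro exI[of _ "max N M"] exI[of _ "min e d"]) auto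
  next
    case (UN K)
    then obtain k where k: "k \<in> K" "a \<in> k" by blast
    from UN.IH[OF k] k(1) show ?case by blast
  next
    case (Basis S)
    then obtain f k "is" e where S: "S = {h \<in> schwartz. schwartz_seminorm k is (\<lambda>x. h x - f x) < e}"
      and f: "f \<in> schwartz" and e: "0 < e" by blast
    have a: "a \<in> schwartz" and ae: "schwartz_seminorm k is (\<lambda>x. a x - f x) < e"
      using Basis S by auto
    \<comment> \<open>A subbasic set is centred at \<open>f\<close>, not at \<open>a\<close>. Only
      half of the remaining room is used, because the supremum is bounded weakly while membership is
      strict.\<close>
    let ?e = "(e - schwartz_seminorm k is (\<lambda>x. a x - f x)) / 2"
    let ?N = "max k (length is)"
    have "h \<in> S" if h: "h \<in> schwartz" and s: "sbound ?N (pweight ?N) ?e (\<lambda>x. h x - a x)" for h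
    proof -
      have "pweight k x * cmod (iter_partial_deriv is (\<lambda>x. h x - f x) x) \<le>
          ?e + schwartz_seminorm k is (\<lambda>x. a x - f x)" for x
      proof -
        have "iter_partial_deriv is (\<lambda>x. h x - f x) x =
            iter_partial_deriv is (\<lambda>x. h x - a x) x + iter_partial_deriv is (\<lambda>x. a x - f x) x"
          using iter_partial_deriv_add[OF schwartz_diff[OF h a] schwartz_diff[OF a f], of "is"]
          by (auto dest: fun_cong)
        then have "pweight k x * cmod (iter_partial_deriv is (\<lambda>x. h x - f x) x) \<le>
            pweight k x * cmod (iter_partial_deriv is (\<lambda>x. h x - a x) x) +
            pweight k x * cmod (iter_partial_deriv is (\<lambda>x. a x - f x) x)"
          by (simp add: mult_left_mono norm_triangle_ineq flip: distrib_left)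
        moreover have "pweight ?N x * cmod (iter_partial_deriv is (\<lambda>x. h x - a x) x) \<le> ?e"
          using s unfolding sbound_iff_iter by auto
        then have "pweight k x * cmod (iter_partial_deriv is (\<lambda>x. h x - a x) x) \<le> ?e"
          by (meson max.cobounded1 mult_right_mono norm_ge_zero order_trans pweight_mono)
        ultimately show ?thesis
          using le_schwartz_seminorm[OF schwartz_diff[OF a f], of k x "is"] by linarith
      qed
      from schwartz_seminorm_le[OF this] have "schwartz_seminorm k is (\<lambda>x. h x - f x) < e"
        using ae by (simp add: field_simps)
      then show ?thesis using S h by simp
    qed
    then show ?case using ae by (intro exI[of _ ?N] exI[of _ ?e]) auto
  qed
qed

text \<open>A distribution of finite order: N counts derivatives and powers of the weight at once. B
  ranges over all bounds instead of being a supremum, so that no finiteness has to be shown.\<close>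

definition dist_bound :: "nat \<Rightarrow> real \<Rightarrow> ((real^'n::finite \<Rightarrow> complex) \<Rightarrow> complex) \<Rightarrow> bool" where
  "dist_bound N C T \<longleftrightarrow> (\<forall>\<phi>\<in>schwartz. \<forall>B. sbound N (pweight N) B \<phi> \<longrightarrow> cmod (T \<phi>) \<le> C * B)"

lemma dist_boundD:
  "dist_bound N C T \<Longrightarrow> \<phi> \<in> schwartz \<Longrightarrow> sbound N (pweight N) B \<phi> \<Longrightarrow> cmod (T \<phi>) \<le> C * B"
  by (simp add: dist_bound_def)

lemma apply_dist_props:
  shows apply_dist_add: "f \<in> schwartz \<Longrightarrow> h \<in> schwartz \<Longrightarrow> apply_dist T (\<lambda>x. f x + h x) = apply_dist T f + apply_dist T h"
    and apply_dist_cmult: "f \<in> schwartz \<Longrightarrow> apply_dist T (\<lambda>x. c * f x) = c * apply_dist T f"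
    and apply_dist_continuous: "continuous_map schwartz_topology euclidean (apply_dist T)"
    and apply_dist_outside: "f \<notin> schwartz \<Longrightarrow> apply_dist T f = 0"
  using apply_dist[of T] by auto

lemma apply_dist_0: "apply_dist T (\<lambda>_. 0) = 0"
  using apply_dist_cmult[OF schwartz_0, of T 0] by simp

lemma apply_dist_diff:
  "f \<in> schwartz \<Longrightarrow> h \<in> schwartz \<Longrightarrow> apply_dist T (\<lambda>x. f x - h x) = apply_dist T f - apply_dist T h"
  using apply_dist_add[of f "\<lambda>x. (-1) * h x" T] schwartz_cmult[of h "-1"] apply_dist_cmult[of h T "-1"]
  by simp

lemma apply_dist_sum:
  "(\<And>i. i \<in> I \<Longrightarrow> f i \<in> schwartz) \<Longrightarrow>
    apply_dist T (\<lambda>x. \<Sum>i\<in>I. c i * f i x) = (\<Sum>i\<in>I. c i * apply_dist T (f i))"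
proof (induction I rule: infinite_finite_induct)
  case (insert i I)
  then have "apply_dist T (\<lambda>x. c i * f i x + (\<Sum>i\<in>I. c i * f i x)) =
      apply_dist T (\<lambda>x. c i * f i x) + apply_dist T (\<lambda>x. \<Sum>i\<in>I. c i * f i x)"
    by (intro apply_dist_add schwartz_sum schwartz_cmult) auto
  with insert show ?case by (simp add: apply_dist_cmult)
qed (simp_all add: apply_dist_0)

lemma apply_dist_eqI:
  assumes "\<And>\<phi>. \<phi> \<in> schwartz \<Longrightarrow> apply_dist S \<phi> = apply_dist T \<phi>"
  shows "S = T"
  using assms apply_dist_outside by (metis apply_dist_inject ext)

lemma topspace_schwartz: "topspace schwartz_topology = (schwartz :: (real^'n::finite \<Rightarrow> complex) set)"
proof -
  have "f \<in> topspace schwartz_topology" if f: "f \<in> schwartz" for f :: "real^'n \<Rightarrow> complex"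
  proof -
    have "schwartz_seminorm 0 [] (\<lambda>x. f x - f x) < 1"
      by (simp add: schwartz_seminorm_def iter_partial_deriv_def)
    moreover have "{h \<in> schwartz. schwartz_seminorm 0 [] (\<lambda>x. h x - f x) < 1} \<in>
      {{h \<in> schwartz. schwartz_seminorm k is (\<lambda>x. h x - f x) < e} |f k is e. f \<in> schwartz \<and> e > 0}"
      using f zero_less_one by blast
    ultimately show ?thesis
      unfolding schwartz_topology_def topology_generated_by_topspace using f by blast
  qed
  then show ?thesis
    unfolding schwartz_topology_def topology_generated_by_topspace by blast
qed

text \<open>Continuity at 0 makes the functional smaller than 1 on some \<open>sbound\<close> ball,
  and homogeneity extends this to all test functions.\<close>

lemma dist_bound_apply_dist: "\<exists>N C. 0 \<le> C \<and> dist_bound N C (apply_dist T)"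
proof -
  let ?U = "{h \<in> topspace schwartz_topology. apply_dist T h \<in> ball 0 1}"
  have "openin schwartz_topology ?U"
    by (rule openin_continuous_map_preimage[OF apply_dist_continuous]) simp
  moreover have "(\<lambda>_. 0) \<in> ?U"
    by (simp add: topspace_schwartz schwartz_0 apply_dist_0)
  ultimately obtain N e where e: "0 < e"
    and U: "\<And>h. h \<in> schwartz \<Longrightarrow> sbound N (pweight N) e h \<Longrightarrow> h \<in> ?U"
    using schwartz_neighbourhood[of ?U "\<lambda>_. 0"] by auto
  have "cmod (apply_dist T \<phi>) \<le> 1 / e * B" if \<phi>: "\<phi> \<in> schwartz" and B: "sbound N (pweight N) B \<phi>" for \<phi> B
  proof -
    have B0: "0 \<le> B" using sbound_nonneg[OF B] by simp
    \<comment> \<open>The scaling divides by the bound, and \<open>B\<close> may be 0; any larger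
      number is positive, and the limit is taken afterwards.\<close>
    have "cmod (apply_dist T \<phi>) \<le> 1 / e * B'" if "B < B'" for B'
    proof -
      have pos: "0 < B'" using that B0 by simp
      let ?c = "complex_of_real (e / B')"
      have "sbound N (pweight N) (cmod ?c * B') (\<lambda>x. ?c * \<phi> x)"
        using that by (intro sbound_cmult sbound_monoB[OF B]) simp
      moreover have "cmod ?c * B' = e" using pos e by (simp del: of_real_divide)
      ultimately have "(\<lambda>x. ?c * \<phi> x) \<in> ?U"
        using U schwartz_cmult[OF \<phi>, of ?c] by simp
      then have "cmod (apply_dist T (\<lambda>x. ?c * \<phi> x)) < 1" by (simp only: mem_Collect_eq mem_ball dist_0_norm)
      then have "cmod ?c * cmod (apply_dist T \<phi>) < 1"
        by (simp only: apply_dist_cmult[OF \<phi>] norm_mult)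
      then show ?thesis using pos e by (simp add: field_simps norm_divide)
    qed
    then have "\<forall>B'>B. e * cmod (apply_dist T \<phi>) \<le> B'"
      using e by (simp add: field_simps)
    then have "e * cmod (apply_dist T \<phi>) \<le> B" by (meson dense_ge)
    then show ?thesis using e by (simp add: field_simps)
  qed
  then show ?thesis using e by (auto simp: dist_bound_def intro!: exI[of _ N] exI[of _ "1 / e"])
qed

text \<open>The converse of \<open>dist_bound_apply_dist\<close>; it is the only way in which
  distributions are constructed below.\<close>

lemma dist_exists:
  fixes T :: "(real^'n::finite \<Rightarrow> complex) \<Rightarrow> complex"
  assumes add: "\<And>f h. f \<in> schwartz \<Longrightarrow> h \<in> schwartz \<Longrightarrow> T (\<lambda>x. f x + h x) = T f + T h"
    and cmult: "\<And>c f. f \<in> schwartz \<Longrightarrow> T (\<lambda>x. c * f x) = c * T f"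
    and bound: "dist_bound N C T"
  shows "\<exists>D. \<forall>\<phi>\<in>schwartz. apply_dist D \<phi> = T \<phi>"
proof -
  \<comment> \<open>The type of distributions requires the value 0 at functions that are not
    Schwartz.\<close>
  define T' where "T' = (\<lambda>\<phi>. if \<phi> \<in> schwartz then T \<phi> else 0)"
  have "continuous_map schwartz_topology euclidean T'"
    unfolding continuous_map_def
  proof (intro conjI allI impI)
    fix V :: "complex set" assume "openin euclidean V"
    then have V: "open V" by simp
    show "openin schwartz_topology {x \<in> topspace schwartz_topology. T' x \<in> V}"
    proof (subst openin_subopen, intro ballI)
      fix a assume "a \<in> {x \<in> topspace schwartz_topology. T' x \<in> V}"
      then have a: "a \<in> schwartz" "T a \<in> V" by (auto simp: topspace_schwartz T'_def split: if_splits)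
      obtain d where d: "0 < d" "ball (T a) d \<subseteq> V" using V a(2) open_contains_ball by blast
      \<comment> \<open>Chosen to give \<open>C * e < d\<close> whatever the sign of
        \<open>C\<close>.\<close>
      define e where "e = d / (\<bar>C\<bar> + 1)"
      have e: "0 < e" using d by (simp add: e_def add_nonneg_pos)
      have Ce: "C * e < d"
      proof -
        have "C * e \<le> \<bar>C\<bar> * e" using e by (simp add: mult_right_mono)
        also have "\<dots> < (\<bar>C\<bar> + 1) * e" using e by simp
        also have "\<dots> = d" by (simp add: e_def add_nonneg_eq_0_iff)
        finally show ?thesis .
      qed
      \<comment> \<open>Finitely many seminorms control \<open>sbound N\<close>. The empty list is
        among them, so the intersection below is over a nonempty index set.\<close>
      define L where "L = {is :: 'n list. set is \<subseteq> UNIV \<and> length is \<le> N}"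
      have L: "finite L" "[] \<in> L" unfolding L_def by (intro finite_lists_length_le) auto
      let ?W = "\<lambda>is. {h \<in> schwartz. schwartz_seminorm N is (\<lambda>x. h x - a x) < e}"
      have "openin schwartz_topology (?W is)" for "is"
        unfolding schwartz_topology_def openin_topology_generated_by_iff
        by (rule generate_topology_on.Basis) (use a e in blast)
      then have "openin schwartz_topology (\<Inter>is\<in>L. ?W is)"
        using L by (intro openin_INT2) auto
      moreover have "a \<in> (\<Inter>is\<in>L. ?W is)"
      proof -
        have "schwartz_seminorm N is (\<lambda>x. a x - a x) \<le> 0" for "is"
          using sbound_zero[of 0 "length is" "pweight N"]
          by (intro schwartz_seminorm_le) (auto simp: sbound_iff_iter)
        then show ?thesis using a e by (auto intro: le_less_trans)
      qed
      moreover have "(\<Inter>is\<in>L. ?W is) \<subseteq> {x \<in> topspace schwartz_topology. T' x \<in> V}"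
      proof
        fix h assume h: "h \<in> (\<Inter>is\<in>L. ?W is)"
        then have hs: "h \<in> schwartz" using L by blast
        have "sbound N (pweight N) e (\<lambda>x. h x - a x)"
          unfolding sbound_iff_iter
        proof (intro allI impI conjI)
          fix "is" :: "'n list" and x assume "length is \<le> N"
          then have "schwartz_seminorm N is (\<lambda>x. h x - a x) < e" using h by (auto simp: L_def)
          then show "pweight N x * cmod (iter_partial_deriv is (\<lambda>x. h x - a x) x) \<le> e"
            using le_schwartz_seminorm[OF schwartz_diff[OF hs a(1)], of N x "is"] by simp
        qed (use schwartz_iter_differentiable[OF schwartz_diff[OF hs a(1)]] in blast)
        then have "cmod (T (\<lambda>x. h x - a x)) \<le> C * e"
          by (rule dist_boundD[OF bound schwartz_diff[OF hs a(1)]])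
        moreover have "T (\<lambda>x. h x - a x) = T h - T a"
          using add[OF hs schwartz_cmult[OF a(1), of "-1"]] cmult[OF a(1), of "-1"] by simp
        ultimately have "T h \<in> ball (T a) d"
          using Ce by (simp add: dist_norm norm_minus_commute)
        then show "h \<in> {x \<in> topspace schwartz_topology. T' x \<in> V}"
          using d hs by (auto simp: topspace_schwartz T'_def)
      qed
      ultimately show "\<exists>Ta. openin schwartz_topology Ta \<and> a \<in> Ta \<and> Ta \<subseteq> {x \<in> topspace schwartz_topology. T' x \<in> V}"
        by blast
    qed
  qed simp
  then have "T' \<in> {T. (\<forall>f\<in>schwartz. \<forall>h\<in>schwartz. T (\<lambda>x. f x + h x) = T f + T h) \<and>
      (\<forall>c. \<forall>f\<in>schwartz. T (\<lambda>x. c * f x) = c * T f) \<and>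
      continuous_map schwartz_topology euclidean T \<and> (\<forall>f. f \<notin> schwartz \<longrightarrow> T f = 0)}"
    using add cmult by (auto simp: T'_def schwartz_add schwartz_cmult)
  from Abs_dist_inverse[OF this] show ?thesis
    by (intro exI[of _ "Abs_dist T'"]) (simp add: T'_def)
qed

section \<open>Quadrature and integrals of Schwartz functions\<close>

lemma integral_norm_le_integral:
  fixes f :: "'a \<Rightarrow> complex"
  assumes "integrable M f" "integrable M g" "\<And>x. cmod (f x) \<le> g x"
  shows "cmod (\<integral>x. f x \<partial>M) \<le> (\<integral>x. g x \<partial>M)"
proof -
  have "cmod (\<integral>x. f x \<partial>M) \<le> (\<integral>x. cmod (f x) \<partial>M)" by (rule integral_norm_bound)
  also have "\<dots> \<le> (\<integral>x. g x \<partial>M)" using assms by (intro integral_mono) auto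
  finally show ?thesis .
qed

lemma continuous_on_local_Lipschitz:
  fixes a :: "'a::real_normed_vector \<Rightarrow> 'b::real_normed_vector"
  assumes "\<And>u u'. norm (u - u') \<le> 1 \<Longrightarrow> norm (a u - a u') \<le> norm (u - u') * K u"
  shows "continuous_on UNIV a"
proof (intro continuous_at_imp_continuous_on ballI)
  fix u
  have "((\<lambda>u'. norm (u - u') * K u) \<longlongrightarrow> norm (u - u) * K u) (at u)"
    by (intro tendsto_intros)
  then have "((\<lambda>u'. norm (u - u') * K u) \<longlongrightarrow> 0) (at u)" by simp
  moreover have "\<forall>\<^sub>F u' in at u. norm (a u' - a u) \<le> norm (u - u') * K u"
    unfolding eventually_at
  proof (intro exI[of _ 1] conjI ballI impI)
    fix u' assume "u' \<noteq> u \<and> dist u' u < 1"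
    then show "norm (a u' - a u) \<le> norm (u - u') * K u"
      using assms[of u u'] by (simp add: dist_norm norm_minus_commute)
  qed simp
  ultimately have "((\<lambda>u'. a u' - a u) \<longlongrightarrow> 0) (at u)"
    by (rule Lim_null_comparison[rotated])
  then show "isCont a u" by (simp add: isCont_def LIM_zero_iff)
qed

text \<open>
  A quadrature rule for \<open>\<nu>\<close>: finite sums converging to the integral, with an error that is uniform
  over all integrands sharing the same envelope and local Lipschitz bound \<open>\<beta>\<close>. Through it a
  distribution may be applied under the integral sign, and integrals of operators become limits of
  finite linear combinations.
\<close>

definition quadrature :: "'a::euclidean_space measure \<Rightarrow> (nat \<Rightarrow> 'a set) \<Rightarrow> (nat \<Rightarrow> 'a \<Rightarrow> real) \<Rightarrow> bool" where
  "quadrature \<nu> J c \<longleftrightarrow> (\<forall>n. finite (J n)) \<and> (\<forall>n u. 0 \<le> c n u) \<and>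
    (\<forall>\<beta>. integrable \<nu> \<beta> \<and> (\<forall>u. 0 \<le> \<beta> u) \<longrightarrow> (\<exists>e. e \<longlonglongrightarrow> 0 \<and>
      (\<forall>(a :: 'a \<Rightarrow> complex) B n.
        (\<forall>u. cmod (a u) \<le> B * \<beta> u \<and> (\<forall>u'. norm (u - u') \<le> 1 \<longrightarrow> cmod (a u - a u') \<le> norm (u - u') * (B * \<beta> u)))
        \<longrightarrow> cmod ((\<Sum>u\<in>J n. complex_of_real (c n u) * a u) - (\<integral>u. a u \<partial>\<nu>)) \<le> e n * B)))"

text \<open>Points of the ball of radius n are rounded to a grid, and a node is weighted by the
  measure of its cell. The Lipschitz bound controls the error inside the ball, the envelope the part
  outside; both errors are linear in \<open>B\<close> and otherwise depend on \<beta> only.\<close>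

lemma quadrature_exists:
  fixes \<nu> :: "'a::euclidean_space measure"
  assumes sets: "sets \<nu> = sets borel" and fin: "\<And>n::nat. emeasure \<nu> (cball 0 (real n)) < \<infinity>"
  shows "\<exists>J c. quadrature \<nu> J c"
proof -
  have sp: "space \<nu> = UNIV" using sets_eq_imp_space_eq[OF sets] by simp
  \<comment> \<open>The mesh is \<open>1 / s n\<close>; the factor \<open>DIM('a)\<close> makes the
    sum of the coordinate errors at most \<open>1 / real (Suc n)\<close>.\<close>
  define s where "s n = real (Suc n) * DIM('a)" for n
  have s: "0 < s n" for n by (simp add: s_def)
  define r :: "nat \<Rightarrow> 'a \<Rightarrow> 'a" where "r n u = (\<Sum>b\<in>Basis. (of_int \<lfloor>s n * (u \<bullet> b)\<rfloor> / s n) *\<^sub>R b)" for n u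
  have r_meas[measurable]: "r n \<in> borel_measurable borel" for n unfolding r_def by measurable
  have r_close: "norm (u - r n u) \<le> 1 / real (Suc n)" for n u
  proof -
    have "norm (u - r n u) \<le> (\<Sum>b\<in>Basis. \<bar>(u - r n u) \<bullet> b\<bar>)" by (rule norm_le_l1)
    also have "\<dots> \<le> (\<Sum>b\<in>(Basis::'a set). 1 / s n)"
    proof (rule sum_mono)
      fix b :: 'a assume b: "b \<in> Basis"
      have "(u - r n u) \<bullet> b = (s n * (u \<bullet> b) - of_int \<lfloor>s n * (u \<bullet> b)\<rfloor>) / s n"
        using s[of n] b by (simp add: r_def inner_diff_left inner_sum_left_Basis diff_divide_distrib)
      moreover have "\<bar>s n * (u \<bullet> b) - of_int \<lfloor>s n * (u \<bullet> b)\<rfloor>\<bar> \<le> 1" by linarith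
      ultimately show "\<bar>(u - r n u) \<bullet> b\<bar> \<le> 1 / s n" using s[of n] by (simp add: divide_right_mono)
    qed
    also have "\<dots> = 1 / real (Suc n)" by (simp add: s_def)
    finally show ?thesis .
  qed
  define J where "J n = r n ` cball 0 (real n)" for n
  have J_fin: "finite (J n)" for n
  proof -
    \<comment> \<open>A node is determined by an integer vector, and its entries are bounded because
      the point being rounded lies in the ball.\<close>
    define K where "K = \<lceil>s n * real n\<rceil> + 1"
    let ?G = "\<lambda>k. \<Sum>b\<in>Basis. (of_int (k b) / s n) *\<^sub>R b"
    have "J n \<subseteq> ?G ` (PiE Basis (\<lambda>_. {- K..K}))"
    proof
      fix v assume "v \<in> J n"
      then obtain u where u: "norm u \<le> real n" "v = r n u" by (auto simp: J_def)
      have "\<lfloor>s n * (u \<bullet> b)\<rfloor> \<in> {- K..K}" if b: "b \<in> Basis" for b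
      proof -
        have "\<bar>u \<bullet> b\<bar> \<le> real n" using Basis_le_norm[OF b, of u] u by linarith
        then have "\<bar>s n * (u \<bullet> b)\<bar> \<le> s n * real n" using s[of n] by (simp add: abs_mult)
        then show ?thesis unfolding K_def atLeastAtMost_iff by linarith
      qed
      then have "restrict (\<lambda>b. \<lfloor>s n * (u \<bullet> b)\<rfloor>) Basis \<in> PiE Basis (\<lambda>_. {- K..K})" by auto
      moreover have "v = ?G (restrict (\<lambda>b. \<lfloor>s n * (u \<bullet> b)\<rfloor>) Basis)"
        unfolding u(2) r_def by (intro sum.cong) auto
      ultimately show "v \<in> ?G ` (PiE Basis (\<lambda>_. {- K..K}))" by blast
    qed
    moreover have "finite (PiE (Basis :: 'a set) (\<lambda>_. {- K..K}))" by (intro finite_PiE) auto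
    ultimately show ?thesis by (meson finite_imageI finite_subset)
  qed
  define A where "A n v = {u \<in> cball 0 (real n). r n u = v}" for n v
  define c where "c n v = measure \<nu> (A n v)" for n v
  have A_meas: "A n v \<in> sets \<nu>" for n v
  proof -
    have "A n v = cball 0 (real n) \<inter> (r n -` {v} \<inter> space borel)" by (auto simp: A_def)
    also have "\<dots> \<in> sets borel" by (intro sets.Int measurable_sets[OF r_meas]) auto
    finally show ?thesis by (simp add: sets)
  qed
  have A_fin: "emeasure \<nu> (A n v) < \<infinity>" for n v
  proof -
    have "emeasure \<nu> (A n v) \<le> emeasure \<nu> (cball 0 (real n))"
      by (rule emeasure_mono) (auto simp: A_def sets)
    then show ?thesis using fin[of n] by (rule le_less_trans)
  qed
  \<comment> \<open>The quadrature sum is the integral of the simple function obtained by composing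
    \<open>a\<close> with the rounding, cut off outside the ball.\<close>
  have sum_eq: "indicator (cball 0 (real n)) u *\<^sub>R a (r n u) =
      (\<Sum>v\<in>J n. indicator (A n v) u *\<^sub>R a v)" for n u and a :: "'a \<Rightarrow> complex"
  proof (cases "u \<in> cball 0 (real n)")
    case True
    then have v: "r n u \<in> J n" by (simp add: J_def)
    have "(\<Sum>v\<in>J n. indicator (A n v) u *\<^sub>R a v) = (\<Sum>v\<in>J n. if v = r n u then a v else 0)"
      using True by (intro sum.cong) (auto simp: A_def)
    then show ?thesis using True v J_fin by simp
  next
    case False
    then show ?thesis by (auto simp: A_def)
  qed
  have int_term: "integrable \<nu> (\<lambda>u. indicator (A n v) u *\<^sub>R (z::complex))" for n v z
    using A_meas A_fin by (intro integrable_scaleR_left integrable_real_indicator) auto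
  have int_sum: "(\<integral>u. indicator (cball 0 (real n)) u *\<^sub>R a (r n u) \<partial>\<nu>) = (\<Sum>v\<in>J n. complex_of_real (c n v) * a v)"
    for n and a :: "'a \<Rightarrow> complex"
    unfolding sum_eq using A_meas A_fin
    by (subst Bochner_Integration.integral_sum) (auto intro!: int_term sum.cong simp: c_def scaleR_conv_of_real)
  have int_r: "integrable \<nu> (\<lambda>u. indicator (cball 0 (real n)) u *\<^sub>R a (r n u))" for n and a :: "'a \<Rightarrow> complex"
    unfolding sum_eq by (intro Bochner_Integration.integrable_sum int_term)
  have "\<exists>e. e \<longlonglongrightarrow> (0::real) \<and> (\<forall>(a :: 'a \<Rightarrow> complex) B n.
        (\<forall>u. cmod (a u) \<le> B * \<beta> u \<and> (\<forall>u'. norm (u - u') \<le> 1 \<longrightarrow> cmod (a u - a u') \<le> norm (u - u') * (B * \<beta> u)))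
        \<longrightarrow> cmod ((\<Sum>u\<in>J n. complex_of_real (c n u) * a u) - (\<integral>u. a u \<partial>\<nu>)) \<le> e n * B)"
    if \<beta>: "integrable \<nu> \<beta>" "\<And>u. 0 \<le> \<beta> u" for \<beta> :: "'a \<Rightarrow> real"
  proof -
    \<comment> \<open>The pointwise error, up to the factor \<open>B\<close>: the first term for a
      rounded point, the second for a point outside the ball.\<close>
    define err where "err n u = (1 / real (Suc n)) * \<beta> u + indicator (- cball 0 (real n)) u * \<beta> u" for n u
    have err_int1: "integrable \<nu> (\<lambda>u. indicator (- cball 0 (real n)) u * \<beta> u)" for n
      using \<beta>(1) integrable_mult_indicator[of "- cball 0 (real n)" \<nu> \<beta>] by (simp add: sets)
    have err_int: "integrable \<nu> (err n)" for n
      unfolding err_def using \<beta>(1) err_int1 by auto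
    define e where "e n = (\<integral>u. err n u \<partial>\<nu>)" for n
    have "(\<lambda>n. \<integral>u. indicator (- cball 0 (real n)) u * \<beta> u \<partial>\<nu>) \<longlonglongrightarrow> (\<integral>u. 0 \<partial>\<nu>)"
    proof (rule integral_dominated_convergence[where w = \<beta>])
      show "AE u in \<nu>. (\<lambda>n. indicator (- cball 0 (real n)) u * \<beta> u) \<longlonglongrightarrow> 0"
      proof (rule AE_I2)
        fix u :: 'a
        obtain N :: nat where N: "norm u \<le> real N" using real_arch_simple by blast
        have "\<forall>\<^sub>F n in sequentially. indicator (- cball 0 (real n)) u * \<beta> u = 0"
          using eventually_ge_at_top[of N]
        proof eventually_elim
          case (elim n)
          then have "norm u \<le> real n" using N by linarith
          then show ?case by simp
        qed
        then show "(\<lambda>n. indicator (- cball 0 (real n)) u * \<beta> u) \<longlonglongrightarrow> 0" by (rule tendsto_eventually)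
      qed
    qed (use \<beta> err_int1 in \<open>auto simp: indicator_def\<close>)
    moreover have "(\<lambda>n. (1 / real (Suc n)) * (\<integral>u. \<beta> u \<partial>\<nu>)) \<longlonglongrightarrow> 0"
      by (intro tendsto_mult_left_zero) real_asymp
    ultimately have "(\<lambda>n. (1 / real (Suc n)) * (\<integral>u. \<beta> u \<partial>\<nu>) + (\<integral>u. indicator (- cball 0 (real n)) u * \<beta> u \<partial>\<nu>)) \<longlonglongrightarrow> 0 + 0"
      by (intro tendsto_add) simp_all
    moreover have "e = (\<lambda>n. (1 / real (Suc n)) * (\<integral>u. \<beta> u \<partial>\<nu>) + (\<integral>u. indicator (- cball 0 (real n)) u * \<beta> u \<partial>\<nu>))"
      unfolding e_def err_def using \<beta>(1) err_int1 by (intro ext) (subst Bochner_Integration.integral_add, auto)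
    ultimately have e0: "e \<longlonglongrightarrow> 0" by simp
    have "cmod ((\<Sum>u\<in>J n. complex_of_real (c n u) * a u) - (\<integral>u. a u \<partial>\<nu>)) \<le> e n * B"
      if a: "\<And>u. cmod (a u) \<le> B * \<beta> u"
        "\<And>u u'. norm (u - u') \<le> 1 \<Longrightarrow> cmod (a u - a u') \<le> norm (u - u') * (B * \<beta> u)" for a :: "'a \<Rightarrow> complex" and B n
    proof -
      have "a \<in> borel_measurable borel"
        using continuous_on_local_Lipschitz[of a, OF a(2)] by (rule borel_measurable_continuous_onI)
      then have a_meas: "a \<in> borel_measurable \<nu>" using measurable_cong_sets[OF sets refl] by blast
      have a_int: "integrable \<nu> a"
        by (rule Bochner_Integration.integrable_bound[of \<nu> "\<lambda>u. B * \<beta> u"])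
          (use \<beta>(1) a_meas a(1) in \<open>auto intro: order_trans[OF a(1) abs_ge_self]\<close>)
      have "cmod (indicator (cball 0 (real n)) u *\<^sub>R a (r n u) - a u) \<le> B * err n u" for u
      proof (cases "u \<in> cball 0 (real n)")
        case True
        have 1: "norm (u - r n u) \<le> 1" using r_close[of u n] by (rule order_trans) simp
        have B0: "0 \<le> B * \<beta> u" using a(1)[of u] norm_ge_zero order_trans by blast
        have "cmod (a u - a (r n u)) \<le> norm (u - r n u) * (B * \<beta> u)" using a(2)[OF 1] .
        also have "\<dots> \<le> 1 / real (Suc n) * (B * \<beta> u)" using r_close B0 by (intro mult_right_mono)
        finally show ?thesis using True by (simp add: err_def norm_minus_commute mult_ac)
      next
        case False
        have "0 \<le> B * \<beta> u" using a(1)[of u] norm_ge_zero order_trans by blast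
        then have "0 \<le> B * (\<beta> u / (1 + real n))" by simp
        then show ?thesis using False a(1)[of u] by (simp add: err_def distrib_left)
      qed
      then have "cmod (\<integral>u. (indicator (cball 0 (real n)) u *\<^sub>R a (r n u) - a u) \<partial>\<nu>) \<le> (\<integral>u. B * err n u \<partial>\<nu>)"
        by (intro integral_norm_le_integral Bochner_Integration.integrable_diff int_r a_int integrable_mult_right err_int)
      then show ?thesis
        using int_r a_int by (simp add: int_sum e_def mult.commute)
    qed
    then show ?thesis using e0 by blast
  qed
  then have "quadrature \<nu> J c"
    unfolding quadrature_def using J_fin by (auto simp: c_def)
  then show ?thesis by blast
qed

lemma quadrature_error:
  assumes "quadrature \<nu> J c" "integrable \<nu> \<beta>" "\<And>u. 0 \<le> \<beta> u"
  obtains e where "e \<longlonglongrightarrow> 0"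
    "\<And>a B n. (\<And>u. cmod (a u) \<le> B * \<beta> u) \<Longrightarrow>
      (\<And>u u'. norm (u - u') \<le> 1 \<Longrightarrow> cmod (a u - a u') \<le> norm (u - u') * (B * \<beta> u)) \<Longrightarrow>
      cmod ((\<Sum>u\<in>J n. complex_of_real (c n u) * a u) - (\<integral>u. a u \<partial>\<nu>)) \<le> e n * B"
proof -
  obtain e where e: "e \<longlonglongrightarrow> 0" and *: "\<forall>(a :: 'a \<Rightarrow> complex) B n.
        (\<forall>u. cmod (a u) \<le> B * \<beta> u \<and> (\<forall>u'. norm (u - u') \<le> 1 \<longrightarrow> cmod (a u - a u') \<le> norm (u - u') * (B * \<beta> u)))
        \<longrightarrow> cmod ((\<Sum>u\<in>J n. complex_of_real (c n u) * a u) - (\<integral>u. a u \<partial>\<nu>)) \<le> e n * B"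
    using assms unfolding quadrature_def by blast
  show thesis
    by (rule that[OF e], rule *[rule_format]) auto
qed

lemma quadrature_LIMSEQ:
  assumes "quadrature \<nu> J c" "integrable \<nu> \<beta>" "\<And>u. cmod (a u) \<le> \<beta> u"
    "\<And>u u'. norm (u - u') \<le> 1 \<Longrightarrow> cmod (a u - a u') \<le> norm (u - u') * \<beta> u"
  shows "(\<lambda>n. \<Sum>u\<in>J n. complex_of_real (c n u) * a u) \<longlonglongrightarrow> (\<integral>u. a u \<partial>\<nu>)"
proof -
  have "0 \<le> \<beta> u" for u using assms(3)[of u] norm_ge_zero order_trans by blast
  then obtain e where e: "e \<longlonglongrightarrow> 0" and err: "\<And>a B n. (\<And>u. cmod (a u) \<le> B * \<beta> u) \<Longrightarrow>
      (\<And>u u'. norm (u - u') \<le> 1 \<Longrightarrow> cmod (a u - a u') \<le> norm (u - u') * (B * \<beta> u)) \<Longrightarrow>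
      cmod ((\<Sum>u\<in>J n. complex_of_real (c n u) * a u) - (\<integral>u. a u \<partial>\<nu>)) \<le> e n * B"
    by (rule quadrature_error[OF assms(1,2)]) blast
  have "cmod ((\<Sum>u\<in>J n. complex_of_real (c n u) * a u) - (\<integral>u. a u \<partial>\<nu>)) \<le> e n * 1" for n
    by (rule err) (use assms(3,4) in auto)
  then have "(\<lambda>n. (\<Sum>u\<in>J n. complex_of_real (c n u) * a u) - (\<integral>u. a u \<partial>\<nu>)) \<longlonglongrightarrow> 0"
    by (intro Lim_null_comparison[OF _ e]) auto
  then show ?thesis by (simp add: LIM_zero_iff)
qed

lemma integrable_local_Lipschitz:
  fixes \<nu> :: "'a::euclidean_space measure" and a :: "'a \<Rightarrow> complex"
  assumes sets: "sets \<nu> = sets borel" and "integrable \<nu> \<beta>" and "\<And>u. cmod (a u) \<le> \<beta> u"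
    and "\<And>u u'. norm (u - u') \<le> 1 \<Longrightarrow> cmod (a u - a u') \<le> norm (u - u') * \<beta> u"
  shows "integrable \<nu> a"
proof (rule Bochner_Integration.integrable_bound[OF assms(2)])
  have "a \<in> borel_measurable borel"
    using continuous_on_local_Lipschitz[of a, OF assms(4)] by (rule borel_measurable_continuous_onI)
  then show "a \<in> borel_measurable \<nu>" using measurable_cong_sets[OF sets refl] by blast
qed (use assms(3) in \<open>auto intro: order_trans[OF assms(3) abs_ge_self]\<close>)

text \<open>
  In the following condition \<open>\<beta>\<close> serves both as envelope and as local Lipschitz constant, so that a
  single integrability assumption on \<open>\<beta>\<close> permits applying a distribution under the integral sign.
\<close>

definition fam :: "nat \<Rightarrow> (real^'n::finite \<Rightarrow> real) \<Rightarrow> ('a::real_normed_vector \<Rightarrow> real) \<Rightarrow>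
    ('a \<Rightarrow> real^'n \<Rightarrow> complex) \<Rightarrow> bool" where
  "fam m W \<beta> \<Phi> \<longleftrightarrow> (\<forall>u. sbound m W (\<beta> u) (\<Phi> u)) \<and>
    (\<forall>u u'. norm (u - u') \<le> 1 \<longrightarrow> sbound m W (norm (u - u') * \<beta> u) (\<lambda>y. \<Phi> u y - \<Phi> u' y))"

section \<open>Differentiation and quadrature under the integral sign\<close>

lemma partial_deriv_diff:
  assumes "\<And>x. f differentiable at x" "\<And>x. g differentiable at x"
  shows "partial_deriv i (\<lambda>x. f x - g x) = (\<lambda>x. partial_deriv i f x - partial_deriv i g x)"
  using has_derivative_diff[OF frechet_derivative_works[THEN iffD1, OF assms(1)]
      frechet_derivative_works[THEN iffD1, OF assms(2)], THEN partial_deriv_eq]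
  by (auto simp: partial_deriv_def)

lemma fam_partial_deriv:
  assumes "fam (Suc m) W \<beta> \<Phi>"
  shows "fam m W \<beta> (\<lambda>u. partial_deriv i (\<Phi> u))"
proof -
  have d: "\<Phi> u differentiable at x" for u x
    using assms sbound_diffD unfolding fam_def by blast
  have "partial_deriv i (\<lambda>y. \<Phi> u y - \<Phi> u' y) = (\<lambda>y. partial_deriv i (\<Phi> u) y - partial_deriv i (\<Phi> u') y)" for u u'
    by (rule partial_deriv_diff) (use d in auto)
  then show ?thesis using assms unfolding fam_def by auto metis+
qed

lemma fam_le: "fam m W \<beta> \<Phi> \<Longrightarrow> m' \<le> m \<Longrightarrow> fam m' W \<beta> \<Phi>"
  unfolding fam_def using sbound_le by blast

lemma fam_monoB:
  assumes "fam m W \<beta> \<Phi>" "\<And>u. \<beta> u \<le> \<beta>' u"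
  shows "fam m W \<beta>' \<Phi>"
  using assms unfolding fam_def by (meson mult_left_mono norm_ge_zero sbound_monoB)

lemma fam_value:
  assumes "fam m W \<beta> \<Phi>" "\<And>y. 1 \<le> W y"
  shows "cmod (\<Phi> u y) \<le> \<beta> u" "norm (u - u') \<le> 1 \<Longrightarrow> cmod (\<Phi> u y - \<Phi> u' y) \<le> norm (u - u') * \<beta> u"
proof -
  have *: "cmod z \<le> b" if "W y * cmod z \<le> b" for z b
    using that mult_right_mono[OF assms(2)[of y], of "cmod z"] by simp
  show "cmod (\<Phi> u y) \<le> \<beta> u"
    using assms(1) sbound_leD unfolding fam_def by (intro *) blast
  show "cmod (\<Phi> u y - \<Phi> u' y) \<le> norm (u - u') * \<beta> u" if "norm (u - u') \<le> 1"
    using assms(1) sbound_leD[where f = "\<lambda>y. \<Phi> u y - \<Phi> u' y"] that unfolding fam_def by (intro *) blast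
qed

lemma fam_integrable:
  fixes \<nu> :: "'a::euclidean_space measure"
  assumes "sets \<nu> = sets borel" "integrable \<nu> \<beta>" "fam m W \<beta> \<Phi>" "\<And>y. 1 \<le> W y"
  shows "integrable \<nu> (\<lambda>u. \<Phi> u y)"
  using fam_value[OF assms(3,4)] by (intro integrable_local_Lipschitz[OF assms(1,2)])

text \<open>The constant is explicit and linear in \<open>B\<close>, so the remainder can be
  integrated over a family whose bound depends on the parameter.\<close>

lemma second_order_remainder:
  fixes f :: "real^'n::finite \<Rightarrow> complex"
  assumes "sbound (Suc (Suc 0)) W B f" "\<And>y. 1 \<le> W y"
  shows "cmod (f (y + v) - f y - (\<Sum>i\<in>UNIV. (v $ i) *\<^sub>R partial_deriv i f y)) \<le> (real CARD('n))\<^sup>2 * B * (norm v)\<^sup>2"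
proof -
  have d: "f differentiable at x" "partial_deriv i f differentiable at x" for i x
    using sbound_diffD[OF assms(1)] sbound_diffD[OF sbound_SucD[OF assms(1)]] by auto
  have le: "cmod (partial_deriv j (partial_deriv i f) z) \<le> B" for i j z
    using sbound_leD[OF sbound_SucD[OF sbound_SucD[OF assms(1)]], of z j i]
      mult_right_mono[OF assms(2)[of z], of "cmod (partial_deriv j (partial_deriv i f) z)"] by simp
  have lip: "cmod (partial_deriv i f z - partial_deriv i f y) \<le> (CARD('n) * B) * norm (z - y)" for i z
    by (rule differentiable_bound[where S = UNIV and f' = "\<lambda>z v. \<Sum>j\<in>UNIV. (v $ j) *\<^sub>R partial_deriv j (partial_deriv i f) z"])
      (auto intro!: norm_le_sum_partial_deriv le has_derivative_partial_deriv d)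
  let ?D = "\<lambda>z v. \<Sum>i\<in>UNIV. (v $ i) *\<^sub>R partial_deriv i f z"
  let ?S = "closed_segment y (y + v)"
  have "cmod (f (y + v) - f y - ?D y ((y + v) - y)) \<le> norm ((y + v) - y) * (CARD('n) * ((CARD('n) * B) * norm v))"
  proof (rule differentiable_bound_linearization[where S = ?S])
    fix t :: real assume "t \<in> {0..1}"
    then show "y + t *\<^sub>R (y + v - y) \<in> ?S" by (auto simp: closed_segment_def algebra_simps)
  next
    fix z assume z: "z \<in> ?S"
    show "(f has_derivative ?D z) (at z within ?S)"
      using has_derivative_partial_deriv[OF d(1)] has_derivative_at_withinI by blast
    have nz: "norm (z - y) \<le> norm v"
      using z segment_bound1[of z y "y + v"] by (simp add: norm_minus_commute)
    show "onorm (?D z - ?D y) \<le> CARD('n) * ((CARD('n) * B) * norm v)"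
    proof (rule onorm_le)
      fix h :: "real^'n"
      have "cmod ((?D z - ?D y) h) = cmod (\<Sum>i\<in>UNIV. (h $ i) *\<^sub>R (partial_deriv i f z - partial_deriv i f y))"
        by (simp add: sum_subtractf[symmetric] scaleR_diff_right)
      also have "\<dots> \<le> (\<Sum>i\<in>(UNIV::'n set). norm h * ((CARD('n) * B) * norm v))"
      proof (rule order_trans[OF norm_sum], rule sum_mono)
        fix i
        have "0 \<le> B" using le norm_ge_zero order_trans by blast
        then have "cmod (partial_deriv i f z - partial_deriv i f y) \<le> (CARD('n) * B) * norm v"
          using lip[of i z] nz by (meson mult_left_mono mult_nonneg_nonneg of_nat_0_le_iff order_trans)
        then show "norm ((h $ i) *\<^sub>R (partial_deriv i f z - partial_deriv i f y)) \<le> norm h * ((CARD('n) * B) * norm v)"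
          using component_le_norm_cart[of h i] by (auto intro!: mult_mono)
      qed
      finally show "cmod ((?D z - ?D y) h) \<le> CARD('n) * ((CARD('n) * B) * norm v) * norm h"
        by (simp add: mult_ac)
    qed
  qed auto
  then show ?thesis by (simp add: power2_eq_square mult_ac)
qed

text \<open>The second order remainders are integrated over the parameter, which leaves a multiple
  of the squared increment. This use of two derivatives is the origin of \<open>Suc (Suc m)\<close>
  in what follows.\<close>

lemma has_derivative_integral_fam:
  fixes \<nu> :: "'a::euclidean_space measure" and \<Phi> :: "'a \<Rightarrow> real^'n::finite \<Rightarrow> complex"
  assumes sets: "sets \<nu> = sets borel" and \<beta>: "integrable \<nu> \<beta>" and fam: "fam (Suc (Suc 0)) W \<beta> \<Phi>"
    and W: "\<And>y. 1 \<le> W y"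
  shows "((\<lambda>y. \<integral>u. \<Phi> u y \<partial>\<nu>) has_derivative
    (\<lambda>v. \<Sum>i\<in>UNIV. (v $ i) *\<^sub>R (\<integral>u. partial_deriv i (\<Phi> u) y \<partial>\<nu>))) (at y)"
proof -
  let ?F = "\<lambda>y. \<integral>u. \<Phi> u y \<partial>\<nu>"
  let ?D = "\<lambda>v. \<Sum>i\<in>UNIV. (v $ i) *\<^sub>R (\<integral>u. partial_deriv i (\<Phi> u) y \<partial>\<nu>)"
  define K where "K = (real CARD('n))\<^sup>2 * (\<integral>u. \<beta> u \<partial>\<nu>)"
  have i1: "integrable \<nu> (\<lambda>u. \<Phi> u y)" for y by (rule fam_integrable[OF sets \<beta> fam W])
  have i2: "integrable \<nu> (\<lambda>u. partial_deriv i (\<Phi> u) y)" for i y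
    by (rule fam_integrable[OF sets \<beta> fam_partial_deriv[OF fam] W])
  have i3: "integrable \<nu> (\<lambda>u. \<Sum>i\<in>UNIV. (v $ i) *\<^sub>R partial_deriv i (\<Phi> u) y)" for v :: "real^'n"
    using i2 by (intro Bochner_Integration.integrable_sum integrable_scaleR_right) auto
  have bound: "cmod (?F (y + v) - ?F y - ?D v) \<le> K * (norm v)\<^sup>2" for v
  proof -
    have "?F (y + v) - ?F y - ?D v = (\<integral>u. \<Phi> u (y + v) - \<Phi> u y - (\<Sum>i\<in>UNIV. (v $ i) *\<^sub>R partial_deriv i (\<Phi> u) y) \<partial>\<nu>)"
      using i1 i2 i3 by (simp add: Bochner_Integration.integral_sum)
    also have "cmod \<dots> \<le> (\<integral>u. (real CARD('n))\<^sup>2 * \<beta> u * (norm v)\<^sup>2 \<partial>\<nu>)"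
    proof (rule integral_norm_le_integral)
      fix u
      have "sbound (Suc (Suc 0)) W (\<beta> u) (\<Phi> u)" using fam by (simp add: fam_def)
      from second_order_remainder[OF this W]
      show "cmod (\<Phi> u (y + v) - \<Phi> u y - (\<Sum>i\<in>UNIV. (v $ i) *\<^sub>R partial_deriv i (\<Phi> u) y)) \<le> (real CARD('n))\<^sup>2 * \<beta> u * (norm v)\<^sup>2" .
    qed (use i1 i3 \<beta> in auto)
    finally show ?thesis by (simp add: K_def)
  qed
  show ?thesis
    unfolding has_derivative_at
  proof
    show "bounded_linear ?D"
      by (intro bounded_linear_sum bounded_linear_compose[OF bounded_linear_scaleR_left bounded_linear_vec_nth])
    have L: "((\<lambda>v::real^'n. K * norm v) \<longlongrightarrow> 0) (at 0)" by (auto intro!: tendsto_eq_intros)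
    have H: "norm (norm (?F (y + v) - ?F y - ?D v) / norm v) \<le> K * norm v" for v
      using bound[of v] by (cases "v = 0") (auto simp: divide_le_eq power2_eq_square mult_ac)
    show "((\<lambda>v. norm (?F (y + v) - ?F y - ?D v) / norm v) \<longlongrightarrow> 0) (at 0)"
      by (rule Lim_null_comparison[OF always_eventually[OF allI[OF H]] L])
  qed
qed

lemma partial_deriv_integral_fam:
  fixes \<nu> :: "'a::euclidean_space measure"
  assumes "sets \<nu> = sets borel" "integrable \<nu> \<beta>" "fam (Suc (Suc 0)) W \<beta> \<Phi>" "\<And>y. 1 \<le> W y"
  shows "partial_deriv i (\<lambda>y. \<integral>u. \<Phi> u y \<partial>\<nu>) = (\<lambda>y. \<integral>u. partial_deriv i (\<Phi> u) y \<partial>\<nu>)"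
  by (rule ext, subst partial_deriv_eq[OF has_derivative_integral_fam[OF assms]])
    (simp add: axis_def if_distrib[of "\<lambda>r. r *\<^sub>R _"] cong: if_cong)

text \<open>Each derivative passes under the integral and is bounded there by the envelope; the two
  extra orders only justify the differentiation.\<close>

lemma sbound_integral_fam:
  fixes \<nu> :: "'a::euclidean_space measure"
  assumes sets: "sets \<nu> = sets borel" and \<beta>: "integrable \<nu> \<beta>" and W: "\<And>y. 1 \<le> W y"
  shows "fam (Suc (Suc m)) W \<beta> \<Phi> \<Longrightarrow> sbound m W (\<integral>u. \<beta> u \<partial>\<nu>) (\<lambda>y. \<integral>u. \<Phi> u y \<partial>\<nu>)"
proof -
  have *: "sbound 0 W (\<integral>u. \<beta> u \<partial>\<nu>) (\<lambda>y. \<integral>u. \<Phi> u y \<partial>\<nu>)" if fam: "fam (Suc (Suc 0)) W \<beta> \<Phi>" for \<Phi>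
  proof -
    have "W y * cmod (\<integral>u. \<Phi> u y \<partial>\<nu>) \<le> (\<integral>u. \<beta> u \<partial>\<nu>)" for y
    proof -
      have "W y * cmod (\<integral>u. \<Phi> u y \<partial>\<nu>) = cmod (\<integral>u. W y *\<^sub>R \<Phi> u y \<partial>\<nu>)"
        using W[of y] by simp
      also have "\<dots> \<le> (\<integral>u. \<beta> u \<partial>\<nu>)"
      proof (rule integral_norm_le_integral)
        show "cmod (W y *\<^sub>R \<Phi> u y) \<le> \<beta> u" for u
          using fam sbound_leD[of _ W "\<beta> u" "\<Phi> u" y] W[of y] by (auto simp: fam_def)
      qed (use \<beta> fam_integrable[OF sets \<beta> fam W] in auto)
      finally show ?thesis .
    qed
    then show ?thesis using has_derivative_integral_fam[OF sets \<beta> fam W] by (auto simp: differentiable_def)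
  qed
  show "fam (Suc (Suc m)) W \<beta> \<Phi> \<Longrightarrow> sbound m W (\<integral>u. \<beta> u \<partial>\<nu>) (\<lambda>y. \<integral>u. \<Phi> u y \<partial>\<nu>)"
  proof (induction m arbitrary: \<Phi>)
    case 0
    then show ?case using * by simp
  next
    case (Suc m)
    have "sbound m W (\<integral>u. \<beta> u \<partial>\<nu>) (partial_deriv i (\<lambda>y. \<integral>u. \<Phi> u y \<partial>\<nu>))" for i
      using Suc.IH[OF fam_partial_deriv[OF Suc.prems]]
      by (simp only: partial_deriv_integral_fam[OF sets \<beta> fam_le[OF Suc.prems] W])
    then show ?case using *[OF fam_le[OF Suc.prems]] by (intro sbound_SucI) auto
  qed
qed

lemma partial_deriv_sum:
  assumes "\<And>u x. u \<in> I \<Longrightarrow> f u differentiable at x"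
  shows "partial_deriv i (\<lambda>x. \<Sum>u\<in>I. c u * f u x) = (\<lambda>x. \<Sum>u\<in>I. c u * partial_deriv i (f u) x)"
proof
  fix x
  have "((\<lambda>x. \<Sum>u\<in>I. c u * f u x) has_derivative (\<lambda>h. \<Sum>u\<in>I. c u * frechet_derivative (f u) (at x) h)) (at x)"
    using assms by (intro has_derivative_sum has_derivative_mult_right) (simp add: frechet_derivative_works[symmetric])
  from partial_deriv_eq[OF this] show "partial_deriv i (\<lambda>x. \<Sum>u\<in>I. c u * f u x) x = (\<Sum>u\<in>I. c u * partial_deriv i (f u) x)"
    by (simp add: partial_deriv_def)
qed

text \<open>The scalar error estimate is applied at each fixed \<open>y\<close> to the weighted
  derivatives of the family. All of them share the envelope, so the sums converge in the Schwartz
  seminorms and not just pointwise.\<close>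

lemma sbound_quadrature:
  fixes \<nu> :: "'a::euclidean_space measure"
  assumes sets: "sets \<nu> = sets borel" and \<beta>: "integrable \<nu> \<beta>" and W: "\<And>y. 1 \<le> W y"
    and e: "\<And>a. (\<And>u. cmod (a u) \<le> \<beta> u) \<Longrightarrow>
      (\<And>u u'. norm (u - u') \<le> 1 \<Longrightarrow> cmod (a u - a u') \<le> norm (u - u') * \<beta> u) \<Longrightarrow>
      cmod ((\<Sum>u\<in>J. complex_of_real (c u) * a u) - (\<integral>u. a u \<partial>\<nu>)) \<le> e"
  shows "fam (Suc (Suc m)) W \<beta> \<Phi> \<Longrightarrow>
    sbound m W e (\<lambda>y. (\<Sum>u\<in>J. complex_of_real (c u) * \<Phi> u y) - (\<integral>u. \<Phi> u y \<partial>\<nu>))"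
proof -
  have d: "\<Phi> u differentiable at x" if "fam (Suc (Suc 0)) W \<beta> \<Phi>" for u x \<Phi>
    using that sbound_diffD unfolding fam_def by blast
  have di: "(\<lambda>y. \<integral>u. \<Phi> u y \<partial>\<nu>) differentiable at x" if "fam (Suc (Suc 0)) W \<beta> \<Phi>" for x \<Phi>
    using has_derivative_integral_fam[OF sets \<beta> that W] by (auto simp: differentiable_def)
  have ds: "(\<lambda>y. \<Sum>u\<in>J. complex_of_real (c u) * \<Phi> u y) differentiable at x" if "fam (Suc (Suc 0)) W \<beta> \<Phi>" for x \<Phi>
    using d[OF that] by (cases "finite J") (auto intro!: differentiable_sum differentiable_mult)
  have *: "sbound 0 W e (\<lambda>y. (\<Sum>u\<in>J. complex_of_real (c u) * \<Phi> u y) - (\<integral>u. \<Phi> u y \<partial>\<nu>))"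
    if fam: "fam (Suc (Suc 0)) W \<beta> \<Phi>" for \<Phi>
  proof -
    have "W y * cmod ((\<Sum>u\<in>J. complex_of_real (c u) * \<Phi> u y) - (\<integral>u. \<Phi> u y \<partial>\<nu>)) \<le> e" for y
    proof -
      \<comment> \<open>Including the weight in the integrand gives an error uniform in
        \<open>y\<close>.\<close>
      have "cmod ((\<Sum>u\<in>J. complex_of_real (c u) * (W y * \<Phi> u y)) - (\<integral>u. W y * \<Phi> u y \<partial>\<nu>)) \<le> e"
      proof (rule e)
        show "cmod (W y * \<Phi> u y) \<le> \<beta> u" for u
          using fam sbound_leD[of _ W "\<beta> u" "\<Phi> u" y] W[of y] by (auto simp: fam_def norm_mult)
        show "cmod (W y * \<Phi> u y - W y * \<Phi> u' y) \<le> norm (u - u') * \<beta> u" if "norm (u - u') \<le> 1" for u u'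
          using fam sbound_leD[of _ W "norm (u - u') * \<beta> u" "\<lambda>y. \<Phi> u y - \<Phi> u' y" y] W[of y] that
          by (auto simp: fam_def norm_mult right_diff_distrib[symmetric])
      qed
      moreover have "(\<Sum>u\<in>J. complex_of_real (c u) * (W y * \<Phi> u y)) - (\<integral>u. W y * \<Phi> u y \<partial>\<nu>) =
          complex_of_real (W y) * ((\<Sum>u\<in>J. complex_of_real (c u) * \<Phi> u y) - (\<integral>u. \<Phi> u y \<partial>\<nu>))"
        by (simp add: right_diff_distrib sum_distrib_left mult_ac)
      ultimately show ?thesis using W[of y] by (simp add: norm_mult)
    qed
    then show ?thesis using di[OF fam] ds[OF fam] by (auto intro!: differentiable_diff)
  qed
  show "fam (Suc (Suc m)) W \<beta> \<Phi> \<Longrightarrow> sbound m W e (\<lambda>y. (\<Sum>u\<in>J. complex_of_real (c u) * \<Phi> u y) - (\<integral>u. \<Phi> u y \<partial>\<nu>))"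
  proof (induction m arbitrary: \<Phi>)
    case 0
    then show ?case using * by simp
  next
    case (Suc m)
    have fam2: "fam (Suc (Suc 0)) W \<beta> \<Phi>" by (rule fam_le[OF Suc.prems]) simp
    have "partial_deriv i (\<lambda>y. (\<Sum>u\<in>J. complex_of_real (c u) * \<Phi> u y) - (\<integral>u. \<Phi> u y \<partial>\<nu>)) =
      (\<lambda>y. (\<Sum>u\<in>J. complex_of_real (c u) * partial_deriv i (\<Phi> u) y) - (\<integral>u. partial_deriv i (\<Phi> u) y \<partial>\<nu>))" for i
      by (simp only: partial_deriv_diff[OF ds[OF fam2] di[OF fam2]] partial_deriv_sum[OF d[OF fam2]]
          partial_deriv_integral_fam[OF sets \<beta> fam2 W])
    then have "sbound m W e (partial_deriv i (\<lambda>y. (\<Sum>u\<in>J. complex_of_real (c u) * \<Phi> u y) - (\<integral>u. \<Phi> u y \<partial>\<nu>)))" for i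
      using Suc.IH[OF fam_partial_deriv[OF Suc.prems]] by simp
    then show ?case using *[OF fam2] by (intro sbound_SucI) auto
  qed
qed

lemma schwartz_integral_fam:
  fixes \<nu> :: "'a::euclidean_space measure"
  assumes "sets \<nu> = sets borel" "\<And>m. \<exists>\<beta>. integrable \<nu> \<beta> \<and> fam m (pweight m) \<beta> \<Phi>"
  shows "(\<lambda>y. \<integral>u. \<Phi> u y \<partial>\<nu>) \<in> schwartz"
  unfolding schwartz_iff
proof (intro allI)
  fix m k
  let ?N = "max (Suc (Suc m)) k"
  obtain \<beta> where \<beta>: "integrable \<nu> \<beta>" "fam ?N (pweight ?N) \<beta> \<Phi>" using assms(2) by blast
  have "fam (Suc (Suc m)) (pweight ?N) \<beta> \<Phi>" by (rule fam_le[OF \<beta>(2)]) simp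
  from sbound_integral_fam[OF assms(1) \<beta>(1) pweight_ge1 this]
  show "\<exists>B. sbound m (pweight k) B (\<lambda>y. \<integral>u. \<Phi> u y \<partial>\<nu>)"
    by (meson max.cobounded2 order_refl pweight_mono sbound_mono)
qed

text \<open>A distribution of finite order turns a family of test functions into a scalar integrand
  that the quadrature accepts, with the envelope multiplied by the constant C.\<close>

lemma dist_fam:
  assumes T: "dist_bound N C (apply_dist T)" and C: "0 \<le> C"
    and fam: "fam N (pweight N) \<beta> \<Phi>" and \<Phi>: "\<And>u. \<Phi> u \<in> schwartz"
  shows "cmod (apply_dist T (\<Phi> u)) \<le> C * \<beta> u"
    "norm (u - u') \<le> 1 \<Longrightarrow> cmod (apply_dist T (\<Phi> u) - apply_dist T (\<Phi> u')) \<le> norm (u - u') * (C * \<beta> u)"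
proof -
  show "cmod (apply_dist T (\<Phi> u)) \<le> C * \<beta> u"
    using fam by (intro dist_boundD[OF T \<Phi>]) (simp add: fam_def)
  assume "norm (u - u') \<le> 1"
  then have "cmod (apply_dist T (\<lambda>y. \<Phi> u y - \<Phi> u' y)) \<le> C * (norm (u - u') * \<beta> u)"
    using fam by (intro dist_boundD[OF T schwartz_diff[OF \<Phi> \<Phi>]]) (simp add: fam_def)
  then show "cmod (apply_dist T (\<Phi> u) - apply_dist T (\<Phi> u')) \<le> norm (u - u') * (C * \<beta> u)"
    by (simp add: apply_dist_diff \<Phi> mult_ac)
qed

text \<open>The distribution is applied to the quadrature sums. By linearity the values converge to
  the right side, and by convergence in the Schwartz seminorms to the left side.\<close>

theorem apply_dist_integral:
  fixes \<nu> :: "'a::euclidean_space measure"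
  assumes sets: "sets \<nu> = sets borel" and fin: "\<And>n::nat. emeasure \<nu> (cball 0 (real n)) < \<infinity>"
    and fam: "\<And>m. \<exists>\<beta>. integrable \<nu> \<beta> \<and> fam m (pweight m) \<beta> \<Phi>" and \<Phi>: "\<And>u. \<Phi> u \<in> schwartz"
  shows "apply_dist T (\<lambda>y. \<integral>u. \<Phi> u y \<partial>\<nu>) = (\<integral>u. apply_dist T (\<Phi> u) \<partial>\<nu>)"
proof -
  obtain J c where q: "quadrature \<nu> J c" using quadrature_exists[OF sets fin] by blast
  obtain N C where C: "0 \<le> C" and T: "dist_bound N C (apply_dist T)" using dist_bound_apply_dist by blast
  \<comment> \<open>\<open>sbound_quadrature\<close> loses two orders.\<close>
  let ?N = "Suc (Suc N)"
  obtain \<beta> where \<beta>: "integrable \<nu> \<beta>" and fam2: "fam ?N (pweight ?N) \<beta> \<Phi>" using fam by blast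
  have fam1: "fam ?N (pweight N) \<beta> \<Phi>"
    using fam2 unfolding fam_def by (meson le_SucI order_refl pweight_mono sbound_mono)
  have fam0: "fam N (pweight N) \<beta> \<Phi>" by (rule fam_le[OF fam1]) simp
  have \<beta>0: "0 \<le> \<beta> u" for u using fam_value(1)[OF fam0 pweight_ge1] norm_ge_zero order_trans by blast
  obtain e where e: "e \<longlonglongrightarrow> 0" and err: "\<And>a B n. (\<And>u. cmod (a u) \<le> B * \<beta> u) \<Longrightarrow>
      (\<And>u u'. norm (u - u') \<le> 1 \<Longrightarrow> cmod (a u - a u') \<le> norm (u - u') * (B * \<beta> u)) \<Longrightarrow>
      cmod ((\<Sum>u\<in>J n. complex_of_real (c n u) * a u) - (\<integral>u. a u \<partial>\<nu>)) \<le> e n * B"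
    by (rule quadrature_error[OF q \<beta> \<beta>0]) blast
  define S where "S n = (\<lambda>y. \<Sum>u\<in>J n. complex_of_real (c n u) * \<Phi> u y)" for n
  define F where "F = (\<lambda>y. \<integral>u. \<Phi> u y \<partial>\<nu>)"
  have F: "F \<in> schwartz" unfolding F_def by (rule schwartz_integral_fam[OF sets fam])
  have S: "S n \<in> schwartz" for n unfolding S_def by (intro schwartz_sum schwartz_cmult \<Phi>)
  have "(\<lambda>n. apply_dist T (S n)) \<longlonglongrightarrow> (\<integral>u. apply_dist T (\<Phi> u) \<partial>\<nu>)"
  proof -
    have "apply_dist T (S n) = (\<Sum>u\<in>J n. complex_of_real (c n u) * apply_dist T (\<Phi> u))" for n
      unfolding S_def by (rule apply_dist_sum) (rule \<Phi>)
    then show ?thesis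
      using quadrature_LIMSEQ[OF q, of "\<lambda>u. C * \<beta> u" "\<lambda>u. apply_dist T (\<Phi> u)"] dist_fam[OF T C fam0 \<Phi>] \<beta> by simp
  qed
  moreover have "(\<lambda>n. apply_dist T (S n)) \<longlonglongrightarrow> apply_dist T F"
  proof -
    have "sbound N (pweight N) (e n) (\<lambda>y. S n y - F y)" for n
      unfolding S_def F_def
      by (rule sbound_quadrature[OF sets \<beta> pweight_ge1 _ fam1]) (use err[where B = 1] in simp)
    from dist_boundD[OF T schwartz_diff[OF S F] this]
    have H: "cmod (apply_dist T (S n) - apply_dist T F) \<le> C * e n" for n by (simp add: apply_dist_diff S F)
    have L: "(\<lambda>n. C * e n) \<longlonglongrightarrow> 0" using tendsto_mult_right_zero[OF e] .
    have "(\<lambda>n. apply_dist T (S n) - apply_dist T F) \<longlonglongrightarrow> 0"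
      by (rule Lim_null_comparison[OF always_eventually[OF allI[OF H]] L])
    then show ?thesis by (simp add: LIM_zero_iff)
  qed
  ultimately show ?thesis using LIMSEQ_unique unfolding F_def by blast
qed

section \<open>Gaussian measures and the Fourier transform\<close>

lemma borel_measurable_pweight[measurable]: "pweight k \<in> borel_measurable borel"
  unfolding pweight_def by measurable

lemma integrable_inverse_1_plus_square_real: "integrable lborel (\<lambda>x::real. inverse (1 + x\<^sup>2))"
  using integrable_inverse_1_plus_square by (simp add: set_integrable_def einterval_def)

text \<open>The product of all \<open>1 + (u \<bullet> b)\<^sup>2\<close> is at most
  \<open>pweight (2 * DIM('a)) u\<close>, so the integral is dominated by a product of
  one-dimensional ones. This is where the exponent \<open>2 * DIM('a)\<close> comes from.\<close>

lemma integrable_inverse_pweight: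
  "integrable lborel (\<lambda>u::'a::euclidean_space. 1 / pweight (2 * DIM('a)) u)"
proof (rule integrableI_bounded)
  have "(\<integral>\<^sup>+u. ennreal (norm (1 / pweight (2 * DIM('a)) u)) \<partial>(lborel :: 'a measure)) \<le>
      (\<integral>\<^sup>+u. (\<Prod>b\<in>Basis. ennreal (inverse (1 + (u \<bullet> b)\<^sup>2))) \<partial>(lborel :: 'a measure))"
  proof (rule nn_integral_mono)
    fix u :: 'a
    have "(\<Prod>b\<in>(Basis::'a set). 1 + (u \<bullet> b)\<^sup>2) \<le> (\<Prod>b\<in>(Basis::'a set). (1 + norm u)\<^sup>2)"
    proof (rule prod_mono)
      fix b :: 'a assume "b \<in> Basis"
      then have "\<bar>u \<bullet> b\<bar> \<le> norm u" by (rule Basis_le_norm)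
      then have "(u \<bullet> b)\<^sup>2 \<le> (norm u)\<^sup>2" by (simp add: abs_le_square_iff[symmetric])
      then show "0 \<le> 1 + (u \<bullet> b)\<^sup>2 \<and> 1 + (u \<bullet> b)\<^sup>2 \<le> (1 + norm u)\<^sup>2"
        by (simp add: power2_sum add_increasing2)
    qed
    also have "\<dots> = pweight (2 * DIM('a)) u" by (simp add: pweight_def power_mult)
    finally have "1 / pweight (2 * DIM('a)) u \<le> 1 / (\<Prod>b\<in>(Basis::'a set). 1 + (u \<bullet> b)\<^sup>2)"
      by (intro frac_le prod_pos) (auto simp: add_pos_nonneg)
    also have "\<dots> = (\<Prod>b\<in>(Basis::'a set). inverse (1 + (u \<bullet> b)\<^sup>2))"
      by (simp add: prod_inversef[symmetric] o_def divide_inverse)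
    finally show "ennreal (norm (1 / pweight (2 * DIM('a)) u)) \<le> (\<Prod>b\<in>(Basis::'a set). ennreal (inverse (1 + (u \<bullet> b)\<^sup>2)))"
      by (simp add: prod_ennreal add_nonneg_nonneg ennreal_leI)
  qed
  also have "\<dots> = (\<Prod>b\<in>(Basis::'a set). \<integral>\<^sup>+x. ennreal (inverse (1 + x\<^sup>2)) \<partial>lborel)"
    by (rule nn_integral_lborel_prod) auto
  also have "\<dots> < \<infinity>"
    using integrable_inverse_1_plus_square_real
    by (auto simp: integrable_iff_bounded power_less_top_ennreal)
  finally show "(\<integral>\<^sup>+u. ennreal (norm (1 / pweight (2 * DIM('a)) u)) \<partial>(lborel :: 'a measure)) < \<infinity>" .
qed simp

lemma integrable_pweight_bound:
  fixes f :: "'a::euclidean_space \<Rightarrow> 'b::{banach, second_countable_topology}"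
  assumes "f \<in> borel_measurable borel" "\<And>u. pweight (2 * DIM('a)) u * norm (f u) \<le> B"
  shows "integrable lborel f"
proof (rule Bochner_Integration.integrable_bound)
  show "integrable lborel (\<lambda>u::'a. B * (1 / pweight (2 * DIM('a)) u))"
    by (intro integrable_mult_right integrable_inverse_pweight)
  have "norm (f u) \<le> B / pweight (2 * DIM('a)) u" for u
    using assms(2)[of u] pweight_pos[of "2 * DIM('a)" u] by (simp add: pos_le_divide_eq mult.commute)
  then show "AE u in lborel. norm (f u) \<le> norm (B * (1 / pweight (2 * DIM('a)) u))"
    by (intro AE_I2) (metis abs_ge_self mult.right_neutral order_trans real_norm_def times_divide_eq_right)
qed (use assms in simp)

lemma borel_measurable_gauss[measurable]: "gauss \<in> borel_measurable borel"
  unfolding gauss_def by measurable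

lemma integrable_pweight_gauss:
  assumes "c \<noteq> 0"
  shows "integrable lborel (\<lambda>u::'a::euclidean_space. pweight k u * gauss (c *\<^sub>R u))"
proof -
  obtain B where "\<And>u::'a. pweight (2 * DIM('a) + k) u * gauss (c *\<^sub>R u) \<le> B"
    using pweight_gauss_bounded[OF assms] by blast
  then show ?thesis
    by (intro integrable_pweight_bound[where B = B]) (auto simp: pweight_add mult.assoc abs_mult)
qed

lemma gauss_prod: "gauss u = (\<Prod>b\<in>Basis. exp (- (u \<bullet> b)\<^sup>2 / 2))"
  for u :: "'a::euclidean_space"
proof -
  have "(norm u)\<^sup>2 = (\<Sum>b\<in>Basis. (u \<bullet> b)\<^sup>2)"
    by (subst power2_norm_eq_inner, subst euclidean_inner) (simp add: power2_eq_square)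
  then show ?thesis
    by (simp add: gauss_def exp_sum[symmetric] sum_negf sum_divide_distrib[symmetric])
qed

definition gconst :: real where "gconst = 1 / sqrt (2 * pi)"

lemma gconst_pos: "0 < gconst" by (simp add: gconst_def)

definition gdens :: "'a::euclidean_space \<Rightarrow> real" where
  "gdens u = gconst ^ DIM('a) * gauss u"

lemma gdens_nonneg [simp]: "0 \<le> gdens u" using gconst_pos by (simp add: gdens_def)

lemma borel_measurable_gdens[measurable]: "gdens \<in> borel_measurable borel"
  unfolding gdens_def by measurable

lemma gdens_prod: "gdens u = (\<Prod>b\<in>Basis. std_normal_density (u \<bullet> b))" for u :: "'a::euclidean_space"
  by (simp add: gdens_def gauss_prod std_normal_density_def gconst_def prod.distrib prod_dividef power_one_over)

lemma nn_integral_gdens: "(\<integral>\<^sup>+u. ennreal (gdens u) \<partial>(lborel :: 'a::euclidean_space measure)) = 1"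
proof -
  have "(\<integral>\<^sup>+u. ennreal (gdens u) \<partial>(lborel :: 'a measure)) =
      (\<integral>\<^sup>+u. (\<Prod>b\<in>Basis. ennreal (std_normal_density (u \<bullet> b))) \<partial>(lborel :: 'a measure))"
    by (simp add: gdens_prod prod_ennreal)
  also have "\<dots> = (\<Prod>b\<in>(Basis::'a set). \<integral>\<^sup>+x. ennreal (std_normal_density x) \<partial>lborel)"
    by (rule nn_integral_lborel_prod) auto
  also have "\<dots> = 1"
    using prob_space.emeasure_space_1[OF prob_space_normal_density[of 1 0]]
    by (simp add: emeasure_density)
  finally show ?thesis .
qed

definition gmeasure :: "'a::euclidean_space measure" where
  "gmeasure = density lborel (\<lambda>u. ennreal (gdens u))"

lemma sets_gmeasure [simp, measurable_cong]: "sets gmeasure = sets borel" by (simp add: gmeasure_def)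
lemma space_gmeasure [simp]: "space gmeasure = UNIV" by (simp add: gmeasure_def)

lemma prob_space_gmeasure: "prob_space gmeasure"
  by (rule prob_spaceI) (simp add: gmeasure_def emeasure_density nn_integral_gdens)

interpretation gmeasure: prob_space gmeasure by (rule prob_space_gmeasure)

lemma gmeasure_finite: "emeasure gmeasure A < \<infinity>"
  using gmeasure.emeasure_finite[of A] by (simp add: less_top[symmetric])

lemma integral_gmeasure:
  fixes f :: "'a::euclidean_space \<Rightarrow> 'b::{banach, second_countable_topology}"
  assumes "f \<in> borel_measurable borel"
  shows "(\<integral>u. f u \<partial>gmeasure) = (\<integral>u. gdens u *\<^sub>R f u \<partial>lborel)"
  unfolding gmeasure_def using assms by (intro integral_density) auto

lemma integrable_gmeasure:
  fixes f :: "'a::euclidean_space \<Rightarrow> 'b::{banach, second_countable_topology}"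
  assumes "f \<in> borel_measurable borel"
  shows "integrable gmeasure f \<longleftrightarrow> integrable lborel (\<lambda>u. gdens u *\<^sub>R f u)"
  unfolding gmeasure_def using assms by (intro integrable_density) auto

lemma integrable_gmeasure_pweight: "integrable (gmeasure :: 'a::euclidean_space measure) (pweight k)"
  using integrable_mult_right[OF integrable_pweight_gauss[of 1 k], of "gconst ^ DIM('a)"]
  by (subst integrable_gmeasure) (simp_all add: gdens_def mult_ac)

text \<open>Left unnormalised: for small c it regularises Lebesgue measure in the Fourier inversion,
  where the density must increase to 1, and for c = \<delta> it is the measure of the rank-one
  decomposition.\<close>

definition gdm :: "real \<Rightarrow> 'a::euclidean_space measure" where
  "gdm c = density lborel (\<lambda>u. ennreal (gauss (c *\<^sub>R u)))"

lemma sets_gdm [simp, measurable_cong]: "sets (gdm c) = sets borel" by (simp add: gdm_def)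
lemma space_gdm [simp]: "space (gdm c) = UNIV" by (simp add: gdm_def)

lemma integral_gdm:
  fixes f :: "'a::euclidean_space \<Rightarrow> 'b::{banach, second_countable_topology}"
  assumes "f \<in> borel_measurable borel"
  shows "(\<integral>u. f u \<partial>gdm c) = (\<integral>u. gauss (c *\<^sub>R u) *\<^sub>R f u \<partial>lborel)"
  unfolding gdm_def using assms by (intro integral_density) auto

lemma integrable_gdm_pweight: "c \<noteq> 0 \<Longrightarrow> integrable (gdm c :: 'a::euclidean_space measure) (pweight k)"
  using integrable_pweight_gauss[of c k, where 'a='a] unfolding gdm_def
  by (subst integrable_density) (auto simp: mult.commute)

lemma gdm_finite:
  assumes "c \<noteq> 0"
  shows "emeasure (gdm c :: 'a::euclidean_space measure) A < \<infinity>"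
proof -
  have "emeasure (gdm c :: 'a measure) A \<le> emeasure (gdm c :: 'a measure) (space (gdm c))" by (rule emeasure_space)
  also have "\<dots> < \<infinity>"
    using integrable_pweight_gauss[OF assms, of 0, where 'a = 'a]
    by (simp add: gdm_def emeasure_density pweight_def integrable_iff_bounded)
  finally show ?thesis .
qed

lemma integral_lborel_prod:
  fixes F :: "'a::euclidean_space \<Rightarrow> real \<Rightarrow> complex"
  assumes "\<And>b. b \<in> Basis \<Longrightarrow> integrable lborel (F b)"
  shows "(\<integral>u. (\<Prod>b\<in>Basis. F b (u \<bullet> b)) \<partial>lborel) = (\<Prod>b\<in>Basis. \<integral>x. F b x \<partial>lborel)"
proof -
  interpret product_sigma_finite "\<lambda>_::'a. lborel :: real measure" ..
  have m: "F b \<in> borel_measurable borel" if "b \<in> Basis" for b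
    using borel_measurable_integrable[OF assms[OF that]] by simp
  have "(\<integral>u. (\<Prod>b\<in>Basis. F b (u \<bullet> b)) \<partial>lborel) =
      (\<integral>f. (\<Prod>b\<in>Basis. F b ((\<Sum>b\<in>Basis. f b *\<^sub>R b) \<bullet> b)) \<partial>(\<Pi>\<^sub>M b\<in>(Basis::'a set). lborel))"
    unfolding lborel_eq[where 'a = 'a] using m
    by (intro integral_distr) (auto intro!: borel_measurable_prod measurable_compose[OF _ m])
  also have "\<dots> = (\<integral>f. (\<Prod>b\<in>Basis. F b (f b)) \<partial>(\<Pi>\<^sub>M b\<in>(Basis::'a set). lborel))"
    by (intro Bochner_Integration.integral_cong prod.cong) auto
  also have "\<dots> = (\<Prod>b\<in>Basis. \<integral>x. F b x \<partial>lborel)"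
    by (intro product_integral_prod assms) auto
  finally show ?thesis .
qed

lemma fourier_gauss_real:
  "(\<integral>x. std_normal_density x *\<^sub>R exp (\<i> * complex_of_real (x * t)) \<partial>lborel) = complex_of_real (exp (- t\<^sup>2 / 2))"
proof -
  have "char std_normal_distribution t = (\<integral>x. exp (\<i> * complex_of_real (x * t)) \<partial>std_normal_distribution)"
    by (simp add: char_def mult.commute)
  also have "\<dots> = (\<integral>x. std_normal_density x *\<^sub>R exp (\<i> * complex_of_real (x * t)) \<partial>lborel)"
    by (subst integral_density) auto
  finally show ?thesis by (simp add: char_std_normal_distribution)
qed

text \<open>Density and character both factor over the basis, which leaves the characteristic
  function of the one-dimensional normal distribution.\<close>

lemma fourier_gmeasure:
  fixes y :: "'a::euclidean_space"
  shows "(\<integral>u. exp (\<i> * complex_of_real (u \<bullet> y)) \<partial>gmeasure) = complex_of_real (gauss y)"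
proof -
  have "(\<integral>u. exp (\<i> * complex_of_real (u \<bullet> y)) \<partial>gmeasure) =
      (\<integral>u. (\<Prod>b\<in>Basis. std_normal_density (u \<bullet> b) *\<^sub>R exp (\<i> * complex_of_real ((u \<bullet> b) * (y \<bullet> b)))) \<partial>lborel)"
  proof (subst integral_gmeasure, measurable, intro Bochner_Integration.integral_cong refl)
    fix u :: 'a
    have "exp (\<i> * complex_of_real (u \<bullet> y)) = (\<Prod>b\<in>Basis. exp (\<i> * complex_of_real ((u \<bullet> b) * (y \<bullet> b))))"
      by (simp add: euclidean_inner[of u y] sum_distrib_left exp_sum)
    then show "gdens u *\<^sub>R exp (\<i> * complex_of_real (u \<bullet> y)) =
        (\<Prod>b\<in>Basis. std_normal_density (u \<bullet> b) *\<^sub>R exp (\<i> * complex_of_real ((u \<bullet> b) * (y \<bullet> b))))"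
      by (simp add: gdens_prod scaleR_conv_of_real prod.distrib)
  qed
  also have "\<dots> = (\<Prod>b\<in>Basis. \<integral>x. std_normal_density x *\<^sub>R exp (\<i> * complex_of_real (x * (y \<bullet> b))) \<partial>lborel)"
  proof (rule integral_lborel_prod)
    fix b :: 'a
    show "integrable lborel (\<lambda>x. std_normal_density x *\<^sub>R exp (\<i> * complex_of_real (x * (y \<bullet> b))))"
      by (rule Bochner_Integration.integrable_bound[OF integrable_std_normal_moment[of 0]])
        (auto simp: norm_exp_eq_Re)
  qed
  also have "\<dots> = complex_of_real (gauss y)"
    by (simp only: fourier_gauss_real gauss_prod of_real_prod)
  finally show ?thesis .
qed

section \<open>Affine changes of variable\<close>

lemma integral_lborel_affine:
  fixes f :: "'a::euclidean_space \<Rightarrow> 'b::{banach, second_countable_topology}"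
  assumes "f \<in> borel_measurable borel" "c \<noteq> 0"
  shows "(\<integral>u. f u \<partial>lborel) = \<bar>c\<bar> ^ DIM('a) *\<^sub>R (\<integral>u. f (t + c *\<^sub>R u) \<partial>lborel)"
proof -
  have "(\<integral>u. f u \<partial>lborel) = (\<integral>u. f u \<partial>density (distr lborel borel (\<lambda>x. t + c *\<^sub>R x)) (\<lambda>_. \<bar>c\<bar> ^ DIM('a)))"
    using lborel_affine[OF assms(2), of t] by simp
  also have "\<dots> = (\<integral>u. \<bar>c\<bar> ^ DIM('a) *\<^sub>R f u \<partial>distr lborel borel (\<lambda>x. t + c *\<^sub>R x))"
    using assms by (subst integral_density) auto
  also have "\<dots> = (\<integral>u. \<bar>c\<bar> ^ DIM('a) *\<^sub>R f (t + c *\<^sub>R u) \<partial>lborel)"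
    using assms by (subst integral_distr) auto
  finally show ?thesis by simp
qed

lemma nn_integral_lborel_affine:
  fixes f :: "'a::euclidean_space \<Rightarrow> ennreal"
  assumes "f \<in> borel_measurable borel" "c \<noteq> 0"
  shows "(\<integral>\<^sup>+u. f u \<partial>lborel) = ennreal (\<bar>c\<bar> ^ DIM('a)) * (\<integral>\<^sup>+u. f (t + c *\<^sub>R u) \<partial>lborel)"
proof -
  have "(\<integral>\<^sup>+u. f u \<partial>lborel) = (\<integral>\<^sup>+u. f u \<partial>density (distr lborel borel (\<lambda>x. t + c *\<^sub>R x)) (\<lambda>_. \<bar>c\<bar> ^ DIM('a)))"
    using lborel_affine[OF assms(2), of t] by simp
  also have "\<dots> = (\<integral>\<^sup>+u. ennreal (\<bar>c\<bar> ^ DIM('a)) * f u \<partial>distr lborel borel (\<lambda>x. t + c *\<^sub>R x))"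
    using assms by (subst nn_integral_density) auto
  also have "\<dots> = (\<integral>\<^sup>+u. ennreal (\<bar>c\<bar> ^ DIM('a)) * f (t + c *\<^sub>R u) \<partial>lborel)"
    using assms by (subst nn_integral_distr) auto
  finally show ?thesis using assms by (simp add: nn_integral_cmult)
qed

lemma integral_lborel_translate:
  fixes f :: "'a::euclidean_space \<Rightarrow> 'b::{banach, second_countable_topology}"
  assumes "f \<in> borel_measurable borel"
  shows "(\<integral>u. f (u - t) \<partial>lborel) = (\<integral>u. f u \<partial>lborel)"
  using integral_lborel_affine[OF assms, of 1 "- t"] by simp

section \<open>Integrals and Fourier transforms of Schwartz functions\<close>

lemma schwartz_integrable: 
  assumes "f \<in> schwartz"
  shows "integrable lborel f"
proof -
  obtain B where "sbound 0 (pweight (2 * CARD('a))) B f" using assms schwartz_iff by blast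
  then show ?thesis
    using schwartz_measurable[OF assms]
    by (intro integrable_pweight_bound[where B = B]) auto
qed

text \<open>The constant by which a weighted supremum bounds an integral. It depends on the
  dimension alone, which the \<open>itself\<close> argument supplies.\<close>

definition ipw :: "'n::finite itself \<Rightarrow> real" where
  "ipw t = (\<integral>u. 1 / pweight (2 * CARD('n)) u \<partial>(lborel :: (real^'n) measure))"

lemma ipw_nonneg: "0 \<le> ipw TYPE('n::finite)"
  unfolding ipw_def by (intro integral_nonneg_AE) auto

lemma schwartz_integral_bound:
  fixes f :: "real^'n::finite \<Rightarrow> complex"
  assumes "f \<in> borel_measurable borel" "\<And>y. pweight (2 * CARD('n)) y * cmod (f y) \<le> B"
  shows "cmod (\<integral>y. f y \<partial>lborel) \<le> ipw TYPE('n) * B"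
proof -
  have "cmod (\<integral>y. f y \<partial>lborel) \<le> (\<integral>y. B * (1 / pweight (2 * CARD('n)) y) \<partial>(lborel :: (real^'n) measure))"
  proof (rule integral_norm_le_integral)
    show "integrable lborel f" using assms by (intro integrable_pweight_bound[where B = B]) auto
    show "integrable lborel (\<lambda>y::real^'n. B * (1 / pweight (2 * CARD('n)) y))"
      using integrable_inverse_pweight[where 'a = "real^'n"] by (intro integrable_mult_right) simp
    show "cmod (f y) \<le> B * (1 / pweight (2 * CARD('n)) y)" for y
      using assms(2)[of y] pweight_pos[of "2 * CARD('n)" y] by (simp add: pos_le_divide_eq mult.commute)
  qed
  then show ?thesis by (subst mult.commute) (simp only: ipw_def integral_mult_right_zero)
qed

text \<open>The difference quotients \<open>q n\<close> have integral 0 by translation invariance,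
  and dominated convergence carries this over to the derivative.\<close>

lemma integral_partial_deriv_eq_0:
  fixes f :: "real^'n::finite \<Rightarrow> complex"
  assumes f: "f \<in> schwartz"
  shows "(\<integral>y. partial_deriv i f y \<partial>lborel) = 0"
proof -
  let ?k = "2 * CARD('n)"
  let ?e = "axis i 1 :: real^'n"
  define q where "q n y = complex_of_real (real (Suc n)) * (f (y + (1 / real (Suc n)) *\<^sub>R ?e) - f y)" for n y
  obtain B where B: "0 < B" "sbound (Suc 0) (pweight ?k) B f" using schwartzE[OF f] by blast
  \<comment> \<open>A bound for all weighted difference quotients: the displacement has norm at most
    1, so its weight is at most \<open>2 ^ ?k\<close>.\<close>
  define M where "M = CARD('n) * 2 ^ ?k * B"
  have q0: "(\<integral>y. q n y \<partial>lborel) = 0" for n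
  proof -
    let ?x = "(1 / real (Suc n)) *\<^sub>R ?e"
    have "(\<integral>y. f (y + ?x) \<partial>lborel) = (\<integral>y. f y \<partial>lborel)"
      using integral_lborel_translate[OF schwartz_measurable[OF f], of "- ?x"] by simp
    moreover have "integrable lborel (\<lambda>y. f (y + ?x))"
      using schwartz_integrable[OF schwartz_translate[OF f, of "- ?x"]] by simp
    ultimately show ?thesis
      unfolding q_def using schwartz_integrable[OF f] by simp
  qed
  have "(\<lambda>n. \<integral>y. q n y \<partial>lborel) \<longlonglongrightarrow> (\<integral>y. partial_deriv i f y \<partial>lborel)"
  proof (rule integral_dominated_convergence[where w = "\<lambda>y. M * (1 / pweight ?k y)"])
    show "integrable lborel (\<lambda>y::real^'n. M * (1 / pweight ?k y))"
      using integrable_inverse_pweight[where 'a = "real^'n"] by (intro integrable_mult_right) simp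
    show "partial_deriv i f \<in> borel_measurable lborel"
      using schwartz_measurable[OF schwartz_partial_deriv[OF f]] by simp
    show "q n \<in> borel_measurable lborel" for n
      using schwartz_measurable[OF f] unfolding q_def by simp
    have "cmod (q n y) \<le> M * (1 / pweight ?k y)" for n y
    proof -
      let ?x = "- ((1 / real (Suc n)) *\<^sub>R ?e)"
      have nx: "norm ?x = 1 / real (Suc n)" by (simp add: norm_axis_1)
      then have "pweight ?k ?x \<le> 2 ^ ?k" unfolding pweight_def by (intro power_mono) auto
      have "pweight ?k y * cmod (f (y - ?x) - f y) \<le> CARD('n) * norm ?x * pweight ?k ?x * B"
        by (rule sbound_translate_diff_0[OF B(2)])
      also have "\<dots> \<le> CARD('n) * norm ?x * 2 ^ ?k * B"
        using \<open>pweight ?k ?x \<le> 2 ^ ?k\<close> B(1) by (intro mult_right_mono mult_left_mono) auto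
      finally have "pweight ?k y * cmod (f (y - ?x) - f y) \<le> M / real (Suc n)"
        unfolding nx M_def by (simp add: mult_ac)
      then have "real (Suc n) * (pweight ?k y * cmod (f (y - ?x) - f y)) \<le> M"
        by (subst (asm) pos_le_divide_eq) (auto simp: mult.commute)
      moreover have "cmod (q n y) = real (Suc n) * cmod (f (y - ?x) - f y)"
        unfolding q_def norm_mult norm_of_real by simp
      ultimately have "pweight ?k y * cmod (q n y) \<le> M" by (simp only: mult.left_commute)
      then show ?thesis using pweight_pos[of ?k y] by (simp add: pos_le_divide_eq mult.commute)
    qed
    then show "AE y in lborel. cmod (q n y) \<le> M * (1 / pweight ?k y)" for n by simp
    have "(\<lambda>n. q n y) \<longlonglongrightarrow> partial_deriv i f y" for y
    proof -
      let ?F = "\<lambda>s. f (y + s *\<^sub>R ?e)"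
      have "(f has_derivative frechet_derivative f (at y)) (at (y + 0 *\<^sub>R ?e))"
        using schwartz_differentiable[OF f, of y] unfolding frechet_derivative_works by simp
      moreover have "((\<lambda>s::real. y + s *\<^sub>R ?e) has_derivative (\<lambda>s. s *\<^sub>R ?e)) (at 0)"
        by (auto intro!: derivative_eq_intros)
      ultimately have "(?F has_derivative (\<lambda>s. frechet_derivative f (at y) (s *\<^sub>R ?e))) (at 0)"
        by (rule has_derivative_compose[rotated])
      moreover have "linear (frechet_derivative f (at y))"
        using schwartz_differentiable[OF f] linear_frechet_derivative by blast
      ultimately have "(?F has_vector_derivative partial_deriv i f y) (at 0)"
        by (simp add: has_vector_derivative_def partial_deriv_def linear_cmul)
      then have N: "((\<lambda>s. norm (?F (0 + s) - ?F 0 - s *\<^sub>R partial_deriv i f y) / norm s) \<longlongrightarrow> 0) (at 0)"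
        unfolding has_vector_derivative_def has_derivative_at by blast
      have "((\<lambda>s. norm ((?F s - ?F 0) /\<^sub>R s - partial_deriv i f y)) \<longlongrightarrow> 0) (at 0)"
      proof (rule Lim_transform_eventually[OF N])
        have "norm (?F (0 + s) - ?F 0 - s *\<^sub>R partial_deriv i f y) / norm s = norm ((?F s - ?F 0) /\<^sub>R s - partial_deriv i f y)"
          if "s \<noteq> 0" for s
        proof -
          have "(?F s - ?F 0) /\<^sub>R s - partial_deriv i f y = (?F s - ?F 0 - s *\<^sub>R partial_deriv i f y) /\<^sub>R s"
            using that by (simp add: scaleR_diff_right)
          then show ?thesis by (simp add: divide_inverse mult.commute)
        qed
        then show "\<forall>\<^sub>F s in at 0. norm (?F (0 + s) - ?F 0 - s *\<^sub>R partial_deriv i f y) / norm s = norm ((?F s - ?F 0) /\<^sub>R s - partial_deriv i f y)"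
          by (simp add: eventually_at_filter)
      qed
      then have L: "((\<lambda>s. (?F s - ?F 0) /\<^sub>R s) \<longlongrightarrow> partial_deriv i f y) (at 0)"
        by (simp add: tendsto_norm_zero_iff LIM_zero_iff)
      have "filterlim (\<lambda>n. 1 / real (Suc n)) (at 0) sequentially"
        unfolding filterlim_at by (intro conjI always_eventually allI) (simp, simp, real_asymp)
      from filterlim_compose[OF L this] show ?thesis
        by (simp add: q_def scaleR_conv_of_real)
    qed
    then show "AE y in lborel. (\<lambda>n. q n y) \<longlonglongrightarrow> partial_deriv i f y" by simp
  qed
  then show ?thesis using q0 LIMSEQ_unique[OF _ tendsto_const[of 0]] by (simp add: LIMSEQ_const_iff)
qed

text \<open>No power of \<open>2 * pi\<close> is included; the whole factor appears in the
  inversion, as \<open>gconst ^ CARD('n) * gconst ^ CARD('n)\<close>.\<close>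

definition ft :: "(real^'n::finite \<Rightarrow> complex) \<Rightarrow> real^'n \<Rightarrow> complex" where
  "ft f \<eta> = (\<integral>t. f t * cexp (- \<eta>) t \<partial>lborel)"

lemma ft_integrand_measurable: "f \<in> schwartz \<Longrightarrow> (\<lambda>t. f t * cexp \<eta> t) \<in> borel_measurable borel"
  using schwartz_measurable by measurable

lemma ft_partial_deriv:
  assumes f: "f \<in> schwartz"
  shows "ft (partial_deriv i f) \<eta> = \<i> * complex_of_real (\<eta> $ i) * ft f \<eta>"
proof -
  let ?h = "\<lambda>t. f t * cexp (- \<eta>) t"
  have hs: "?h \<in> schwartz" using schwartz_modulate[OF f, of "- \<eta>"] by (simp add: mult.commute)
  have pd: "partial_deriv i ?h = (\<lambda>t. partial_deriv i f t * cexp (- \<eta>) t - (\<i> * complex_of_real (\<eta> $ i)) * ?h t)"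
    using schwartz_differentiable[OF f] sbound_diffD[OF sbound_cexp]
    by (subst partial_deriv_mult) (auto simp: partial_deriv_cexp)
  have i1: "integrable lborel (\<lambda>t. partial_deriv i f t * cexp (- \<eta>) t)"
    using schwartz_integrable[OF schwartz_modulate[OF schwartz_partial_deriv[OF f], where \<xi> = "- \<eta>"]] by (simp add: mult.commute)
  have "0 = (\<integral>t. partial_deriv i f t * cexp (- \<eta>) t \<partial>lborel) - (\<i> * complex_of_real (\<eta> $ i)) * (\<integral>t. ?h t \<partial>lborel)"
    using integral_partial_deriv_eq_0[OF hs, of i] i1 schwartz_integrable[OF hs] by (simp add: pd)
  then show ?thesis by (simp add: ft_def)
qed

text \<open>By \<open>1 + norm \<eta> \<le> 1 + (\<Sum>i\<in>UNIV. \<bar>\<eta> $ i\<bar>)\<close>,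
  and since a factor \<open>\<eta> $ i\<close> corresponds to a derivative, each power of the weight
  is traded for the function and its \<open>CARD('n)\<close> derivatives.\<close>

lemma ft_decay:
  fixes f :: "real^'n::finite \<Rightarrow> complex"
  shows "f \<in> schwartz \<Longrightarrow> sbound L (pweight (2 * CARD('n))) B f \<Longrightarrow>
    pweight L \<eta> * cmod (ft f \<eta>) \<le> (1 + CARD('n)) ^ L * ipw TYPE('n) * B"
proof (induction L arbitrary: f)
  case 0
  have "cmod (ft f \<eta>) \<le> ipw TYPE('n) * B"
    unfolding ft_def
  proof (rule schwartz_integral_bound)
    show "pweight (2 * CARD('n)) y * cmod (f y * cexp (- \<eta>) y) \<le> B" for y
      using sbound_leD[OF 0(2), of y] by (simp only: norm_mult norm_cexp mult_1_right)
  qed (use ft_integrand_measurable[OF 0(1)] in auto)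
  then show ?case by (simp add: pweight_def)
next
  case (Suc L)
  let ?K = "(1 + CARD('n)) ^ L * ipw TYPE('n) * B"
  have "1 + norm \<eta> \<le> 1 + (\<Sum>i\<in>UNIV. \<bar>\<eta> $ i\<bar>)" using norm_le_l1_cart[of \<eta>] by simp
  then have "pweight (Suc L) \<eta> * cmod (ft f \<eta>) \<le> (1 + (\<Sum>i\<in>UNIV. \<bar>\<eta> $ i\<bar>)) * (pweight L \<eta> * cmod (ft f \<eta>))"
    by (simp add: pweight_def mult.assoc mult_right_mono)
  also have "\<dots> = pweight L \<eta> * cmod (ft f \<eta>) + (\<Sum>i\<in>UNIV. pweight L \<eta> * cmod (ft (partial_deriv i f) \<eta>))"
    by (simp add: ft_partial_deriv[OF Suc.prems(1)] norm_mult distrib_right distrib_left sum_distrib_right sum_distrib_left mult_ac)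
  also have "\<dots> \<le> ?K + (\<Sum>i\<in>(UNIV::'n set). ?K)"
    by (intro add_mono sum_mono Suc.IH Suc.prems schwartz_partial_deriv sbound_less[OF Suc.prems(2)] sbound_SucD[OF Suc.prems(2)])
  also have "\<dots> = (1 + CARD('n)) ^ Suc L * ipw TYPE('n) * B" by (simp add: algebra_simps)
  finally show ?case .
qed

text \<open>Makes the transform measurable and admissible as a scalar coefficient in
  \<open>fam_scale\<close>.\<close>

lemma ft_Lipschitz:
  assumes f: "f \<in> schwartz"
  shows "\<exists>A>0. \<forall>\<eta> \<eta>'. cmod (ft f \<eta>) \<le> A \<and> cmod (ft f \<eta> - ft f \<eta>') \<le> A * norm (\<eta> - \<eta>')"
proof -
  let ?k = "2 * CARD('a)"
  obtain B where B: "0 < B" "sbound 0 (pweight (Suc ?k)) B f" using schwartzE[OF f] by blast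
  let ?A = "ipw TYPE('a) * B"
  have 1: "cmod (ft f \<eta>) \<le> ?A" for \<eta>
  proof -
    have "sbound 0 (pweight ?k) B f"
      using B(2) by (rule sbound_mono) (auto intro: pweight_mono)
    from ft_decay[OF f this, of \<eta>] show ?thesis by (simp add: pweight_def)
  qed
  have 2: "cmod (ft f \<eta> - ft f \<eta>') \<le> ?A * norm (\<eta> - \<eta>')" for \<eta> \<eta>'
  proof -
    have i: "integrable lborel (\<lambda>t. f t * cexp \<xi> t)" for \<xi>
      using schwartz_integrable[OF schwartz_modulate[OF f, of \<xi>]] by (simp add: mult.commute)
    have "ft f \<eta> - ft f \<eta>' = (\<integral>t. f t * (cexp (- \<eta>) t - cexp (- \<eta>') t) \<partial>lborel)"
      unfolding ft_def using i by (simp add: right_diff_distrib)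
    also have "cmod \<dots> \<le> ipw TYPE('a) * (B * norm (\<eta> - \<eta>'))"
    proof (rule schwartz_integral_bound)
      fix t :: "real^'a"
      have "cexp (- \<eta>) t - cexp (- \<eta>') t = cexp (- \<eta>') t * (cexp (\<eta>' - \<eta>) t - 1)"
        using cexp_add[of "- \<eta>'" "\<eta>' - \<eta>" t] by (simp add: right_diff_distrib)
      then have "cmod (cexp (- \<eta>) t - cexp (- \<eta>') t) = cmod (cexp (\<eta>' - \<eta>) t - 1)"
        by (simp only: norm_mult norm_cexp mult_1_left)
      also have "\<dots> \<le> norm (\<eta>' - \<eta>) * norm t" by (rule cexp_minus_1_le)
      finally have le: "cmod (cexp (- \<eta>) t - cexp (- \<eta>') t) \<le> norm (\<eta> - \<eta>') * (1 + norm t)"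
        by (simp add: norm_minus_commute distrib_left add_increasing)
      have "pweight ?k t * cmod (f t * (cexp (- \<eta>) t - cexp (- \<eta>') t)) \<le>
          pweight ?k t * (cmod (f t) * (norm (\<eta> - \<eta>') * (1 + norm t)))"
        unfolding norm_mult by (intro mult_left_mono le) auto
      also have "\<dots> = (pweight (Suc ?k) t * cmod (f t)) * norm (\<eta> - \<eta>')" by (simp add: pweight_def mult_ac)
      also have "\<dots> \<le> B * norm (\<eta> - \<eta>')" by (intro mult_right_mono sbound_leD[OF B(2)]) auto
      finally show "pweight ?k t * cmod (f t * (cexp (- \<eta>) t - cexp (- \<eta>') t)) \<le> B * norm (\<eta> - \<eta>')" .
    qed (use schwartz_measurable[OF f] in measurable)
    finally show ?thesis by (simp add: mult_ac)
  qed
  have "0 \<le> ?A" using B(1) ipw_nonneg[where 'n = 'a] by simp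
  moreover have "?A * norm (\<eta> - \<eta>') \<le> (?A + 1) * norm (\<eta> - \<eta>')" for \<eta> \<eta>' :: "real^'a"
    by (intro mult_right_mono) auto
  ultimately show ?thesis using 1 2
    by (intro exI[of _ "?A + 1"]) (smt (verit, best))
qed

text \<open>The choice is justified for Schwartz \<psi> in \<open>apply_dist_of\<close>. The pairing
  has no conjugation, so it is symmetric in two Schwartz functions; this is used for the kernel
  below.\<close>

definition dist_of :: "(real^'n::finite \<Rightarrow> complex) \<Rightarrow> 'n tempered_distribution" where
  "dist_of \<psi> = (SOME D. \<forall>\<phi>\<in>schwartz. apply_dist D \<phi> = (\<integral>y. \<psi> y * \<phi> y \<partial>lborel))"

lemma apply_dist_of:
  fixes \<psi> :: "real^'n::finite \<Rightarrow> complex"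
  assumes \<psi>: "\<psi> \<in> schwartz" and "\<phi> \<in> schwartz"
  shows "apply_dist (dist_of \<psi>) \<phi> = (\<integral>y. \<psi> y * \<phi> y \<partial>lborel)"
proof -
  have i: "integrable lborel (\<lambda>y. \<psi> y * \<phi> y)" if "\<phi> \<in> schwartz" for \<phi>
    by (rule schwartz_integrable[OF schwartz_mult[OF \<psi> that]])
  obtain A where A: "sbound 0 (pweight (2 * CARD('n))) A \<psi>" using \<psi> schwartz_iff by blast
  have "\<exists>D. \<forall>\<phi>\<in>schwartz. apply_dist D \<phi> = (\<integral>y. \<psi> y * \<phi> y \<partial>lborel)"
  proof (rule dist_exists)
    show "dist_bound 0 (ipw TYPE('n) * A) (\<lambda>\<phi>. \<integral>y. \<psi> y * \<phi> y \<partial>lborel)"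
      unfolding dist_bound_def
    proof (intro ballI allI impI)
      fix \<phi> :: "real^'n \<Rightarrow> complex" and B
      assume \<phi>: "\<phi> \<in> schwartz" and B: "sbound 0 (pweight 0) B \<phi>"
      have "cmod (\<integral>y. \<psi> y * \<phi> y \<partial>lborel) \<le> ipw TYPE('n) * (A * B)"
      proof (rule schwartz_integral_bound)
        fix y
        have "(pweight (2 * CARD('n)) y * cmod (\<psi> y)) * (pweight 0 y * cmod (\<phi> y)) \<le> A * B"
          using sbound_nonneg[OF A]
          by (intro mult_mono sbound_leD[OF A] sbound_leD[OF B]) (auto intro: mult_nonneg_nonneg)
        then show "pweight (2 * CARD('n)) y * cmod (\<psi> y * \<phi> y) \<le> A * B"
          by (simp add: pweight_def norm_mult mult_ac)
      qed (use schwartz_measurable[OF \<psi>] schwartz_measurable[OF \<phi>] in measurable)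
      then show "cmod (\<integral>y. \<psi> y * \<phi> y \<partial>lborel) \<le> ipw TYPE('n) * A * B" by (simp add: mult_ac)
    qed
  qed (use i in \<open>simp_all add: distrib_left mult.left_commute[of "\<psi> _"]\<close>)
  from someI_ex[OF this] show ?thesis unfolding dist_of_def[symmetric] using assms(2) by blast
qed

section \<open>Time-frequency shifts and regularised Fourier inversion\<close>

lemma sbound_minus_commute:
  assumes "sbound m W B (\<lambda>y. f y - g y)" shows "sbound m W B (\<lambda>y. g y - f y)"
  using sbound_cmult[OF assms, of "-1"] by simp

text \<open>The translation by \<open>fst u\<close> acts first and the modulation by
  \<open>snd u\<close> second; the opposite order differs by a phase factor.\<close>

definition tfshift :: "(real^'n::finite) \<times> (real^'n) \<Rightarrow> (real^'n \<Rightarrow> complex) \<Rightarrow> real^'n \<Rightarrow> complex" where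
  "tfshift u \<phi> = (\<lambda>y. cexp (snd u) y * \<phi> (y - fst u))"

lemma schwartz_tfshift: "\<phi> \<in> schwartz \<Longrightarrow> tfshift u \<phi> \<in> schwartz"
  unfolding tfshift_def by (intro schwartz_modulate schwartz_translate)

lemma pweight_le_add:
  assumes "norm u' \<le> norm u + 1"
  shows "pweight k u' \<le> 2 ^ k * pweight k u"
proof -
  have "1 + norm u' \<le> 2 * (1 + norm u)" using assms norm_ge_zero[of u] by (simp del: norm_ge_zero)
  then show ?thesis unfolding pweight_def power_mult_distrib[symmetric] by (intro power_mono) auto
qed

lemma pweight_le_norm: "norm x \<le> norm u \<Longrightarrow> pweight k x \<le> pweight k u"
  unfolding pweight_def by (rule power_mono) auto

lemma pweight_le_1: "norm x \<le> 1 \<Longrightarrow> pweight k x \<le> 2 ^ k"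
  unfolding pweight_def by (rule power_mono) auto

text \<open>One index more than N suffices: the extra derivative serves the translation and the
  extra power of the weight the modulation. What matters is that \<open>C\<close>, \<open>M\<close>
  and \<open>N'\<close> depend neither on \<phi> nor on \<open>B\<close>.\<close>

lemma fam_tfshift:
  fixes N :: nat
  shows "\<exists>C M N'. 0 \<le> C \<and> (\<forall>(\<phi> :: real^'n::finite \<Rightarrow> complex) B. sbound N' (pweight N') B \<phi> \<longrightarrow>
    fam N (pweight N) (\<lambda>u. C * B * pweight M u) (\<lambda>u. tfshift u \<phi>))"
proof -
  let ?d = "real CARD('n)"
  let ?N' = "Suc N"
  define C1 where "C1 = (2::real) ^ N"
  define C2 where "C2 = (2 ^ N * 2 ^ N * 2 ^ N * 2 ^ N * 2 ^ N * 2 ^ Suc N) + 2 ^ N * 2 ^ N * (?d * 2 ^ N * 2 ^ N)"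
  define M where "M = Suc N + N"
  have bd: "sbound N (pweight N) (C1 * B * pweight M u) (tfshift u \<phi>)"
    if \<phi>: "sbound ?N' (pweight ?N') B \<phi>" for \<phi> :: "real^'n \<Rightarrow> complex" and B u
  proof -
    have B0: "0 \<le> B" using sbound_nonneg[OF \<phi>] by simp
    have \<phi>1: "sbound N (pweight N) B \<phi>"
      using sbound_less[OF \<phi>] by (rule sbound_mono) (auto intro: pweight_mono)
    have "sbound N (pweight N) (2 ^ N * (1 + norm (snd u)) ^ N * (pweight N (fst u) * B)) (tfshift u \<phi>)"
      unfolding tfshift_def by (intro sbound_modulate sbound_translate_pweight \<phi>1)
    then show ?thesis
    proof (rule sbound_monoB)
      have "(1 + norm (snd u)) ^ N * pweight N (fst u) \<le> pweight N u * pweight N u"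
        using pweight_le_norm[of "snd u" u N] pweight_le_norm[of "fst u" u N]
          norm_fst_le[of "fst u" "snd u"] norm_snd_le[of "snd u" "fst u"]
        by (intro mult_mono) (auto simp: pweight_def[of N "snd u", symmetric])
      also have "\<dots> \<le> pweight M u"
        unfolding M_def pweight_add[symmetric] by (rule pweight_mono) simp
      finally have "(2 ^ N * B) * ((1 + norm (snd u)) ^ N * pweight N (fst u)) \<le> (2 ^ N * B) * pweight M u"
        using B0 by (intro mult_left_mono) auto
      then show "2 ^ N * (1 + norm (snd u)) ^ N * (pweight N (fst u) * B) \<le> C1 * B * pweight M u"
        by (simp add: C1_def mult_ac)
    qed
  qed
  have lip: "sbound N (pweight N) (norm (u - u') * (C2 * B * pweight M u)) (\<lambda>y. tfshift u \<phi> y - tfshift u' \<phi> y)"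
    if \<phi>: "sbound ?N' (pweight ?N') B \<phi>" and near: "norm (u - u') \<le> 1" for \<phi> :: "real^'n \<Rightarrow> complex" and B u u'
  proof -
    have B0: "0 \<le> B" using sbound_nonneg[OF \<phi>] by simp
    obtain x \<xi> where u: "u = (x, \<xi>)" by (cases u)
    obtain x' \<xi>' where u': "u' = (x', \<xi>')" by (cases u')
    have dx: "norm (x' - x) \<le> norm (u - u')" and d\<xi>: "norm (\<xi> - \<xi>') \<le> norm (u - u')"
      using norm_fst_le[of "x - x'" "\<xi> - \<xi>'"] norm_snd_le[of "\<xi> - \<xi>'" "x - x'"] by (auto simp: u u' norm_minus_commute)
    have nx: "norm x \<le> norm u" using norm_fst_le[of x \<xi>] by (simp add: u)
    have "norm \<xi>' \<le> norm \<xi> + norm (\<xi> - \<xi>')" using norm_triangle_sub[of \<xi>' \<xi>] by (simp add: norm_minus_commute)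
    then have n\<xi>': "norm \<xi>' \<le> norm u + 1" using d\<xi> near norm_snd_le[of \<xi> x] by (simp add: u)
    define A where "A = norm (u - u')"
    have A: "0 \<le> A" "A \<le> 1" using near by (auto simp: A_def)
    let ?\<phi>x = "\<lambda>y. \<phi> (y - x)"
    define B1 where "B1 = pweight (Suc N) u * B"
    have B1: "0 \<le> B1" using B0 by (simp add: B1_def)
    have \<phi>x: "sbound (Suc N) (pweight (Suc N)) B1 ?\<phi>x"
      using sbound_translate_pweight[OF \<phi>, of x] by (rule sbound_monoB)
        (use pweight_le_norm[OF nx] B0 in \<open>auto simp: B1_def intro: mult_right_mono\<close>)
    \<comment> \<open>The difference of the two shifts is the modulation by \<xi>' applied to a sum
      of two changes: first of the frequency at the fixed position \<open>x\<close>, then of the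
      position.\<close>
    have 1: "sbound N (pweight N) (2 ^ N * A * 2 ^ N * B1) (\<lambda>y. cexp (\<xi> - \<xi>') y * ?\<phi>x y - ?\<phi>x y)"
    proof (rule sbound_monoB[OF sbound_modulate_diff[OF sbound_less[OF \<phi>x]]])
      have "(1 + norm (\<xi> - \<xi>')) ^ N \<le> 2 ^ N" using d\<xi> near by (intro power_mono) auto
      then show "2 ^ N * norm (\<xi> - \<xi>') * (1 + norm (\<xi> - \<xi>')) ^ N * B1 \<le> 2 ^ N * A * 2 ^ N * B1"
        using d\<xi> B1 by (intro mult_mono) (auto simp: A_def)
    qed
    have \<phi>x': "sbound (Suc N) (pweight N) B1 ?\<phi>x"
      using \<phi>x by (rule sbound_mono) (auto intro: pweight_mono)
    have "sbound N (pweight N) (?d * norm (x' - x) * pweight N (x' - x) * B1) (\<lambda>y. ?\<phi>x (y - (x' - x)) - ?\<phi>x y)"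
      by (rule sbound_translate_diff[OF \<phi>x'])
    then have d2: "sbound N (pweight N) (?d * A * 2 ^ N * B1) (\<lambda>y. ?\<phi>x (y - (x' - x)) - ?\<phi>x y)"
    proof (rule sbound_monoB)
      have "pweight N (x' - x) \<le> 2 ^ N" using dx near by (intro pweight_le_1) auto
      then show "?d * norm (x' - x) * pweight N (x' - x) * B1 \<le> ?d * A * 2 ^ N * B1"
        using dx B1 by (intro mult_mono) (auto simp: A_def)
    qed
    have 2: "sbound N (pweight N) (?d * A * 2 ^ N * B1) (\<lambda>y. ?\<phi>x y - \<phi> (y - x'))"
      by (rule sbound_cong[OF sbound_minus_commute[OF d2]]) (simp add: algebra_simps)
    have "sbound N (pweight N) (2 ^ N * A * 2 ^ N * B1 + ?d * A * 2 ^ N * B1)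
        (\<lambda>y. (cexp (\<xi> - \<xi>') y * ?\<phi>x y - ?\<phi>x y) + (?\<phi>x y - \<phi> (y - x')))"
      by (rule sbound_add[OF 1 2]) simp
    then have "sbound N (pweight N) (2 ^ N * (1 + norm \<xi>') ^ N * (2 ^ N * A * 2 ^ N * B1 + ?d * A * 2 ^ N * B1))
        (\<lambda>y. cexp \<xi>' y * ((cexp (\<xi> - \<xi>') y * ?\<phi>x y - ?\<phi>x y) + (?\<phi>x y - \<phi> (y - x'))))"
      by (rule sbound_modulate)
    then have "sbound N (pweight N) (2 ^ N * (1 + norm \<xi>') ^ N * (2 ^ N * A * 2 ^ N * B1 + ?d * A * 2 ^ N * B1))
        (\<lambda>y. tfshift u \<phi> y - tfshift u' \<phi> y)"
    proof (rule sbound_cong)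
      fix y
      have "cexp \<xi> y = cexp \<xi>' y * cexp (\<xi> - \<xi>') y" using cexp_add[of \<xi>' "\<xi> - \<xi>'" y] by simp
      then show "cexp \<xi>' y * ((cexp (\<xi> - \<xi>') y * ?\<phi>x y - ?\<phi>x y) + (?\<phi>x y - \<phi> (y - x'))) = tfshift u \<phi> y - tfshift u' \<phi> y"
        by (simp add: tfshift_def u u' algebra_simps)
    qed
    then show ?thesis
    proof (rule sbound_monoB)
      have "(1 + norm \<xi>') ^ N \<le> 2 ^ N * pweight N u"
        using pweight_le_add[OF n\<xi>', of N] by (simp add: pweight_def)
      then have "2 ^ N * (1 + norm \<xi>') ^ N * (2 ^ N * A * 2 ^ N * B1 + ?d * A * 2 ^ N * B1)
          \<le> 2 ^ N * (2 ^ N * pweight N u) * (2 ^ N * A * 2 ^ N * B1 + ?d * A * 2 ^ N * B1)"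
        using A B1 by (intro mult_right_mono mult_left_mono) auto
      also have "\<dots> = (2 ^ N * 2 ^ N * (2 ^ N * 2 ^ N + ?d * 2 ^ N)) * (A * B * pweight M u)"
      proof -
        have "pweight M u = pweight (Suc N) u * pweight N u" unfolding M_def by (rule pweight_add)
        then show ?thesis unfolding B1_def by (simp only: algebra_simps)
      qed
      also have "\<dots> \<le> C2 * (A * B * pweight M u)"
      proof (rule mult_right_mono)
        have 1: "1 \<le> (2::real) ^ N" by simp
        have "(2::real) ^ N * 2 ^ N * 2 ^ N * 2 ^ N * 1 \<le> 2 ^ N * 2 ^ N * 2 ^ N * 2 ^ N * (2 ^ N * 2 ^ Suc N)"
          by (intro mult_left_mono) (auto simp del: power_Suc simp flip: power_add)
        moreover have "(2::real) ^ N * 2 ^ N * (?d * 2 ^ N * 1) \<le> 2 ^ N * 2 ^ N * (?d * 2 ^ N * 2 ^ N)"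
          by (intro mult_left_mono) auto
        ultimately show "2 ^ N * 2 ^ N * (2 ^ N * 2 ^ N + ?d * 2 ^ N) \<le> C2"
          unfolding C2_def by (simp only: distrib_left mult.assoc mult_1_right)
        show "0 \<le> A * B * pweight M u" using A B0 by simp
      qed
      finally show "2 ^ N * (1 + norm \<xi>') ^ N * (2 ^ N * A * 2 ^ N * B1 + ?d * A * 2 ^ N * B1) \<le> norm (u - u') * (C2 * B * pweight M u)"
        by (simp add: A_def mult_ac)
    qed
  qed
  have C: "0 \<le> C1" "0 \<le> C2" by (auto simp: C1_def C2_def)
  have "fam N (pweight N) (\<lambda>u. (C1 + C2) * B * pweight M u) (\<lambda>u. tfshift u \<phi>)"
    if \<phi>: "sbound ?N' (pweight ?N') B \<phi>" for \<phi> :: "real^'n \<Rightarrow> complex" and B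
    unfolding fam_def
  proof (intro conjI allI impI)
    have B0: "0 \<le> B" using sbound_nonneg[OF \<phi>] by simp
    show "sbound N (pweight N) ((C1 + C2) * B * pweight M u) (tfshift u \<phi>)" for u
      by (rule sbound_monoB[OF bd[OF \<phi>]]) (use C B0 in \<open>auto intro!: mult_right_mono\<close>)
    show "sbound N (pweight N) (norm (u - u') * ((C1 + C2) * B * pweight M u)) (\<lambda>y. tfshift u \<phi> y - tfshift u' \<phi> y)"
      if "norm (u - u') \<le> 1" for u u'
      by (rule sbound_monoB[OF lip[OF \<phi> that]]) (use C B0 in \<open>auto intro!: mult_left_mono mult_right_mono\<close>)
  qed
  then show ?thesis using C by (intro exI[of _ "C1 + C2"] exI[of _ M] exI[of _ ?N']) auto
qed

lemma fam_tfshift_schwartz: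
  fixes \<phi> :: "real^'n::finite \<Rightarrow> complex"
  assumes "\<phi> \<in> schwartz"
  shows "\<exists>C M. 0 \<le> C \<and> fam N (pweight N) (\<lambda>u. C * pweight M u) (\<lambda>u. tfshift u \<phi>)"
proof -
  obtain C M N' where C: "0 \<le> C" and *: "\<And>(\<phi> :: real^'n \<Rightarrow> complex) B. sbound N' (pweight N') B \<phi> \<Longrightarrow>
    fam N (pweight N) (\<lambda>u. C * B * pweight M u) (\<lambda>u. tfshift u \<phi>)"
    using fam_tfshift[of N, where 'n = 'n] by blast
  obtain B where B: "0 < B" "sbound N' (pweight N') B \<phi>" using schwartzE[OF assms] by blast
  show ?thesis using C B(1) *[OF B(2)] by (intro exI[of _ "C * B"] exI[of _ M]) auto
qed

lemma fam_reparam: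
  assumes "fam m W \<beta> \<Phi>" "\<And>u u'. norm (l u - l u') \<le> norm (u - u')" "\<And>y. 0 \<le> W y"
  shows "fam m W (\<lambda>u. \<beta> (l u)) (\<lambda>u. \<Phi> (l u))"
  unfolding fam_def
proof (intro conjI allI impI)
  show "sbound m W (\<beta> (l u)) (\<Phi> (l u))" for u using assms(1) by (simp add: fam_def)
  then have \<beta>: "0 \<le> \<beta> (l u)" for u using assms(3) sbound_nonneg by blast
  show "sbound m W (norm (u - u') * \<beta> (l u)) (\<lambda>y. \<Phi> (l u) y - \<Phi> (l u') y)" if "norm (u - u') \<le> 1" for u u'
  proof -
    have "sbound m W (norm (l u - l u') * \<beta> (l u)) (\<lambda>y. \<Phi> (l u) y - \<Phi> (l u') y)"
      using assms(1) order_trans[OF assms(2) that] by (simp add: fam_def)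
    then show ?thesis by (rule sbound_monoB) (intro mult_right_mono assms(2) \<beta>)
  qed
qed

text \<open>Splitting the increment as \<open>a u * (\<Phi> u y - \<Phi> u' y) + (a u - a u') *
  \<Phi> u' y\<close> brings in the envelope at \<open>u'\<close>; slow variation of \<beta> returns
  it to \<open>u\<close>.\<close>

lemma fam_scale:
  assumes fam: "fam m W \<beta> \<Phi>" and W: "\<And>y. 0 \<le> W y" and \<gamma>: "\<And>u. cmod (a u) \<le> \<gamma> u"
    "\<And>u u'. norm (u - u') \<le> 1 \<Longrightarrow> cmod (a u - a u') \<le> norm (u - u') * \<gamma> u"
    and sl: "\<And>u u'. norm (u - u') \<le> 1 \<Longrightarrow> \<beta> u' \<le> K * \<beta> u" and K: "0 \<le> K"
  shows "fam m W (\<lambda>u. (1 + K) * (\<gamma> u * \<beta> u)) (\<lambda>u y. a u * \<Phi> u y)"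
  unfolding fam_def
proof (intro conjI allI impI)
  have \<beta>: "0 \<le> \<beta> u" for u using fam W sbound_nonneg unfolding fam_def by blast
  have \<gamma>0: "0 \<le> \<gamma> u" for u using \<gamma>(1) norm_ge_zero order_trans by blast
  fix u
  have "sbound m W (cmod (a u) * \<beta> u) (\<lambda>y. a u * \<Phi> u y)"
    using fam by (intro sbound_cmult) (simp add: fam_def)
  then show "sbound m W ((1 + K) * (\<gamma> u * \<beta> u)) (\<lambda>y. a u * \<Phi> u y)"
  proof (rule sbound_monoB)
    have "cmod (a u) * \<beta> u \<le> 1 * (\<gamma> u * \<beta> u)" using \<gamma>(1)[of u] \<beta>[of u] by (simp add: mult_right_mono)
    also have "\<dots> \<le> (1 + K) * (\<gamma> u * \<beta> u)" using K \<beta>[of u] \<gamma>0[of u] by (intro mult_right_mono) auto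
    finally show "cmod (a u) * \<beta> u \<le> (1 + K) * (\<gamma> u * \<beta> u)" .
  qed
  fix u' assume near: "norm (u - u') \<le> 1"
  have 1: "sbound m W (cmod (a u) * (norm (u - u') * \<beta> u)) (\<lambda>y. a u * (\<Phi> u y - \<Phi> u' y))"
    using fam near by (intro sbound_cmult) (simp add: fam_def)
  have 2: "sbound m W (cmod (a u - a u') * \<beta> u') (\<lambda>y. (a u - a u') * \<Phi> u' y)"
    using fam by (intro sbound_cmult) (simp add: fam_def)
  from sbound_add[OF 1 2 W]
  have "sbound m W (cmod (a u) * (norm (u - u') * \<beta> u) + cmod (a u - a u') * \<beta> u') (\<lambda>y. a u * \<Phi> u y - a u' * \<Phi> u' y)"
    by (simp add: algebra_simps)
  then show "sbound m W (norm (u - u') * ((1 + K) * (\<gamma> u * \<beta> u))) (\<lambda>y. a u * \<Phi> u y - a u' * \<Phi> u' y)"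
  proof (rule sbound_monoB)
    have "cmod (a u) * (norm (u - u') * \<beta> u) \<le> \<gamma> u * (norm (u - u') * \<beta> u)"
      using \<gamma>(1)[of u] \<beta>[of u] by (intro mult_right_mono) auto
    moreover have "cmod (a u - a u') * \<beta> u' \<le> (norm (u - u') * \<gamma> u) * (K * \<beta> u)"
      using \<gamma>(2)[OF near] sl[OF near] \<beta> \<gamma>0 by (intro mult_mono) auto
    ultimately show "cmod (a u) * (norm (u - u') * \<beta> u) + cmod (a u - a u') * \<beta> u' \<le> norm (u - u') * ((1 + K) * (\<gamma> u * \<beta> u))"
      by (simp add: algebra_simps)
  qed
qed

lemma fam_mult_right:
  assumes fam: "fam m (pweight k) \<beta> \<Phi>" and \<theta>: "sbound m (\<lambda>_. 1) B \<theta>"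
  shows "fam m (pweight k) (\<lambda>u. 2 ^ m * B * \<beta> u) (\<lambda>u y. \<Phi> u y * \<theta> y)"
  unfolding fam_def
proof (intro conjI allI impI)
  show "sbound m (pweight k) (2 ^ m * B * \<beta> u) (\<lambda>y. \<Phi> u y * \<theta> y)" for u
  proof -
    have "sbound m (pweight k) (\<beta> u) (\<Phi> u)" using fam by (simp add: fam_def)
    from sbound_mult_pweight[OF this \<theta>] show ?thesis by (simp only: mult.assoc mult.commute[of B])
  qed
  show "sbound m (pweight k) (norm (u - u') * (2 ^ m * B * \<beta> u)) (\<lambda>y. \<Phi> u y * \<theta> y - \<Phi> u' y * \<theta> y)"
    if "norm (u - u') \<le> 1" for u u'
  proof -
    have "sbound m (pweight k) (norm (u - u') * \<beta> u) (\<lambda>y. \<Phi> u y - \<Phi> u' y)"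
      using fam that by (simp add: fam_def)
    from sbound_mult_pweight[OF this \<theta>]
    have "sbound m (pweight k) (2 ^ m * (norm (u - u') * \<beta> u) * B) (\<lambda>y. \<Phi> u y * \<theta> y - \<Phi> u' y * \<theta> y)"
      by (simp only: left_diff_distrib)
    moreover have "2 ^ m * (norm (u - u') * \<beta> u) * B = norm (u - u') * (2 ^ m * B * \<beta> u)" by simp
    ultimately show ?thesis by (simp only:)
  qed
qed

lemma pweight_slow: "norm (u - u') \<le> 1 \<Longrightarrow> pweight M u' \<le> 2 ^ M * pweight M u"
  by (rule pweight_le_add) (use norm_triangle_sub[of u' u] norm_minus_commute[of u u'] in linarith)

lemma schwartz_bounded: "f \<in> schwartz \<Longrightarrow> \<exists>B. sbound m (\<lambda>_. 1) B f"
proof -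
  assume "f \<in> schwartz"
  then obtain B where "sbound m (pweight 0) B f" using schwartz_iff by blast
  moreover have "pweight 0 = (\<lambda>_::real^'a. 1)" by (simp add: pweight_def fun_eq_iff)
  ultimately show ?thesis by auto
qed

lemma norm_Pair_0: "norm (x, 0) = norm x" "norm (0, x) = norm x"
  by (simp_all add: norm_Pair)

lemma fam_translates:
  fixes \<psi> :: "real^'n::finite \<Rightarrow> complex" and c :: real
  assumes "\<psi> \<in> schwartz" "\<bar>c\<bar> \<le> 1"
  shows "\<exists>C M. 0 \<le> C \<and> fam N (pweight N) (\<lambda>t. C * pweight M t) (\<lambda>t y. \<psi> (y - c *\<^sub>R t))"
proof -
  obtain C M where C: "0 \<le> C" and fam: "fam N (pweight N) (\<lambda>u. C * pweight M u) (\<lambda>u. tfshift u \<psi>)"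
    using fam_tfshift_schwartz[OF assms(1)] by blast
  have n: "norm (c *\<^sub>R t) \<le> norm t" for t :: "real^'n"
    using mult_right_mono[OF assms(2), of "norm t"] by simp
  have "fam N (pweight N) (\<lambda>t. C * pweight M (c *\<^sub>R t, 0::real^'n)) (\<lambda>t. tfshift (c *\<^sub>R t, 0) \<psi>)"
    by (rule fam_reparam[OF fam]) (use n in \<open>auto simp: norm_Pair_0 scaleR_diff_right[symmetric]\<close>)
  then have "fam N (pweight N) (\<lambda>t. C * pweight M (c *\<^sub>R t, 0::real^'n)) (\<lambda>t y. \<psi> (y - c *\<^sub>R t))"
    by (simp add: tfshift_def)
  then have "fam N (pweight N) (\<lambda>t. C * pweight M t) (\<lambda>t y. \<psi> (y - c *\<^sub>R t))"
    by (rule fam_monoB) (use C n in \<open>auto simp: norm_Pair_0 intro!: mult_left_mono pweight_le_norm\<close>)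
  then show ?thesis using C by blast
qed

lemma fam_modulates:
  fixes \<theta> :: "real^'n::finite \<Rightarrow> complex"
  assumes "\<theta> \<in> schwartz"
  shows "\<exists>C M. 0 \<le> C \<and> fam N (pweight N) (\<lambda>t. C * pweight M t) (\<lambda>\<eta> y. cexp \<eta> y * \<theta> y)"
proof -
  obtain C M where C: "0 \<le> C" and fam: "fam N (pweight N) (\<lambda>u. C * pweight M u) (\<lambda>u. tfshift u \<theta>)"
    using fam_tfshift_schwartz[OF assms(1)] by blast
  have "fam N (pweight N) (\<lambda>t. C * pweight M (0::real^'n, t)) (\<lambda>t. tfshift (0, t) \<theta>)"
    by (rule fam_reparam[OF fam]) (auto simp: norm_Pair_0)
  then have "fam N (pweight N) (\<lambda>t. C * pweight M t) (\<lambda>\<eta> y. cexp \<eta> y * \<theta> y)"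
    by (simp add: tfshift_def pweight_def norm_Pair_0)
  then show ?thesis using C by blast
qed

text \<open>Fourier inversion, regularised by a Gaussian at scale \<open>R\<close>, with its two sides paired with \<open>T\<close>.\<close>

lemma dist_mollified:
  fixes \<psi> \<theta> :: "real^'n::finite \<Rightarrow> complex" and R :: real
  assumes \<psi>: "\<psi> \<in> schwartz" and \<theta>: "\<theta> \<in> schwartz" and R: "1 \<le> R"
  shows "(\<integral>t. apply_dist T (\<lambda>y. \<psi> (y - (1 / R) *\<^sub>R t) * \<theta> y) \<partial>gmeasure) =
    complex_of_real (gconst ^ CARD('n) * gconst ^ CARD('n)) * (\<integral>\<eta>. ft \<psi> \<eta> * apply_dist T (\<lambda>y. cexp \<eta> y * \<theta> y) \<partial>gdm (1 / R))"
proof -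
  let ?k = "gconst ^ CARD('n)"
  have R1: "\<bar>1 / R\<bar> \<le> 1" "1 / R \<noteq> 0" "0 < R" using R by auto
  define F1 where "F1 = (\<lambda>t y. \<psi> (y - (1 / R) *\<^sub>R t) * \<theta> y)"
  define F2 where "F2 = (\<lambda>\<eta> y. ft \<psi> \<eta> * (cexp \<eta> y * \<theta> y))"
  have F1s: "F1 t \<in> schwartz" for t
    unfolding F1_def by (intro schwartz_mult[OF schwartz_translate[OF \<psi>] \<theta>])
  have F2s: "F2 \<eta> \<in> schwartz" for \<eta>
    unfolding F2_def by (intro schwartz_cmult schwartz_modulate \<theta>)
  have F1: "\<exists>\<beta>. integrable gmeasure \<beta> \<and> fam m (pweight m) \<beta> F1" for m
  proof -
    obtain C M where "fam m (pweight m) (\<lambda>t. C * pweight M t) (\<lambda>t y. \<psi> (y - (1 / R) *\<^sub>R t))"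
      using fam_translates[OF \<psi> R1(1)] by blast
    moreover obtain B where "sbound m (\<lambda>_. 1) B \<theta>" using schwartz_bounded[OF \<theta>] by blast
    ultimately have "fam m (pweight m) (\<lambda>t. 2 ^ m * B * (C * pweight M t)) F1"
      unfolding F1_def by (rule fam_mult_right)
    moreover have "integrable gmeasure (\<lambda>t::real^'n. 2 ^ m * B * (C * pweight M t))"
      by (intro integrable_mult_right integrable_gmeasure_pweight)
    ultimately show ?thesis by (intro exI conjI)
  qed
  have F2: "\<exists>\<beta>. integrable (gdm (1 / R)) \<beta> \<and> fam m (pweight m) \<beta> F2" for m
  proof -
    obtain C M where C: "0 \<le> C" and fam: "fam m (pweight m) (\<lambda>t. C * pweight M t) (\<lambda>\<eta> y. cexp \<eta> y * \<theta> y)"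
      using fam_modulates[OF \<theta>] by blast
    obtain A where A: "\<And>\<eta> \<eta>'. cmod (ft \<psi> \<eta>) \<le> A \<and> cmod (ft \<psi> \<eta> - ft \<psi> \<eta>') \<le> A * norm (\<eta> - \<eta>')"
      using ft_Lipschitz[OF \<psi>] by blast
    have "fam m (pweight m) (\<lambda>u. (1 + 2 ^ M) * (A * (C * pweight M u))) F2"
      unfolding F2_def
    proof (rule fam_scale[OF fam])
      show "C * pweight M u' \<le> 2 ^ M * (C * pweight M u)" if "norm (u - u') \<le> 1" for u u' :: "real^'n"
        using mult_left_mono[OF pweight_slow[OF that, of M] C] by (simp only: mult.left_commute)
    qed (use A in \<open>auto simp: mult.commute\<close>)
    moreover have "integrable (gdm (1 / R)) (\<lambda>u::real^'n. (1 + 2 ^ M) * (A * (C * pweight M u)))"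
      by (intro integrable_mult_right integrable_gdm_pweight[OF R1(2)])
    ultimately show ?thesis by (intro exI conjI)
  qed
  \<comment> \<open>The pointwise identity: averaged translates of \<psi> are a convolution with a
    narrow Gaussian, and the Fourier representation of that Gaussian produces
    \<open>ft \<psi>\<close>.\<close>
  have eq: "(\<integral>t. F1 t y \<partial>gmeasure) = complex_of_real (?k * ?k) * (\<integral>\<eta>. F2 \<eta> y \<partial>gdm (1 / R))" for y
  proof -
    have m1: "(\<lambda>t. \<psi> (y - (1 / R) *\<^sub>R t)) \<in> borel_measurable borel"
      by (rule measurable_compose[OF _ schwartz_measurable[OF \<psi>]]) measurable
    have [measurable]: "\<psi> \<in> borel_measurable borel" by (rule schwartz_measurable[OF \<psi>])
    let ?G = "\<lambda>s \<eta>. \<psi> s * complex_of_real (gauss ((1 / R) *\<^sub>R \<eta>)) * cexp \<eta> (y - s)"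
    \<comment> \<open>A narrow Gaussian is the Fourier integral of a wide one.\<close>
    have G1: "complex_of_real (R ^ CARD('n) * gauss (R *\<^sub>R (y - s))) = complex_of_real ?k * (\<integral>\<eta>. complex_of_real (gauss ((1 / R) *\<^sub>R \<eta>)) * cexp \<eta> (y - s) \<partial>lborel)" for s
    proof -
      have "complex_of_real (gauss (R *\<^sub>R (y - s))) = (\<integral>u. gdens u *\<^sub>R exp (\<i> * complex_of_real (u \<bullet> (R *\<^sub>R (y - s)))) \<partial>lborel)"
        by (subst fourier_gmeasure[symmetric], subst integral_gmeasure) auto
      also have "\<dots> = \<bar>1 / R\<bar> ^ CARD('n) *\<^sub>R (\<integral>u. gdens (0 + (1 / R) *\<^sub>R u) *\<^sub>R exp (\<i> * complex_of_real ((0 + (1 / R) *\<^sub>R u) \<bullet> (R *\<^sub>R (y - s)))) \<partial>lborel)"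
        using integral_lborel_affine[of "\<lambda>u. gdens u *\<^sub>R exp (\<i> * complex_of_real (u \<bullet> (R *\<^sub>R (y - s))))" "1 / R" 0] R1 by simp
      also have "(\<lambda>u. gdens (0 + (1 / R) *\<^sub>R u) *\<^sub>R exp (\<i> * complex_of_real ((0 + (1 / R) *\<^sub>R u) \<bullet> (R *\<^sub>R (y - s))))) =
          (\<lambda>\<eta>. complex_of_real ?k * (complex_of_real (gauss ((1 / R) *\<^sub>R \<eta>)) * cexp \<eta> (y - s)))"
      proof
        fix u :: "real^'n"
        have ip: "((1 / R) *\<^sub>R u) \<bullet> (R *\<^sub>R (y - s)) = (y - s) \<bullet> u"
          using R1 by (simp add: inner_commute)
        have "gdens (0 + (1 / R) *\<^sub>R u) = ?k * gauss ((1 / R) *\<^sub>R u)" by (simp add: gdens_def)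
        then show "gdens (0 + (1 / R) *\<^sub>R u) *\<^sub>R exp (\<i> * complex_of_real ((0 + (1 / R) *\<^sub>R u) \<bullet> (R *\<^sub>R (y - s)))) =
          complex_of_real ?k * (complex_of_real (gauss ((1 / R) *\<^sub>R u)) * cexp u (y - s))"
          unfolding add_0 ip by (simp add: cexp_def scaleR_conv_of_real mult.assoc)
      qed
      finally have "complex_of_real (gauss (R *\<^sub>R (y - s))) = complex_of_real ((1 / R) ^ CARD('n)) *
          (complex_of_real ?k * (\<integral>\<eta>. complex_of_real (gauss ((1 / R) *\<^sub>R \<eta>)) * cexp \<eta> (y - s) \<partial>lborel))"
        using R1 by (simp add: scaleR_conv_of_real)
      then show ?thesis using R1 by (simp add: power_one_over field_simps)
    qed
    have "(\<integral>t. \<psi> (y - (1 / R) *\<^sub>R t) \<partial>gmeasure) = (\<integral>t. gdens t *\<^sub>R \<psi> (y - (1 / R) *\<^sub>R t) \<partial>lborel)"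
      by (rule integral_gmeasure[OF m1])
    \<comment> \<open>Substitution \<open>t = R *\<^sub>R (y - s)\<close>, which is affine in s with
      factor \<open>- R\<close>.\<close>
    also have "\<dots> = \<bar>- R\<bar> ^ CARD('n) *\<^sub>R (\<integral>s. gdens (R *\<^sub>R y + (- R) *\<^sub>R s) *\<^sub>R \<psi> (y - (1 / R) *\<^sub>R (R *\<^sub>R y + (- R) *\<^sub>R s)) \<partial>lborel)"
      using integral_lborel_affine[of "\<lambda>t. gdens t *\<^sub>R \<psi> (y - (1 / R) *\<^sub>R t)" "- R" "R *\<^sub>R y"] R1 m1 by simp
    also have "(\<lambda>s. gdens (R *\<^sub>R y + (- R) *\<^sub>R s) *\<^sub>R \<psi> (y - (1 / R) *\<^sub>R (R *\<^sub>R y + (- R) *\<^sub>R s))) =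
        (\<lambda>s. gdens (R *\<^sub>R (y - s)) *\<^sub>R \<psi> s)"
      using R1 by (auto simp: fun_eq_iff algebra_simps)
    also have "\<bar>- R\<bar> ^ CARD('n) *\<^sub>R (\<integral>s. gdens (R *\<^sub>R (y - s)) *\<^sub>R \<psi> s \<partial>lborel) =
        (\<integral>s. complex_of_real ?k * (complex_of_real (R ^ CARD('n) * gauss (R *\<^sub>R (y - s))) * \<psi> s) \<partial>lborel)"
      using R1 by (subst integral_scaleR_right[symmetric]) (auto simp: gdens_def scaleR_conv_of_real mult_ac intro!: Bochner_Integration.integral_cong)
    also have "\<dots> = (\<integral>s. complex_of_real (?k * ?k) * (\<integral>\<eta>. ?G s \<eta> \<partial>lborel) \<partial>lborel)"
      unfolding G1 by (intro Bochner_Integration.integral_cong refl) (simp add: mult_ac)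
    also have "\<dots> = complex_of_real (?k * ?k) * (\<integral>s. \<integral>\<eta>. ?G s \<eta> \<partial>lborel \<partial>lborel)" by simp
    \<comment> \<open>The Gaussian factor makes the double integral absolutely convergent, so the
      order may be exchanged.\<close>
    also have "(\<integral>s. \<integral>\<eta>. ?G s \<eta> \<partial>lborel \<partial>lborel) = (\<integral>\<eta>. \<integral>s. ?G s \<eta> \<partial>lborel \<partial>lborel)"
    proof (rule lborel_pair.Fubini_integral[symmetric])
      have ig: "integrable lborel (\<lambda>\<eta>::real^'n. gauss ((1 / R) *\<^sub>R \<eta>))"
        using integrable_pweight_gauss[OF R1(2), of 0, where 'a = "real^'n"] by (simp add: pweight_def)
      have ip: "integrable lborel (\<lambda>s. cmod (\<psi> s))" using schwartz_integrable[OF \<psi>] by simp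
      have n: "cmod (?G s \<eta>) = cmod (\<psi> s) * gauss ((1 / R) *\<^sub>R \<eta>)" for s \<eta>
        by (simp only: norm_mult norm_cexp norm_of_real abs_of_nonneg[OF gauss_nonneg] mult_1_right)
      show "integrable (lborel \<Otimes>\<^sub>M lborel) (\<lambda>(s, \<eta>). ?G s \<eta>)"
      proof (rule lborel_pair.Fubini_integrable)
        show "(\<lambda>(s, \<eta>). ?G s \<eta>) \<in> borel_measurable (lborel \<Otimes>\<^sub>M lborel)" unfolding cexp_def by measurable
        have "integrable lborel (\<lambda>s. \<integral>\<eta>. cmod (?G s \<eta>) \<partial>lborel)"
          unfolding n using ip by simp
        then show "integrable lborel (\<lambda>s. \<integral>\<eta>. norm (case (s, \<eta>) of (s, \<eta>) \<Rightarrow> ?G s \<eta>) \<partial>lborel)" by simp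
        have "integrable lborel (\<lambda>\<eta>. ?G s \<eta>)" for s
        proof (rule Bochner_Integration.integrable_bound)
          show "integrable lborel (\<lambda>\<eta>::real^'n. cmod (\<psi> s) * gauss ((1 / R) *\<^sub>R \<eta>))" using ig by simp
          show "(\<lambda>\<eta>. ?G s \<eta>) \<in> borel_measurable lborel" unfolding cexp_def by measurable
        qed (intro AE_I2, simp only: n real_norm_def abs_ge_self)
        then show "AE s in lborel. integrable lborel (\<lambda>\<eta>. case (s, \<eta>) of (s, \<eta>) \<Rightarrow> ?G s \<eta>)" by simp
      qed
    qed
    also have "(\<lambda>\<eta>. \<integral>s. ?G s \<eta> \<partial>lborel) = (\<lambda>\<eta>. gauss ((1 / R) *\<^sub>R \<eta>) *\<^sub>R (ft \<psi> \<eta> * cexp \<eta> y))"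
    proof
      fix \<eta>
      have "(\<integral>s. ?G s \<eta> \<partial>lborel) = (\<integral>s. complex_of_real (gauss ((1 / R) *\<^sub>R \<eta>)) * cexp \<eta> y * (\<psi> s * cexp (- \<eta>) s) \<partial>lborel)"
        using cexp_add_right[of \<eta> y "- _"] by (intro Bochner_Integration.integral_cong refl) (simp add: cexp_minus mult_ac)
      also have "\<dots> = complex_of_real (gauss ((1 / R) *\<^sub>R \<eta>)) * cexp \<eta> y * ft \<psi> \<eta>"
        unfolding ft_def by (rule integral_mult_right_zero)
      finally show "(\<integral>s. ?G s \<eta> \<partial>lborel) = gauss ((1 / R) *\<^sub>R \<eta>) *\<^sub>R (ft \<psi> \<eta> * cexp \<eta> y)"
        by (simp only: scaleR_conv_of_real mult_ac)
    qed
    also have "(\<integral>\<eta>. gauss ((1 / R) *\<^sub>R \<eta>) *\<^sub>R (ft \<psi> \<eta> * cexp \<eta> y) \<partial>lborel) = (\<integral>\<eta>. ft \<psi> \<eta> * cexp \<eta> y \<partial>gdm (1 / R))"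
    proof (rule integral_gdm[symmetric])
      have "continuous_on UNIV (ft \<psi>)"
      proof -
        obtain A where A: "\<And>\<eta> \<eta>'. cmod (ft \<psi> \<eta>) \<le> A \<and> cmod (ft \<psi> \<eta> - ft \<psi> \<eta>') \<le> A * norm (\<eta> - \<eta>')"
          using ft_Lipschitz[OF \<psi>] by blast
        then show ?thesis by (intro continuous_on_local_Lipschitz[where K = "\<lambda>_. A"]) (simp add: mult.commute)
      qed
      then have [measurable]: "ft \<psi> \<in> borel_measurable borel" by (rule borel_measurable_continuous_onI)
      show "(\<lambda>\<eta>. ft \<psi> \<eta> * cexp \<eta> y) \<in> borel_measurable borel" unfolding cexp_def by measurable
    qed
    finally show ?thesis
      unfolding F1_def F2_def by (simp add: mult.assoc[symmetric])
  qed
  have "(\<integral>t. apply_dist T (F1 t) \<partial>gmeasure) = apply_dist T (\<lambda>y. \<integral>t. F1 t y \<partial>gmeasure)"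
    by (rule apply_dist_integral[symmetric]) (use F1 F1s gmeasure_finite in auto)
  also have "\<dots> = complex_of_real (?k * ?k) * apply_dist T (\<lambda>y. \<integral>\<eta>. F2 \<eta> y \<partial>gdm (1 / R))"
    unfolding eq by (rule apply_dist_cmult[OF schwartz_integral_fam[OF _ F2]]) simp
  also have "apply_dist T (\<lambda>y. \<integral>\<eta>. F2 \<eta> y \<partial>gdm (1 / R)) = (\<integral>\<eta>. apply_dist T (F2 \<eta>) \<partial>gdm (1 / R))"
    by (rule apply_dist_integral) (use F2 F2s gdm_finite[OF R1(2)] in auto)
  finally show ?thesis
    unfolding F1_def F2_def by (simp add: apply_dist_cmult[OF schwartz_modulate[OF \<theta>]])
qed

text \<open>The limit of \<open>dist_mollified\<close> for R tending to infinity. Only an inequality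
  is kept, because the regularising Gaussian is at most 1 on the right side; with extended values an
  infinite integral does no harm.\<close>

lemma apply_dist_product_le:
  fixes \<psi> \<theta> :: "real^'n::finite \<Rightarrow> complex"
  assumes \<psi>: "\<psi> \<in> schwartz" and \<theta>: "\<theta> \<in> schwartz"
  shows "ennreal (cmod (apply_dist T (\<lambda>y. \<psi> y * \<theta> y))) \<le> ennreal (gconst ^ CARD('n) * gconst ^ CARD('n)) *
    (\<integral>\<^sup>+\<eta>. ennreal (cmod (ft \<psi> \<eta>) * cmod (apply_dist T (\<lambda>y. cexp \<eta> y * \<theta> y))) \<partial>lborel)"
proof -
  let ?k = "gconst ^ CARD('n)"
  define I where "I = (\<integral>\<^sup>+\<eta>. ennreal (cmod (ft \<psi> \<eta>) * cmod (apply_dist T (\<lambda>y. cexp \<eta> y * \<theta> y))) \<partial>lborel)"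
  obtain N C where C: "0 \<le> C" and T: "dist_bound N C (apply_dist T)" using dist_bound_apply_dist by blast
  define \<alpha> where "\<alpha> x = apply_dist T (\<lambda>y. \<psi> (y - x) * \<theta> y)" for x
  have \<alpha>s: "(\<lambda>y. \<psi> (y - x) * \<theta> y) \<in> schwartz" for x
    by (rule schwartz_mult[OF schwartz_translate[OF \<psi>] \<theta>])
  obtain D M where D: "0 \<le> D" and fam: "fam N (pweight N) (\<lambda>t. D * pweight M t) (\<lambda>t y. \<psi> (y - t) * \<theta> y)"
  proof -
    obtain D M where "0 \<le> D" "fam N (pweight N) (\<lambda>t. D * pweight M t) (\<lambda>t y. \<psi> (y - 1 *\<^sub>R t))"
      using fam_translates[OF \<psi>, of 1 N] by auto
    moreover obtain B where B: "sbound N (\<lambda>_. 1) B \<theta>" using schwartz_bounded[OF \<theta>] by blast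
    ultimately have "fam N (pweight N) (\<lambda>t. 2 ^ N * B * (D * pweight M t)) (\<lambda>t y. \<psi> (y - 1 *\<^sub>R t) * \<theta> y)"
      by (intro fam_mult_right)
    then show thesis using that[of "2 ^ N * B * D" M] \<open>0 \<le> D\<close> sbound_nonneg[OF B] by (simp add: mult.assoc)
  qed
  have \<alpha>: "cmod (\<alpha> u) \<le> C * (D * pweight M u)"
    "norm (u - u') \<le> 1 \<Longrightarrow> cmod (\<alpha> u - \<alpha> u') \<le> norm (u - u') * (C * (D * pweight M u))" for u u'
    using dist_fam[OF T C fam \<alpha>s] unfolding \<alpha>_def by auto
  have cont: "continuous_on UNIV \<alpha>" by (rule continuous_on_local_Lipschitz) (rule \<alpha>(2))
  then have [measurable]: "\<alpha> \<in> borel_measurable borel" by (rule borel_measurable_continuous_onI)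
  define a where "a n = (\<integral>t. \<alpha> ((1 / real (Suc n)) *\<^sub>R t) \<partial>gmeasure)" for n
  \<comment> \<open>As the averages concentrate at the origin they recover the value at the
    translation 0; the polynomial growth of \<alpha> is integrable for the Gaussian.\<close>
  have "a \<longlonglongrightarrow> (\<integral>t. \<alpha> 0 \<partial>(gmeasure :: (real^'n) measure))"
    unfolding a_def
  proof (rule integral_dominated_convergence[where w = "\<lambda>t. C * (D * pweight M t)"])
    show "integrable gmeasure (\<lambda>t::real^'n. C * (D * pweight M t))"
      using integrable_gmeasure_pweight by (intro integrable_mult_right) auto
    show "AE t in gmeasure. (\<lambda>n. \<alpha> ((1 / real (Suc n)) *\<^sub>R t)) \<longlonglongrightarrow> \<alpha> 0"
    proof (rule AE_I2)
      fix t :: "real^'n"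
      have "(\<lambda>n. 1 / real (Suc n)) \<longlonglongrightarrow> 0" by real_asymp
      then have "(\<lambda>n. (1 / real (Suc n)) *\<^sub>R t) \<longlonglongrightarrow> 0 *\<^sub>R t" by (intro tendsto_scaleR tendsto_const)
      moreover have "isCont \<alpha> (0 *\<^sub>R t)" using cont by (simp add: continuous_on_eq_continuous_at)
      ultimately show "(\<lambda>n. \<alpha> ((1 / real (Suc n)) *\<^sub>R t)) \<longlonglongrightarrow> \<alpha> 0"
        using isCont_tendsto_compose[of "0 *\<^sub>R t" \<alpha>] by simp
    qed
    have "cmod (\<alpha> ((1 / real (Suc n)) *\<^sub>R t)) \<le> C * (D * pweight M t)" for n t
    proof -
      have "norm ((1 / real (Suc n)) *\<^sub>R t) \<le> norm t"
        using mult_right_mono[of "1 / real (Suc n)" 1 "norm t"] by simp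
      from pweight_le_norm[OF this, of M]
      have "C * (D * pweight M ((1 / real (Suc n)) *\<^sub>R t)) \<le> C * (D * pweight M t)"
        using C D by (intro mult_left_mono) auto
      then show ?thesis using \<alpha>(1)[of "(1 / real (Suc n)) *\<^sub>R t"] by linarith
    qed
    then show "AE t in gmeasure. cmod (\<alpha> ((1 / real (Suc n)) *\<^sub>R t)) \<le> C * (D * pweight M t)" for n
      by simp
  qed auto
  moreover have "(\<integral>t. \<alpha> 0 \<partial>(gmeasure :: (real^'n) measure)) = apply_dist T (\<lambda>y. \<psi> y * \<theta> y)"
    using gmeasure.prob_space[where 'a = "real^'n"] by (simp add: \<alpha>_def)
  ultimately have lim: "(\<lambda>n. ennreal (cmod (a n))) \<longlonglongrightarrow> ennreal (cmod (apply_dist T (\<lambda>y. \<psi> y * \<theta> y)))"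
    by (intro tendsto_ennrealI tendsto_norm) simp
  have "ennreal (cmod (a n)) \<le> ennreal (?k * ?k) * I" for n
  proof -
    let ?R = "real (Suc n)"
    let ?h = "\<lambda>\<eta>. ft \<psi> \<eta> * apply_dist T (\<lambda>y. cexp \<eta> y * \<theta> y)"
    have "a n = complex_of_real (?k * ?k) * (\<integral>\<eta>. ?h \<eta> \<partial>gdm (1 / ?R))"
      unfolding a_def \<alpha>_def by (rule dist_mollified[OF \<psi> \<theta>]) simp
    then have "cmod (a n) = (?k * ?k) * cmod (\<integral>\<eta>. ?h \<eta> \<partial>gdm (1 / ?R))"
      using gconst_pos by (simp only: norm_mult norm_of_real) simp
    then have "ennreal (cmod (a n)) = ennreal (?k * ?k) * ennreal (cmod (\<integral>\<eta>. ?h \<eta> \<partial>gdm (1 / ?R)))"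
      using gconst_pos by (simp only: ennreal_mult norm_ge_zero mult_nonneg_nonneg zero_le_power less_imp_le)
    also have "ennreal (cmod (\<integral>\<eta>. ?h \<eta> \<partial>gdm (1 / ?R))) \<le> (\<integral>\<^sup>+\<eta>. ennreal (cmod (?h \<eta>)) \<partial>gdm (1 / ?R))"
    \<comment> \<open>If the integrand is not integrable, its integral is 0 by convention and the
      bound is trivial.\<close>
    proof (cases "integrable (gdm (1 / ?R)) ?h")
      case True
      then show ?thesis by (rule integral_norm_bound_ennreal)
    qed (simp add: not_integrable_integral_eq)
    also have "\<dots> \<le> I"
    proof -
      have m: "?h \<in> borel_measurable borel"
      proof -
        obtain A where A: "\<And>\<eta> \<eta>'. cmod (ft \<psi> \<eta>) \<le> A \<and> cmod (ft \<psi> \<eta> - ft \<psi> \<eta>') \<le> A * norm (\<eta> - \<eta>')"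
          using ft_Lipschitz[OF \<psi>] by blast
        then have "continuous_on UNIV (ft \<psi>)" by (intro continuous_on_local_Lipschitz[where K = "\<lambda>_. A"]) (simp add: mult.commute)
        then have [measurable]: "ft \<psi> \<in> borel_measurable borel" by (rule borel_measurable_continuous_onI)
        obtain D M where fam2: "fam N (pweight N) (\<lambda>t. D * pweight M t) (\<lambda>\<eta> y. cexp \<eta> y * \<theta> y)"
          using fam_modulates[OF \<theta>] by blast
        have "continuous_on UNIV (\<lambda>\<eta>. apply_dist T (\<lambda>y. cexp \<eta> y * \<theta> y))"
          by (rule continuous_on_local_Lipschitz) (rule dist_fam(2)[OF T C fam2 schwartz_modulate[OF \<theta>]])
        then have [measurable]: "(\<lambda>\<eta>. apply_dist T (\<lambda>y. cexp \<eta> y * \<theta> y)) \<in> borel_measurable borel"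
          by (rule borel_measurable_continuous_onI)
        show ?thesis by measurable
      qed
      have "(\<integral>\<^sup>+\<eta>. ennreal (cmod (?h \<eta>)) \<partial>gdm (1 / ?R)) = (\<integral>\<^sup>+\<eta>. ennreal (gauss ((1 / ?R) *\<^sub>R \<eta>)) * ennreal (cmod (?h \<eta>)) \<partial>lborel)"
        unfolding gdm_def using m by (subst nn_integral_density) auto
      also have "\<dots> \<le> (\<integral>\<^sup>+\<eta>. 1 * ennreal (cmod (?h \<eta>)) \<partial>lborel)"
        by (intro nn_integral_mono mult_right_mono) (auto simp: gauss_le_1)
      finally show ?thesis by (simp add: I_def norm_mult)
    qed
    finally show ?thesis by (simp add: mult_left_mono)
  qed
  then show ?thesis
    unfolding I_def[symmetric] by (intro LIMSEQ_le_const2[OF lim]) auto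
qed

section \<open>The short-time Fourier transform\<close>

text \<open>If \<open>norm x\<close> is large then so is \<open>norm y\<close> or
  \<open>norm (y - x)\<close>. Hence the decay of the two factors becomes decay in the displacement
  \<open>x\<close>.\<close>

lemma sbound_mult_translate:
  assumes "sbound m (pweight (k + L)) B \<phi>" "sbound m (pweight L) G g"
  shows "sbound m (pweight k) (2 ^ m * B * G / pweight L x) (\<lambda>y. \<phi> y * g (y - x))"
proof -
  have "sbound m (\<lambda>y. pweight (k + L) y * pweight L (y - x)) (2 ^ m * B * G) (\<lambda>y. \<phi> y * g (y - x))"
    by (rule sbound_mult[OF _ _ assms(1) sbound_translate[OF assms(2)]]) auto
  moreover have "pweight L x * pweight k y \<le> pweight (k + L) y * pweight L (y - x)" for y
  proof -
    have "pweight L x \<le> pweight L y * pweight L (y - x)"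
      using pweight_diff[of L x y] pweight_minus[of L "y - x"] by simp
    then have "pweight k y * pweight L x \<le> pweight k y * (pweight L y * pweight L (y - x))"
      by (rule mult_left_mono) simp
    then show ?thesis by (simp add: pweight_add mult_ac)
  qed
  ultimately have "sbound m (\<lambda>y. pweight L x * pweight k y) (2 ^ m * B * G) (\<lambda>y. \<phi> y * g (y - x))"
    by (rule sbound_mono) simp
  moreover have "2 ^ m * B * G = pweight L x * (2 ^ m * B * G / pweight L x)"
    using pweight_pos[of L x] by simp
  ultimately have "sbound m (\<lambda>y. pweight L x * pweight k y) (pweight L x * (2 ^ m * B * G / pweight L x)) (\<lambda>y. \<phi> y * g (y - x))"
    by (simp only:)
  then show ?thesis by (simp only: sbound_rescale[OF pweight_pos[of L x]])
qed

text \<open>Localisation by the window gives the decay in \<open>x\<close>, smoothness the decay in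
  \<xi>. The window is not conjugated, because both versions occur: with \<open>cnj\<close> in the
  short-time Fourier transform and without it in the inversion.\<close>

lemma ft_window_decay:
  fixes g :: "real^'n::finite \<Rightarrow> complex"
  assumes g: "g \<in> schwartz"
  shows "\<exists>C N. 0 \<le> C \<and> (\<forall>\<psi>\<in>schwartz. \<forall>B x \<xi>. sbound N (pweight N) B \<psi> \<longrightarrow>
    cmod (ft (\<lambda>y. \<psi> y * g (y - x)) \<xi>) \<le> C * B / (pweight L x * pweight L \<xi>))"
proof -
  let ?d = "2 * CARD('n)"
  let ?N = "?d + L"
  obtain G where G: "0 < G" "sbound L (pweight L) G g" using schwartzE[OF g] by blast
  define C where "C = (1 + CARD('n)) ^ L * ipw TYPE('n) * (2 ^ L * G)"
  have "cmod (ft (\<lambda>y. \<psi> y * g (y - x)) \<xi>) \<le> C * B / (pweight L x * pweight L \<xi>)"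
    if \<psi>: "\<psi> \<in> schwartz" and B: "sbound ?N (pweight ?N) B \<psi>" for \<psi> B x \<xi>
  proof -
    have "sbound L (pweight (?d + L)) B \<psi>" by (rule sbound_le[OF B]) simp
    from ft_decay[OF schwartz_mult[OF \<psi> schwartz_translate[OF g]] sbound_mult_translate[OF this G(2), of x]]
    have "pweight L \<xi> * cmod (ft (\<lambda>y. \<psi> y * g (y - x)) \<xi>) \<le> C * B / pweight L x"
      by (simp add: C_def mult_ac)
    then show ?thesis
      using pweight_pos[of L x] pweight_pos[of L \<xi>] by (simp add: field_simps)
  qed
  moreover have "0 \<le> C" using G(1) ipw_nonneg[where 'n = 'n] by (simp add: C_def)
  ultimately show ?thesis by blast
qed

lemma stft_eq: "stft g f x \<xi> = apply_dist f (tfshift (x, - \<xi>) (\<lambda>y. cnj (g y)))"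
  by (simp add: stft_def tfshift_def cexp_def mult.commute)

lemma stft_dist_of:
  assumes \<psi>: "\<psi> \<in> schwartz" and g: "g \<in> schwartz"
  shows "stft g (dist_of \<psi>) x \<xi> = ft (\<lambda>y. \<psi> y * cnj (g (y - x))) \<xi>"
  unfolding stft_eq ft_def
  by (subst apply_dist_of[OF \<psi> schwartz_tfshift[OF schwartz_cnj[OF g]]]) (simp add: tfshift_def mult_ac)

lemma stft_dist_of_decay:
  fixes g :: "real^'n::finite \<Rightarrow> complex"
  assumes g: "g \<in> schwartz"
  shows "\<exists>C N. 0 \<le> C \<and> (\<forall>\<psi>\<in>schwartz. \<forall>B x \<xi>. sbound N (pweight N) B \<psi> \<longrightarrow>
    cmod (stft g (dist_of \<psi>) x \<xi>) \<le> C * B / (pweight L x * pweight L \<xi>))"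
  using ft_window_decay[OF schwartz_cnj[OF g], of L] by (simp add: stft_dist_of g)

text \<open>The values of the transform are those of \<open>f\<close> on a family of time-frequency
  shifts of one Schwartz function, so \<open>dist_fam\<close> applies; changing the sign of the
  frequency is an isometry.\<close>

lemma stft_bounds:
  fixes f :: "'n::finite tempered_distribution"
  assumes g: "g \<in> schwartz"
  obtains D M where "0 \<le> D" "\<And>z. cmod (stft g f (fst z) (snd z)) \<le> D * pweight M z"
    "\<And>z z'. norm (z - z') \<le> 1 \<Longrightarrow>
      cmod (stft g f (fst z) (snd z) - stft g f (fst z') (snd z')) \<le> norm (z - z') * (D * pweight M z)"
proof -
  obtain N C where C: "0 \<le> C" and T: "dist_bound N C (apply_dist f)" using dist_bound_apply_dist by blast
  obtain A M where A: "0 \<le> A" and fam: "fam N (pweight N) (\<lambda>u. A * pweight M u) (\<lambda>u. tfshift u (\<lambda>y. cnj (g y)))"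
    using fam_tfshift_schwartz[OF schwartz_cnj[OF g]] by blast
  have n: "norm (a, - b) = norm (a, b)" for a b :: "real^'n" by (simp add: norm_Pair)
  have "fam N (pweight N) (\<lambda>z. A * pweight M (fst z, - snd z)) (\<lambda>z. tfshift (fst z, - snd z) (\<lambda>y. cnj (g y)))"
  proof (rule fam_reparam[OF fam])
    show "norm ((fst z, - snd z) - (fst z', - snd z')) \<le> norm (z - z')" for z z' :: "(real^'n) \<times> (real^'n)"
      using n[of "fst z - fst z'" "snd z - snd z'"] by (cases z; cases z') (simp add: algebra_simps)
  qed simp
  moreover have "pweight M (fst z, - snd z) = pweight M z" for z :: "(real^'n) \<times> (real^'n)"
    by (simp add: pweight_def n)
  ultimately have fam': "fam N (pweight N) (\<lambda>z. A * pweight M z) (\<lambda>z. tfshift (fst z, - snd z) (\<lambda>y. cnj (g y)))"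
    by simp
  note * = dist_fam[OF T C fam' schwartz_tfshift[OF schwartz_cnj[OF g]], folded stft_eq]
  show thesis
    by (rule that[of "C * A" M]) (use * C A in \<open>auto simp: mult.assoc\<close>)
qed

lemma continuous_stft:
  assumes "g \<in> schwartz"
  shows "continuous_on UNIV (\<lambda>z. stft g f (fst z) (snd z))"
proof -
  obtain D M where "0 \<le> D" "\<And>z. cmod (stft g f (fst z) (snd z)) \<le> D * pweight M z"
    and *: "\<And>z z'. norm (z - z') \<le> 1 \<Longrightarrow>
      cmod (stft g f (fst z) (snd z) - stft g f (fst z') (snd z')) \<le> norm (z - z') * (D * pweight M z)"
    by (rule stft_bounds[OF assms, of f], rule that)
  show ?thesis
    by (rule continuous_on_local_Lipschitz[where K = "\<lambda>z. D * pweight M z"]) (rule *)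
qed

lemma borel_measurable_stft:
  assumes "g \<in> schwartz"
  shows "(\<lambda>z. stft g f (fst z) (snd z)) \<in> borel_measurable borel"
  using continuous_stft[OF assms] by (rule borel_measurable_continuous_onI)

section \<open>Recovering a distribution from its short-time Fourier transform\<close>

lemma integral_norm_square_pos:
  assumes g: "g \<in> schwartz" and "g \<noteq> (\<lambda>_. 0)"
  shows "0 < (\<integral>y. (cmod (g y))\<^sup>2 \<partial>lborel)"
proof -
  have i: "integrable lborel (\<lambda>y. (cmod (g y))\<^sup>2)"
    using integrable_norm[OF schwartz_integrable[OF schwartz_mult[OF g g]]] by (simp add: norm_mult power2_eq_square)
  have "(\<integral>y. (cmod (g y))\<^sup>2 \<partial>lborel) \<noteq> 0"
  proof
    assume "(\<integral>y. (cmod (g y))\<^sup>2 \<partial>lborel) = 0"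
    then have "AE y in lborel. (cmod (g y))\<^sup>2 = 0"
      by (subst (asm) integral_nonneg_eq_0_iff_AE[OF i]) auto
    then have "AE y in lborel. y \<notin> {y. g y \<noteq> 0}" by simp
    moreover have o: "open {y. g y \<noteq> 0}"
    proof -
      have "continuous_on UNIV g" using schwartz_isCont[OF g] by (simp add: continuous_at_imp_continuous_on)
      then have "open (g -` (- {0}))" by (intro open_vimage) auto
      then show ?thesis by (simp add: vimage_def)
    qed
    ultimately have "{y. g y \<noteq> 0} \<in> null_sets lborel"
      using AE_iff_null_sets[of "{y. g y \<noteq> 0}" lborel] by auto
    then have "negligible {y. g y \<noteq> 0}"
      by (simp add: negligible_iff_null_sets null_sets_completionI)
    then have "{y. g y \<noteq> 0} = {}" using open_not_negligible[OF o] by blast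
    then show False using assms(2) by auto
  qed
  moreover have "0 \<le> (\<integral>y. (cmod (g y))\<^sup>2 \<partial>lborel)" by simp
  ultimately show ?thesis by linarith
qed

text \<open>The envelope decays like any negative power of the weight, so this family can be
  integrated over Lebesgue measure and not only over Gaussian measures.\<close>

lemma fam_localised:
  fixes \<phi> h :: "real^'n::finite \<Rightarrow> complex"
  assumes \<phi>: "\<phi> \<in> schwartz" and h: "h \<in> schwartz"
  shows "\<exists>K. fam m (pweight m) (\<lambda>x. K * (1 / pweight L x)) (\<lambda>x y. \<phi> y * h (y - x))"
proof -
  obtain B where B: "0 < B" "sbound m (pweight (m + L)) B \<phi>" using schwartzE[OF \<phi>] by blast
  obtain G where G: "0 < G" "sbound (Suc m) (pweight L) G h" using schwartzE[OF h] by blast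
  define K1 where "K1 = 2 ^ m * B * G"
  define K2 where "K2 = 2 ^ m * B * (CARD('n) * 2 ^ L * G)"
  have K: "0 \<le> K1" "0 \<le> K2" using B G by (auto simp: K1_def K2_def)
  have "fam m (pweight m) (\<lambda>x. (K1 + K2) * (1 / pweight L x)) (\<lambda>x y. \<phi> y * h (y - x))"
    unfolding fam_def
  proof (intro conjI allI impI)
    show "sbound m (pweight m) ((K1 + K2) * (1 / pweight L x)) (\<lambda>y. \<phi> y * h (y - x))" for x
      using sbound_mult_translate[OF B(2) sbound_less[OF G(2)], of x]
      by (rule sbound_monoB) (use K pweight_pos[of L x] in \<open>auto simp: K1_def intro: divide_right_mono\<close>)
    fix x x' :: "real^'n" assume near: "norm (x - x') \<le> 1"
    have "sbound m (pweight L) (CARD('n) * norm (x' - x) * pweight L (x' - x) * G) (\<lambda>y. h (y - (x' - x)) - h y)"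
      by (rule sbound_translate_diff[OF G(2)])
    then have "sbound m (pweight L) (norm (x - x') * (CARD('n) * 2 ^ L * G)) (\<lambda>y. h (y - (x' - x)) - h y)"
    proof (rule sbound_monoB)
      have "pweight L (x' - x) \<le> 2 ^ L" using near by (intro pweight_le_1) (simp add: norm_minus_commute)
      then have "norm (x' - x) * G * CARD('n) * pweight L (x' - x) \<le> norm (x' - x) * G * CARD('n) * 2 ^ L"
        using G(1) by (intro mult_left_mono) auto
      then show "CARD('n) * norm (x' - x) * pweight L (x' - x) * G \<le> norm (x - x') * (CARD('n) * 2 ^ L * G)"
        by (simp add: norm_minus_commute mult_ac)
    qed
    from sbound_mult_translate[OF B(2) sbound_minus_commute[OF this], of x]
    have "sbound m (pweight m) (2 ^ m * B * (norm (x - x') * (CARD('n) * 2 ^ L * G)) / pweight L x)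
        (\<lambda>y. \<phi> y * (h (y - x) - h (y - x - (x' - x))))" .
    then have "sbound m (pweight m) (2 ^ m * B * (norm (x - x') * (CARD('n) * 2 ^ L * G)) / pweight L x)
        (\<lambda>y. \<phi> y * h (y - x) - \<phi> y * h (y - x'))"
      by (rule sbound_cong) (simp add: right_diff_distrib)
    moreover have "2 ^ m * B * (norm (x - x') * (CARD('n) * 2 ^ L * G)) / pweight L x = norm (x - x') * (K2 * (1 / pweight L x))"
      by (simp add: K2_def)
    ultimately have "sbound m (pweight m) (norm (x - x') * (K2 * (1 / pweight L x))) (\<lambda>y. \<phi> y * h (y - x) - \<phi> y * h (y - x'))"
      by (simp only:)
    then show "sbound m (pweight m) (norm (x - x') * ((K1 + K2) * (1 / pweight L x))) (\<lambda>y. \<phi> y * h (y - x) - \<phi> y * h (y - x'))"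
      by (rule sbound_monoB) (use K pweight_pos[of L x] in \<open>auto intro!: mult_left_mono divide_right_mono\<close>)
  qed
  then show ?thesis by blast
qed

lemma nn_integral_stft_measurable:
  fixes f :: "'n::finite tempered_distribution"
  assumes "g \<in> schwartz"
  shows "(\<lambda>x. \<integral>\<^sup>+\<xi>. ennreal (cmod (stft g f x \<xi>) / (pweight L x * pweight L \<xi>)) \<partial>lborel) \<in> borel_measurable lborel"
proof -
  have "(\<lambda>(x, \<xi>). stft g f x \<xi>) \<in> borel_measurable (lborel \<Otimes>\<^sub>M lborel)"
    using borel_measurable_stft[OF assms, of f] by (simp add: lborel_prod split_beta')
  then have [measurable]: "(\<lambda>z. stft g f (fst z) (snd z)) \<in> borel_measurable (lborel \<Otimes>\<^sub>M lborel)"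
    by (simp add: split_beta')
  show ?thesis
    by (rule lborel.borel_measurable_nn_integral) (simp add: split_beta')
qed

text \<open>The inversion formula of the short-time Fourier transform, read as an estimate:
  \<open>\<phi>\<close> is the average of its localisations by the squared modulus of the window,
  and each localised piece is estimated by \<open>apply_dist_product_le\<close>.\<close>

theorem dist_le_stft:
  fixes g :: "real^'n::finite \<Rightarrow> complex"
  assumes g: "g \<in> schwartz" "g \<noteq> (\<lambda>_. 0)"
  shows "\<exists>C N. 0 \<le> C \<and> (\<forall>f. \<forall>\<phi>\<in>schwartz. \<forall>B. sbound N (pweight N) B \<phi> \<longrightarrow>
    ennreal (cmod (apply_dist f \<phi>)) \<le> ennreal (C * B) *
      (\<integral>\<^sup>+x. \<integral>\<^sup>+\<xi>. ennreal (cmod (stft g f x \<xi>) / (pweight L x * pweight L \<xi>)) \<partial>lborel \<partial>lborel))"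
proof -
  define c2 where "c2 = (\<integral>y. (cmod (g y))\<^sup>2 \<partial>lborel)"
  have c2: "0 < c2" unfolding c2_def by (rule integral_norm_square_pos[OF g])
  \<comment> \<open>The squared modulus of the window, written as a product so that it can later be
    split between test function and distribution.\<close>
  define h where "h = (\<lambda>y. g y * cnj (g y))"
  have h: "h \<in> schwartz" unfolding h_def by (intro schwartz_mult schwartz_cnj g)
  let ?\<kappa> = "gconst ^ CARD('n) * gconst ^ CARD('n)"
  have \<kappa>: "0 \<le> ?\<kappa>" using gconst_pos by simp
  obtain C N where C: "0 \<le> C" and decay: "\<And>\<psi> B x \<xi>. \<psi> \<in> schwartz \<Longrightarrow> sbound N (pweight N) B \<psi> \<Longrightarrow>
    cmod (ft (\<lambda>y. \<psi> y * g (y - x)) \<xi>) \<le> C * B / (pweight L x * pweight L \<xi>)"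
    using ft_window_decay[OF g(1), of L] by blast
  have "ennreal (cmod (apply_dist f \<phi>)) \<le> ennreal ((1 / c2 * ?\<kappa> * C) * B) *
      (\<integral>\<^sup>+x. \<integral>\<^sup>+\<xi>. ennreal (cmod (stft g f x \<xi>) / (pweight L x * pweight L \<xi>)) \<partial>lborel \<partial>lborel)"
    if \<phi>: "\<phi> \<in> schwartz" and B: "sbound N (pweight N) B \<phi>" for f \<phi> B
  proof -
    have B0: "0 \<le> B" using sbound_nonneg[OF B] by simp
    define F where "F = (\<lambda>x y. \<phi> y * h (y - x))"
    have Fs: "F x \<in> schwartz" for x unfolding F_def by (intro schwartz_mult schwartz_translate \<phi> h)
    have fam: "\<exists>\<beta>. integrable lborel \<beta> \<and> fam m (pweight m) \<beta> F" for m
    proof -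
      obtain K where "fam m (pweight m) (\<lambda>x. K * (1 / pweight (2 * DIM(real^'n)) x)) F"
        unfolding F_def using fam_localised[OF \<phi> h] by blast
      moreover have "integrable lborel (\<lambda>x::real^'n. K * (1 / pweight (2 * DIM(real^'n)) x))"
        by (intro integrable_mult_right integrable_inverse_pweight)
      ultimately show ?thesis by (intro exI conjI)
    qed
    have "(\<integral>x. F x y \<partial>lborel) = complex_of_real c2 * \<phi> y" for y
    proof -
      have "(\<integral>x. h (y - x) \<partial>lborel) = (\<integral>x. h x \<partial>lborel)"
        using integral_lborel_affine[OF schwartz_measurable[OF h], of "-1" y] by simp
      also have "\<dots> = complex_of_real c2"
        unfolding c2_def h_def integral_complex_of_real[symmetric]
        by (simp only: complex_norm_square)
      finally show ?thesis by (simp add: F_def)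
    qed
    then have "complex_of_real c2 * apply_dist f \<phi> = apply_dist f (\<lambda>y. \<integral>x. F x y \<partial>lborel)"
      by (simp add: apply_dist_cmult[OF \<phi>])
    also have "\<dots> = (\<integral>x. apply_dist f (F x) \<partial>lborel)"
      by (rule apply_dist_integral) (use fam Fs emeasure_lborel_cball_finite in \<open>auto simp: less_top\<close>)
    finally have eq: "complex_of_real c2 * apply_dist f \<phi> = (\<integral>x. apply_dist f (F x) \<partial>lborel)" .
    have "ennreal (cmod (complex_of_real c2 * apply_dist f \<phi>)) \<le> (\<integral>\<^sup>+x. ennreal (cmod (apply_dist f (F x))) \<partial>lborel)"
      unfolding eq by (cases "integrable lborel (\<lambda>x. apply_dist f (F x))")
        (auto intro: integral_norm_bound_ennreal simp: not_integrable_integral_eq)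
    also have "\<dots> \<le> (\<integral>\<^sup>+x. ennreal (?\<kappa> * (C * B)) *
        (\<integral>\<^sup>+\<xi>. ennreal (cmod (stft g f x \<xi>) / (pweight L x * pweight L \<xi>)) \<partial>lborel) \<partial>lborel)"
    proof (rule nn_integral_mono)
      fix x :: "real^'n"
      \<comment> \<open>One window factor joins the test function, where it gives decay; its
        conjugate stays with the distribution.\<close>
      let ?\<psi> = "\<lambda>y. \<phi> y * g (y - x)"
      let ?\<theta> = "\<lambda>y. cnj (g (y - x))"
      have [measurable]: "(\<lambda>\<xi>. stft g f x \<xi>) \<in> borel_measurable borel"
      proof -
        have "(\<lambda>\<xi>. (\<lambda>z. stft g f (fst z) (snd z)) (x, \<xi>)) \<in> borel_measurable borel"
          by (rule measurable_compose[OF _ borel_measurable_stft[OF g(1)]]) (simp add: borel_prod[symmetric])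
        then show ?thesis by simp
      qed
      have "ennreal (cmod (apply_dist f (F x))) \<le> ennreal ?\<kappa> *
          (\<integral>\<^sup>+\<eta>. ennreal (cmod (ft ?\<psi> \<eta>) * cmod (apply_dist f (\<lambda>y. cexp \<eta> y * ?\<theta> y))) \<partial>lborel)"
        using apply_dist_product_le[OF schwartz_mult[OF \<phi> schwartz_translate[OF g(1)]] schwartz_translate[OF schwartz_cnj[OF g(1)]], of f x x]
        by (simp add: F_def h_def mult.assoc)
      also have "(\<integral>\<^sup>+\<eta>. ennreal (cmod (ft ?\<psi> \<eta>) * cmod (apply_dist f (\<lambda>y. cexp \<eta> y * ?\<theta> y))) \<partial>lborel) \<le>
          (\<integral>\<^sup>+\<eta>. ennreal (C * B) * ennreal (cmod (stft g f x (- \<eta>)) / (pweight L x * pweight L \<eta>)) \<partial>lborel)"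
      proof (rule nn_integral_mono)
        fix \<eta>
        \<comment> \<open>The modulated conjugate window is the function that defines the short-time
          Fourier transform at \<open>- \<eta>\<close>; a reflection removes the sign
          afterwards.\<close>
        have "apply_dist f (\<lambda>y. cexp \<eta> y * ?\<theta> y) = stft g f x (- \<eta>)"
          by (simp add: stft_eq tfshift_def)
        then have "cmod (ft ?\<psi> \<eta>) * cmod (apply_dist f (\<lambda>y. cexp \<eta> y * ?\<theta> y)) \<le>
            C * B / (pweight L x * pweight L \<eta>) * cmod (stft g f x (- \<eta>))"
          using mult_right_mono[OF decay[OF \<phi> B, of x \<eta>], of "cmod (stft g f x (- \<eta>))"] by (simp only: norm_ge_zero simp_thms)
        then show "ennreal (cmod (ft ?\<psi> \<eta>) * cmod (apply_dist f (\<lambda>y. cexp \<eta> y * ?\<theta> y))) \<le>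
            ennreal (C * B) * ennreal (cmod (stft g f x (- \<eta>)) / (pweight L x * pweight L \<eta>))"
          using C B0 by (subst ennreal_mult[symmetric]) (auto intro!: ennreal_leI)
      qed
      also have "\<dots> = ennreal (C * B) * (\<integral>\<^sup>+\<eta>. ennreal (cmod (stft g f x (- \<eta>)) / (pweight L x * pweight L \<eta>)) \<partial>lborel)"
        by (rule nn_integral_cmult) measurable
      also have "(\<integral>\<^sup>+\<eta>. ennreal (cmod (stft g f x (- \<eta>)) / (pweight L x * pweight L \<eta>)) \<partial>lborel) =
          (\<integral>\<^sup>+\<xi>. ennreal (cmod (stft g f x \<xi>) / (pweight L x * pweight L \<xi>)) \<partial>lborel)"
        using nn_integral_lborel_affine[of "\<lambda>\<xi>. ennreal (cmod (stft g f x \<xi>) / (pweight L x * pweight L \<xi>))" "-1" 0] by simp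
      finally have *: "ennreal (cmod (apply_dist f (F x))) \<le> ennreal ?\<kappa> * (ennreal (C * B) *
          (\<integral>\<^sup>+\<xi>. ennreal (cmod (stft g f x \<xi>) / (pweight L x * pweight L \<xi>)) \<partial>lborel))"
        by (simp add: mult_left_mono)
      have "ennreal (?\<kappa> * (C * B)) = ennreal ?\<kappa> * ennreal (C * B)"
        using \<kappa> C B0 by (intro ennreal_mult) auto
      with * show "ennreal (cmod (apply_dist f (F x))) \<le> ennreal (?\<kappa> * (C * B)) *
          (\<integral>\<^sup>+\<xi>. ennreal (cmod (stft g f x \<xi>) / (pweight L x * pweight L \<xi>)) \<partial>lborel)"
        by (simp only: mult.assoc)
    qed
    also have "\<dots> = ennreal (?\<kappa> * (C * B)) *
        (\<integral>\<^sup>+x. \<integral>\<^sup>+\<xi>. ennreal (cmod (stft g f x \<xi>) / (pweight L x * pweight L \<xi>)) \<partial>lborel \<partial>lborel)" (is "_ = _ * ?I")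
      by (rule nn_integral_cmult[OF nn_integral_stft_measurable[OF g(1)]])
    finally have "ennreal (1 / c2) * ennreal (cmod (complex_of_real c2 * apply_dist f \<phi>)) \<le> ennreal (1 / c2) * (ennreal (?\<kappa> * (C * B)) * ?I)"
      by (rule mult_left_mono) simp
    also have "\<dots> = ennreal ((1 / c2 * ?\<kappa> * C) * B) * ?I"
      using c2 \<kappa> C B0 by (simp add: ennreal_mult[symmetric] mult.assoc[symmetric])
    finally show ?thesis using c2 by (simp add: ennreal_mult[symmetric] norm_mult)
  qed
  moreover have "0 \<le> 1 / c2 * ?\<kappa> * C" using c2 \<kappa> C by simp
  ultimately show ?thesis by blast
qed

section \<open>Spaces defined by the short-time Fourier transform\<close>

lemma stft_add: "stft g (S + T) x \<xi> = stft g S x \<xi> + stft g T x \<xi>"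
  by (simp add: stft_def plus_tempered_distribution.rep_eq)

lemma stft_diff: "stft g (S - T) x \<xi> = stft g S x \<xi> - stft g T x \<xi>"
  by (simp add: stft_def minus_tempered_distribution.rep_eq)

lemma stft_scale: "stft g (scale_dist c T) x \<xi> = c * stft g T x \<xi>"
  by (simp add: stft_def scale_dist.rep_eq)

lemma stft_0: "stft g 0 x \<xi> = 0"
  by (simp add: stft_def zero_tempered_distribution.rep_eq)

text \<open>The decay rate of the short-time Fourier transform of Schwartz functions. The same
  weight expresses that these functions lie in the space (\<open>rho_bweight\<close>) and that its
  elements act on them (\<open>rho_pairing\<close>).\<close>

definition bweight :: "nat \<Rightarrow> (real^'n::finite) \<times> (real^'n) \<Rightarrow> real" where
  "bweight L z = 1 / (pweight L (fst z) * pweight L (snd z))"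

lemma bweight_pos: "0 < bweight L z" by (simp add: bweight_def pweight_pos)
lemma bweight_nonneg [simp]: "0 \<le> bweight L z" using bweight_pos less_imp_le by blast

lemma borel_measurable_fst_pair[measurable]: "fst \<in> borel_measurable (borel :: ('a::second_countable_topology \<times> 'b::second_countable_topology) measure)"
  by (intro borel_measurable_continuous_onI continuous_intros)

lemma borel_measurable_snd_pair[measurable]: "snd \<in> borel_measurable (borel :: ('a::second_countable_topology \<times> 'b::second_countable_topology) measure)"
  by (intro borel_measurable_continuous_onI continuous_intros)

lemma borel_measurable_bweight[measurable]: "bweight L \<in> borel_measurable borel"
  unfolding bweight_def by measurable

text \<open>
  The properties of the weighted mixed \<open>L\<close>-norms, as functionals of the modulus of the
  short-time Fourier transform, on which the approximation argument rests.
\<close>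

locale bf_norm =
  fixes \<rho> :: "((real^'n::finite) \<times> (real^'n) \<Rightarrow> ennreal) \<Rightarrow> ennreal"
    and S L :: nat and C\<rho> :: real
  assumes rho_mono: "F \<in> borel_measurable borel \<Longrightarrow> G \<in> borel_measurable borel \<Longrightarrow>
      (\<And>z. F z \<le> G z) \<Longrightarrow> \<rho> F \<le> \<rho> G"
    and rho_cmult: "F \<in> borel_measurable borel \<Longrightarrow> 0 \<le> c \<Longrightarrow> \<rho> (\<lambda>z. ennreal c * F z) = ennreal c * \<rho> F"
    and rho_add: "F \<in> borel_measurable borel \<Longrightarrow> G \<in> borel_measurable borel \<Longrightarrow>
      \<rho> (\<lambda>z. F z + G z) \<le> \<rho> F + \<rho> G"
    and rho_Fatou: "(\<And>n. Fs n \<in> borel_measurable borel) \<Longrightarrow>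
      \<rho> (\<lambda>z. liminf (\<lambda>n. Fs n z)) \<le> liminf (\<lambda>n. \<rho> (Fs n))"
    and rho_dominated: "(\<And>n. Fs n \<in> borel_measurable borel) \<Longrightarrow> G \<in> borel_measurable borel \<Longrightarrow>
      (\<And>n z. Fs n z \<le> G z) \<Longrightarrow> \<rho> G < \<infinity> \<Longrightarrow> (\<And>z. (\<lambda>n. Fs n z) \<longlonglongrightarrow> 0) \<Longrightarrow> (\<lambda>n. \<rho> (Fs n)) \<longlonglongrightarrow> 0"
    and rho_shift: "F \<in> borel_measurable borel \<Longrightarrow> \<rho> (\<lambda>z. F (z - u)) \<le> ennreal (pweight S u) * \<rho> F"
    and rho_bweight: "\<rho> (\<lambda>z. ennreal (bweight L z)) < \<infinity>"
    and C\<rho>: "0 \<le> C\<rho>"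
    and rho_pairing: "F \<in> borel_measurable borel \<Longrightarrow>
      (\<integral>\<^sup>+x. \<integral>\<^sup>+\<xi>. F (x, \<xi>) * ennreal (bweight L (x, \<xi>)) \<partial>lborel \<partial>lborel) \<le> ennreal C\<rho> * \<rho> F"
begin

section \<open>Consequences of the norm axioms\<close>

lemma rho_0: "\<rho> (\<lambda>z. 0) = 0"
  using rho_cmult[of "\<lambda>z. 0" 0] by simp

lemma rho_sum_le:
  assumes "finite J" "\<And>u. u \<in> J \<Longrightarrow> a u \<in> borel_measurable borel" "\<And>u. 0 \<le> c u"
  shows "\<rho> (\<lambda>z. ennreal (cmod (\<Sum>u\<in>J. complex_of_real (c u) * a u z))) \<le>
    (\<Sum>u\<in>J. ennreal (c u) * \<rho> (\<lambda>z. ennreal (cmod (a u z))))"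
  using assms(1,2)
proof (induction J rule: finite_induct)
  case empty
  then show ?case by (simp add: rho_0)
next
  case (insert u J)
  have m[measurable]: "a v \<in> borel_measurable borel" if "v \<in> insert u J" for v using insert.prems that by blast
  have [measurable]: "a u \<in> borel_measurable borel" by (rule m) simp
  have mJ: "(\<lambda>z. \<Sum>u\<in>J. complex_of_real (c u) * a u z) \<in> borel_measurable borel"
    using m by (intro borel_measurable_sum borel_measurable_times) auto
  have "\<rho> (\<lambda>z. ennreal (cmod (\<Sum>u\<in>insert u J. complex_of_real (c u) * a u z))) \<le>
      \<rho> (\<lambda>z. ennreal (c u) * ennreal (cmod (a u z)) + ennreal (cmod (\<Sum>u\<in>J. complex_of_real (c u) * a u z)))"
  proof (rule rho_mono)
    fix z
    have "cmod (\<Sum>u\<in>insert u J. complex_of_real (c u) * a u z) \<le> c u * cmod (a u z) + cmod (\<Sum>u\<in>J. complex_of_real (c u) * a u z)"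
      using insert.hyps norm_triangle_ineq[of "complex_of_real (c u) * a u z" "\<Sum>u\<in>J. complex_of_real (c u) * a u z"] assms(3)[of u]
      by (simp add: norm_mult)
    then show "ennreal (cmod (\<Sum>u\<in>insert u J. complex_of_real (c u) * a u z)) \<le>
        ennreal (c u) * ennreal (cmod (a u z)) + ennreal (cmod (\<Sum>u\<in>J. complex_of_real (c u) * a u z))"
      using assms(3)[of u] by (simp add: ennreal_mult[symmetric] ennreal_plus[symmetric] ennreal_leI del: ennreal_plus)
  qed (use mJ insert.hyps in \<open>auto intro!: borel_measurable_sum borel_measurable_times m\<close>)
  also have "\<dots> \<le> \<rho> (\<lambda>z. ennreal (c u) * ennreal (cmod (a u z))) + \<rho> (\<lambda>z. ennreal (cmod (\<Sum>u\<in>J. complex_of_real (c u) * a u z)))"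
    using mJ by (intro rho_add) auto
  also have "\<rho> (\<lambda>z. ennreal (c u) * ennreal (cmod (a u z))) = ennreal (c u) * \<rho> (\<lambda>z. ennreal (cmod (a u z)))"
    using assms(3) by (intro rho_cmult) auto
  also have "\<rho> (\<lambda>z. ennreal (cmod (\<Sum>u\<in>J. complex_of_real (c u) * a u z))) \<le> (\<Sum>u\<in>J. ennreal (c u) * \<rho> (\<lambda>z. ennreal (cmod (a u z))))"
    using insert.prems by (intro insert.IH) auto
  finally show ?case using insert.hyps by (simp add: add_left_mono)
qed

text \<open>Fatou's lemma for norm bounds: pointwise convergence of the functions is enough, without
  any convergence in norm.\<close>

lemma rho_limit_le:
  assumes "\<And>n. a n \<in> borel_measurable borel" "\<And>z. (\<lambda>n. a n z) \<longlonglongrightarrow> (b z :: complex)"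
    and "\<And>n. \<rho> (\<lambda>z. ennreal (cmod (a n z))) \<le> ennreal (m n)" "m \<longlonglongrightarrow> l"
  shows "\<rho> (\<lambda>z. ennreal (cmod (b z))) \<le> ennreal l"
proof -
  have "(\<lambda>n. ennreal (cmod (a n z))) \<longlonglongrightarrow> ennreal (cmod (b z))" for z
    by (intro tendsto_ennrealI tendsto_norm assms(2))
  then have "ennreal (cmod (b z)) = liminf (\<lambda>n. ennreal (cmod (a n z)))" for z
    by (metis lim_imp_Liminf trivial_limit_sequentially)
  then have "\<rho> (\<lambda>z. ennreal (cmod (b z))) = \<rho> (\<lambda>z. liminf (\<lambda>n. ennreal (cmod (a n z))))" by simp
  also have "\<dots> \<le> liminf (\<lambda>n. \<rho> (\<lambda>z. ennreal (cmod (a n z))))"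
    using assms(1) by (intro rho_Fatou) auto
  also have "\<dots> \<le> liminf (\<lambda>n. ennreal (m n))"
    by (intro Liminf_mono always_eventually allI assms(3))
  also have "\<dots> = ennreal l"
    using assms(4) by (intro lim_imp_Liminf tendsto_ennrealI) auto
  finally show ?thesis .
qed

end

locale bf_window = bf_norm \<rho> S L C\<rho>
  for \<rho> :: "((real^'n::finite) \<times> (real^'n) \<Rightarrow> ennreal) \<Rightarrow> ennreal" and S L C\<rho> +
  fixes g :: "real^'n \<Rightarrow> complex"
  assumes g: "g \<in> schwartz" and g_nz: "g \<noteq> (\<lambda>_. 0)"
begin

definition V :: "'n tempered_distribution \<Rightarrow> (real^'n) \<times> (real^'n) \<Rightarrow> complex" where
  "V f z = stft g f (fst z) (snd z)"

text \<open>Extended values allow estimates to be proved before finiteness is known;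
  \<open>N\<close> is the real form, meaningful on \<open>X\<close>.\<close>

definition nm :: "'n tempered_distribution \<Rightarrow> ennreal" where
  "nm f = \<rho> (\<lambda>z. ennreal (cmod (V f z)))"

definition X :: "'n tempered_distribution set" where "X = {f. nm f < \<infinity>}"

definition N :: "'n tempered_distribution \<Rightarrow> real" where "N f = enn2real (nm f)"

lemma V_measurable[measurable]: "V f \<in> borel_measurable borel"
  unfolding V_def using borel_measurable_stft[OF g, of f] by simp

lemma V_add: "V (f + h) z = V f z + V h z" by (simp add: V_def stft_add)
lemma V_diff: "V (f - h) z = V f z - V h z" by (simp add: V_def stft_diff)
lemma V_scale: "V (scale_dist c f) z = c * V f z" by (simp add: V_def stft_scale)
lemma V_0: "V 0 z = 0" by (simp add: V_def stft_0)

lemma V_eq: "V f z = apply_dist f (tfshift (fst z, - snd z) (\<lambda>y. cnj (g y)))"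
  by (simp add: V_def stft_eq)

lemma N_nonneg [simp]: "0 \<le> N f" by (simp add: N_def)

lemma nm_eq: "f \<in> X \<Longrightarrow> nm f = ennreal (N f)" by (simp add: X_def N_def)

text \<open>One extended inequality yields membership together with the real bound.\<close>

lemma N_le: "nm f \<le> ennreal c \<Longrightarrow> 0 \<le> c \<Longrightarrow> f \<in> X \<and> N f \<le> c"
  unfolding X_def N_def using enn2real_leI by (auto intro: le_less_trans)

lemma nm_add: "nm (f + h) \<le> nm f + nm h"
proof -
  have "nm (f + h) \<le> \<rho> (\<lambda>z. ennreal (cmod (V f z)) + ennreal (cmod (V h z)))"
    unfolding nm_def
    by (rule rho_mono) (auto simp: V_add ennreal_plus[symmetric] norm_triangle_ineq ennreal_leI simp del: ennreal_plus)
  also have "\<dots> \<le> nm f + nm h" unfolding nm_def by (rule rho_add) auto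
  finally show ?thesis .
qed

lemma nm_scale: "nm (scale_dist c f) = ennreal (cmod c) * nm f"
  unfolding nm_def by (subst rho_cmult[symmetric]) (auto simp: V_scale norm_mult ennreal_mult)

lemma X_0: "0 \<in> X" by (simp add: X_def nm_def V_0 rho_0)

lemma X_add: "f \<in> X \<Longrightarrow> h \<in> X \<Longrightarrow> f + h \<in> X"
  unfolding X_def using nm_add[of f h] by (auto intro: le_less_trans)

lemma X_scale: "f \<in> X \<Longrightarrow> scale_dist c f \<in> X"
  unfolding X_def by (auto simp: nm_scale ennreal_mult_less_top)

lemma X_uminus: "f \<in> X \<Longrightarrow> - f \<in> X"
  using X_scale[of f "-1"] by (simp add: dist.scale_minus_left)

lemma X_diff: "f \<in> X \<Longrightarrow> h \<in> X \<Longrightarrow> f - h \<in> X"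
  using X_add[OF _ X_uminus, of f h] by simp

lemma N_add: "f \<in> X \<Longrightarrow> h \<in> X \<Longrightarrow> N (f + h) \<le> N f + N h"
  using nm_add[of f h] by (simp add: nm_eq X_add flip: ennreal_plus)

lemma N_scale: "N (scale_dist c f) = cmod c * N f"
  by (simp add: N_def nm_scale enn2real_mult)

text \<open>\<open>dist_le_stft\<close> bounds the value by a weighted integral of the short-time
  Fourier transform, and \<open>rho_pairing\<close> bounds that integral by the norm. Thus the space
  embeds continuously into the tempered distributions, with one order for all its elements.\<close>

theorem dist_le_norm:
  obtains A M where "0 \<le> A" "\<And>f \<phi> B. f \<in> X \<Longrightarrow> \<phi> \<in> schwartz \<Longrightarrow> sbound M (pweight M) B \<phi> \<Longrightarrow>
    cmod (apply_dist f \<phi>) \<le> A * B * N f"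
proof -
  obtain C M where C: "0 \<le> C" and key: "\<And>f \<phi> B. \<phi> \<in> schwartz \<Longrightarrow> sbound M (pweight M) B \<phi> \<Longrightarrow>
    ennreal (cmod (apply_dist f \<phi>)) \<le> ennreal (C * B) *
      (\<integral>\<^sup>+x. \<integral>\<^sup>+\<xi>. ennreal (cmod (stft g f x \<xi>) / (pweight L x * pweight L \<xi>)) \<partial>lborel \<partial>lborel)"
    using dist_le_stft[OF g g_nz, of L] by blast
  have "cmod (apply_dist f \<phi>) \<le> (C * C\<rho>) * B * N f" if f: "f \<in> X" and \<phi>: "\<phi> \<in> schwartz" and B: "sbound M (pweight M) B \<phi>" for f \<phi> B
  proof -
    have B0: "0 \<le> B" using sbound_nonneg[OF B] by simp
    have "(\<integral>\<^sup>+x. \<integral>\<^sup>+\<xi>. ennreal (cmod (stft g f x \<xi>) / (pweight L x * pweight L \<xi>)) \<partial>lborel \<partial>lborel) =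
        (\<integral>\<^sup>+x. \<integral>\<^sup>+\<xi>. ennreal (cmod (V f (x, \<xi>))) * ennreal (bweight L (x, \<xi>)) \<partial>lborel \<partial>lborel)"
      by (simp add: V_def bweight_def ennreal_mult[symmetric])
    also have "\<dots> \<le> ennreal C\<rho> * nm f" unfolding nm_def by (rule rho_pairing) measurable
    finally have "ennreal (C * B) * (\<integral>\<^sup>+x. \<integral>\<^sup>+\<xi>. ennreal (cmod (stft g f x \<xi>) / (pweight L x * pweight L \<xi>)) \<partial>lborel \<partial>lborel)
        \<le> ennreal (C * B) * (ennreal C\<rho> * ennreal (N f))"
      unfolding nm_eq[OF f] by (rule mult_left_mono) simp
    with key[OF \<phi> B, of f] have "ennreal (cmod (apply_dist f \<phi>)) \<le> ennreal (C * B) * (ennreal C\<rho> * ennreal (N f))"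
      by (rule order_trans)
    also have "\<dots> = ennreal ((C * C\<rho>) * B * N f)"
      using C B0 C\<rho> by (simp add: ennreal_mult[symmetric] mult_ac)
    finally show ?thesis using C B0 C\<rho> by (simp add: mult_nonneg_nonneg)
  qed
  then show thesis using that[of "C * C\<rho>" M] C C\<rho> by simp
qed

lemma N_eq_0_iff: "f \<in> X \<Longrightarrow> N f = 0 \<longleftrightarrow> f = 0"
proof
  assume f: "f \<in> X" and "N f = 0"
  obtain A M where A: "0 \<le> A" and key: "\<And>f \<phi> B. f \<in> X \<Longrightarrow> \<phi> \<in> schwartz \<Longrightarrow> sbound M (pweight M) B \<phi> \<Longrightarrow>
    cmod (apply_dist f \<phi>) \<le> A * B * N f"
    by (rule dist_le_norm, rule that)
  have "apply_dist f \<phi> = 0" if \<phi>: "\<phi> \<in> schwartz" for \<phi>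
  proof -
    obtain B where "sbound M (pweight M) B \<phi>" using \<phi> schwartz_iff by blast
    from key[OF f \<phi> this] show ?thesis using \<open>N f = 0\<close> by simp
  qed
  then show "f = 0" by (intro apply_dist_eqI) (simp add: zero_tempered_distribution.rep_eq)
qed (simp add: N_def nm_def V_0 rho_0)

lemma normed_space: "normed_space_on scale_dist X N"
proof unfold_locales
  show "dist.subspace X" unfolding dist.subspace_def using X_0 X_add X_scale by blast
qed (auto simp: N_eq_0_iff N_add N_scale)

sublocale ns: normed_space_on scale_dist X N
  by (rule normed_space)

lemma N_diff_commute: "N (f - h) = N (h - f)"
  using N_scale[of "-1" "f - h"] by (simp add: dist.scale_minus_left)

text \<open>Closed balls are closed under pointwise convergence of the short-time Fourier transform,
  by Fatou.\<close>

lemma N_le_limit: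
  assumes "\<And>n. f n \<in> X" "\<And>z. (\<lambda>n. V (f n) z) \<longlonglongrightarrow> V h z" "\<And>n. N (f n) \<le> c" "0 \<le> c"
  shows "h \<in> X \<and> N h \<le> c"
proof (rule N_le)
  show "nm h \<le> ennreal c"
    unfolding nm_def
  proof (rule rho_limit_le[where a = "\<lambda>n. V (f n)" and m = "\<lambda>_. c"])
    show "\<rho> (\<lambda>z. ennreal (cmod (V (f n) z))) \<le> ennreal c" for n
      using nm_eq[OF assms(1)[of n]] assms(3)[of n] by (simp add: nm_def ennreal_leI)
  qed (use assms in auto)
qed (rule assms)

text \<open>By \<open>dist_le_norm\<close> a Cauchy sequence converges on every test function. The
  limit is a distribution because the bounds are uniform, and Fatou turns the Cauchy condition into
  convergence in norm.\<close>

lemma mcomplete: "ns.mcomplete"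
  unfolding ns.mcomplete_def
proof (intro allI impI)
  fix \<sigma> assume "ns.MCauchy \<sigma>"
  then have \<sigma>: "\<sigma> n \<in> X" and C: "\<And>\<epsilon>. 0 < \<epsilon> \<Longrightarrow> \<exists>n0. \<forall>n m. n0 \<le> n \<longrightarrow> n0 \<le> m \<longrightarrow> N (\<sigma> n - \<sigma> m) < \<epsilon>" for n
    unfolding ns.MCauchy_def norm_dist_def by (auto simp: range_subsetD)
  obtain A M where A: "0 \<le> A" and key: "\<And>f \<phi> B. f \<in> X \<Longrightarrow> \<phi> \<in> schwartz \<Longrightarrow> sbound M (pweight M) B \<phi> \<Longrightarrow>
    cmod (apply_dist f \<phi>) \<le> A * B * N f"
    by (rule dist_le_norm, rule that)
  \<comment> \<open>From here on the norms are bounded; this uniform bound makes the limit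
    functional continuous.\<close>
  obtain n1 where n1: "\<And>n. n1 \<le> n \<Longrightarrow> N (\<sigma> n - \<sigma> n1) < 1" using C[of 1] by auto
  define K where "K = N (\<sigma> n1) + 1"
  have K: "N (\<sigma> n) \<le> K" if "n1 \<le> n" for n
    using N_add[OF X_diff[OF \<sigma> \<sigma>] \<sigma>, of n n1 n1] n1[OF that] by (simp add: K_def)
  have conv: "convergent (\<lambda>n. apply_dist (\<sigma> n) \<phi>)" if \<phi>: "\<phi> \<in> schwartz" for \<phi>
  proof -
    obtain B where B: "0 < B" "sbound M (pweight M) B \<phi>" using schwartzE[OF \<phi>] by blast
    have "Cauchy (\<lambda>n. apply_dist (\<sigma> n) \<phi>)"
    proof (rule CauchyI)
      fix e :: real assume e: "0 < e"
      have pos: "0 < A * B + 1" using A B by (simp add: add_nonneg_pos)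
      obtain n0 where n0: "\<forall>n m. n0 \<le> n \<longrightarrow> n0 \<le> m \<longrightarrow> N (\<sigma> n - \<sigma> m) < e / (A * B + 1)"
        using C[of "e / (A * B + 1)"] e pos by auto
      have "norm (apply_dist (\<sigma> m) \<phi> - apply_dist (\<sigma> n) \<phi>) < e" if "n0 \<le> m" "n0 \<le> n" for m n
      proof -
        have "cmod (apply_dist (\<sigma> m - \<sigma> n) \<phi>) \<le> A * B * N (\<sigma> m - \<sigma> n)"
          by (rule key[OF X_diff[OF \<sigma> \<sigma>] \<phi> B(2)])
        also have "\<dots> \<le> (A * B + 1) * N (\<sigma> m - \<sigma> n)" by (intro mult_right_mono) auto
        also have "\<dots> < e" using n0 that pos by (simp add: pos_less_divide_eq mult.commute)
        finally show ?thesis by (simp add: minus_tempered_distribution.rep_eq)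
      qed
      then show "\<exists>Ma. \<forall>m\<ge>Ma. \<forall>n\<ge>Ma. norm (apply_dist (\<sigma> m) \<phi> - apply_dist (\<sigma> n) \<phi>) < e" by blast
    qed
    then show ?thesis by (rule Cauchy_convergent)
  qed
  define T where "T \<phi> = lim (\<lambda>n. apply_dist (\<sigma> n) \<phi>)" for \<phi>
  have T: "(\<lambda>n. apply_dist (\<sigma> n) \<phi>) \<longlonglongrightarrow> T \<phi>" if "\<phi> \<in> schwartz" for \<phi>
    using conv[OF that] unfolding T_def by (simp add: convergent_LIMSEQ_iff)
  have "\<exists>D. \<forall>\<phi>\<in>schwartz. apply_dist D \<phi> = T \<phi>"
  proof (rule dist_exists[where N = M and C = "A * K"])
    show "T (\<lambda>x. f x + h x) = T f + T h" if "f \<in> schwartz" "h \<in> schwartz" for f h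
      using T[OF schwartz_add[OF that]] tendsto_add[OF T[OF that(1)] T[OF that(2)]]
      by (simp add: apply_dist_add that LIMSEQ_unique)
    show "T (\<lambda>x. c * f x) = c * T f" if "f \<in> schwartz" for c f
      using T[OF schwartz_cmult[OF that], of c] tendsto_mult_left[OF T[OF that], of c]
      by (simp add: apply_dist_cmult that LIMSEQ_unique)
    show "dist_bound M (A * K) T"
      unfolding dist_bound_def
    proof (intro ballI allI impI)
      fix \<phi> :: "real^'n \<Rightarrow> complex" and B
      assume \<phi>: "\<phi> \<in> schwartz" and B: "sbound M (pweight M) B \<phi>"
      have B0: "0 \<le> B" using sbound_nonneg[OF B] by simp
      have "cmod (apply_dist (\<sigma> n) \<phi>) \<le> A * K * B" if "n1 \<le> n" for n
        using key[OF \<sigma> \<phi> B, of n] mult_left_mono[OF K[OF that], of "A * B"] A B0 by (simp add: mult_ac)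
      then show "cmod (T \<phi>) \<le> A * K * B"
        by (intro LIMSEQ_le_const2[OF tendsto_norm[OF T[OF \<phi>]]]) blast
    qed
  qed
  then obtain D where D: "\<And>\<phi>. \<phi> \<in> schwartz \<Longrightarrow> apply_dist D \<phi> = T \<phi>" by blast
  have VD: "(\<lambda>n. V (\<sigma> n) z) \<longlonglongrightarrow> V D z" for z
    using T[OF schwartz_tfshift[OF schwartz_cnj[OF g]]] D[OF schwartz_tfshift[OF schwartz_cnj[OF g]]]
    by (simp add: V_eq)
  \<comment> \<open>For fixed n the differences with all later members converge pointwise to
    \<open>D - \<sigma> n\<close>, so their common bound is inherited.\<close>
  have lim: "D - \<sigma> n \<in> X \<and> N (D - \<sigma> n) \<le> \<epsilon>" if "0 < \<epsilon>" "\<And>m. n0 \<le> m \<Longrightarrow> N (\<sigma> m - \<sigma> n) < \<epsilon>" for n n0 \<epsilon>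
  proof (rule N_le_limit[where f = "\<lambda>k. \<sigma> (k + n0) - \<sigma> n"])
    show "(\<lambda>k. V (\<sigma> (k + n0) - \<sigma> n) z) \<longlonglongrightarrow> V (D - \<sigma> n) z" for z
      unfolding V_diff by (intro tendsto_diff LIMSEQ_ignore_initial_segment[OF VD] tendsto_const)
    show "N (\<sigma> (k + n0) - \<sigma> n) \<le> \<epsilon>" for k using that(2)[of "k + n0"] by simp
  qed (use that X_diff \<sigma> in auto)
  \<comment> \<open>Membership of \<open>D\<close> follows from that of a difference
    \<open>D - \<sigma> n2\<close>.\<close>
  obtain n2 where "\<And>m. n2 \<le> m \<Longrightarrow> N (\<sigma> m - \<sigma> n2) < 1" using C[of 1] by auto
  then have "D - \<sigma> n2 \<in> X" using lim[of 1 n2 n2] by simp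
  from X_add[OF this \<sigma>[of n2]] have DX: "D \<in> X" by simp
  have "limitin ns.mtopology \<sigma> D sequentially"
    unfolding ns.limit_metric_sequentially
  proof (intro conjI allI impI DX)
    fix \<epsilon> :: real assume e: "0 < \<epsilon>"
    obtain n0 where n0: "\<forall>n m. n0 \<le> n \<longrightarrow> n0 \<le> m \<longrightarrow> N (\<sigma> n - \<sigma> m) < \<epsilon> / 2" using C[of "\<epsilon> / 2"] e by auto
    have "norm_dist X N (\<sigma> n) D < \<epsilon>" if "n0 \<le> n" for n
    proof -
      have "N (D - \<sigma> n) \<le> \<epsilon> / 2" using lim[of "\<epsilon> / 2" n0 n] n0 that e by simp
      then show ?thesis using e \<sigma> DX by (simp add: norm_dist_def N_diff_commute[of "\<sigma> n" D])
    qed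
    then show "\<exists>Na. \<forall>n\<ge>Na. \<sigma> n \<in> X \<and> norm_dist X N (\<sigma> n) D < \<epsilon>" using \<sigma> by blast
  qed
  then show "\<exists>x. limitin ns.mtopology \<sigma> x sequentially" by blast
qed

lemma banach_space: "banach_space_on scale_dist X N"
  by unfold_locales (rule mcomplete)

end

section \<open>Weighted mixed norms\<close>

lemma ennpowr_ennreal: "0 \<le> a \<Longrightarrow> ennpowr (ennreal a) r = ennreal (a powr r)"
  by (simp add: ennpowr_def)

lemma ennpowr_top [simp]: "ennpowr \<top> r = \<top>"
  by (simp add: ennpowr_def)

lemma ennpowr_0 [simp]: "ennpowr 0 r = 0"
  by (simp add: ennpowr_def)

lemma ennpowr_1 [simp]: "ennpowr a 1 = a"
  by (cases a) (simp_all add: ennpowr_ennreal)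

lemma ennpowr_mono: "a \<le> b \<Longrightarrow> 0 \<le> r \<Longrightarrow> ennpowr a r \<le> ennpowr b r"
  by (cases a; cases b) (auto simp: ennpowr_ennreal top_unique intro!: ennreal_leI powr_mono2)

lemma ennpowr_mult: "0 < r \<Longrightarrow> ennpowr (a * b) r = ennpowr a r * ennpowr b r"
proof (cases a; cases b)
  fix x y :: real assume "0 < r" "0 \<le> x" "a = ennreal x" "0 \<le> y" "b = ennreal y"
  then show ?thesis by (simp add: ennreal_mult[symmetric] ennpowr_ennreal powr_mult)
next
  fix x :: real assume "0 < r" "0 \<le> x" "a = ennreal x" "b = \<top>"
  then show ?thesis by (cases "x = 0") (auto simp: ennreal_mult_top ennpowr_ennreal)
next
  fix y :: real assume "0 < r" "a = \<top>" "0 \<le> y" "b = ennreal y"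
  then show ?thesis by (cases "y = 0") (auto simp: ennreal_top_mult ennpowr_ennreal)
next
  assume "a = \<top>" "b = \<top>"
  then show ?thesis by simp
qed

lemma ennpowr_ennpowr: "ennpowr (ennpowr a r) s = ennpowr a (r * s)"
  by (cases a) (simp_all add: ennpowr_ennreal powr_powr)

lemma ennpowr_inverse: "0 < r \<Longrightarrow> ennpowr (ennpowr a r) (1 / r) = a" "0 < r \<Longrightarrow> ennpowr (ennpowr a (1 / r)) r = a"
  by (simp_all add: ennpowr_ennpowr)

lemma ennpowr_less_iff: "0 < r \<Longrightarrow> ennpowr a r < ennpowr b r \<longleftrightarrow> a < b"
  using ennpowr_mono[of a b r] ennpowr_mono[of b a r] ennpowr_mono[of "ennpowr b r" "ennpowr a r" "1 / r"]
    ennpowr_inverse(1)[of r]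
  by (metis less_imp_le not_le zero_le_divide_1_iff)

lemma ennpowr_less_top: "ennpowr a r < \<top> \<longleftrightarrow> a < \<top>"
  by (cases a) (simp_all add: ennpowr_ennreal)

lemma borel_measurable_ennpowr[measurable]: "(\<lambda>a. ennpowr a r) \<in> borel_measurable borel"
  unfolding ennpowr_def by measurable

text \<open>A positive power is a strictly increasing bijection, so thresholds below the lower limit
  can be pulled back through the inverse power.\<close>

lemma ennpowr_liminf: 
  assumes "0 < r"
  shows "ennpowr (liminf x) r \<le> liminf (\<lambda>n. ennpowr (x n) r)"
  unfolding le_Liminf_iff
proof (intro allI impI)
  fix y assume y: "y < ennpowr (liminf x) r"
  then have "ennpowr y (1 / r) < liminf x"
    using ennpowr_less_iff[OF assms, of "ennpowr y (1 / r)" "liminf x"] assms by (simp add: ennpowr_inverse)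
  then have "\<forall>\<^sub>F n in sequentially. ennpowr y (1 / r) < x n" by (rule less_LiminfD)
  then show "\<forall>\<^sub>F n in sequentially. y < ennpowr (x n) r"
  proof eventually_elim
    case (elim n)
    then have "ennpowr (ennpowr y (1 / r)) r < ennpowr (x n) r" using ennpowr_less_iff[OF assms] by blast
    then show ?case using assms by (simp add: ennpowr_inverse)
  qed
qed

lemma ennpowr_tendsto_0:
  assumes "0 < r" "x \<longlonglongrightarrow> 0"
  shows "(\<lambda>n. ennpowr (x n) r) \<longlonglongrightarrow> 0"
proof (rule order_tendstoI)
  fix a :: ennreal assume "0 < a"
  then have "0 < ennpowr a (1 / r)" using ennpowr_less_iff[of "1 / r" 0 a] assms(1) by simp
  with assms(2) have "\<forall>\<^sub>F n in sequentially. x n < ennpowr a (1 / r)" by (rule order_tendstoD)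
  then show "\<forall>\<^sub>F n in sequentially. ennpowr (x n) r < a"
  proof eventually_elim
    case (elim n)
    then have "ennpowr (x n) r < ennpowr (ennpowr a (1 / r)) r" using ennpowr_less_iff[OF assms(1)] by blast
    then show ?case using assms(1) by (simp add: ennpowr_inverse)
  qed
qed simp

text \<open>Convexity is used for positive points; a point equal to 0 is reduced to
  \<open>t powr p \<le> t\<close> on the unit interval.\<close>

lemma powr_convex_le:
  fixes x y u v p :: real
  assumes p: "1 \<le> p" and "0 \<le> x" "0 \<le> y" and uv: "u + v = 1" "0 \<le> u" "0 \<le> v"
  shows "(u * x + v * y) powr p \<le> u * x powr p + v * y powr p"
proof -
  have le: "t powr p \<le> t" if "0 \<le> t" "t \<le> 1" for t
    using powr_mono'[of 1 p t] p that by (cases "t = 0") auto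
  have "(t * z) powr p \<le> t * z powr p" if "0 \<le> t" "t \<le> 1" "0 \<le> z" for t z
    using mult_right_mono[OF le[OF that(1,2)], of "z powr p"] that by (simp add: powr_mult)
  note z = this
  show ?thesis
  proof (cases "x = 0 \<or> y = 0")
    case True
    then show ?thesis using z[of v y] z[of u x] assms by auto
  next
    case False
    then show ?thesis
      using convex_onD[OF powr_convex[OF p], of v x y] assms
      by (simp add: eq_diff_eq[symmetric])
  qed
qed

text \<open>Convexity of the power with the weights \<open>a / (a + b)\<close> and
  \<open>b / (a + b)\<close>, at \<open>x / a\<close> and \<open>y / b\<close>. With a and b close
  to the two norms it is the pointwise form of Minkowski's inequality.\<close>

lemma ennpowr_convex:
  assumes p: "1 \<le> p" and ab: "0 < a" "0 < b"
  shows "ennpowr (x + y) p \<le> ennreal ((a + b) powr p) *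
    (ennreal (a / (a + b) / a powr p) * ennpowr x p + ennreal (b / (a + b) / b powr p) * ennpowr y p)"
proof -
  have pos: "0 < (a + b) powr p * (a / (a + b) / a powr p)" "0 < (a + b) powr p * (b / (a + b) / b powr p)"
    using ab by auto
  show ?thesis
  proof (cases x)
    case x: (real r)
    show ?thesis
    proof (cases y)
      case y: (real s)
      let ?u = "a / (a + b)" and ?v = "b / (a + b)"
      have uv: "?u + ?v = 1" "0 \<le> ?u" "0 \<le> ?v" using ab by (auto simp: add_divide_distrib[symmetric])
      have "(?u * (r / a) + ?v * (s / b)) powr p \<le> ?u * (r / a) powr p + ?v * (s / b) powr p"
        using ab x y uv by (intro powr_convex_le p) auto
      moreover have "?u * (r / a) + ?v * (s / b) = (r + s) / (a + b)" using ab by (simp add: add_divide_distrib)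
      ultimately have "((r + s) / (a + b)) powr p \<le> ?u * (r / a) powr p + ?v * (s / b) powr p" by simp
      then have "(r + s) powr p / (a + b) powr p \<le> ?u / a powr p * r powr p + ?v / b powr p * s powr p"
        using ab x y by (simp add: powr_divide)
      then have "(r + s) powr p \<le> (a + b) powr p * (?u / a powr p * r powr p + ?v / b powr p * s powr p)"
        using ab by (simp add: pos_divide_le_eq mult.commute)
      then have "ennreal ((r + s) powr p) \<le> ennreal ((a + b) powr p * (?u / a powr p * r powr p + ?v / b powr p * s powr p))"
        by (rule ennreal_leI)
      also have "\<dots> = ennreal ((a + b) powr p) * (ennreal (?u / a powr p) * ennreal (r powr p) + ennreal (?v / b powr p) * ennreal (s powr p))"
      proof -
        have gen: "ennreal (P * (c1 * R + c2 * T)) = ennreal P * (ennreal c1 * ennreal R + ennreal c2 * ennreal T)"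
          if "0 \<le> P" "0 \<le> c1" "0 \<le> R" "0 \<le> c2" "0 \<le> T" for P c1 R c2 T
          using that by (simp add: ennreal_mult ennreal_plus)
        show ?thesis by (rule gen) (use ab in auto)
      qed
      finally show ?thesis using x y by (simp add: ennpowr_ennreal ennreal_plus[symmetric] del: ennreal_plus)
    next
      case top
      then show ?thesis using pos ab by (simp add: ennreal_mult_top distrib_left mult.assoc[symmetric] ennreal_mult[symmetric])
    qed
  next
    case top
    then show ?thesis using pos ab by (simp add: ennreal_mult_top distrib_left mult.assoc[symmetric] ennreal_mult[symmetric])
  qed
qed

section \<open>Lebesgue norms of extended functions\<close>

definition Lp :: "real \<Rightarrow> 'a measure \<Rightarrow> ('a \<Rightarrow> ennreal) \<Rightarrow> ennreal" where
  "Lp p M F = ennpowr (\<integral>\<^sup>+x. ennpowr (F x) p \<partial>M) (1 / p)"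

lemma Lp_mono: "1 \<le> p \<Longrightarrow> (\<And>x. x \<in> space M \<Longrightarrow> F x \<le> G x) \<Longrightarrow> Lp p M F \<le> Lp p M G"
  unfolding Lp_def by (intro ennpowr_mono nn_integral_mono) auto

lemma Lp_cmult:
  assumes "1 \<le> p" "F \<in> borel_measurable M"
  shows "Lp p M (\<lambda>x. c * F x) = c * Lp p M F"
proof -
  have "(\<integral>\<^sup>+x. ennpowr (c * F x) p \<partial>M) = ennpowr c p * (\<integral>\<^sup>+x. ennpowr (F x) p \<partial>M)"
    using assms by (subst nn_integral_cmult[symmetric]) (auto simp: ennpowr_mult)
  then show ?thesis using assms(1) by (simp add: Lp_def ennpowr_mult ennpowr_inverse)
qed

lemma Lp_le_iff:
  assumes "1 \<le> p" "0 \<le> a"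
  shows "Lp p M F \<le> ennreal a \<longleftrightarrow> (\<integral>\<^sup>+x. ennpowr (F x) p \<partial>M) \<le> ennreal (a powr p)"
proof -
  have "Lp p M F \<le> ennreal a \<longleftrightarrow> ennpowr (Lp p M F) p \<le> ennpowr (ennreal a) p"
    using ennpowr_less_iff[of p "ennreal a" "Lp p M F"] assms(1) by (simp add: not_less[symmetric])
  then show ?thesis using assms by (simp add: Lp_def ennpowr_inverse ennpowr_ennreal)
qed

text \<open>Minkowski's inequality: integrating \<open>ennpowr_convex\<close> makes each normalised
  integral at most 1, so the two weights sum to 1.\<close>

lemma Lp_add:
  assumes p: "1 \<le> p" and F: "F \<in> borel_measurable M" and G: "G \<in> borel_measurable M"
  shows "Lp p M (\<lambda>x. F x + G x) \<le> Lp p M F + Lp p M G"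
proof (rule ennreal_le_epsilon)
  fix e :: real assume fin: "Lp p M F + Lp p M G < \<top>" and e: "0 < e"
  obtain A where A: "0 \<le> A" "Lp p M F = ennreal A" using fin by (cases "Lp p M F") auto
  obtain B where B: "0 \<le> B" "Lp p M G = ennreal B" using fin by (cases "Lp p M G") auto
  \<comment> \<open>The summand \<open>e / 2\<close> keeps the divisors positive even if a norm is
    0.\<close>
  define a where "a = A + e / 2"
  define b where "b = B + e / 2"
  have ab: "0 < a" "0 < b" using A B e by (auto simp: a_def b_def)
  have IF: "(\<integral>\<^sup>+x. ennpowr (F x) p \<partial>M) \<le> ennreal (a powr p)"
    using Lp_le_iff[OF p, of a M F] ab A e by (simp add: a_def ennreal_leI)
  have IG: "(\<integral>\<^sup>+x. ennpowr (G x) p \<partial>M) \<le> ennreal (b powr p)"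
    using Lp_le_iff[OF p, of b M G] ab B e by (simp add: b_def ennreal_leI)
  have "(\<integral>\<^sup>+x. ennpowr (F x + G x) p \<partial>M) \<le> (\<integral>\<^sup>+x. ennreal ((a + b) powr p) *
    (ennreal (a / (a + b) / a powr p) * ennpowr (F x) p + ennreal (b / (a + b) / b powr p) * ennpowr (G x) p) \<partial>M)"
    by (intro nn_integral_mono ennpowr_convex p ab)
  also have "\<dots> = ennreal ((a + b) powr p) * (ennreal (a / (a + b) / a powr p) * (\<integral>\<^sup>+x. ennpowr (F x) p \<partial>M) +
      ennreal (b / (a + b) / b powr p) * (\<integral>\<^sup>+x. ennpowr (G x) p \<partial>M))"
    using F G by (simp add: nn_integral_cmult nn_integral_add)
  also have "\<dots> \<le> ennreal ((a + b) powr p) * (ennreal (a / (a + b) / a powr p) * ennreal (a powr p) +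
      ennreal (b / (a + b) / b powr p) * ennreal (b powr p))"
    by (intro mult_left_mono add_mono IF IG) auto
  also have "\<dots> = ennreal ((a + b) powr p * (a / (a + b) + b / (a + b)))"
    using ab by (simp add: ennreal_mult[symmetric] ennreal_plus[symmetric] del: ennreal_plus)
  also have "(a + b) powr p * (a / (a + b) + b / (a + b)) = (a + b) powr p"
    using ab by (simp add: add_divide_distrib[symmetric])
  finally have "Lp p M (\<lambda>x. F x + G x) \<le> ennreal (a + b)"
    using Lp_le_iff[OF p, of "a + b" M "\<lambda>x. F x + G x"] ab by (simp del: ennreal_plus)
  also have "a + b = A + B + e" by (simp add: a_def b_def)
  finally show "Lp p M (\<lambda>x. F x + G x) \<le> Lp p M F + Lp p M G + ennreal e"
    using A B e by (simp add: ennreal_plus)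
qed

lemma Lp_Fatou:
  assumes p: "1 \<le> p" and F: "\<And>n. F n \<in> borel_measurable M"
  shows "Lp p M (\<lambda>x. liminf (\<lambda>n. F n x)) \<le> liminf (\<lambda>n. Lp p M (F n))"
proof -
  have "(\<integral>\<^sup>+x. ennpowr (liminf (\<lambda>n. F n x)) p \<partial>M) \<le> (\<integral>\<^sup>+x. liminf (\<lambda>n. ennpowr (F n x) p) \<partial>M)"
    using p by (intro nn_integral_mono ennpowr_liminf) auto
  also have "\<dots> \<le> liminf (\<lambda>n. \<integral>\<^sup>+x. ennpowr (F n x) p \<partial>M)"
    using F by (intro nn_integral_liminf) auto
  finally have "Lp p M (\<lambda>x. liminf (\<lambda>n. F n x)) \<le> ennpowr (liminf (\<lambda>n. \<integral>\<^sup>+x. ennpowr (F n x) p \<partial>M)) (1 / p)"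
    unfolding Lp_def using p by (intro ennpowr_mono) auto
  also have "\<dots> \<le> liminf (\<lambda>n. Lp p M (F n))"
    unfolding Lp_def using p by (intro ennpowr_liminf) auto
  finally show ?thesis .
qed

lemma Lp_dominated:
  assumes p: "1 \<le> p" and F: "\<And>n. F n \<in> borel_measurable M" and G: "G \<in> borel_measurable M"
    and le: "\<And>n x. F n x \<le> G x" and fin: "Lp p M G < \<infinity>" and lim: "AE x in M. (\<lambda>n. F n x) \<longlonglongrightarrow> 0"
  shows "(\<lambda>n. Lp p M (F n)) \<longlonglongrightarrow> 0"
proof -
  have "(\<lambda>n. \<integral>\<^sup>+x. ennpowr (F n x) p \<partial>M) \<longlonglongrightarrow> (\<integral>\<^sup>+x. 0 \<partial>M)"
  proof (rule nn_integral_dominated_convergence[where w = "\<lambda>x. ennpowr (G x) p"])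
    show "(\<integral>\<^sup>+x. ennpowr (G x) p \<partial>M) < \<infinity>" using fin by (simp add: Lp_def ennpowr_less_top)
    show "AE x in M. (\<lambda>n. ennpowr (F n x) p) \<longlonglongrightarrow> 0"
      using lim by eventually_elim (use p in \<open>auto intro: ennpowr_tendsto_0\<close>)
  qed (use F G p in \<open>auto intro!: AE_I2 ennpowr_mono le\<close>)
  then show ?thesis unfolding Lp_def using p by (intro ennpowr_tendsto_0) auto
qed

lemma Lp_finite_AE:
  assumes "F \<in> borel_measurable M" "Lp p M F < \<infinity>"
  shows "AE x in M. F x < \<infinity>"
proof -
  have "(\<integral>\<^sup>+x. ennpowr (F x) p \<partial>M) \<noteq> \<infinity>" using assms(2) by (auto simp: Lp_def ennpowr_less_top less_top)
  then have "AE x in M. ennpowr (F x) p \<noteq> \<infinity>" using assms(1) by (intro nn_integral_PInf_AE) auto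
  then show ?thesis by eventually_elim (auto simp: less_top[symmetric] ennpowr_less_top)
qed

lemma ennreal_le_1_plus_powr:
  assumes "1 \<le> p" shows "x \<le> 1 + ennpowr x p"
proof (cases x)
  case (real r)
  have "r \<le> 1 + r powr p"
  proof (cases "r \<le> 1")
    case False
    then have "r powr 1 \<le> r powr p" using assms by (intro powr_mono) auto
    then show ?thesis using False by simp
  qed (simp add: add_increasing2)
  then have "ennreal r \<le> ennreal (1 + r powr p)" by (rule ennreal_leI)
  then show ?thesis using real by (simp add: ennpowr_ennreal ennreal_plus)
qed simp

text \<open>
  A substitute for Hoelder's inequality without conjugate exponents, so that \<open>p = 1\<close> needs no
  separate treatment: after normalising \<open>F\<close>, it is enough to use \<open>x \<le> 1 + x\<^sup>p\<close>.
\<close>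

lemma Lp_pairing:
  assumes p: "1 \<le> p" and F: "F \<in> borel_measurable M" and W: "W \<in> borel_measurable M"
    and W1: "\<And>x. W x \<le> 1" and I: "(\<integral>\<^sup>+x. W x \<partial>M) \<le> ennreal I" "0 \<le> I"
  shows "(\<integral>\<^sup>+x. F x * W x \<partial>M) \<le> ennreal (I + 1) * Lp p M F"
proof (rule ennreal_le_epsilon)
  fix e :: real assume fin: "ennreal (I + 1) * Lp p M F < \<top>" and e: "0 < e"
  obtain A where A: "0 \<le> A" "Lp p M F = ennreal A"
    using fin I(2) by (cases "Lp p M F") (auto simp: ennreal_mult_top)
  \<comment> \<open>Positive even if the norm is 0; after multiplication by \<open>I + 1\<close> the
    surplus is exactly e.\<close>
  define a where "a = A + e / (I + 1)"
  have a: "0 < a" using A e I by (simp add: a_def add_nonneg_pos)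
  have IF: "(\<integral>\<^sup>+x. ennpowr (F x) p \<partial>M) \<le> ennreal (a powr p)"
    using Lp_le_iff[OF p, of a M F] a A e I by (simp add: a_def ennreal_leI)
  have "F x * W x \<le> ennreal a * (W x + ennreal (1 / a powr p) * ennpowr (F x) p)" for x
  proof -
    have "F x = ennreal a * (ennreal (1 / a) * F x)"
      using a by (simp add: mult.assoc[symmetric] ennreal_mult[symmetric])
    also have "\<dots> * W x \<le> ennreal a * ((1 + ennpowr (ennreal (1 / a) * F x) p) * W x)"
      unfolding mult.assoc[of "ennreal a"] by (intro mult_left_mono mult_right_mono ennreal_le_1_plus_powr p) auto
    also have "(1 + ennpowr (ennreal (1 / a) * F x) p) * W x \<le> W x + ennpowr (ennreal (1 / a) * F x) p * 1"
      unfolding distrib_right mult_1 by (intro add_left_mono mult_left_mono W1) auto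
    also have "ennpowr (ennreal (1 / a) * F x) p = ennreal (1 / a powr p) * ennpowr (F x) p"
      using p a by (simp add: ennpowr_mult ennpowr_ennreal powr_divide)
    finally show ?thesis by (simp add: mult_left_mono)
  qed
  then have "(\<integral>\<^sup>+x. F x * W x \<partial>M) \<le> (\<integral>\<^sup>+x. ennreal a * (W x + ennreal (1 / a powr p) * ennpowr (F x) p) \<partial>M)"
    by (intro nn_integral_mono)
  also have "\<dots> = ennreal a * ((\<integral>\<^sup>+x. W x \<partial>M) + ennreal (1 / a powr p) * (\<integral>\<^sup>+x. ennpowr (F x) p \<partial>M))"
    using F W by (simp add: nn_integral_cmult nn_integral_add)
  also have "\<dots> \<le> ennreal a * (ennreal I + ennreal (1 / a powr p) * ennreal (a powr p))"
    by (intro mult_left_mono add_mono I IF) auto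
  also have "\<dots> = ennreal (a * (I + 1))"
  proof -
    have "ennreal (1 / a powr p) * ennreal (a powr p) = 1" using a by (simp add: ennreal_mult[symmetric])
    moreover have "ennreal (I + 1) = ennreal I + 1" using I by simp
    moreover have "ennreal (a * (I + 1)) = ennreal a * ennreal (I + 1)" using a I by (intro ennreal_mult) auto
    ultimately show ?thesis by (simp only:)
  qed
  also have "a * (I + 1) = (I + 1) * A + e"
    using I by (simp add: a_def field_simps)
  finally show "(\<integral>\<^sup>+x. F x * W x \<partial>M) \<le> ennreal (I + 1) * Lp p M F + ennreal e"
    using A I e by (simp add: ennreal_mult ennreal_plus)
qed

lemma Lp_translate:
  fixes F :: "'a::euclidean_space \<Rightarrow> ennreal"
  assumes "F \<in> borel_measurable borel"
  shows "Lp p lborel (\<lambda>x. F (x - t)) = Lp p lborel F"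
proof -
  have "(\<integral>\<^sup>+x. ennpowr (F x) p \<partial>lborel) = (\<integral>\<^sup>+x. ennpowr (F (x - t)) p \<partial>lborel)"
    using nn_integral_lborel_affine[of "\<lambda>x. ennpowr (F x) p" 1 "- t"] assms by simp
  then show ?thesis by (simp add: Lp_def)
qed

lemma borel_measurable_Lp:
  fixes F :: "'a::euclidean_space \<times> 'b::euclidean_space \<Rightarrow> ennreal"
  assumes "F \<in> borel_measurable borel"
  shows "(\<lambda>s. Lp p lborel (\<lambda>t. F (s, t))) \<in> borel_measurable lborel"
proof -
  have F: "F \<in> borel_measurable (lborel \<Otimes>\<^sub>M lborel)" using assms by (simp add: lborel_prod)
  have "(\<lambda>s. \<integral>\<^sup>+t. ennpowr (F (s, t)) p \<partial>lborel) \<in> borel_measurable lborel"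
    by (rule lborel.borel_measurable_nn_integral) (use F in measurable)
  then show ?thesis unfolding Lp_def by measurable
qed

lemma borel_measurable_section:
  fixes F :: "'a::euclidean_space \<times> 'b::euclidean_space \<Rightarrow> ennreal"
  assumes "F \<in> borel_measurable borel"
  shows "(\<lambda>t. F (s, t)) \<in> borel_measurable lborel"
proof -
  have "F \<in> borel_measurable (lborel \<Otimes>\<^sub>M lborel)" using assms by (simp add: lborel_prod)
  then show ?thesis by measurable
qed

text \<open>The inner norm runs over the second variable. The amalgam norms, which integrate over
  the frequency first, have this form with exponents (q, p); the modulation norms need the
  coordinates exchanged.\<close>

definition mixn :: "real \<Rightarrow> real \<Rightarrow> ((real^'n::finite) \<times> (real^'n) \<Rightarrow> real) \<Rightarrow>
    ((real^'n) \<times> (real^'n) \<Rightarrow> ennreal) \<Rightarrow> ennreal" where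
  "mixn a b w F = Lp b lborel (\<lambda>s. Lp a lborel (\<lambda>t. F (s, t) * ennreal (w (s, t))))"

lemma nn_integral_inverse_pweight:
  obtains I where "0 \<le> I" "(\<integral>\<^sup>+u. ennreal (1 / pweight (2 * CARD('n)) (u::real^'n::finite)) \<partial>lborel) = ennreal I"
proof -
  have "integrable lborel (\<lambda>u::real^'n. 1 / pweight (2 * CARD('n)) u)"
    using integrable_inverse_pweight[where 'a = "real^'n"] by simp
  from nn_integral_eq_integral[OF this]
  have "(\<integral>\<^sup>+u. ennreal (1 / pweight (2 * CARD('n)) (u::real^'n)) \<partial>lborel) = ennreal (\<integral>u. 1 / pweight (2 * CARD('n)) (u::real^'n) \<partial>lborel)"
    by simp
  then show thesis by (rule that[rotated]) (intro Bochner_Integration.integral_nonneg, simp)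
qed

lemma Lp_inverse_pweight:
  assumes p: "1 \<le> p"
  shows "Lp p lborel (\<lambda>u::real^'n::finite. ennreal (1 / pweight (2 * CARD('n)) u)) < \<infinity>"
proof -
  obtain I where I: "(\<integral>\<^sup>+u. ennreal (1 / pweight (2 * CARD('n)) (u::real^'n)) \<partial>lborel) = ennreal I"
    by (rule nn_integral_inverse_pweight)
  have "(\<integral>\<^sup>+u. ennpowr (ennreal (1 / pweight (2 * CARD('n)) (u::real^'n))) p \<partial>lborel) \<le> (\<integral>\<^sup>+u. ennreal (1 / pweight (2 * CARD('n)) (u::real^'n)) \<partial>lborel)"
  proof (rule nn_integral_mono)
    fix u :: "real^'n"
    let ?x = "1 / pweight (2 * CARD('n)) u"
    have x: "0 < ?x" "?x \<le> 1" using pweight_pos[of "2 * CARD('n)" u] pweight_ge1[of "2 * CARD('n)" u] by auto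
    have "?x powr p \<le> ?x powr 1" using p x by (intro powr_mono') auto
    then show "ennpowr (ennreal ?x) p \<le> ennreal ?x" using x by (simp add: ennpowr_ennreal ennreal_leI)
  qed
  also have "\<dots> < \<infinity>" using I by simp
  finally show ?thesis by (simp add: Lp_def ennpowr_less_top)
qed

text \<open>Moderateness confines the weight between multiples of \<open>1 / pweight S\<close> and
  \<open>pweight S\<close>. With \<open>L = S + 2 * CARD('n)\<close> an integrable power in each
  variable is left over, both for the finiteness of \<open>bweight\<close> and for the
  pairing.\<close>

lemma bf_norm_mixn:
  fixes w :: "(real^'n::finite) \<times> (real^'n) \<Rightarrow> real"
  assumes a: "1 \<le> a" and b: "1 \<le> b" and w_cont: "continuous_on UNIV w" and w_pos: "\<And>z. 0 < w z"
    and w_mod: "\<And>u z. w (u + z) \<le> pweight S u * w z"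
  shows "\<exists>C. bf_norm (mixn a b w) S (S + 2 * CARD('n)) C"
proof -
  let ?d = "2 * CARD('n)"
  let ?L = "S + ?d"
  have w_meas[measurable]: "w \<in> borel_measurable borel" using w_cont by (rule borel_measurable_continuous_onI)
  have Fw: "(\<lambda>z. F z * ennreal (w z)) \<in> borel_measurable borel" if "F \<in> borel_measurable borel" for F :: "(real^'n) \<times> (real^'n) \<Rightarrow> ennreal"
    using that by measurable
  note inner = borel_measurable_section[OF Fw]
  note outer = borel_measurable_Lp[OF Fw]
  have pair_le: "pweight S (s, t) \<le> pweight S s * pweight S t" for s t :: "real^'n"
  proof -
    have "norm (s, t) \<le> norm s + norm t" by (rule norm_Pair_le)
    then have "1 + norm (s, t) \<le> (1 + norm s) * (1 + norm t)"
      using mult_nonneg_nonneg[OF norm_ge_zero norm_ge_zero, of s t] by (simp add: algebra_simps del: mult_nonneg_nonneg)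
    then show ?thesis unfolding pweight_def power_mult_distrib[symmetric] by (intro power_mono) auto
  qed
  have w_upper: "bweight ?L (s, t) * w (s, t) \<le> w 0 * (1 / pweight ?d s * (1 / pweight ?d t))" for s t
  proof -
    have "w (s, t) \<le> pweight S (s, t) * w 0" using w_mod[of "(s, t)" 0] by simp
    also have "\<dots> \<le> (pweight S s * pweight S t) * w 0" using w_pos[of 0] by (intro mult_right_mono pair_le) auto
    finally have "bweight ?L (s, t) * w (s, t) \<le> bweight ?L (s, t) * ((pweight S s * pweight S t) * w 0)"
      by (rule mult_left_mono) simp
    also have "\<dots> = w 0 * (1 / pweight ?d s * (1 / pweight ?d t))"
      using pweight_pos[of S s] pweight_pos[of S t] by (simp add: bweight_def pweight_add field_simps)
    finally show ?thesis .
  qed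
  have w_lower: "bweight ?L (s, t) \<le> 1 / w 0 * w (s, t) * (1 / pweight ?d s * (1 / pweight ?d t))" for s t
  proof -
    \<comment> \<open>Moderateness applied to the opposite shift gives the lower bound.\<close>
    have "w 0 \<le> pweight S (s, t) * w (s, t)" using w_mod[of "- (s, t)" "(s, t)"] by (simp del: uminus_Pair)
    also have "\<dots> \<le> (pweight S s * pweight S t) * w (s, t)" using w_pos[of "(s, t)"] by (intro mult_right_mono pair_le) auto
    finally have "bweight ?L (s, t) * w 0 \<le> bweight ?L (s, t) * ((pweight S s * pweight S t) * w (s, t))"
      by (rule mult_left_mono) simp
    also have "\<dots> = w (s, t) * (1 / pweight ?d s * (1 / pweight ?d t))"
      using pweight_pos[of S s] pweight_pos[of S t] by (simp add: bweight_def pweight_add field_simps)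
    finally have "bweight ?L (s, t) \<le> w (s, t) * (1 / pweight ?d s * (1 / pweight ?d t)) / w 0"
      using w_pos[of 0] by (simp only: pos_le_divide_eq)
    then show ?thesis by (simp add: mult_ac)
  qed
  obtain I where I: "0 \<le> I" "(\<integral>\<^sup>+u. ennreal (1 / pweight ?d (u::real^'n)) \<partial>lborel) = ennreal I"
    by (rule nn_integral_inverse_pweight)
  have pwm: "(\<lambda>u::real^'n. ennreal (1 / pweight ?d u)) \<in> borel_measurable lborel" by measurable
  have pw1: "ennreal (1 / pweight ?d u) \<le> 1" for u :: "real^'n"
    using pweight_ge1[of ?d u] by (simp add: ennreal_le_1 divide_le_eq)
  have "bf_norm (mixn a b w) S ?L (1 / w 0 * (I + 1) * (I + 1))"
  proof
    fix F G :: "(real^'n) \<times> (real^'n) \<Rightarrow> ennreal"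
    assume F: "F \<in> borel_measurable borel"
    show "mixn a b w F \<le> mixn a b w G" if "\<And>z. F z \<le> G z"
      unfolding mixn_def by (intro Lp_mono a b mult_right_mono that) auto
    show "mixn a b w (\<lambda>z. ennreal c * F z) = ennreal c * mixn a b w F" for c
      unfolding mixn_def mult.assoc Lp_cmult[OF a inner[OF F]] Lp_cmult[OF b outer[OF F]] ..
    assume G: "G \<in> borel_measurable borel"
    show "mixn a b w (\<lambda>z. F z + G z) \<le> mixn a b w F + mixn a b w G"
    proof -
      have "mixn a b w (\<lambda>z. F z + G z) \<le> Lp b lborel (\<lambda>s. Lp a lborel (\<lambda>t. F (s, t) * ennreal (w (s, t))) + Lp a lborel (\<lambda>t. G (s, t) * ennreal (w (s, t))))"
        unfolding mixn_def distrib_right by (intro Lp_mono b Lp_add a inner F G)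
      also have "\<dots> \<le> mixn a b w F + mixn a b w G"
        unfolding mixn_def by (intro Lp_add b outer F G)
      finally show ?thesis .
    qed
  next
    fix Fs :: "nat \<Rightarrow> (real^'n) \<times> (real^'n) \<Rightarrow> ennreal"
    assume Fs: "\<And>n. Fs n \<in> borel_measurable borel"
    have "mixn a b w (\<lambda>z. liminf (\<lambda>n. Fs n z)) \<le> Lp b lborel (\<lambda>s. Lp a lborel (\<lambda>t. liminf (\<lambda>n. Fs n (s, t) * ennreal (w (s, t)))))"
      unfolding mixn_def
    proof (intro Lp_mono a b)
      fix s t
      \<comment> \<open>A positive finite factor passes through the lower limit, by dividing
        thresholds by it.\<close>
      show "liminf (\<lambda>n. Fs n (s, t)) * ennreal (w (s, t)) \<le> liminf (\<lambda>n. Fs n (s, t) * ennreal (w (s, t)))"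
        unfolding le_Liminf_iff
      proof (intro allI impI)
        fix y assume y: "y < liminf (\<lambda>n. Fs n (s, t)) * ennreal (w (s, t))"
        have m: "ennreal (1 / w (s, t)) * ennreal (w (s, t)) = 1"
          using w_pos[of "(s, t)"] by (simp add: ennreal_mult[symmetric])
        have pos: "0 < ennreal (w (s, t))" "ennreal (w (s, t)) < \<top>" "0 < ennreal (1 / w (s, t))" "ennreal (1 / w (s, t)) < \<top>"
          using w_pos[of "(s, t)"] by auto
        have "y * ennreal (1 / w (s, t)) < liminf (\<lambda>n. Fs n (s, t)) * ennreal (w (s, t)) * ennreal (1 / w (s, t))"
          using y pos by (intro ennreal_mult_strict_right_mono) auto
        also have "\<dots> = liminf (\<lambda>n. Fs n (s, t))" using m by (simp add: mult.assoc mult.commute[of "ennreal (w (s, t))"])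
        finally have "\<forall>\<^sub>F n in sequentially. y * ennreal (1 / w (s, t)) < Fs n (s, t)" by (rule less_LiminfD)
        then show "\<forall>\<^sub>F n in sequentially. y < Fs n (s, t) * ennreal (w (s, t))"
        proof eventually_elim
          case (elim n)
          then have "y * ennreal (1 / w (s, t)) * ennreal (w (s, t)) < Fs n (s, t) * ennreal (w (s, t))"
            using pos by (intro ennreal_mult_strict_right_mono) auto
          then show ?case using m by (simp add: mult.assoc)
        qed
      qed
    qed
    also have "\<dots> \<le> Lp b lborel (\<lambda>s. liminf (\<lambda>n. Lp a lborel (\<lambda>t. Fs n (s, t) * ennreal (w (s, t)))))"
      by (intro Lp_mono b Lp_Fatou a inner Fs)
    also have "\<dots> \<le> liminf (\<lambda>n. mixn a b w (Fs n))"
      unfolding mixn_def by (intro Lp_Fatou b outer Fs)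
    finally show "mixn a b w (\<lambda>z. liminf (\<lambda>n. Fs n z)) \<le> liminf (\<lambda>n. mixn a b w (Fs n))" .
    fix G :: "(real^'n) \<times> (real^'n) \<Rightarrow> ennreal"
    assume G: "G \<in> borel_measurable borel" and le: "\<And>n z. Fs n z \<le> G z" and fin: "mixn a b w G < \<infinity>"
      and lim: "\<And>z. (\<lambda>n. Fs n z) \<longlonglongrightarrow> 0"
    show "(\<lambda>n. mixn a b w (Fs n)) \<longlonglongrightarrow> 0"
      unfolding mixn_def
    proof (rule Lp_dominated[OF b outer[OF Fs] outer[OF G]])
      show "Lp a lborel (\<lambda>t. Fs n (s, t) * ennreal (w (s, t))) \<le> Lp a lborel (\<lambda>t. G (s, t) * ennreal (w (s, t)))" for n s
        by (intro Lp_mono a mult_right_mono le) auto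
      show fin': "Lp b lborel (\<lambda>s. Lp a lborel (\<lambda>t. G (s, t) * ennreal (w (s, t)))) < \<infinity>"
        using fin by (simp add: mixn_def)
      \<comment> \<open>The inner norm of the majorant is finite for almost every s; for these
        dominated convergence applies to the inner norm, and once more to the outer one.\<close>
      have "AE s in lborel. Lp a lborel (\<lambda>t. G (s, t) * ennreal (w (s, t))) < \<infinity>"
        by (rule Lp_finite_AE[OF outer[OF G] fin'])
      then show "AE s in lborel. (\<lambda>n. Lp a lborel (\<lambda>t. Fs n (s, t) * ennreal (w (s, t)))) \<longlonglongrightarrow> 0"
      proof eventually_elim
        case (elim s)
        show ?case
        proof (rule Lp_dominated[OF a inner[OF Fs] inner[OF G] _ elim])
          show "Fs n (s, t) * ennreal (w (s, t)) \<le> G (s, t) * ennreal (w (s, t))" for n t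
            by (intro mult_right_mono le) auto
          have "(\<lambda>n. ennreal (w (s, t)) * Fs n (s, t)) \<longlonglongrightarrow> ennreal (w (s, t)) * 0" for t
            by (intro ennreal_tendsto_cmult lim) auto
          then have "(\<lambda>n. Fs n (s, t) * ennreal (w (s, t))) \<longlonglongrightarrow> 0" for t by (simp add: mult.commute)
          then show "AE t in lborel. (\<lambda>n. Fs n (s, t) * ennreal (w (s, t))) \<longlonglongrightarrow> 0" by simp
        qed
      qed
    qed
  next
    fix F :: "(real^'n) \<times> (real^'n) \<Rightarrow> ennreal" and u :: "(real^'n) \<times> (real^'n)"
    assume F: "F \<in> borel_measurable borel"
    let ?H = "\<lambda>z. F z * ennreal (w z)"
    have Fu: "(\<lambda>z. F (z - u)) \<in> borel_measurable borel" using F by measurable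
    have Hu: "(\<lambda>z. ?H (z - u)) \<in> borel_measurable borel" using F by measurable
    have "mixn a b w (\<lambda>z. F (z - u)) \<le> Lp b lborel (\<lambda>s. Lp a lborel (\<lambda>t. ennreal (pweight S u) * ?H ((s, t) - u)))"
      unfolding mixn_def
    proof (intro Lp_mono a b)
      fix s t
      have "w (s, t) \<le> pweight S u * w ((s, t) - u)" using w_mod[of u "(s, t) - u"] by simp
      then have "ennreal (w (s, t)) \<le> ennreal (pweight S u) * ennreal (w ((s, t) - u))"
        using w_pos[of "(s, t) - u"] by (simp add: ennreal_mult[symmetric] ennreal_leI)
      then have "F ((s, t) - u) * ennreal (w (s, t)) \<le> F ((s, t) - u) * (ennreal (pweight S u) * ennreal (w ((s, t) - u)))"
        by (rule mult_left_mono) simp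
      then show "F ((s, t) - u) * ennreal (w (s, t)) \<le> ennreal (pweight S u) * ?H ((s, t) - u)" by (simp only: mult_ac)
    qed
    also have "\<dots> = ennreal (pweight S u) * Lp b lborel (\<lambda>s. Lp a lborel (\<lambda>t. ?H ((s, t) - u)))"
      unfolding Lp_cmult[OF a borel_measurable_section[OF Hu]] Lp_cmult[OF b borel_measurable_Lp[OF Hu]] ..
    \<comment> \<open>A shift of phase space acts on the two coordinates separately, so the inner
      and the outer norm are each translation invariant.\<close>
    also have "(\<lambda>s. Lp a lborel (\<lambda>t. ?H ((s, t) - u))) = (\<lambda>s. Lp a lborel (\<lambda>t. ?H (s - fst u, t)))"
    proof
      fix s
      have m: "(\<lambda>t. ?H (s - fst u, t)) \<in> borel_measurable borel" using inner[OF F, of "s - fst u"] by simp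
      have "(s, t) - u = (s - fst u, t - snd u)" for t by (cases u) simp
      then show "Lp a lborel (\<lambda>t. ?H ((s, t) - u)) = Lp a lborel (\<lambda>t. ?H (s - fst u, t))"
        using Lp_translate[OF m, of a "snd u"] by simp
    qed
    also have "Lp b lborel (\<lambda>s. Lp a lborel (\<lambda>t. ?H (s - fst u, t))) = mixn a b w F"
      unfolding mixn_def
      using Lp_translate[of "\<lambda>s. Lp a lborel (\<lambda>t. ?H (s, t))" b "fst u"] outer[OF F] by simp
    finally show "mixn a b w (\<lambda>z. F (z - u)) \<le> ennreal (pweight S u) * mixn a b w F" .
  next
    let ?P = "\<lambda>u::real^'n. ennreal (1 / pweight ?d u)"
    have "mixn a b w (\<lambda>z. ennreal (bweight ?L z)) \<le> Lp b lborel (\<lambda>s. Lp a lborel (\<lambda>t. (ennreal (w 0) * ?P s) * ?P t))"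
      unfolding mixn_def
    proof (intro Lp_mono a b)
      fix s t :: "real^'n"
      show "ennreal (bweight ?L (s, t)) * ennreal (w (s, t)) \<le> ennreal (w 0) * ?P s * ?P t"
        using w_upper[of s t] w_pos[of 0] w_pos[of "(s, t)"]
        by (simp add: ennreal_mult[symmetric] mult.assoc less_imp_le ennreal_leI)
    qed
    also have "\<dots> = Lp b lborel (\<lambda>s. (ennreal (w 0) * Lp a lborel ?P) * ?P s)"
      unfolding Lp_cmult[OF a pwm] by (simp only: mult_ac)
    also have "\<dots> = ennreal (w 0) * Lp a lborel ?P * Lp b lborel ?P" by (rule Lp_cmult[OF b pwm])
    also have "\<dots> < \<infinity>"
      using Lp_inverse_pweight[OF a, where 'n = 'n] Lp_inverse_pweight[OF b, where 'n = 'n] by (simp add: ennreal_mult_less_top)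
    finally show "mixn a b w (\<lambda>z. ennreal (bweight ?L z)) < \<infinity>" .
  next
    show "0 \<le> 1 / w 0 * (I + 1) * (I + 1)" using w_pos[of 0] I by (simp add: less_imp_le)
  next
    fix F :: "(real^'n) \<times> (real^'n) \<Rightarrow> ennreal"
    assume F: "F \<in> borel_measurable borel"
    let ?P = "\<lambda>u::real^'n. ennreal (1 / pweight ?d u)"
    let ?H = "\<lambda>z. F z * ennreal (w z)"
    let ?A = "\<lambda>s. Lp a lborel (\<lambda>t. ?H (s, t))"
    have "(\<integral>\<^sup>+s. \<integral>\<^sup>+t. F (s, t) * ennreal (bweight ?L (s, t)) \<partial>lborel \<partial>lborel) \<le>
        (\<integral>\<^sup>+s. (ennreal (1 / w 0) * ennreal (I + 1)) * (?A s * ?P s) \<partial>lborel)"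
    proof (rule nn_integral_mono)
      fix s :: "real^'n"
      have "(\<integral>\<^sup>+t. F (s, t) * ennreal (bweight ?L (s, t)) \<partial>lborel) \<le> (\<integral>\<^sup>+t. (ennreal (1 / w 0) * ?P s) * (?H (s, t) * ?P t) \<partial>lborel)"
      proof (rule nn_integral_mono)
        fix t :: "real^'n"
        have "ennreal (bweight ?L (s, t)) \<le> ennreal (1 / w 0 * w (s, t) * (1 / pweight ?d s * (1 / pweight ?d t)))"
          by (rule ennreal_leI[OF w_lower])
        also have "\<dots> = ennreal (1 / w 0) * ennreal (w (s, t)) * (?P s * ?P t)"
        proof -
          have gen: "ennreal (c1 * c2 * (c3 * c4)) = ennreal c1 * ennreal c2 * (ennreal c3 * ennreal c4)"
            if "0 \<le> c1" "0 \<le> c2" "0 \<le> c3" "0 \<le> c4" for c1 c2 c3 c4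
            using that by (simp add: ennreal_mult)
          show ?thesis by (rule gen) (use w_pos[of 0] w_pos[of "(s, t)"] in auto)
        qed
        finally have "F (s, t) * ennreal (bweight ?L (s, t)) \<le> F (s, t) * (ennreal (1 / w 0) * ennreal (w (s, t)) * (?P s * ?P t))"
          by (rule mult_left_mono) simp
        then show "F (s, t) * ennreal (bweight ?L (s, t)) \<le> (ennreal (1 / w 0) * ?P s) * (?H (s, t) * ?P t)" by (simp only: mult_ac)
      qed
      also have "\<dots> = (ennreal (1 / w 0) * ?P s) * (\<integral>\<^sup>+t. ?H (s, t) * ?P t \<partial>lborel)"
        by (rule nn_integral_cmult) (intro borel_measurable_times_ennreal inner[OF F] pwm)
      also have "\<dots> \<le> (ennreal (1 / w 0) * ?P s) * (ennreal (I + 1) * ?A s)"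
        by (intro mult_left_mono Lp_pairing[OF a inner[OF F] pwm pw1 _ I(1)]) (use I in auto)
      finally show "(\<integral>\<^sup>+t. F (s, t) * ennreal (bweight ?L (s, t)) \<partial>lborel) \<le> (ennreal (1 / w 0) * ennreal (I + 1)) * (?A s * ?P s)"
        by (simp only: mult_ac)
    qed
    also have "\<dots> = (ennreal (1 / w 0) * ennreal (I + 1)) * (\<integral>\<^sup>+s. ?A s * ?P s \<partial>lborel)"
      by (rule nn_integral_cmult) (intro borel_measurable_times_ennreal outer[OF F] pwm)
    also have "\<dots> \<le> (ennreal (1 / w 0) * ennreal (I + 1)) * (ennreal (I + 1) * Lp b lborel ?A)"
      by (intro mult_left_mono Lp_pairing[OF b outer[OF F] pwm pw1 _ I(1)]) (use I in auto)
    also have "\<dots> = ennreal (1 / w 0 * (I + 1) * (I + 1)) * mixn a b w F"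
    proof -
      have gen: "ennreal (c1 * c2 * c3) = ennreal c1 * ennreal c2 * ennreal c3" if "0 \<le> c1" "0 \<le> c2" "0 \<le> c3" for c1 c2 c3
        using that by (simp add: ennreal_mult)
      have "ennreal (1 / w 0 * (I + 1) * (I + 1)) = ennreal (1 / w 0) * ennreal (I + 1) * ennreal (I + 1)"
        by (rule gen) (use w_pos[of 0] I in auto)
      then show ?thesis by (simp only: mixn_def mult.assoc)
    qed
    finally show "(\<integral>\<^sup>+s. \<integral>\<^sup>+t. F (s, t) * ennreal (bweight ?L (s, t)) \<partial>lborel \<partial>lborel) \<le> ennreal (1 / w 0 * (I + 1) * (I + 1)) * mixn a b w F" .
  qed
  then show ?thesis by blast
qed

text \<open>Covers the modulation norms, where position is the inner variable. Exchanging the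
  coordinates preserves the norm of a shift and leaves \<open>bweight\<close> unchanged.\<close>

lemma bf_norm_swap:
  fixes \<rho> :: "((real^'a::finite) \<times> (real^'a) \<Rightarrow> ennreal) \<Rightarrow> ennreal"
  assumes "bf_norm \<rho> S L C"
  shows "bf_norm (\<lambda>F. \<rho> (\<lambda>z. F (prod.swap z))) S L C"
proof -
  interpret bf_norm \<rho> S L C by fact
  have m: "(\<lambda>z. F (prod.swap z)) \<in> borel_measurable borel"
    if "F \<in> borel_measurable borel" for F :: "(real^'a) \<times> (real^'a) \<Rightarrow> ennreal"
  proof (rule measurable_compose[OF _ that])
    show "prod.swap \<in> borel_measurable (borel :: ((real^'a) \<times> (real^'a)) measure)"
      by (intro borel_measurable_continuous_onI continuous_intros)
  qed
  have bs: "bweight L (prod.swap z) = bweight L z" for z :: "(real^'a) \<times> (real^'a)"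
    by (simp add: bweight_def mult.commute)
  show ?thesis
  proof
    fix F :: "(real^'a) \<times> (real^'a) \<Rightarrow> ennreal" and u :: "(real^'a) \<times> (real^'a)"
    assume F: "F \<in> borel_measurable borel"
    have "norm (prod.swap u) = norm u" by (cases u) (simp add: norm_Pair add.commute)
    then have "pweight S (prod.swap u) = pweight S u" by (simp add: pweight_def)
    moreover have "prod.swap z - u = prod.swap (z - prod.swap u)" for z :: "(real^'a) \<times> (real^'a)" by (cases z; cases u) simp
    ultimately show "\<rho> (\<lambda>z. F (prod.swap z - u)) \<le> ennreal (pweight S u) * \<rho> (\<lambda>z. F (prod.swap z))"
      using rho_shift[OF m[OF F], of "prod.swap u"] by simp
  next
    fix F :: "(real^'a) \<times> (real^'a) \<Rightarrow> ennreal"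
    assume F: "F \<in> borel_measurable borel"
    \<comment> \<open>\<open>rho_pairing\<close> prescribes an order of integration, which Tonelli's
      theorem reverses.\<close>
    have "(\<lambda>z. F z * ennreal (bweight L z)) \<in> borel_measurable (lborel \<Otimes>\<^sub>M lborel)"
      using F by (simp add: lborel_prod)
    then have "(\<integral>\<^sup>+x. \<integral>\<^sup>+\<xi>. F (x, \<xi>) * ennreal (bweight L (x, \<xi>)) \<partial>lborel \<partial>lborel) =
        (\<integral>\<^sup>+\<xi>. \<integral>\<^sup>+x. F (x, \<xi>) * ennreal (bweight L (x, \<xi>)) \<partial>lborel \<partial>lborel)"
      by (rule lborel_pair.Fubini[symmetric])
    also have "\<dots> \<le> ennreal C * \<rho> (\<lambda>z. F (prod.swap z))"
      using rho_pairing[OF m[OF F]] by (simp add: bweight_def mult.commute)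
    finally show "(\<integral>\<^sup>+x. \<integral>\<^sup>+\<xi>. F (x, \<xi>) * ennreal (bweight L (x, \<xi>)) \<partial>lborel \<partial>lborel) \<le> ennreal C * \<rho> (\<lambda>z. F (prod.swap z))" .
  next
    fix Fs :: "nat \<Rightarrow> (real^'a) \<times> (real^'a) \<Rightarrow> ennreal" and G :: "(real^'a) \<times> (real^'a) \<Rightarrow> ennreal"
    assume "\<And>n. Fs n \<in> borel_measurable borel" "G \<in> borel_measurable borel" "\<And>n z. Fs n z \<le> G z"
      "\<rho> (\<lambda>z. G (prod.swap z)) < \<infinity>" "\<And>z. (\<lambda>n. Fs n z) \<longlonglongrightarrow> 0"
    then show "(\<lambda>n. \<rho> (\<lambda>z. Fs n (prod.swap z))) \<longlonglongrightarrow> 0"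
      by (intro rho_dominated[where G = "\<lambda>z. G (prod.swap z)"] m) auto
  qed (use rho_bweight C\<rho> in \<open>auto simp: bs intro!: rho_mono rho_cmult rho_add rho_Fatou m\<close>)
qed

section \<open>Averaged time-frequency shifts\<close>

text \<open>The signs are those of the transposed shift: moving the test function by this point
  translates \<open>V f\<close> by \<open>\<delta> *\<^sub>R u\<close>, as shown in
  \<open>V_tfshift\<close>.\<close>

definition tfpoint :: "real \<Rightarrow> (real^'n::finite) \<times> (real^'n) \<Rightarrow> (real^'n) \<times> (real^'n)" where
  "tfpoint \<delta> u = (- (\<delta> *\<^sub>R fst u), \<delta> *\<^sub>R snd u)"

lemma norm_tfpoint: "norm (tfpoint \<delta> u) = \<bar>\<delta>\<bar> * norm u"
proof -
  have "norm (tfpoint \<delta> u) = norm (\<delta> *\<^sub>R u)" by (cases u) (simp add: tfpoint_def norm_Pair)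
  then show ?thesis by simp
qed

lemma norm_tfpoint_le: "\<bar>\<delta>\<bar> \<le> 1 \<Longrightarrow> norm (tfpoint \<delta> u) \<le> norm u"
  unfolding norm_tfpoint using mult_right_mono[of "\<bar>\<delta>\<bar>" 1 "norm u"] by simp

lemma tfpoint_diff: "tfpoint \<delta> u - tfpoint \<delta> u' = tfpoint \<delta> (u - u')"
  by (simp add: tfpoint_def scaleR_diff_right)

text \<open>The transpose of the averaging operator, acting on test functions, where the integral
  can be taken pointwise.\<close>

definition smoothing_adj :: "real \<Rightarrow> (real^'n::finite \<Rightarrow> complex) \<Rightarrow> real^'n \<Rightarrow> complex" where
  "smoothing_adj \<delta> \<phi> = (\<lambda>y. \<integral>u. tfshift (tfpoint \<delta> u) \<phi> y \<partial>gmeasure)"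

lemma fam_tfpoint:
  fixes k :: nat and \<delta> :: real
  assumes \<delta>: "\<bar>\<delta>\<bar> \<le> 1"
  shows "\<exists>C M N'. 0 \<le> C \<and> (\<forall>(\<phi> :: real^'n::finite \<Rightarrow> complex) B. sbound N' (pweight N') B \<phi> \<longrightarrow>
    fam k (pweight k) (\<lambda>u. C * B * pweight M u) (\<lambda>u. tfshift (tfpoint \<delta> u) \<phi>))"
proof -
  obtain C M N' where C: "0 \<le> C" and *: "\<And>(\<phi> :: real^'n \<Rightarrow> complex) B. sbound N' (pweight N') B \<phi> \<Longrightarrow>
    fam k (pweight k) (\<lambda>u. C * B * pweight M u) (\<lambda>u. tfshift u \<phi>)"
    using fam_tfshift[of k, where 'n = 'n] by blast
  have "fam k (pweight k) (\<lambda>u. C * B * pweight M u) (\<lambda>u. tfshift (tfpoint \<delta> u) \<phi>)"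
    if B: "sbound N' (pweight N') B \<phi>" for \<phi> :: "real^'n \<Rightarrow> complex" and B
  proof -
    have B0: "0 \<le> B" using sbound_nonneg[OF B] by simp
    have "fam k (pweight k) (\<lambda>u. C * B * pweight M (tfpoint \<delta> u)) (\<lambda>u. tfshift (tfpoint \<delta> u) \<phi>)"
      by (rule fam_reparam[OF *[OF B]]) (use norm_tfpoint_le[OF \<delta>] in \<open>auto simp: tfpoint_diff\<close>)
    then show ?thesis
      by (rule fam_monoB) (use C B0 norm_tfpoint_le[OF \<delta>] in \<open>auto intro!: mult_left_mono pweight_le_norm\<close>)
  qed
  then show ?thesis using C by blast
qed

lemma fam_tfpoint_schwartz:
  fixes \<phi> :: "real^'n::finite \<Rightarrow> complex"
  assumes \<delta>: "\<bar>\<delta>\<bar> \<le> 1" and \<phi>: "\<phi> \<in> schwartz"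
  obtains C M where "0 \<le> C" "fam k (pweight k) (\<lambda>u. C * pweight M u) (\<lambda>u. tfshift (tfpoint \<delta> u) \<phi>)"
proof -
  obtain C M N' where C: "0 \<le> C" and *: "\<And>(\<phi> :: real^'n \<Rightarrow> complex) B. sbound N' (pweight N') B \<phi> \<Longrightarrow>
    fam k (pweight k) (\<lambda>u. C * B * pweight M u) (\<lambda>u. tfshift (tfpoint \<delta> u) \<phi>)"
    using fam_tfpoint[OF \<delta>, of k, where 'n = 'n] by blast
  obtain B where B: "0 < B" "sbound N' (pweight N') B \<phi>" using schwartzE[OF \<phi>] by blast
  show thesis by (rule that[of "C * B" M]) (use C B *[OF B(2)] in auto)
qed

lemma smoothing_adj_fam:
  fixes \<phi> :: "real^'n::finite \<Rightarrow> complex"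
  assumes "\<bar>\<delta>\<bar> \<le> 1" "\<phi> \<in> schwartz"
  shows "\<exists>\<beta>. integrable gmeasure \<beta> \<and> fam m (pweight m) \<beta> (\<lambda>u. tfshift (tfpoint \<delta> u) \<phi>)"
proof -
  obtain C M where "0 \<le> C" and f: "fam m (pweight m) (\<lambda>u. C * pweight M u) (\<lambda>u. tfshift (tfpoint \<delta> u) \<phi>)"
    by (rule fam_tfpoint_schwartz[OF assms], rule that)
  have "integrable gmeasure (\<lambda>u::(real^'n) \<times> (real^'n). C * pweight M u)"
    by (intro integrable_mult_right integrable_gmeasure_pweight)
  with f show ?thesis by (intro exI conjI)
qed

lemma smoothing_adj_schwartz:
  assumes "\<bar>\<delta>\<bar> \<le> 1" "\<phi> \<in> schwartz"
  shows "smoothing_adj \<delta> \<phi> \<in> schwartz"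
  unfolding smoothing_adj_def by (rule schwartz_integral_fam) (use smoothing_adj_fam[OF assms] in auto)

lemma smoothing_adj_integrable:
  assumes "\<bar>\<delta>\<bar> \<le> 1" "\<phi> \<in> schwartz"
  shows "integrable gmeasure (\<lambda>u. tfshift (tfpoint \<delta> u) \<phi> y)"
proof -
  obtain \<beta> where "integrable gmeasure \<beta>" "fam 0 (pweight 0) \<beta> (\<lambda>u. tfshift (tfpoint \<delta> u) \<phi>)"
    using smoothing_adj_fam[OF assms, of 0] by blast
  then show ?thesis by (intro fam_integrable[where W = "pweight 0"]) (auto simp: pweight_ge1)
qed

lemma smoothing_adj_add:
  assumes "\<bar>\<delta>\<bar> \<le> 1" "f \<in> schwartz" "h \<in> schwartz"
  shows "smoothing_adj \<delta> (\<lambda>x. f x + h x) = (\<lambda>x. smoothing_adj \<delta> f x + smoothing_adj \<delta> h x)"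
proof
  fix y
  have "smoothing_adj \<delta> (\<lambda>x. f x + h x) y = (\<integral>u. tfshift (tfpoint \<delta> u) f y + tfshift (tfpoint \<delta> u) h y \<partial>gmeasure)"
    by (simp add: smoothing_adj_def tfshift_def distrib_left)
  also have "\<dots> = smoothing_adj \<delta> f y + smoothing_adj \<delta> h y"
    unfolding smoothing_adj_def using assms by (intro Bochner_Integration.integral_add smoothing_adj_integrable)
  finally show "smoothing_adj \<delta> (\<lambda>x. f x + h x) y = smoothing_adj \<delta> f y + smoothing_adj \<delta> h y" .
qed

lemma smoothing_adj_cmult: "smoothing_adj \<delta> (\<lambda>x. c * f x) = (\<lambda>x. c * smoothing_adj \<delta> f x)"
  by (rule ext) (simp add: smoothing_adj_def tfshift_def mult.left_commute[of _ c])

lemma smoothing_adj_bound: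
  fixes k :: nat
  assumes \<delta>: "\<bar>\<delta>\<bar> \<le> 1"
  shows "\<exists>C N'. 0 \<le> C \<and> (\<forall>(\<phi> :: real^'n::finite \<Rightarrow> complex) B. sbound N' (pweight N') B \<phi> \<longrightarrow>
    sbound k (pweight k) (C * B) (smoothing_adj \<delta> \<phi>))"
proof -
  let ?k = "Suc (Suc k)"
  obtain C M N' where C: "0 \<le> C" and *: "\<And>(\<phi> :: real^'n \<Rightarrow> complex) B. sbound N' (pweight N') B \<phi> \<Longrightarrow>
    fam ?k (pweight ?k) (\<lambda>u. C * B * pweight M u) (\<lambda>u. tfshift (tfpoint \<delta> u) \<phi>)"
    using fam_tfpoint[OF \<delta>, of ?k, where 'n = 'n] by blast
  define D where "D = C * (\<integral>u. pweight M u \<partial>(gmeasure :: ((real^'n) \<times> (real^'n)) measure))"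
  have "sbound k (pweight k) (D * B) (smoothing_adj \<delta> \<phi>)"
    if B: "sbound N' (pweight N') B \<phi>" for \<phi> :: "real^'n \<Rightarrow> complex" and B
  proof -
    have i: "integrable gmeasure (\<lambda>u::(real^'n) \<times> (real^'n). C * B * pweight M u)"
      by (intro integrable_mult_right integrable_gmeasure_pweight)
    have "sbound k (pweight ?k) (\<integral>u. C * B * pweight M u \<partial>(gmeasure :: ((real^'n) \<times> (real^'n)) measure)) (smoothing_adj \<delta> \<phi>)"
      unfolding smoothing_adj_def by (rule sbound_integral_fam[OF _ i pweight_ge1 *[OF B]]) simp
    then show ?thesis
    proof (rule sbound_mono)
      show "pweight k x \<le> pweight ?k x" for x :: "real^'n" by (rule pweight_mono) simp
      show "(\<integral>u. C * B * pweight M u \<partial>(gmeasure :: ((real^'n) \<times> (real^'n)) measure)) \<le> D * B"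
        unfolding D_def integral_mult_right_zero by simp
    qed
  qed
  moreover have "0 \<le> D" unfolding D_def using C by (intro mult_nonneg_nonneg Bochner_Integration.integral_nonneg) auto
  ultimately show ?thesis by blast
qed

text \<open>The operator \<open>E\<close> at scale \<delta>, defined by duality; the choice is
  justified for \<open>\<bar>\<delta>\<bar> \<le> 1\<close> in
  \<open>apply_smoothing\<close>.\<close>

definition smoothing :: "real \<Rightarrow> 'n::finite tempered_distribution \<Rightarrow> 'n tempered_distribution" where
  "smoothing \<delta> f = (SOME D. \<forall>\<phi>\<in>schwartz. apply_dist D \<phi> = apply_dist f (smoothing_adj \<delta> \<phi>))"

lemma apply_smoothing:
  fixes f :: "'n::finite tempered_distribution"
  assumes \<delta>: "\<bar>\<delta>\<bar> \<le> 1" and "\<phi> \<in> schwartz"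
  shows "apply_dist (smoothing \<delta> f) \<phi> = apply_dist f (smoothing_adj \<delta> \<phi>)"
proof -
  obtain k C where C: "0 \<le> C" and T: "dist_bound k C (apply_dist f)" using dist_bound_apply_dist by blast
  obtain D N' where D: "\<And>(\<phi> :: real^'n \<Rightarrow> complex) B. sbound N' (pweight N') B \<phi> \<Longrightarrow> sbound k (pweight k) (D * B) (smoothing_adj \<delta> \<phi>)"
    using smoothing_adj_bound[OF \<delta>, of k, where 'n = 'n] by blast
  have "\<exists>D. \<forall>\<phi>\<in>schwartz. apply_dist D \<phi> = apply_dist f (smoothing_adj \<delta> \<phi>)"
  proof (rule dist_exists)
    show "dist_bound N' (C * D) (\<lambda>\<phi>. apply_dist f (smoothing_adj \<delta> \<phi>))"
      unfolding dist_bound_def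
    proof (intro ballI allI impI)
      fix \<phi> :: "real^'n \<Rightarrow> complex" and B assume "\<phi> \<in> schwartz" "sbound N' (pweight N') B \<phi>"
      then show "cmod (apply_dist f (smoothing_adj \<delta> \<phi>)) \<le> C * D * B"
        using dist_boundD[OF T smoothing_adj_schwartz[OF \<delta>] D] by (simp add: mult.assoc)
    qed
  qed (simp_all add: smoothing_adj_add[OF \<delta>] smoothing_adj_cmult apply_dist_add apply_dist_cmult smoothing_adj_schwartz[OF \<delta>])
  from someI_ex[OF this] show ?thesis unfolding smoothing_def[symmetric] using assms(2) by blast
qed

lemma apply_smoothing_integral:
  assumes "\<bar>\<delta>\<bar> \<le> 1" "\<phi> \<in> schwartz"
  shows "apply_dist (smoothing \<delta> f) \<phi> = (\<integral>u. apply_dist f (tfshift (tfpoint \<delta> u) \<phi>) \<partial>gmeasure)"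
  unfolding apply_smoothing[OF assms] smoothing_adj_def
  by (rule apply_dist_integral) (use smoothing_adj_fam[OF assms] schwartz_tfshift[OF assms(2)] gmeasure_finite in auto)

context bf_norm
begin

text \<open>Minkowski's integral inequality, obtained from quadrature and Fatou's lemma instead of duality.\<close>

lemma rho_integral_le:
  fixes a :: "'a::euclidean_space \<Rightarrow> (real^'n) \<times> (real^'n) \<Rightarrow> complex"
  assumes meas: "\<And>u. a u \<in> borel_measurable borel"
    and lip: "\<And>z. \<exists>C M. \<forall>u. cmod (a u z) \<le> C * pweight M u \<and>
      (\<forall>u'. norm (u - u') \<le> 1 \<longrightarrow> cmod (a u z - a u' z) \<le> norm (u - u') * (C * pweight M u))"
    and m: "\<And>u. \<rho> (\<lambda>z. ennreal (cmod (a u z))) \<le> ennreal (c0 + c1 * pweight k u)"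
    and c: "0 \<le> c0" "0 \<le> c1"
  shows "\<rho> (\<lambda>z. ennreal (cmod (\<integral>u. a u z \<partial>gmeasure))) \<le>
    ennreal (c0 + c1 * (\<integral>u. pweight k u \<partial>(gmeasure :: 'a measure)))"
proof -
  obtain J cf where q: "quadrature (gmeasure :: 'a measure) J cf"
    using quadrature_exists[of "gmeasure :: 'a measure"] gmeasure_finite by auto
  then have J: "finite (J n)" and cf: "0 \<le> cf n u" for n u unfolding quadrature_def by auto
  define S where "S n z = (\<Sum>u\<in>J n. complex_of_real (cf n u) * a u z)" for n z
  define s where "s n = (\<Sum>u\<in>J n. cf n u * (c0 + c1 * pweight k u))" for n
  \<comment> \<open>The sums of the bounds must converge to their integral under the same quadrature
    rule, so the weight needs a local Lipschitz bound as well.\<close>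
  have pw_lip: "\<bar>pweight k u - pweight k u'\<bar> \<le> norm (u - u') * (k * 2 ^ k * pweight k u)" if "norm (u - u') \<le> 1" for u u' :: 'a
  proof -
    let ?A = "1 + norm u" and ?B = "1 + norm u'"
    have "\<bar>?A ^ k - ?B ^ k\<bar> = \<bar>(?A - ?B) * (\<Sum>i<k. ?B ^ (k - Suc i) * ?A ^ i)\<bar>"
      by (simp only: power_diff_sumr2[of ?A k ?B])
    also have "\<dots> \<le> norm (u - u') * (\<Sum>i<k. 2 ^ k * ?A ^ k)"
    proof -
      have "norm u' \<le> norm u + 1" using that norm_triangle_sub[of u' u] norm_minus_commute[of u u'] by linarith
      then have B: "?B \<le> 2 * ?A" using norm_ge_zero[of u] by (simp del: norm_ge_zero)
      have "?B ^ (k - Suc i) * ?A ^ i \<le> 2 ^ k * ?A ^ k" if "i < k" for i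
      proof -
        have "?B ^ (k - Suc i) * ?A ^ i \<le> (2 * ?A) ^ (k - Suc i) * (2 * ?A) ^ i"
          using B norm_ge_zero[of u] norm_ge_zero[of u'] by (intro mult_mono power_mono) auto
        also have "\<dots> = (2 * ?A) ^ (k - 1)" using that by (simp flip: power_add)
        also have "\<dots> \<le> (2 * ?A) ^ k" using norm_ge_zero[of u] by (intro power_increasing) auto
        finally show ?thesis by (simp only: power_mult_distrib)
      qed
      then have "(\<Sum>i<k. ?B ^ (k - Suc i) * ?A ^ i) \<le> (\<Sum>i<k. 2 ^ k * ?A ^ k)" by (intro sum_mono) auto
      moreover have "0 \<le> (\<Sum>i<k. ?B ^ (k - Suc i) * ?A ^ i)" by (intro sum_nonneg) auto
      moreover have "\<bar>?A - ?B\<bar> \<le> norm (u - u')" using norm_triangle_ineq3[of u u'] by simp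
      ultimately show ?thesis unfolding abs_mult by (intro mult_mono) auto
    qed
    finally show ?thesis by (simp add: pweight_def)
  qed
  have "\<rho> (\<lambda>z. ennreal (cmod (\<integral>u. a u z \<partial>gmeasure))) \<le> ennreal (\<integral>u. c0 + c1 * pweight k u \<partial>(gmeasure :: 'a measure))"
  proof (rule rho_limit_le[where a = S and m = s])
    show "S n \<in> borel_measurable borel" for n
      unfolding S_def using meas by (intro borel_measurable_sum borel_measurable_times) auto
    show "(\<lambda>n. S n z) \<longlonglongrightarrow> (\<integral>u. a u z \<partial>gmeasure)" for z
    proof -
      obtain C M where CM: "\<forall>u. cmod (a u z) \<le> C * pweight M u \<and>
          (\<forall>u'. norm (u - u') \<le> 1 \<longrightarrow> cmod (a u z - a u' z) \<le> norm (u - u') * (C * pweight M u))"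
        using lip[of z] by blast
      show ?thesis unfolding S_def
        by (rule quadrature_LIMSEQ[OF q, where \<beta> = "\<lambda>u. C * pweight M u"])
          (use CM in \<open>auto intro!: integrable_mult_right integrable_gmeasure_pweight\<close>)
    qed
    show "\<rho> (\<lambda>z. ennreal (cmod (S n z))) \<le> ennreal (s n)" for n
    proof -
      have "\<rho> (\<lambda>z. ennreal (cmod (S n z))) \<le> (\<Sum>u\<in>J n. ennreal (cf n u) * \<rho> (\<lambda>z. ennreal (cmod (a u z))))"
        unfolding S_def by (rule rho_sum_le) (use J meas cf in auto)
      also have "\<dots> \<le> (\<Sum>u\<in>J n. ennreal (cf n u) * ennreal (c0 + c1 * pweight k u))"
        by (intro sum_mono mult_left_mono m) auto
      also have "\<dots> = ennreal (s n)"
        unfolding s_def using cf c by (subst sum_ennreal[symmetric]) (auto simp: ennreal_mult)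
      finally show ?thesis .
    qed
    \<comment> \<open>The quadrature is stated for complex integrands; the limit of the real bounds
      is read off from it.\<close>
    have "(\<lambda>n. \<Sum>u\<in>J n. complex_of_real (cf n u) * complex_of_real (c0 + c1 * pweight k u)) \<longlonglongrightarrow>
        (\<integral>u. complex_of_real (c0 + c1 * pweight k u) \<partial>(gmeasure :: 'a measure))"
    proof (rule quadrature_LIMSEQ[OF q, where \<beta> = "\<lambda>u. (c0 + c1 + c1 * (k * 2 ^ k)) * pweight k u"])
      fix u u' :: 'a
      have 1: "1 \<le> pweight k u" by (rule pweight_ge1)
      have "c0 \<le> c0 * pweight k u" using c 1 by (simp add: mult_left_mono[of 1 _ c0, simplified])
      moreover have "0 \<le> c1 * (k * 2 ^ k) * pweight k u" using c by simp
      ultimately have "c0 + c1 * pweight k u \<le> (c0 + c1 + c1 * (k * 2 ^ k)) * pweight k u"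
        by (simp add: distrib_right)
      moreover have "0 \<le> c0 + c1 * pweight k u" using c by simp
      ultimately show "cmod (complex_of_real (c0 + c1 * pweight k u)) \<le> (c0 + c1 + c1 * (k * 2 ^ k)) * pweight k u"
        by (simp only: norm_of_real abs_of_nonneg)
      assume near: "norm (u - u') \<le> 1"
      have "cmod (complex_of_real (c0 + c1 * pweight k u) - complex_of_real (c0 + c1 * pweight k u')) = c1 * \<bar>pweight k u - pweight k u'\<bar>"
        using c by (simp only: of_real_diff[symmetric] norm_of_real) (simp add: right_diff_distrib[symmetric] abs_mult)
      also have "\<dots> \<le> c1 * (norm (u - u') * (k * 2 ^ k * pweight k u))"
        using c by (intro mult_left_mono pw_lip[OF near]) auto
      also have "\<dots> = norm (u - u') * ((c1 * (k * 2 ^ k)) * pweight k u)" by simp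
      also have "\<dots> \<le> norm (u - u') * ((c0 + c1 + c1 * (k * 2 ^ k)) * pweight k u)"
        using c by (intro mult_left_mono mult_right_mono) auto
      finally show "cmod (complex_of_real (c0 + c1 * pweight k u) - complex_of_real (c0 + c1 * pweight k u')) \<le>
          norm (u - u') * ((c0 + c1 + c1 * (k * 2 ^ k)) * pweight k u)" .
    qed (intro integrable_mult_right integrable_gmeasure_pweight)
    then have "(\<lambda>n. complex_of_real (s n)) \<longlonglongrightarrow> complex_of_real (\<integral>u. c0 + c1 * pweight k u \<partial>(gmeasure :: 'a measure))"
      unfolding s_def integral_complex_of_real by simp
    then show "s \<longlonglongrightarrow> (\<integral>u. c0 + c1 * pweight k u \<partial>(gmeasure :: 'a measure))"
      by (simp only: tendsto_of_real_iff)
  qed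
  also have "(\<integral>u. c0 + c1 * pweight k u \<partial>(gmeasure :: 'a measure)) = c0 + c1 * (\<integral>u. pweight k u \<partial>(gmeasure :: 'a measure))"
    using integrable_gmeasure_pweight[of k, where 'a = 'a] gmeasure.prob_space[where 'a = 'a]
    by (subst Bochner_Integration.integral_add) auto
  finally show ?thesis .
qed

end

section \<open>Averaged shifts seen through the short-time Fourier transform\<close>

context bf_window
begin

text \<open>Covariance of the short-time Fourier transform. Composing two time-frequency shifts adds
  their parameters and produces a phase, which does not affect norms.\<close>

lemma V_tfshift:
  "apply_dist f (tfshift (tfpoint \<delta> u) (tfshift (fst z, - snd z) (\<lambda>y. cnj (g y)))) =
    cexp (- snd z) (\<delta> *\<^sub>R fst u) * V f (z - \<delta> *\<^sub>R u)"
proof -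
  have "tfshift (tfpoint \<delta> u) (tfshift (fst z, - snd z) (\<lambda>y. cnj (g y))) =
      (\<lambda>y. cexp (- snd z) (\<delta> *\<^sub>R fst u) * tfshift (fst (z - \<delta> *\<^sub>R u), - snd (z - \<delta> *\<^sub>R u)) (\<lambda>y. cnj (g y)) y)"
  proof
    fix y
    have "cexp (\<delta> *\<^sub>R snd u + - snd z) y = cexp (\<delta> *\<^sub>R snd u) y * cexp (- snd z) y" by (rule cexp_add)
    moreover have "cexp (- snd z) (y + \<delta> *\<^sub>R fst u) = cexp (- snd z) y * cexp (- snd z) (\<delta> *\<^sub>R fst u)" by (rule cexp_add_right)
    ultimately show "tfshift (tfpoint \<delta> u) (tfshift (fst z, - snd z) (\<lambda>y. cnj (g y))) y =
      cexp (- snd z) (\<delta> *\<^sub>R fst u) * tfshift (fst (z - \<delta> *\<^sub>R u), - snd (z - \<delta> *\<^sub>R u)) (\<lambda>y. cnj (g y)) y"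
      by (simp add: tfshift_def tfpoint_def algebra_simps)
  qed
  then show ?thesis
    by (simp add: V_eq apply_dist_cmult schwartz_tfshift schwartz_cnj g)
qed

lemma V_smoothing:
  assumes "\<bar>\<delta>\<bar> \<le> 1"
  shows "V (smoothing \<delta> f) z = (\<integral>u. cexp (- snd z) (\<delta> *\<^sub>R fst u) * V f (z - \<delta> *\<^sub>R u) \<partial>gmeasure)"
  unfolding V_eq[of "smoothing \<delta> f"] apply_smoothing_integral[OF assms schwartz_tfshift[OF schwartz_cnj[OF g]]] V_tfshift ..

text \<open>Obtained on the side of the test functions from \<open>dist_fam\<close>, so the phase is
  included. It supplies the envelope and Lipschitz hypothesis of
  \<open>rho_integral_le\<close>.\<close>

lemma shifted_V_lip:
  assumes "\<bar>\<delta>\<bar> \<le> 1"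
  shows "\<exists>C M. 0 \<le> C \<and> (\<forall>u. cmod (cexp (- snd z) (\<delta> *\<^sub>R fst u) * V f (z - \<delta> *\<^sub>R u)) \<le> C * pweight M u \<and>
      (\<forall>u'. norm (u - u') \<le> 1 \<longrightarrow> cmod (cexp (- snd z) (\<delta> *\<^sub>R fst u) * V f (z - \<delta> *\<^sub>R u) -
        cexp (- snd z) (\<delta> *\<^sub>R fst u') * V f (z - \<delta> *\<^sub>R u')) \<le> norm (u - u') * (C * pweight M u)))"
proof -
  let ?at = "tfshift (fst z, - snd z) (\<lambda>y. cnj (g y))"
  have at: "?at \<in> schwartz" by (intro schwartz_tfshift schwartz_cnj g)
  obtain k C where C: "0 \<le> C" and T: "dist_bound k C (apply_dist f)" using dist_bound_apply_dist by blast
  obtain D M where D: "0 \<le> D" and fam: "fam k (pweight k) (\<lambda>u. D * pweight M u) (\<lambda>u. tfshift (tfpoint \<delta> u) ?at)"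
    by (rule fam_tfpoint_schwartz[OF assms at], rule that)
  note * = dist_fam[OF T C fam schwartz_tfshift[OF at], unfolded V_tfshift]
  show ?thesis
    by (intro exI[of _ "C * D"] exI[of _ M]) (use * C D in \<open>auto simp: mult.assoc\<close>)
qed

lemma shifted_V_measurable: "(\<lambda>z. cexp (- snd z) a * V f (z - b)) \<in> borel_measurable borel"
  unfolding cexp_def by measurable

lemma nm_shift:
  "\<rho> (\<lambda>z. ennreal (cmod (cexp (- snd z) a * V f (z - b)))) \<le> ennreal (pweight S b) * nm f"
  unfolding norm_mult norm_cexp mult_1_left nm_def by (rule rho_shift) measurable

definition pmoment :: "nat \<Rightarrow> real" where
  "pmoment k = (\<integral>u. pweight k u \<partial>(gmeasure :: ((real^'n) \<times> (real^'n)) measure))"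

lemma pmoment_nonneg: "0 \<le> pmoment k"
  unfolding pmoment_def by (intro Bochner_Integration.integral_nonneg) auto

text \<open>The function \<open>(1 + t * norm u) ^ k\<close> of t is convex, hence below its chord
  between 0 and 1. The bound tends to 1 with \<delta>; monotonicity of the weight would give only
  some constant, which is useless for contractions.\<close>

lemma pweight_scale_le:
  fixes u :: "'b::real_normed_vector"
  assumes "0 \<le> \<delta>" "\<delta> \<le> 1"
  shows "pweight k (\<delta> *\<^sub>R u) \<le> (1 - \<delta>) + \<delta> * pweight k u"
proof (induction k)
  case 0
  then show ?case by (simp add: pweight_def)
next
  case (Suc k)
  let ?P = "pweight k u" and ?a = "norm u"
  have "pweight (Suc k) (\<delta> *\<^sub>R u) = pweight k (\<delta> *\<^sub>R u) * (1 + \<delta> * ?a)"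
    using assms by (simp add: pweight_def)
  also have "\<dots> \<le> ((1 - \<delta>) + \<delta> * ?P) * (1 + \<delta> * ?a)"
    using Suc assms by (intro mult_right_mono) auto
  \<comment> \<open>The subtracted term is a product of non-negative factors and is dropped in the
    next line.\<close>
  also have "\<dots> = (1 - \<delta>) + \<delta> * (?P * (1 + ?a)) - \<delta> * ?a * (1 - \<delta>) * (?P - 1)" by (simp add: algebra_simps)
  also have "\<dots> \<le> (1 - \<delta>) + \<delta> * (?P * (1 + ?a))"
    using assms pweight_ge1[of k u] by simp
  finally show ?case by (simp add: pweight_def mult_ac)
qed

text \<open>A translate by \<open>\<delta> *\<^sub>R u\<close> costs
  \<open>pweight S (\<delta> *\<^sub>R u)\<close>. Minkowski's inequality averages this cost, and
  the chord estimate bounds the average.\<close>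

lemma smoothing_norm:
  assumes \<delta>: "0 \<le> \<delta>" "\<delta> \<le> 1" and f: "f \<in> X"
  shows "smoothing \<delta> f \<in> X" "N (smoothing \<delta> f) \<le> (1 + \<delta> * pmoment S) * N f"
proof -
  have d: "\<bar>\<delta>\<bar> \<le> 1" using \<delta> by simp
  have "nm (smoothing \<delta> f) \<le> ennreal (N f + (\<delta> * N f) * pmoment S)"
    unfolding nm_def V_smoothing[OF d] pmoment_def
  proof (rule rho_integral_le)
    show "\<exists>C M. \<forall>u. cmod (cexp (- snd z) (\<delta> *\<^sub>R fst u) * V f (z - \<delta> *\<^sub>R u)) \<le> C * pweight M u \<and>
      (\<forall>u'. norm (u - u') \<le> 1 \<longrightarrow> cmod (cexp (- snd z) (\<delta> *\<^sub>R fst u) * V f (z - \<delta> *\<^sub>R u) -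
        cexp (- snd z) (\<delta> *\<^sub>R fst u') * V f (z - \<delta> *\<^sub>R u')) \<le> norm (u - u') * (C * pweight M u))" for z
      using shifted_V_lip[OF d, of z f] by blast
    fix u :: "(real^'n) \<times> (real^'n)"
    have "pweight S (\<delta> *\<^sub>R u) \<le> 1 + \<delta> * pweight S u" using pweight_scale_le[OF \<delta>, of S u] \<delta> by linarith
    then have "pweight S (\<delta> *\<^sub>R u) * N f \<le> (1 + \<delta> * pweight S u) * N f" by (rule mult_right_mono) simp
    then have "ennreal (pweight S (\<delta> *\<^sub>R u)) * nm f \<le> ennreal (N f + \<delta> * N f * pweight S u)"
      unfolding nm_eq[OF f] by (subst ennreal_mult[symmetric]) (auto intro!: ennreal_leI simp: algebra_simps)
    with nm_shift show "\<rho> (\<lambda>z. ennreal (cmod (cexp (- snd z) (\<delta> *\<^sub>R fst u) * V f (z - \<delta> *\<^sub>R u)))) \<le> ennreal (N f + \<delta> * N f * pweight S u)"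
      by (rule order_trans)
  qed (use \<delta> shifted_V_measurable in auto)
  moreover have "0 \<le> N f + (\<delta> * N f) * pmoment S" using \<delta> pmoment_nonneg by simp
  ultimately have *: "smoothing \<delta> f \<in> X \<and> N (smoothing \<delta> f) \<le> N f + (\<delta> * N f) * pmoment S" by (rule N_le)
  then show "smoothing \<delta> f \<in> X" "N (smoothing \<delta> f) \<le> (1 + \<delta> * pmoment S) * N f" by (auto simp: algebra_simps)
qed

section \<open>Strong convergence of the averages to the identity\<close>

definition shift_diff :: "'n tempered_distribution \<Rightarrow> (real^'n) \<times> (real^'n) \<Rightarrow> (real^'n) \<times> (real^'n) \<Rightarrow> complex" where
  "shift_diff f u z = cexp (- snd z) (fst u) * V f (z - u) - V f z"

lemma shift_diff_measurable: "shift_diff f u \<in> borel_measurable borel"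
  unfolding shift_diff_def using shifted_V_measurable by (intro borel_measurable_diff) auto

lemma rho_indicator_compl_small:
  assumes f: "f \<in> X" and e: "0 < e"
  shows "\<exists>R::nat. \<rho> (\<lambda>z. indicator (- cball 0 (real R)) z * ennreal (cmod (V f z))) < ennreal e"
proof -
  have "(\<lambda>n. \<rho> (\<lambda>z. indicator (- cball 0 (real n)) z * ennreal (cmod (V f z)))) \<longlonglongrightarrow> 0"
  proof (rule rho_dominated[where G = "\<lambda>z. ennreal (cmod (V f z))"])
    show "\<rho> (\<lambda>z. ennreal (cmod (V f z))) < \<infinity>" using f by (simp add: X_def nm_def)
    show "(\<lambda>n. indicator (- cball 0 (real n)) z * ennreal (cmod (V f z))) \<longlonglongrightarrow> 0" for z
    proof (rule tendsto_eventually)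
      obtain n0 :: nat where n0: "norm z \<le> real n0" using real_arch_simple by blast
      show "\<forall>\<^sub>F n in sequentially. indicator (- cball 0 (real n)) z * ennreal (cmod (V f z)) = 0"
        using eventually_ge_at_top[of n0]
      proof eventually_elim
        case (elim n)
        then have "norm z \<le> real n" using n0 by linarith
        then show ?case by simp
      qed
    qed
  qed (auto simp: indicator_def)
  then have "\<forall>\<^sub>F n in sequentially. \<rho> (\<lambda>z. indicator (- cball 0 (real n)) z * ennreal (cmod (V f z))) < ennreal e"
    by (rule order_tendstoD) (use e in simp)
  then show ?thesis using eventually_happens'[OF sequentially_bot] by blast
qed

text \<open>On a ball \<open>bweight\<close> is bounded below, so it dominates constants
  there.\<close>

lemma rho_cball_finite: "\<rho> (\<lambda>z. indicator (cball 0 R) z * ennreal c) < \<infinity>"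
proof -
  have "\<rho> (\<lambda>z. indicator (cball 0 R) z * ennreal c) \<le> \<rho> (\<lambda>z. ennreal (\<bar>c\<bar> * (1 + \<bar>R\<bar>) ^ (2 * L)) * ennreal (bweight L z))"
  proof (rule rho_mono)
    fix z :: "(real^'n) \<times> (real^'n)"
    show "indicator (cball 0 R) z * ennreal c \<le> ennreal (\<bar>c\<bar> * (1 + \<bar>R\<bar>) ^ (2 * L)) * ennreal (bweight L z)"
    proof (cases "z \<in> cball 0 R")
      case True
      then have "norm z \<le> \<bar>R\<bar>" by simp
      then have "norm (fst z) \<le> \<bar>R\<bar>" "norm (snd z) \<le> \<bar>R\<bar>"
        using norm_fst_le[of "fst z" "snd z"] norm_snd_le[of "snd z" "fst z"] by auto
      then have "pweight L (fst z) * pweight L (snd z) \<le> (1 + \<bar>R\<bar>) ^ L * (1 + \<bar>R\<bar>) ^ L"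
        unfolding pweight_def by (intro mult_mono power_mono) auto
      then have "1 \<le> (1 + \<bar>R\<bar>) ^ (2 * L) * bweight L z"
        using pweight_pos[of L "fst z"] pweight_pos[of L "snd z"] by (simp add: bweight_def mult_2 power_add)
      from mult_left_mono[OF this, of "\<bar>c\<bar>"]
      have "c \<le> \<bar>c\<bar> * (1 + \<bar>R\<bar>) ^ (2 * L) * bweight L z" by (simp add: mult.assoc)
      then show ?thesis using True by (simp add: ennreal_mult[symmetric] ennreal_leI)
    qed simp
    show "(\<lambda>z. indicator (cball 0 R) z * ennreal c) \<in> borel_measurable borel"
      by (intro borel_measurable_times_ennreal borel_measurable_indicator borel_measurable_const borel_closed closed_cball)
  qed auto
  also have "\<dots> = ennreal (\<bar>c\<bar> * (1 + \<bar>R\<bar>) ^ (2 * L)) * \<rho> (\<lambda>z. ennreal (bweight L z))"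
    by (rule rho_cmult) auto
  also have "\<dots> < \<infinity>" using rho_bweight by (simp add: ennreal_mult_less_top)
  finally show ?thesis .
qed

text \<open>The translates of \<open>V f\<close> come with no common majorant of finite norm, so
  dominated convergence is not applied on all of phase space. Outside a large ball the norm of
  \<open>V f\<close> is small, also after a short shift; inside, \<open>V f\<close> is bounded and
  continuous, and constants have finite norm.\<close>

lemma rho_shift_diff_tendsto:
  assumes f: "f \<in> X" and u: "u \<longlonglongrightarrow> 0" and u1: "\<And>n. norm (u n) \<le> 1"
  shows "(\<lambda>n. \<rho> (\<lambda>z. ennreal (cmod (shift_diff f (u n) z)))) \<longlonglongrightarrow> 0"
proof (rule order_tendstoI)
  fix a :: ennreal assume a: "0 < a"
  \<comment> \<open>The threshold may be infinite; the minimum with 1 makes it a real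
    number.\<close>
  define e where "e = enn2real (min a 1)"
  have fin: "min a 1 < \<top>" by (simp add: min_less_iff_disj)
  then have "ennreal e = min a 1" unfolding e_def by (rule ennreal_enn2real)
  then have e: "0 < e" "ennreal e \<le> a"
    using a fin by (auto simp: e_def enn2real_positive_iff)
  \<comment> \<open>The tail occurs once shifted, at a cost of at most \<open>2 ^ S\<close>, and
    once unshifted; together they stay below \<open>e / 2\<close>.\<close>
  define e' where "e' = e / (2 * (2 ^ S + 1))"
  have e': "0 < e'" using e by (simp add: e'_def add_pos_pos)
  obtain R0 :: nat where R0: "\<rho> (\<lambda>z. indicator (- cball 0 (real R0)) z * ennreal (cmod (V f z))) < ennreal e'"
    using rho_indicator_compl_small[OF f e'] by blast
  let ?T = "\<lambda>z. indicator (- cball 0 (real R0)) z * ennreal (cmod (V f z))"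
  let ?R = "real R0 + 1"
  have T[measurable]: "?T \<in> borel_measurable borel" by measurable
  have sd[measurable]: "(\<lambda>z. ennreal (cmod (shift_diff f v z))) \<in> borel_measurable borel" for v
    using shift_diff_measurable[of f v] by measurable
  have le: "\<rho> (\<lambda>z. ennreal (cmod (shift_diff f v z))) \<le>
      \<rho> (\<lambda>z. indicator (cball 0 ?R) z * ennreal (cmod (shift_diff f v z))) + ennreal ((2 ^ S + 1) * e')"
    if v: "norm v \<le> 1" for v
  proof -
    have Tvm: "(\<lambda>z. ?T (z - v)) \<in> borel_measurable borel"
      by (rule measurable_compose[OF _ T]) measurable
    have TTm: "(\<lambda>z. ?T (z - v) + ?T z) \<in> borel_measurable borel"
      by (intro borel_measurable_add Tvm T)
    have ISm: "(\<lambda>z. indicator (cball 0 ?R) z * ennreal (cmod (shift_diff f v z))) \<in> borel_measurable borel"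
      by (intro borel_measurable_times_ennreal borel_measurable_indicator sd borel_closed closed_cball)
    have "\<rho> (\<lambda>z. ennreal (cmod (shift_diff f v z))) \<le>
        \<rho> (\<lambda>z. indicator (cball 0 ?R) z * ennreal (cmod (shift_diff f v z)) + (?T (z - v) + ?T z))"
    proof (rule rho_mono)
      fix z
      show "ennreal (cmod (shift_diff f v z)) \<le> indicator (cball 0 ?R) z * ennreal (cmod (shift_diff f v z)) + (?T (z - v) + ?T z)"
      proof (cases "norm z \<le> ?R")
        case True
        then show ?thesis by simp
      next
        case False
        \<comment> \<open>The radius was enlarged by 1, so both \<open>z\<close> and
          \<open>z - v\<close> lie outside the smaller ball.\<close>
        have "norm z \<le> norm (z - v) + norm v" using norm_triangle_ineq[of "z - v" v] by simp
        then have "\<not> norm (z - v) \<le> real R0" "\<not> norm z \<le> real R0" using False v by linarith+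
        then have "?T (z - v) + ?T z = ennreal (cmod (V f (z - v)) + cmod (V f z))" by simp
        moreover have "cmod (shift_diff f v z) \<le> cmod (V f (z - v)) + cmod (V f z)"
          using norm_triangle_ineq4[of "cexp (- snd z) (fst v) * V f (z - v)" "V f z"]
          by (simp add: shift_diff_def norm_mult norm_cexp)
        ultimately have "ennreal (cmod (shift_diff f v z)) \<le> ?T (z - v) + ?T z" by (simp only: ennreal_leI)
        then show ?thesis by (rule add_increasing[rotated]) simp
      qed
      show "(\<lambda>z. ennreal (cmod (shift_diff f v z))) \<in> borel_measurable borel" by (rule sd)
      show "(\<lambda>z. indicator (cball 0 ?R) z * ennreal (cmod (shift_diff f v z)) + (?T (z - v) + ?T z)) \<in> borel_measurable borel"
        by (intro borel_measurable_add ISm TTm)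
    qed
    also have "\<dots> \<le> \<rho> (\<lambda>z. indicator (cball 0 ?R) z * ennreal (cmod (shift_diff f v z))) + \<rho> (\<lambda>z. ?T (z - v) + ?T z)"
      by (rule rho_add[OF ISm TTm])
    also have "\<rho> (\<lambda>z. ?T (z - v) + ?T z) \<le> \<rho> (\<lambda>z. ?T (z - v)) + \<rho> ?T"
      by (rule rho_add[OF Tvm T])
    also have "\<rho> (\<lambda>z. ?T (z - v)) \<le> ennreal (pweight S v) * \<rho> ?T" by (rule rho_shift[OF T])
    also have "ennreal (pweight S v) * \<rho> ?T \<le> ennreal (2 ^ S) * ennreal e'"
      using pweight_le_1[OF v, of S] R0 by (intro mult_mono ennreal_leI) auto
    also have "\<rho> ?T \<le> ennreal e'" using R0 by simp
    also have "ennreal (2 ^ S) * ennreal e' + ennreal e' = ennreal ((2 ^ S + 1) * e')"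
      using e' by (simp add: ennreal_mult[symmetric] ennreal_plus[symmetric] distrib_right del: ennreal_plus)
    finally show ?thesis by (simp add: add_left_mono)
  qed
  have "(\<lambda>n. \<rho> (\<lambda>z. indicator (cball 0 ?R) z * ennreal (cmod (shift_diff f (u n) z)))) \<longlonglongrightarrow> 0"
  proof -
    obtain D M where D: "0 \<le> D" "\<And>z. cmod (stft g f (fst z) (snd z)) \<le> D * pweight M z"
      and "\<And>z z'. norm (z - z') \<le> 1 \<Longrightarrow>
        cmod (stft g f (fst z) (snd z) - stft g f (fst z') (snd z')) \<le> norm (z - z') * (D * pweight M z)"
      by (rule stft_bounds[OF g, of f], rule that)
    \<comment> \<open>Twice the bound of \<open>V f\<close> on the ball enlarged once more by 1,
      since the points \<open>z - u n\<close> also occur.\<close>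
    define K where "K = 2 * (D * (1 + (?R + 1)) ^ M)"
    show ?thesis
    proof (rule rho_dominated[where G = "\<lambda>z. indicator (cball 0 ?R) z * ennreal K"])
      show "indicator (cball 0 ?R) z * ennreal (cmod (shift_diff f (u n) z)) \<le> indicator (cball 0 ?R) z * ennreal K" for n z
      proof (cases "norm z \<le> ?R")
        case True
        have V: "cmod (V f w) \<le> D * (1 + (?R + 1)) ^ M" if "norm w \<le> ?R + 1" for w
        proof -
          have "pweight M w \<le> (1 + (?R + 1)) ^ M" unfolding pweight_def using that by (intro power_mono) auto
          then have "D * pweight M w \<le> D * (1 + (?R + 1)) ^ M" using D(1) by (rule mult_left_mono)
          then show ?thesis using D(2)[of w] unfolding V_def by linarith
        qed
        have "norm (z - u n) \<le> ?R + 1" using True u1[of n] norm_triangle_ineq4[of z "u n"] by linarith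
        then have "cmod (V f (z - u n)) + cmod (V f z) \<le> K" using V[of "z - u n"] V[of z] True by (simp add: K_def)
        moreover have "cmod (shift_diff f (u n) z) \<le> cmod (V f (z - u n)) + cmod (V f z)"
          using norm_triangle_ineq4[of "cexp (- snd z) (fst (u n)) * V f (z - u n)" "V f z"]
          by (simp add: shift_diff_def norm_mult norm_cexp)
        ultimately show ?thesis by (intro mult_left_mono ennreal_leI) auto
      qed simp
      show "\<rho> (\<lambda>z. indicator (cball 0 ?R) z * ennreal K) < \<infinity>" by (rule rho_cball_finite)
      show "(\<lambda>n. indicator (cball 0 ?R) z * ennreal (cmod (shift_diff f (u n) z))) \<longlonglongrightarrow> 0" for z
      proof -
        have "isCont (V f) (z - 0)"
          using continuous_stft[OF g, of f] continuous_on_eq_continuous_at[OF open_UNIV, of "V f"]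
          unfolding V_def[abs_def] by blast
        then have 1: "(\<lambda>n. V f (z - u n)) \<longlonglongrightarrow> V f (z - 0)"
          by (rule isCont_tendsto_compose) (intro tendsto_diff tendsto_const u)
        have "(\<lambda>n. fst (u n)) \<longlonglongrightarrow> fst (0 :: (real^'n) \<times> (real^'n))" by (intro tendsto_fst u)
        then have 2: "(\<lambda>n. cexp (- snd z) (fst (u n))) \<longlonglongrightarrow> cexp (- snd z) (fst (0 :: (real^'n) \<times> (real^'n)))"
          unfolding cexp_def by (intro tendsto_intros u)
        have "(\<lambda>n. shift_diff f (u n) z) \<longlonglongrightarrow> cexp (- snd z) (fst (0 :: (real^'n) \<times> (real^'n))) * V f (z - 0) - V f z"
          unfolding shift_diff_def by (intro tendsto_diff tendsto_mult 1 2 tendsto_const)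
        then have "(\<lambda>n. shift_diff f (u n) z) \<longlonglongrightarrow> 0" by (simp add: cexp_def)
        then have "(\<lambda>n. ennreal (cmod (shift_diff f (u n) z))) \<longlonglongrightarrow> ennreal (cmod 0)"
          by (intro tendsto_ennrealI tendsto_norm)
        then show ?thesis by (cases "z \<in> cball 0 ?R") auto
      qed
    qed (intro borel_measurable_times_ennreal borel_measurable_indicator borel_measurable_const sd borel_closed closed_cball)+
  qed
  then have "\<forall>\<^sub>F n in sequentially. \<rho> (\<lambda>z. indicator (cball 0 ?R) z * ennreal (cmod (shift_diff f (u n) z))) < ennreal (e / 2)"
    by (rule order_tendstoD) (use e in simp)
  then show "\<forall>\<^sub>F n in sequentially. \<rho> (\<lambda>z. ennreal (cmod (shift_diff f (u n) z))) < a"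
  proof eventually_elim
    case (elim n)
    have eq: "(2 ^ S + 1) * e' = e / 2" by (simp add: e'_def field_simps add_nonneg_eq_0_iff)
    have "\<rho> (\<lambda>z. ennreal (cmod (shift_diff f (u n) z))) \<le>
        \<rho> (\<lambda>z. indicator (cball 0 ?R) z * ennreal (cmod (shift_diff f (u n) z))) + ennreal (e / 2)"
      using le[OF u1[of n]] unfolding eq .
    also have "\<dots> < ennreal (e / 2) + ennreal (e / 2)" using elim by (simp add: ennreal_add_left_cancel_less add.commute)
    also have "\<dots> = ennreal e" using e by (simp add: ennreal_plus[symmetric] del: ennreal_plus)
    finally show ?case using e(2) by (rule less_le_trans)
  qed
qed simp

lemma rho_shift_diff_small:
  assumes f: "f \<in> X" and e: "0 < e"
  shows "\<exists>r>0. \<forall>v. norm v \<le> r \<longrightarrow> \<rho> (\<lambda>z. ennreal (cmod (shift_diff f v z))) \<le> ennreal e"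
proof (rule ccontr)
  assume "\<not> ?thesis"
  then have "\<exists>v. norm v \<le> 1 / real (Suc n) \<and> \<not> \<rho> (\<lambda>z. ennreal (cmod (shift_diff f v z))) \<le> ennreal e" for n
    by (metis of_nat_0_less_iff zero_less_Suc zero_less_divide_1_iff)
  then obtain v where v: "\<And>n. norm (v n) \<le> 1 / real (Suc n)"
    and ne: "\<And>n. \<not> \<rho> (\<lambda>z. ennreal (cmod (shift_diff f (v n) z))) \<le> ennreal e" by metis
  have "(\<lambda>n. 1 / real (Suc n)) \<longlonglongrightarrow> 0" by real_asymp
  then have "v \<longlonglongrightarrow> 0" by (rule Lim_null_comparison[rotated]) (use v in simp)
  moreover have "norm (v n) \<le> 1" for n using v[of n] by (rule order_trans) simp
  ultimately have "(\<lambda>n. \<rho> (\<lambda>z. ennreal (cmod (shift_diff f (v n) z)))) \<longlonglongrightarrow> 0" by (rule rho_shift_diff_tendsto[OF f])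
  then have "\<forall>\<^sub>F n in sequentially. \<rho> (\<lambda>z. ennreal (cmod (shift_diff f (v n) z))) < ennreal e"
    by (rule order_tendstoD) (use e in simp)
  then obtain n where "\<rho> (\<lambda>z. ennreal (cmod (shift_diff f (v n) z))) < ennreal e"
    using eventually_happens'[OF sequentially_bot] by blast
  then show False using ne[of n] by simp
qed

text \<open>Small shifts change \<open>V f\<close> little in norm. For the remaining ones
  \<open>1 \<le> \<delta> * norm u / r\<close>, so a factor \<delta> is gained at the price of one
  more moment of the Gaussian.\<close>

lemma smoothing_near_identity:
  assumes f: "f \<in> X" and e: "0 < e"
  shows "\<exists>\<delta>0>0. \<forall>\<delta>. 0 \<le> \<delta> \<and> \<delta> \<le> \<delta>0 \<and> \<delta> \<le> 1 \<longrightarrow> N (smoothing \<delta> f - f) \<le> e"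
proof -
  obtain r where r: "0 < r" and small: "\<And>v. norm v \<le> r \<Longrightarrow> \<rho> (\<lambda>z. ennreal (cmod (shift_diff f v z))) \<le> ennreal (e / 2)"
    using rho_shift_diff_small[OF f, of "e / 2"] e by auto
  \<comment> \<open>Twice the norm for the two terms of the difference, divided by r from the
    inequality \<open>1 \<le> \<delta> * norm u / r\<close>.\<close>
  define c1 where "c1 = 2 * N f / r"
  have c1: "0 \<le> c1" using r by (simp add: c1_def)
  \<comment> \<open>The contribution of the large shifts is then at most \<open>e / 2\<close>; the
    summand 1 keeps the divisor positive.\<close>
  define \<delta>0 where "\<delta>0 = e / 2 / (c1 * pmoment (Suc S) + 1)"
  have \<delta>0: "0 < \<delta>0" using e c1 pmoment_nonneg[of "Suc S"] by (simp add: \<delta>0_def add_nonneg_pos)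
  have "N (smoothing \<delta> f - f) \<le> e" if \<delta>: "0 \<le> \<delta>" "\<delta> \<le> \<delta>0" "\<delta> \<le> 1" for \<delta>
  proof -
    have d: "\<bar>\<delta>\<bar> \<le> 1" using \<delta> by simp
    have VE: "V (smoothing \<delta> f - f) z = (\<integral>u. shift_diff f (\<delta> *\<^sub>R u) z \<partial>gmeasure)" for z
    proof -
      obtain C M where CM: "\<forall>u. cmod (cexp (- snd z) (\<delta> *\<^sub>R fst u) * V f (z - \<delta> *\<^sub>R u)) \<le> C * pweight M u \<and>
        (\<forall>u'. norm (u - u') \<le> 1 \<longrightarrow> cmod (cexp (- snd z) (\<delta> *\<^sub>R fst u) * V f (z - \<delta> *\<^sub>R u) -
          cexp (- snd z) (\<delta> *\<^sub>R fst u') * V f (z - \<delta> *\<^sub>R u')) \<le> norm (u - u') * (C * pweight M u))"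
        using shifted_V_lip[OF d, of z f] by blast
      have i: "integrable gmeasure (\<lambda>u. cexp (- snd z) (\<delta> *\<^sub>R fst u) * V f (z - \<delta> *\<^sub>R u))"
        by (rule integrable_local_Lipschitz[where \<beta> = "\<lambda>u. C * pweight M u"])
          (use CM in \<open>auto intro!: integrable_mult_right integrable_gmeasure_pweight\<close>)
      have "(\<integral>u. shift_diff f (\<delta> *\<^sub>R u) z \<partial>gmeasure) = (\<integral>u. cexp (- snd z) (\<delta> *\<^sub>R fst u) * V f (z - \<delta> *\<^sub>R u) \<partial>gmeasure) - V f z"
        unfolding shift_diff_def using i gmeasure.prob_space[where 'a = "(real^'n) \<times> (real^'n)"]
        by (subst Bochner_Integration.integral_diff) (auto simp: fst_scaleR)
      then show ?thesis by (simp add: V_diff V_smoothing[OF d])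
    qed
    have "nm (smoothing \<delta> f - f) \<le> ennreal (e / 2 + (\<delta> * c1) * pmoment (Suc S))"
      unfolding nm_def VE pmoment_def
    proof (rule rho_integral_le)
      show "shift_diff f (\<delta> *\<^sub>R u) \<in> borel_measurable borel" for u by (rule shift_diff_measurable)
      show "\<exists>C M. \<forall>u. cmod (shift_diff f (\<delta> *\<^sub>R u) z) \<le> C * pweight M u \<and>
        (\<forall>u'. norm (u - u') \<le> 1 \<longrightarrow> cmod (shift_diff f (\<delta> *\<^sub>R u) z - shift_diff f (\<delta> *\<^sub>R u') z) \<le> norm (u - u') * (C * pweight M u))" for z
      proof -
        obtain C M where C: "0 \<le> C" and CM: "\<And>u. cmod (cexp (- snd z) (\<delta> *\<^sub>R fst u) * V f (z - \<delta> *\<^sub>R u)) \<le> C * pweight M u \<and>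
          (\<forall>u'. norm (u - u') \<le> 1 \<longrightarrow> cmod (cexp (- snd z) (\<delta> *\<^sub>R fst u) * V f (z - \<delta> *\<^sub>R u) -
            cexp (- snd z) (\<delta> *\<^sub>R fst u') * V f (z - \<delta> *\<^sub>R u')) \<le> norm (u - u') * (C * pweight M u))"
          using shifted_V_lip[OF d, of z f] by blast
        have "cmod (shift_diff f (\<delta> *\<^sub>R u) z) \<le> (C + cmod (V f z)) * pweight M u" for u
        proof -
          have "cmod (shift_diff f (\<delta> *\<^sub>R u) z) \<le> C * pweight M u + cmod (V f z)"
            unfolding shift_diff_def using CM[of u] by (intro order_trans[OF norm_triangle_ineq4] add_mono) (auto simp: fst_scaleR)
          also have "\<dots> \<le> C * pweight M u + cmod (V f z) * pweight M u"
            using mult_left_mono[OF pweight_ge1[of M u], of "cmod (V f z)"] by simp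
          finally show ?thesis by (simp add: distrib_right)
        qed
        moreover have "cmod (shift_diff f (\<delta> *\<^sub>R u) z - shift_diff f (\<delta> *\<^sub>R u') z) \<le> norm (u - u') * ((C + cmod (V f z)) * pweight M u)"
          if "norm (u - u') \<le> 1" for u u'
        proof -
          have "cmod (shift_diff f (\<delta> *\<^sub>R u) z - shift_diff f (\<delta> *\<^sub>R u') z) \<le> norm (u - u') * (C * pweight M u)"
            using conjunct2[OF CM[of u], rule_format, OF that] unfolding shift_diff_def fst_scaleR by simp
          also have "\<dots> \<le> norm (u - u') * ((C + cmod (V f z)) * pweight M u)"
            by (intro mult_left_mono mult_right_mono) auto
          finally show ?thesis .
        qed
        ultimately show ?thesis by blast
      qed
      show "\<rho> (\<lambda>z. ennreal (cmod (shift_diff f (\<delta> *\<^sub>R u) z))) \<le> ennreal (e / 2 + \<delta> * c1 * pweight (Suc S) u)" for u :: "(real^'n) \<times> (real^'n)"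
      proof (cases "norm (\<delta> *\<^sub>R u) \<le> r")
        case True
        show ?thesis by (rule order_trans[OF small[OF True] ennreal_leI]) (use \<delta> c1 in simp)
      next
        case False
        then have big: "1 \<le> \<delta> * norm u / r" using \<delta> r by simp
        have "\<rho> (\<lambda>z. ennreal (cmod (shift_diff f (\<delta> *\<^sub>R u) z))) \<le>
            \<rho> (\<lambda>z. ennreal (cmod (cexp (- snd z) (\<delta> *\<^sub>R fst u) * V f (z - \<delta> *\<^sub>R u))) + ennreal (cmod (V f z)))"
        proof (rule rho_mono)
          show "(\<lambda>z. ennreal (cmod (shift_diff f (\<delta> *\<^sub>R u) z))) \<in> borel_measurable borel"
            using shift_diff_measurable[of f "\<delta> *\<^sub>R u"] by simp
          show "(\<lambda>z. ennreal (cmod (cexp (- snd z) (\<delta> *\<^sub>R fst u) * V f (z - \<delta> *\<^sub>R u))) + ennreal (cmod (V f z))) \<in> borel_measurable borel"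
            using shifted_V_measurable[of "\<delta> *\<^sub>R fst u" f "\<delta> *\<^sub>R u"] by simp
          show "ennreal (cmod (shift_diff f (\<delta> *\<^sub>R u) z)) \<le>
              ennreal (cmod (cexp (- snd z) (\<delta> *\<^sub>R fst u) * V f (z - \<delta> *\<^sub>R u))) + ennreal (cmod (V f z))" for z
            unfolding shift_diff_def fst_scaleR by (subst ennreal_plus[symmetric]) (simp_all only: norm_ge_zero norm_triangle_ineq4 ennreal_leI)
        qed
        also have "\<dots> \<le> \<rho> (\<lambda>z. ennreal (cmod (cexp (- snd z) (\<delta> *\<^sub>R fst u) * V f (z - \<delta> *\<^sub>R u)))) + nm f"
          unfolding nm_def using shifted_V_measurable by (intro rho_add) auto
        also have "\<dots> \<le> ennreal (pweight S (\<delta> *\<^sub>R u)) * nm f + nm f" by (intro add_right_mono nm_shift)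
        also have "\<dots> = ennreal (pweight S (\<delta> *\<^sub>R u) * N f + N f)"
          unfolding nm_eq[OF f] by (simp add: ennreal_mult[symmetric] ennreal_plus[symmetric] del: ennreal_plus)
        also have "\<dots> \<le> ennreal (e / 2 + \<delta> * c1 * pweight (Suc S) u)"
        proof (rule ennreal_leI)
          have "norm (\<delta> *\<^sub>R u) \<le> norm u" using \<delta> mult_right_mono[of \<delta> 1 "norm u"] by simp
          then have "pweight S (\<delta> *\<^sub>R u) \<le> pweight S u" by (rule pweight_le_norm)
          then have "pweight S (\<delta> *\<^sub>R u) * N f + N f \<le> pweight S u * N f + pweight S u * N f"
            using mult_right_mono[OF pweight_ge1[of S u], of "N f"] by (intro add_mono mult_right_mono) auto
          also have "\<dots> = 1 * (2 * N f * pweight S u)" by simp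
          also have "\<dots> \<le> (\<delta> * norm u / r) * (2 * N f * pweight S u)" by (rule mult_right_mono[OF big]) simp
          also have "\<dots> = \<delta> * c1 * (norm u * pweight S u)" by (simp add: c1_def)
          also have "\<dots> \<le> \<delta> * c1 * pweight (Suc S) u"
            using \<delta> c1 by (intro mult_left_mono) (auto simp: pweight_def distrib_right)
          finally show "pweight S (\<delta> *\<^sub>R u) * N f + N f \<le> e / 2 + \<delta> * c1 * pweight (Suc S) u" using e by simp
        qed
        finally show ?thesis .
      qed
    qed (use e \<delta> c1 in auto)
    moreover have "0 \<le> e / 2 + (\<delta> * c1) * pmoment (Suc S)" using e \<delta> c1 pmoment_nonneg by simp
    ultimately have "N (smoothing \<delta> f - f) \<le> e / 2 + (\<delta> * c1) * pmoment (Suc S)" using N_le by blast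
    also have "(\<delta> * c1) * pmoment (Suc S) \<le> \<delta>0 * (c1 * pmoment (Suc S) + 1)"
      using \<delta> c1 pmoment_nonneg[of "Suc S"] by (simp add: mult.assoc, intro mult_mono) auto
    also have "\<delta>0 * (c1 * pmoment (Suc S) + 1) = e / 2"
    proof -
      have "0 < c1 * pmoment (Suc S) + 1" using c1 pmoment_nonneg[of "Suc S"] by (simp add: add_nonneg_pos)
      then show ?thesis unfolding \<delta>0_def by (intro nonzero_eq_divide_eq[THEN iffD1, OF _ refl]) simp
    qed
    finally show ?thesis by simp
  qed
  then show ?thesis using \<delta>0 by blast
qed

end

section \<open>Finite rank approximation\<close>

lemma gdens_Pair:
  fixes t :: "'a::euclidean_space" and \<eta> :: "'b::euclidean_space"
  shows "gdens (t, \<eta>) = gdens t * gdens \<eta>"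
proof -
  have "(norm (t, \<eta>))\<^sup>2 = (norm t)\<^sup>2 + (norm \<eta>)\<^sup>2" by (simp add: norm_Pair)
  then have "gauss (t, \<eta>) = gauss t * gauss \<eta>"
    by (simp add: gauss_def exp_add[symmetric] add_divide_distrib)
  then show ?thesis by (simp add: gdens_def power_add)
qed

text \<open>The integral kernel of the operator \<open>smoothing_adj \<delta>\<close> is \<open>gauss (\<delta> y) * gker \<delta> y s\<close>.\<close>

definition gker :: "real \<Rightarrow> real^'n::finite \<Rightarrow> real^'n \<Rightarrow> complex" where
  "gker \<delta> y s = complex_of_real ((1 / \<delta>) ^ CARD('n) * gdens ((1 / \<delta>) *\<^sub>R (s - y)))"

lemma gker_commute: "gker \<delta> y s = gker \<delta> s y"
proof -
  have "gauss ((1 / \<delta>) *\<^sub>R (s - y)) = gauss (- ((1 / \<delta>) *\<^sub>R (y - s)))" by (simp add: algebra_simps)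
  then show ?thesis unfolding gauss_minus by (simp add: gker_def gdens_def)
qed

lemma gker_eq: "gker \<delta> y s = gker \<delta> 0 (s - y)" by (simp add: gker_def)

lemma gker_0_schwartz: "\<delta> \<noteq> 0 \<Longrightarrow> gker \<delta> 0 \<in> schwartz"
  using schwartz_cmult[OF schwartz_gauss[of "1 / \<delta>"], of "complex_of_real ((1 / \<delta>) ^ CARD('a) * gconst ^ CARD('a))"]
  by (simp add: gker_def[abs_def] gdens_def mult.assoc)

lemma gker_schwartz: "\<delta> \<noteq> 0 \<Longrightarrow> gker \<delta> y \<in> schwartz"
  using schwartz_translate[OF gker_0_schwartz, of \<delta> y] by (simp add: gker_eq[of \<delta> y, abs_def])

lemma fam_gker:
  fixes \<delta> :: real
  assumes "\<delta> \<noteq> 0"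
  obtains C M where "0 \<le> C" "fam k (pweight k) (\<lambda>y. C * pweight M y) (gker \<delta> :: real^'n::finite \<Rightarrow> _)"
proof -
  obtain C M where C: "0 \<le> C" and f: "fam k (pweight k) (\<lambda>y. C * pweight M y) (\<lambda>y s. gker \<delta> 0 (s - 1 *\<^sub>R (y::real^'n)))"
    using fam_translates[OF gker_0_schwartz[OF assms], of 1 k] by auto
  have "(\<lambda>y s. gker \<delta> 0 (s - 1 *\<^sub>R (y::real^'n))) = gker \<delta>"
    by (intro ext) (simp add: gker_def)
  then show thesis using that C f by simp
qed

text \<open>The multiplier left by averaging over the frequencies: the Fourier transform of the
  Gaussian measure.\<close>

definition hmul :: "real \<Rightarrow> real^'n::finite \<Rightarrow> complex" where
  "hmul \<delta> y = complex_of_real (gauss (\<delta> *\<^sub>R y))"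

lemma hmul_schwartz: "\<delta> \<noteq> 0 \<Longrightarrow> hmul \<delta> \<in> schwartz"
  unfolding hmul_def by (rule schwartz_gauss)

lemma fam_hmul_gker:
  fixes \<delta> :: real
  assumes "\<delta> \<noteq> 0"
  obtains C M where "0 \<le> C" "fam k (pweight k) (\<lambda>y. C * pweight M y) (\<lambda>y s. gker \<delta> (y::real^'n::finite) s * hmul \<delta> s)"
proof -
  obtain C M where C: "0 \<le> C" and f: "fam k (pweight k) (\<lambda>y. C * pweight M y) (gker \<delta> :: real^'n::finite \<Rightarrow> _)"
    by (rule fam_gker[OF assms], rule that)
  obtain B where B: "sbound k (\<lambda>_. 1) B (hmul \<delta> :: real^'n \<Rightarrow> _)" using schwartz_bounded[OF hmul_schwartz[OF assms]] by blast
  have "0 \<le> B" using sbound_nonneg[OF B] by simp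
  then show thesis using that[of "2 ^ k * B * C" M] C fam_mult_right[OF f B] by (simp add: mult.assoc)
qed

text \<open>The Gaussian on phase space is a product. Its position factor gives convolution with a
  Gaussian of width \<delta>; its frequency factor averages characters and gives multiplication by
  \<open>hmul \<delta>\<close>.\<close>

lemma smoothing_adj_kernel:
  fixes \<phi> :: "real^'n::finite \<Rightarrow> complex"
  assumes \<delta>: "0 < \<delta>" "\<delta> \<le> 1" and \<phi>: "\<phi> \<in> schwartz"
  shows "smoothing_adj \<delta> \<phi> y = hmul \<delta> y * (\<integral>s. gker \<delta> y s * \<phi> s \<partial>lborel)"
proof -
  have d: "\<bar>\<delta>\<bar> \<le> 1" using \<delta> by simp
  have [measurable]: "\<phi> \<in> borel_measurable borel" by (rule schwartz_measurable[OF \<phi>])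
  let ?F = "\<lambda>t \<eta>. gdens t *\<^sub>R \<phi> (y + \<delta> *\<^sub>R t) * (gdens \<eta> *\<^sub>R cexp (\<delta> *\<^sub>R \<eta>) y)"
  have m: "(\<lambda>u. tfshift (tfpoint \<delta> u) \<phi> y) \<in> borel_measurable borel"
    using borel_measurable_integrable[OF smoothing_adj_integrable[OF d \<phi>, of y]] by simp
  have eq: "gdens u *\<^sub>R tfshift (tfpoint \<delta> u) \<phi> y = ?F (fst u) (snd u)" for u :: "(real^'n) \<times> (real^'n)"
    using gdens_Pair[of "fst u" "snd u"] by (simp add: tfshift_def tfpoint_def scaleR_conv_of_real mult_ac)
  have i: "integrable (lborel \<Otimes>\<^sub>M lborel) (\<lambda>u. ?F (fst u) (snd u))"
    using smoothing_adj_integrable[OF d \<phi>, of y] integrable_gmeasure[OF m] by (simp only: eq lborel_prod)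
  have "smoothing_adj \<delta> \<phi> y = (\<integral>u. ?F (fst u) (snd u) \<partial>(lborel \<Otimes>\<^sub>M lborel))"
    unfolding smoothing_adj_def by (simp only: integral_gmeasure[OF m] eq lborel_prod)
  also have "\<dots> = (\<integral>t. \<integral>\<eta>. ?F t \<eta> \<partial>lborel \<partial>lborel)"
    using lborel_pair.integral_fst'[OF i] by simp
  also have "\<dots> = (\<integral>t. gdens t *\<^sub>R \<phi> (y + \<delta> *\<^sub>R t) * hmul \<delta> y \<partial>lborel)"
  proof (rule Bochner_Integration.integral_cong[OF refl])
    fix t :: "real^'n"
    have "(\<integral>\<eta>. gdens \<eta> *\<^sub>R cexp (\<delta> *\<^sub>R \<eta>) y \<partial>lborel) = (\<integral>\<eta>. exp (\<i> * complex_of_real (\<eta> \<bullet> (\<delta> *\<^sub>R y))) \<partial>gmeasure)"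
      by (subst integral_gmeasure) (auto simp: cexp_def inner_commute)
    also have "\<dots> = hmul \<delta> y" unfolding hmul_def by (rule fourier_gmeasure)
    finally show "(\<integral>\<eta>. ?F t \<eta> \<partial>lborel) = gdens t *\<^sub>R \<phi> (y + \<delta> *\<^sub>R t) * hmul \<delta> y"
      by (simp only: integral_mult_right_zero)
  qed
  also have "\<dots> = hmul \<delta> y * (\<integral>t. gdens t *\<^sub>R \<phi> (y + \<delta> *\<^sub>R t) \<partial>lborel)"
    by (subst integral_mult_right_zero[symmetric]) (simp add: mult.commute)
  also have "(\<integral>t. gdens t *\<^sub>R \<phi> (y + \<delta> *\<^sub>R t) \<partial>lborel) =
      \<bar>1 / \<delta>\<bar> ^ CARD('n) *\<^sub>R (\<integral>s. gdens (- ((1 / \<delta>) *\<^sub>R y) + (1 / \<delta>) *\<^sub>R s) *\<^sub>R \<phi> (y + \<delta> *\<^sub>R (- ((1 / \<delta>) *\<^sub>R y) + (1 / \<delta>) *\<^sub>R s)) \<partial>lborel)"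
    using integral_lborel_affine[of "\<lambda>t. gdens t *\<^sub>R \<phi> (y + \<delta> *\<^sub>R t)" "1 / \<delta>" "- ((1 / \<delta>) *\<^sub>R y)"] \<delta> by simp
  also have "\<dots> = (\<integral>s. gker \<delta> y s * \<phi> s \<partial>lborel)"
  proof -
    have 1: "- ((1 / \<delta>) *\<^sub>R y) + (1 / \<delta>) *\<^sub>R s = (1 / \<delta>) *\<^sub>R (s - y)" for s
      by (simp add: scaleR_diff_right)
    have 2: "y + \<delta> *\<^sub>R ((1 / \<delta>) *\<^sub>R (s - y)) = s" for s using \<delta> by simp
    have "\<bar>1 / \<delta>\<bar> = 1 / \<delta>" using \<delta> by simp
    then show ?thesis unfolding 1 2
      by (subst integral_scaleR_right[symmetric]) (simp add: gker_def scaleR_conv_of_real mult.assoc)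
  qed
  finally show ?thesis .
qed

text \<open>The variable \<open>y\<close> between the two kernels separates the arguments:
  \<open>\<phi>\<close> and \<open>f\<close> each meet a Gaussian centred at \<open>y\<close> and
  not each other. The multiplier \<open>hmul \<delta> y\<close> of the second application becomes
  the density of \<open>gdm \<delta>\<close> and makes the integral converge.\<close>

lemma smoothing_smoothing_integral:
  fixes f :: "'n::finite tempered_distribution"
  assumes \<delta>: "0 < \<delta>" "\<delta> \<le> 1" and \<phi>: "\<phi> \<in> schwartz"
  shows "apply_dist (smoothing \<delta> (smoothing \<delta> f)) \<phi> = (\<integral>y. apply_dist (dist_of (gker \<delta> y)) \<phi> *
    apply_dist f (\<lambda>s. gker \<delta> y s * hmul \<delta> s) \<partial>gdm \<delta>)"
proof -
  have d: "\<bar>\<delta>\<bar> \<le> 1" and nz: "\<delta> \<noteq> 0" using \<delta> by auto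
  define a where "a y = apply_dist (dist_of (gker \<delta> y)) \<phi>" for y
  \<comment> \<open>The symmetry of the pairing exhibits the coefficient as a fixed distribution
    applied to a family of Gaussians, so \<open>dist_fam\<close> bounds it.\<close>
  have a_eq: "a y = apply_dist (dist_of \<phi>) (gker \<delta> y)" for y
    unfolding a_def apply_dist_of[OF gker_schwartz[OF nz] \<phi>] apply_dist_of[OF \<phi> gker_schwartz[OF nz]]
    by (simp add: mult.commute)
  define F where "F y s = a y * (gker \<delta> y s * hmul \<delta> s)" for y s
  have Gs: "(\<lambda>s. gker \<delta> y s * hmul \<delta> s) \<in> schwartz" for y by (intro schwartz_mult gker_schwartz hmul_schwartz nz)
  have Fs: "F y \<in> schwartz" for y unfolding F_def by (rule schwartz_cmult[OF Gs])
  obtain C k where C: "0 \<le> C" and T: "dist_bound k C (apply_dist (dist_of \<phi>))" using dist_bound_apply_dist by blast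
  obtain D M where D: "0 \<le> D" and fam: "fam k (pweight k) (\<lambda>y. D * pweight M y) (gker \<delta> :: real^'n \<Rightarrow> _)"
    by (rule fam_gker[OF nz], rule that)
  have a: "cmod (a y) \<le> C * (D * pweight M y)"
    "norm (y - y') \<le> 1 \<Longrightarrow> cmod (a y - a y') \<le> norm (y - y') * (C * (D * pweight M y))" for y y'
    unfolding a_eq using dist_fam[OF T C fam gker_schwartz[OF nz]] by auto
  have famF: "\<exists>\<beta>. integrable (gdm \<delta>) \<beta> \<and> fam m (pweight m) \<beta> F" for m
  proof -
    obtain D' M' where D': "0 \<le> D'" and fam': "fam m (pweight m) (\<lambda>y. D' * pweight M' y) (\<lambda>y s. gker \<delta> (y::real^'n) s * hmul \<delta> s)"
      by (rule fam_hmul_gker[OF nz], rule that)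
    have "fam m (pweight m) (\<lambda>y. (1 + 2 ^ M') * ((C * (D * pweight M y)) * (D' * pweight M' y))) F"
      unfolding F_def
    proof (rule fam_scale[OF fam' _ a])
      show "D' * pweight M' u' \<le> 2 ^ M' * (D' * pweight M' u)" if "norm (u - u') \<le> 1" for u u' :: "real^'n"
        using mult_left_mono[OF pweight_slow[OF that, of M'] D'] by (simp only: mult.left_commute)
    qed auto
    moreover have "integrable (gdm \<delta>) (\<lambda>y::real^'n. ((1 + 2 ^ M') * (C * D * D')) * pweight (M + M') y)"
      by (intro integrable_mult_right integrable_gdm_pweight nz)
    then have "integrable (gdm \<delta>) (\<lambda>y::real^'n. (1 + 2 ^ M') * ((C * (D * pweight M y)) * (D' * pweight M' y)))"
      by (simp add: pweight_add mult_ac)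
    ultimately show ?thesis by (intro exI conjI)
  qed
  have "smoothing_adj \<delta> (smoothing_adj \<delta> \<phi>) = (\<lambda>s. \<integral>y. F y s \<partial>gdm \<delta>)"
  proof
    fix u :: "real^'n"
    have m: "(\<lambda>y. F y u) \<in> borel_measurable borel"
    proof -
      obtain \<beta> where b: "integrable (gdm \<delta>) \<beta>" "fam 0 (pweight 0) \<beta> F" using famF[of 0] by blast
      have "integrable (gdm \<delta>) (\<lambda>y. F y u)" by (rule fam_integrable[OF _ b pweight_ge1]) simp
      then show ?thesis using borel_measurable_integrable by fastforce
    qed
    have "smoothing_adj \<delta> (smoothing_adj \<delta> \<phi>) u = hmul \<delta> u * (\<integral>y. gker \<delta> u y * smoothing_adj \<delta> \<phi> y \<partial>lborel)"
      by (rule smoothing_adj_kernel[OF \<delta> smoothing_adj_schwartz[OF d \<phi>]])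
    also have "(\<lambda>y. gker \<delta> u y * smoothing_adj \<delta> \<phi> y) = (\<lambda>y. gker \<delta> y u * (hmul \<delta> y * a y))"
      by (rule ext) (simp add: smoothing_adj_kernel[OF \<delta> \<phi>] a_def apply_dist_of[OF gker_schwartz[OF nz] \<phi>] gker_commute[of \<delta> u])
    also have "hmul \<delta> u * (\<integral>y. gker \<delta> y u * (hmul \<delta> y * a y) \<partial>lborel) = (\<integral>y. hmul \<delta> u * (gker \<delta> y u * (hmul \<delta> y * a y)) \<partial>lborel)"
      by (rule integral_mult_right_zero[symmetric])
    also have "\<dots> = (\<integral>y. gauss (\<delta> *\<^sub>R y) *\<^sub>R F y u \<partial>lborel)"
      by (rule Bochner_Integration.integral_cong) (simp_all add: F_def hmul_def scaleR_conv_of_real mult_ac)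
    also have "\<dots> = (\<integral>y. F y u \<partial>gdm \<delta>)" by (rule integral_gdm[symmetric, OF m])
    finally show "smoothing_adj \<delta> (smoothing_adj \<delta> \<phi>) u = (\<integral>y. F y u \<partial>gdm \<delta>)" .
  qed
  then have "apply_dist (smoothing \<delta> (smoothing \<delta> f)) \<phi> = apply_dist f (\<lambda>s. \<integral>y. F y s \<partial>gdm \<delta>)"
    by (simp add: apply_smoothing[OF d] smoothing_adj_schwartz[OF d \<phi>] \<phi>)
  also have "\<dots> = (\<integral>y. apply_dist f (F y) \<partial>gdm \<delta>)"
    by (rule apply_dist_integral) (use famF Fs gdm_finite[OF nz] in auto)
  finally show ?thesis unfolding F_def by (simp add: apply_dist_cmult[OF Gs] a_def)
qed

lemma smoothing_diff:
  assumes "\<bar>\<delta>\<bar> \<le> 1" shows "smoothing \<delta> (f - h) = smoothing \<delta> f - smoothing \<delta> h"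
  by (rule apply_dist_eqI) (simp add: apply_smoothing[OF assms] minus_tempered_distribution.rep_eq)

section \<open>Approximation by finite sums of rank-one operators\<close>

context bf_window
begin

lemma dist_of_in_X: 
  assumes "\<psi> \<in> schwartz"
  shows "dist_of \<psi> \<in> X"
proof -
  obtain C k where C: "0 \<le> C" and decay: "\<And>\<psi> B x \<xi>. \<psi> \<in> schwartz \<Longrightarrow> sbound k (pweight k) B \<psi> \<Longrightarrow>
    cmod (stft g (dist_of \<psi>) x \<xi>) \<le> C * B / (pweight L x * pweight L \<xi>)"
    using stft_dist_of_decay[OF g, of L] by blast
  obtain B where B: "0 < B" "sbound k (pweight k) B \<psi>" using schwartzE[OF assms] by blast
  have "nm (dist_of \<psi>) \<le> \<rho> (\<lambda>z. ennreal (C * B) * ennreal (bweight L z))"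
    unfolding nm_def
  proof (rule rho_mono)
    fix z
    have "cmod (V (dist_of \<psi>) z) \<le> C * B * bweight L z"
      using decay[OF assms B(2), of "fst z" "snd z"] by (simp add: V_def bweight_def)
    then show "ennreal (cmod (V (dist_of \<psi>) z)) \<le> ennreal (C * B) * ennreal (bweight L z)"
      using C B(1) by (simp add: ennreal_mult[symmetric] ennreal_leI)
  qed auto
  also have "\<dots> = ennreal (C * B) * \<rho> (\<lambda>z. ennreal (bweight L z))"
    using C B(1) by (intro rho_cmult) auto
  also have "\<dots> < \<infinity>" using rho_bweight by (simp add: ennreal_mult_less_top)
  finally show ?thesis by (simp add: X_def)
qed

text \<open>The quadrature sum for \<open>smoothing_smoothing_integral\<close>, with nodes
  \<open>J\<close> and weights \<open>c\<close>.\<close>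

definition finite_rank_sum :: "real \<Rightarrow> (real^'n) set \<Rightarrow> (real^'n \<Rightarrow> real) \<Rightarrow> 'n tempered_distribution \<Rightarrow> 'n tempered_distribution" where
  "finite_rank_sum \<delta> J c f = (\<Sum>y\<in>J. scale_dist (complex_of_real (c y) * apply_dist f (\<lambda>s. gker \<delta> y s * hmul \<delta> s)) (dist_of (gker \<delta> y)))"

lemma finite_rank_sum_operator:
  assumes "finite J" "\<delta> \<noteq> 0"
  shows "finite_rank_sum \<delta> J c f \<in> X" "finite_rank_sum \<delta> J c (f + h) = finite_rank_sum \<delta> J c f + finite_rank_sum \<delta> J c h"
    "finite_rank_sum \<delta> J c (scale_dist r f) = scale_dist r (finite_rank_sum \<delta> J c f)"
    "finite_rank_sum \<delta> J c f \<in> dist.span ((\<lambda>y. dist_of (gker \<delta> y)) ` J)"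
proof -
  show "finite_rank_sum \<delta> J c (f + h) = finite_rank_sum \<delta> J c f + finite_rank_sum \<delta> J c h"
    unfolding finite_rank_sum_def
    by (simp add: plus_tempered_distribution.rep_eq distrib_left dist.scale_left_distrib sum.distrib)
  show "finite_rank_sum \<delta> J c (scale_dist r f) = scale_dist r (finite_rank_sum \<delta> J c f)"
    unfolding finite_rank_sum_def by (simp add: dist.scale_sum_right scale_dist.rep_eq mult.left_commute)
  show sp: "finite_rank_sum \<delta> J c f \<in> dist.span ((\<lambda>y. dist_of (gker \<delta> y)) ` J)"
    unfolding finite_rank_sum_def by (intro dist.span_sum dist.span_scale dist.span_base) auto
  have "(\<lambda>y. dist_of (gker \<delta> y)) ` J \<subseteq> X" using dist_of_in_X[OF gker_schwartz[OF assms(2)]] by blast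
  then have "dist.span ((\<lambda>y. dist_of (gker \<delta> y)) ` J) \<subseteq> X"
    by (rule dist.span_minimal) (rule ns.subspace_carrier)
  with sp show "finite_rank_sum \<delta> J c f \<in> X" by blast
qed

lemma V_sum: "V (\<Sum>i\<in>I. F i) z = (\<Sum>i\<in>I. V (F i) z)"
  by (induction I rule: infinite_finite_induct) (auto simp: V_0 V_add)

text \<open>At a point \<open>z\<close> of phase space the integrand is a product of
  \<open>v y\<close>, of size \<open>bweight L z\<close>, and \<open>b y\<close>, of size
  \<open>N f\<close> by \<open>dist_le_norm\<close>. One envelope \<beta> therefore serves for all
  \<open>f\<close> and \<open>z\<close>, and the quadrature error is a small multiple of
  \<open>N f * bweight L z\<close>, whose norm is finite.\<close>

lemma finite_rank_sum_approximates:
  assumes \<delta>: "0 < \<delta>" "\<delta> \<le> 1" and e: "0 < e"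
  shows "\<exists>J c. finite J \<and> (\<forall>f\<in>X. N (smoothing \<delta> (smoothing \<delta> f) - finite_rank_sum \<delta> J c f) \<le> e * N f)"
proof -
  have d: "\<bar>\<delta>\<bar> \<le> 1" and nz: "\<delta> \<noteq> 0" using \<delta> by auto
  obtain J c where q: "quadrature (gdm \<delta> :: (real^'n) measure) J c"
    using quadrature_exists[of "gdm \<delta> :: (real^'n) measure"] gdm_finite[OF nz] by auto
  obtain A k where A: "0 \<le> A" and key: "\<And>f \<phi> B. f \<in> X \<Longrightarrow> \<phi> \<in> schwartz \<Longrightarrow> sbound k (pweight k) B \<phi> \<Longrightarrow>
    cmod (apply_dist f \<phi>) \<le> A * B * N f"
    by (rule dist_le_norm, rule that)
  obtain C k' where C: "0 \<le> C" and decay: "\<And>\<psi> B x \<xi>. \<psi> \<in> schwartz \<Longrightarrow> sbound k' (pweight k') B \<psi> \<Longrightarrow>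
    cmod (stft g (dist_of \<psi>) x \<xi>) \<le> C * B / (pweight L x * pweight L \<xi>)"
    using stft_dist_of_decay[OF g, of L] by blast
  let ?G = "\<lambda>(y::real^'n) s. gker \<delta> y s * hmul \<delta> s"
  obtain D1 M1 where D1: "0 \<le> D1" and fam1: "fam k (pweight k) (\<lambda>y. D1 * pweight M1 y) ?G"
    by (rule fam_hmul_gker[OF nz], rule that)
  obtain D2 M2 where D2: "0 \<le> D2" and fam2: "fam k' (pweight k') (\<lambda>y. D2 * pweight M2 y) (gker \<delta> :: real^'n \<Rightarrow> _)"
    by (rule fam_gker[OF nz], rule that)
  have Gs: "?G y \<in> schwartz" for y by (intro schwartz_mult gker_schwartz hmul_schwartz nz)
  \<comment> \<open>The constants of the two factors; the last one is the cost of the product rule,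
    where the bound of \<open>b\<close> at \<open>y'\<close> is moved to \<open>y\<close>.\<close>
  define K where "K = (A * D1) * (C * D2) * (1 + 2 ^ M1)"
  have K: "0 \<le> K" using A C D1 D2 by (simp add: K_def)
  define \<beta> where "\<beta> y = K * pweight (M1 + M2) y" for y :: "real^'n"
  have \<beta>: "integrable (gdm \<delta>) \<beta>" "\<And>y. 0 \<le> \<beta> y"
    unfolding \<beta>_def using K by (auto intro!: integrable_mult_right integrable_gdm_pweight nz)
  obtain er where er: "er \<longlonglongrightarrow> 0" and err: "\<And>a B n. (\<And>u. cmod (a u) \<le> B * \<beta> u) \<Longrightarrow>
      (\<And>u u'. norm (u - u') \<le> 1 \<Longrightarrow> cmod (a u - a u') \<le> norm (u - u') * (B * \<beta> u)) \<Longrightarrow>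
      cmod ((\<Sum>u\<in>J n. complex_of_real (c n u) * a u) - (\<integral>u. a u \<partial>gdm \<delta>)) \<le> er n * B"
    by (rule quadrature_error[OF q \<beta>]) blast
  define R where "R = enn2real (\<rho> (\<lambda>z. ennreal (bweight L z)))"
  have R: "0 \<le> R" "\<rho> (\<lambda>z. ennreal (bweight L z)) = ennreal R"
    using rho_bweight by (auto simp: R_def)
  have "\<forall>\<^sub>F n in sequentially. er n < e / (R + 1)"
    using er by (rule order_tendstoD) (use e R in auto)
  then obtain n where n: "er n < e / (R + 1)" using eventually_happens'[OF sequentially_bot] by blast
  \<comment> \<open>The error sequence is not assumed to be non-negative.\<close>
  define en where "en = max 0 (er n)"
  have en: "0 \<le> en" "er n \<le> en" "en * R \<le> e"
  proof -
    have "en \<le> e / (R + 1)" using n e R by (simp add: en_def)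
    then have "en * R \<le> e / (R + 1) * R" using R by (intro mult_right_mono)
    also have "\<dots> \<le> e" using e R by (simp add: field_simps)
    finally show "en * R \<le> e" .
  qed (auto simp: en_def)
  have "N (smoothing \<delta> (smoothing \<delta> f) - finite_rank_sum \<delta> (J n) (c n) f) \<le> e * N f" if f: "f \<in> X" for f
  proof -
    define b where "b y = apply_dist f (?G y)" for y
    have b: "cmod (b y) \<le> A * D1 * N f * pweight M1 y"
      "norm (y - y') \<le> 1 \<Longrightarrow> cmod (b y - b y') \<le> norm (y - y') * (A * D1 * N f * pweight M1 y)" for y y'
    proof -
      show "cmod (b y) \<le> A * D1 * N f * pweight M1 y"
        using key[OF f Gs, of "D1 * pweight M1 y" y] fam1 by (simp add: b_def fam_def mult_ac)
      assume "norm (y - y') \<le> 1"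
      then have "sbound k (pweight k) (norm (y - y') * (D1 * pweight M1 y)) (\<lambda>s. ?G y s - ?G y' s)"
        using fam1 by (simp add: fam_def)
      from key[OF f schwartz_diff[OF Gs Gs] this]
      have "cmod (b y - b y') \<le> A * (norm (y - y') * (D1 * pweight M1 y)) * N f"
        unfolding b_def apply_dist_diff[OF Gs Gs] .
      also have "\<dots> = norm (y - y') * (A * D1 * N f * pweight M1 y)" by simp
      finally show "cmod (b y - b y') \<le> norm (y - y') * (A * D1 * N f * pweight M1 y)" .
    qed
    have Vle: "cmod (V (smoothing \<delta> (smoothing \<delta> f) - finite_rank_sum \<delta> (J n) (c n) f) z) \<le> (en * N f) * bweight L z" for z
    proof -
      let ?at = "tfshift (fst z, - snd z) (\<lambda>y. cnj (g y))"
      have at: "?at \<in> schwartz" by (intro schwartz_tfshift schwartz_cnj g)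
      define v where "v y = V (dist_of (gker \<delta> y)) z" for y
      have v: "cmod (v y) \<le> C * D2 * bweight L z * pweight M2 y"
        "norm (y - y') \<le> 1 \<Longrightarrow> cmod (v y - v y') \<le> norm (y - y') * (C * D2 * bweight L z * pweight M2 y)" for y y'
      proof -
        show "cmod (v y) \<le> C * D2 * bweight L z * pweight M2 y"
          using decay[OF gker_schwartz[OF nz], of "D2 * pweight M2 y" y "fst z" "snd z"] fam2
          by (simp add: v_def V_def bweight_def fam_def mult_ac)
        assume "norm (y - y') \<le> 1"
        then have s: "sbound k' (pweight k') (norm (y - y') * (D2 * pweight M2 y)) (\<lambda>s. gker \<delta> y s - gker \<delta> y' s)"
          using fam2 by (simp add: fam_def)
        \<comment> \<open>The decay estimate is stated for the distribution of one function, so the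
          difference of the two distributions is rewritten as such.\<close>
        have "dist_of (\<lambda>s. gker \<delta> y s - gker \<delta> y' s) = dist_of (gker \<delta> y) - dist_of (gker \<delta> y')"
        proof (rule apply_dist_eqI)
          fix \<phi> :: "real^'n \<Rightarrow> complex" assume \<phi>: "\<phi> \<in> schwartz"
          have i: "integrable lborel (\<lambda>s. gker \<delta> w s * \<phi> s)" for w
            by (rule schwartz_integrable[OF schwartz_mult[OF gker_schwartz[OF nz] \<phi>]])
          show "apply_dist (dist_of (\<lambda>s. gker \<delta> y s - gker \<delta> y' s)) \<phi> = apply_dist (dist_of (gker \<delta> y) - dist_of (gker \<delta> y')) \<phi>"
            using i by (simp add: minus_tempered_distribution.rep_eq apply_dist_of gker_schwartz nz schwartz_diff \<phi> left_diff_distrib)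
        qed
        then show "cmod (v y - v y') \<le> norm (y - y') * (C * D2 * bweight L z * pweight M2 y)"
          using decay[OF schwartz_diff[OF gker_schwartz[OF nz] gker_schwartz[OF nz]] s, of "fst z" "snd z"]
          by (simp add: v_def V_diff[symmetric]) (simp add: V_def bweight_def mult_ac)
      qed
      let ?B = "N f * bweight L z"
      have "cmod ((\<Sum>y\<in>J n. complex_of_real (c n y) * (v y * b y)) - (\<integral>y. v y * b y \<partial>gdm \<delta>)) \<le> er n * ?B"
      proof (rule err)
        define P where "P = A * D1 * N f"
        define Q where "Q = C * D2 * bweight L z"
        have P: "0 \<le> P" and Q: "0 \<le> Q" using A D1 C D2 by (auto simp: P_def Q_def)
        have pq: "P * pweight M1 y * (Q * pweight M2 y) * (1 + 2 ^ M1) = ?B * \<beta> y" for y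
          by (simp add: P_def Q_def \<beta>_def K_def pweight_add mult_ac)
        have pq0: "0 \<le> P * pweight M1 y * (Q * pweight M2 y)" for y using P Q by simp
        fix y :: "real^'n"
        have "cmod (v y * b y) \<le> (Q * pweight M2 y) * (P * pweight M1 y)"
          unfolding norm_mult using v(1)[of y] b(1)[of y] Q by (intro mult_mono) (auto simp: P_def Q_def)
        also have "\<dots> \<le> P * pweight M1 y * (Q * pweight M2 y) * (1 + 2 ^ M1)"
          using mult_left_mono[of 1 "1 + 2 ^ M1", OF _ pq0[of y]] by (simp only: mult_1_right) (simp add: mult.commute)
        finally show "cmod (v y * b y) \<le> ?B * \<beta> y" unfolding pq .
        fix y' assume near: "norm (y - y') \<le> 1"
        \<comment> \<open>The product rule for increments; the second term carries \<open>b\<close>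
          at \<open>y'\<close>, which slow variation of the weight brings back to
          \<open>y\<close>.\<close>
        have "v y * b y - v y' * b y' = v y * (b y - b y') + (v y - v y') * b y'" by (simp add: algebra_simps)
        then have "cmod (v y * b y - v y' * b y') \<le> cmod (v y) * cmod (b y - b y') + cmod (v y - v y') * cmod (b y')"
          using norm_triangle_ineq[of "v y * (b y - b y')" "(v y - v y') * b y'"] by (simp add: norm_mult)
        also have "\<dots> \<le> (Q * pweight M2 y) * (norm (y - y') * (P * pweight M1 y)) + (norm (y - y') * (Q * pweight M2 y)) * (P * (2 ^ M1 * pweight M1 y))"
        proof (intro add_mono mult_mono)
          have "P * pweight M1 y' \<le> P * (2 ^ M1 * pweight M1 y)" by (intro mult_left_mono pweight_slow near P)
          then show "cmod (b y') \<le> P * (2 ^ M1 * pweight M1 y)" using b(1)[of y'] by (simp add: P_def)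
        qed (use v[of y] b(2)[OF near] v(2)[OF near] Q in \<open>auto simp: P_def Q_def\<close>)
        also have "\<dots> = norm (y - y') * (P * pweight M1 y * (Q * pweight M2 y) * (1 + 2 ^ M1))"
          by (simp add: algebra_simps)
        finally show "cmod (v y * b y - v y' * b y') \<le> norm (y - y') * (?B * \<beta> y)" unfolding pq .
      qed
      moreover have "V (smoothing \<delta> (smoothing \<delta> f)) z = (\<integral>y. v y * b y \<partial>gdm \<delta>)"
        unfolding V_eq[of "smoothing \<delta> (smoothing \<delta> f)"] smoothing_smoothing_integral[OF \<delta> at] v_def b_def V_eq[of "dist_of _"] ..
      moreover have "V (finite_rank_sum \<delta> (J n) (c n) f) z = (\<Sum>y\<in>J n. complex_of_real (c n y) * (v y * b y))"
        unfolding finite_rank_sum_def V_sum V_scale v_def b_def by (simp add: mult_ac)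
      ultimately have "cmod (V (smoothing \<delta> (smoothing \<delta> f) - finite_rank_sum \<delta> (J n) (c n) f) z) \<le> er n * ?B"
        by (simp add: V_diff norm_minus_commute)
      also have "\<dots> \<le> en * ?B" using en(2) by (intro mult_right_mono) auto
      finally show ?thesis by (simp add: mult.assoc)
    qed
    have "nm (smoothing \<delta> (smoothing \<delta> f) - finite_rank_sum \<delta> (J n) (c n) f) \<le> \<rho> (\<lambda>z. ennreal (en * N f) * ennreal (bweight L z))"
      unfolding nm_def
      by (rule rho_mono) (use Vle en(1) in \<open>auto simp: ennreal_mult[symmetric] intro: ennreal_leI\<close>)
    also have "\<dots> = ennreal (en * N f) * ennreal R"
      unfolding R(2)[symmetric] using en(1) by (intro rho_cmult) auto
    also have "\<dots> = ennreal (en * R * N f)" using en(1) R(1) by (simp add: ennreal_mult[symmetric] mult_ac)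
    finally have "N (smoothing \<delta> (smoothing \<delta> f) - finite_rank_sum \<delta> (J n) (c n) f) \<le> en * R * N f"
      using N_le en(1) R(1) by (simp add: mult_nonneg_nonneg)
    also have "\<dots> \<le> e * N f" by (intro mult_right_mono en(3)) simp
    finally show ?thesis .
  qed
  moreover have "finite (J n)" using q by (simp add: quadrature_def)
  ultimately show ?thesis by blast
qed

text \<open>The finite sum \<open>F0\<close> has norm at most \<theta>, a number exceeding 1 by
  O(\<delta>). Dividing by \<theta> makes it a contraction and moves each element of the finite set
  by only O(\<delta>).\<close>

lemma finite_rank_near_identity:
  assumes "finite K" "K \<subseteq> X" "0 < e"
  shows "\<exists>F B. (\<forall>f h. F (f + h) = F f + F h) \<and> (\<forall>c f. F (scale_dist c f) = scale_dist c (F f)) \<and>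
    (\<forall>f\<in>X. F f \<in> X \<and> N (F f) \<le> N f) \<and> finite B \<and> B \<subseteq> X \<and> (\<forall>f. F f \<in> dist.span B) \<and>
    (\<forall>f\<in>K. N (f - F f) \<le> e)"
proof -
  \<comment> \<open>Inserting 1 keeps the maximum defined when \<open>K\<close> is empty.\<close>
  define H where "H = Max (insert 1 (N ` K))"
  have H: "1 \<le> H" "\<And>f. f \<in> K \<Longrightarrow> N f \<le> H" using assms(1) by (auto simp: H_def)
  define P where "P = pmoment S"
  have P: "0 \<le> P" by (simp add: P_def pmoment_nonneg)
  \<comment> \<open>Replacing f by its second average costs the distance of f from its average plus
    the average of that difference, the latter enlarged by at most \<open>1 + P\<close>; hence the
    divisor \<open>2 + P\<close>.\<close>
  have "\<forall>f\<in>K. \<exists>d>0. \<forall>\<delta>. 0 \<le> \<delta> \<and> \<delta> \<le> d \<and> \<delta> \<le> 1 \<longrightarrow> N (smoothing \<delta> f - f) \<le> e / (4 * (2 + P))"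
    using smoothing_near_identity[of _ "e / (4 * (2 + P))"] assms P by auto
  then obtain dd where dd: "\<And>f. f \<in> K \<Longrightarrow> 0 < dd f"
    "\<And>f \<delta>. f \<in> K \<Longrightarrow> 0 \<le> \<delta> \<Longrightarrow> \<delta> \<le> dd f \<Longrightarrow> \<delta> \<le> 1 \<Longrightarrow> N (smoothing \<delta> f - f) \<le> e / (4 * (2 + P))" by metis
  \<comment> \<open>\<open>(2 + P) * P + 1\<close> is the constant of \<open>\<theta> - 1\<close>
    relative to \<delta>, and H bounds the norms of the given elements.\<close>
  define W where "W = H * ((2 + P) * P + 1)"
  have W: "0 < W" using H(1) P by (simp add: W_def add_nonneg_pos)
  \<comment> \<open>The bound 1 is required by the estimates for \<open>smoothing\<close>,
    \<open>e / (4 * W)\<close> limits the errors proportional to \<delta>, and \<open>dd\<close>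
    makes the averages close to the given elements.\<close>
  define \<delta> where "\<delta> = Min (insert 1 (insert (e / (4 * W)) (dd ` K)))"
  have fin: "finite (insert 1 (insert (e / (4 * W)) (dd ` K)))" using assms(1) by simp
  have \<delta>: "0 < \<delta>" "\<delta> \<le> 1" "\<delta> \<le> e / (4 * W)" "\<And>f. f \<in> K \<Longrightarrow> \<delta> \<le> dd f"
  proof -
    show "0 < \<delta>" unfolding \<delta>_def using fin assms(3) W dd(1) by (subst Min_gr_iff) auto
    show "\<delta> \<le> 1" "\<delta> \<le> e / (4 * W)" "\<And>f. f \<in> K \<Longrightarrow> \<delta> \<le> dd f"
      unfolding \<delta>_def by (rule Min_le[OF fin], blast)+
  qed
  have d: "\<bar>\<delta>\<bar> \<le> 1" using \<delta> by simp
  \<comment> \<open>The accuracy of the finite sum is tied to \<delta> itself, so that it adds only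
    \<delta> to the norm.\<close>
  obtain J c where J: "finite J" and fr: "\<And>f. f \<in> X \<Longrightarrow> N (smoothing \<delta> (smoothing \<delta> f) - finite_rank_sum \<delta> J c f) \<le> \<delta> * N f"
    using finite_rank_sum_approximates[OF \<delta>(1,2,1)] by blast
  have nz: "\<delta> \<noteq> 0" using \<delta>(1) by simp
  define F0 where "F0 = finite_rank_sum \<delta> J c"
  note F0 = finite_rank_sum_operator[OF J nz, of c, folded F0_def]
  \<comment> \<open>Two applications of the average contribute the square, the quadrature error the
    summand \<delta>.\<close>
  define \<theta> where "\<theta> = (1 + \<delta> * P)\<^sup>2 + \<delta>"
  have \<theta>: "1 \<le> \<theta>" using \<delta> P by (simp add: \<theta>_def power2_eq_square distrib_left distrib_right add_increasing2)
  have \<theta>1: "\<theta> - 1 \<le> \<delta> * ((2 + P) * P + 1)"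
  proof -
    have "\<delta> * (P * P * \<delta>) \<le> \<delta> * (P * P * 1)" using \<delta> P by (intro mult_left_mono) auto
    then show ?thesis by (simp add: \<theta>_def power2_eq_square algebra_simps)
  qed
  have EX: "smoothing \<delta> f \<in> X" "N (smoothing \<delta> f) \<le> (1 + \<delta> * P) * N f" if "f \<in> X" for f
    using smoothing_norm[of \<delta> f] \<delta> that by (auto simp: P_def)
  have F0_norm: "N (F0 f) \<le> \<theta> * N f" if f: "f \<in> X" for f
  proof -
    have "N (F0 f) \<le> N (smoothing \<delta> (smoothing \<delta> f)) + N (F0 f - smoothing \<delta> (smoothing \<delta> f))"
      using N_add[OF EX(1)[OF EX(1)[OF f]] X_diff[OF F0(1) EX(1)[OF EX(1)[OF f]]], of f] by simp
    also have "N (F0 f - smoothing \<delta> (smoothing \<delta> f)) \<le> \<delta> * N f"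
      using fr[OF f] by (simp add: F0_def N_diff_commute)
    also have "N (smoothing \<delta> (smoothing \<delta> f)) \<le> (1 + \<delta> * P) * ((1 + \<delta> * P) * N f)"
      using \<delta> P by (intro order_trans[OF EX(2)[OF EX(1)[OF f]]] mult_left_mono EX(2) f) auto
    finally show ?thesis by (simp add: \<theta>_def power2_eq_square algebra_simps)
  qed
  define F where "F f = scale_dist (complex_of_real (1 / \<theta>)) (F0 f)" for f
  have FX: "F f \<in> X" for f unfolding F_def by (intro X_scale F0(1))
  have F_norm: "N (F f) \<le> N f" if "f \<in> X" for f
    using F0_norm[OF that] \<theta> by (simp add: F_def N_scale divide_le_eq mult.commute norm_divide)
  have F_close: "N (f - F f) \<le> e" if f: "f \<in> K" for f
  proof -
    have fX: "f \<in> X" using f assms(2) by blast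
    have 1: "N (smoothing \<delta> f - f) \<le> e / (4 * (2 + P))" using dd(2)[OF f] \<delta> f by simp
    have EfX: "smoothing \<delta> f - f \<in> X" by (rule X_diff[OF EX(1)[OF fX] fX])
    have "N (smoothing \<delta> (smoothing \<delta> f - f)) \<le> (1 + \<delta> * P) * (e / (4 * (2 + P)))"
      using \<delta> P 1 by (intro order_trans[OF EX(2)[OF EfX]] mult_left_mono) auto
    also have "\<dots> \<le> (1 + P) * (e / (4 * (2 + P)))"
      using \<delta> P assms(3) mult_right_mono[of \<delta> 1 P] by (intro mult_right_mono) auto
    finally have 2: "N (smoothing \<delta> (smoothing \<delta> f) - smoothing \<delta> f) \<le> (1 + P) * (e / (4 * (2 + P)))" by (simp add: smoothing_diff[OF d])
    have 3: "N (F0 f - smoothing \<delta> (smoothing \<delta> f)) \<le> \<delta> * N f" using fr[OF fX] by (simp add: F0_def N_diff_commute)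
    have 4: "N (F f - F0 f) \<le> (\<theta> - 1) * N f"
    proof -
      have "F f - F0 f = scale_dist (complex_of_real (1 / \<theta> - 1)) (F0 f)"
        by (simp add: F_def dist.scale_left_diff_distrib)
      then have "N (F f - F0 f) = \<bar>1 / \<theta> - 1\<bar> * N (F0 f)" by (simp only: N_scale norm_of_real)
      also have "\<bar>1 / \<theta> - 1\<bar> = (\<theta> - 1) / \<theta>" using \<theta> by (simp add: field_simps abs_if)
      also have "(\<theta> - 1) / \<theta> * N (F0 f) \<le> (\<theta> - 1) / \<theta> * (\<theta> * N f)"
        using \<theta> F0_norm[OF fX] by (intro mult_left_mono) auto
      also have "\<dots> = (\<theta> - 1) * N f" using \<theta> by simp
      finally show ?thesis .
    qed
    have E2X: "smoothing \<delta> (smoothing \<delta> f) \<in> X" using EX fX by blast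
    have "N (F f - f) \<le> N (F f - F0 f) + (N (F0 f - smoothing \<delta> (smoothing \<delta> f)) + (N (smoothing \<delta> (smoothing \<delta> f) - smoothing \<delta> f) + N (smoothing \<delta> f - f)))"
    proof -
      have "F f - f = (F f - F0 f) + ((F0 f - smoothing \<delta> (smoothing \<delta> f)) + ((smoothing \<delta> (smoothing \<delta> f) - smoothing \<delta> f) + (smoothing \<delta> f - f)))" by simp
      also have "N \<dots> \<le> N (F f - F0 f) + N ((F0 f - smoothing \<delta> (smoothing \<delta> f)) + ((smoothing \<delta> (smoothing \<delta> f) - smoothing \<delta> f) + (smoothing \<delta> f - f)))"
        by (intro N_add X_add X_diff FX F0(1) E2X EX(1) fX)
      also have "N ((F0 f - smoothing \<delta> (smoothing \<delta> f)) + ((smoothing \<delta> (smoothing \<delta> f) - smoothing \<delta> f) + (smoothing \<delta> f - f))) \<le>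
          N (F0 f - smoothing \<delta> (smoothing \<delta> f)) + N ((smoothing \<delta> (smoothing \<delta> f) - smoothing \<delta> f) + (smoothing \<delta> f - f))"
        by (intro N_add X_add X_diff FX F0(1) E2X EX(1) fX)
      also have "N ((smoothing \<delta> (smoothing \<delta> f) - smoothing \<delta> f) + (smoothing \<delta> f - f)) \<le> N (smoothing \<delta> (smoothing \<delta> f) - smoothing \<delta> f) + N (smoothing \<delta> f - f)"
        by (intro N_add X_diff E2X EX(1) fX)
      finally show ?thesis by simp
    qed
    also have "N (smoothing \<delta> (smoothing \<delta> f) - smoothing \<delta> f) + N (smoothing \<delta> f - f) \<le> e / 4"
    proof -
      have "N (smoothing \<delta> (smoothing \<delta> f) - smoothing \<delta> f) + N (smoothing \<delta> f - f) \<le> (2 + P) * (e / (4 * (2 + P)))"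
        using 1 2 by (simp only: distrib_right)
      also have "\<dots> = e / 4" using P by (simp add: field_simps)
      finally show ?thesis .
    qed
    also have "N (F f - F0 f) + (N (F0 f - smoothing \<delta> (smoothing \<delta> f)) + e / 4) \<le> e"
    proof -
      have "(\<theta> - 1) * N f \<le> \<delta> * ((2 + P) * P + 1) * H" using \<theta>1 H(2)[OF f] \<delta> P by (intro mult_mono) auto
      also have "\<dots> = \<delta> * W" by (simp add: W_def mult_ac)
      also have "\<dots> \<le> e / 4" using \<delta>(3) W by (simp add: field_simps)
      finally have a: "N (F f - F0 f) \<le> e / 4" using 4 by simp
      have "\<delta> * N f \<le> \<delta> * W"
      proof (rule mult_left_mono)
        have "H * 1 \<le> W" unfolding W_def using H(1) P by (intro mult_left_mono) auto
        then show "N f \<le> W" using H(2)[OF f] by simp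
      qed (use \<delta> in simp)
      also have "\<dots> \<le> e / 4" using \<delta>(3) W by (simp add: field_simps)
      finally have "N (F0 f - smoothing \<delta> (smoothing \<delta> f)) \<le> e / 4" using 3 by simp
      then show ?thesis using a assms(3) by simp
    qed
    finally show ?thesis by (simp add: N_diff_commute)
  qed
  show ?thesis
  proof (intro exI[of _ F] exI[of _ "(\<lambda>y. dist_of (gker \<delta> y)) ` J"] conjI allI ballI)
    show "F (f + h) = F f + F h" for f h by (simp add: F_def F0(2) dist.scale_right_distrib)
    show "F (scale_dist r f) = scale_dist r (F f)" for r f by (simp add: F_def F0(3) mult.commute)
    show "F f \<in> dist.span ((\<lambda>y. dist_of (gker \<delta> y)) ` J)" for f
      unfolding F_def by (intro dist.span_scale F0(4))
    show "(\<lambda>y. dist_of (gker \<delta> y)) ` J \<subseteq> X" using dist_of_in_X[OF gker_schwartz[OF nz]] by blast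
  qed (use FX F_norm F_close J in auto)
qed

text \<open>Since F is a contraction, closeness to the identity on a finite
  \<open>\<epsilon> / 4\<close> net passes to the compact set: the distance to the net is counted
  twice and the error on the net once, together less than \<epsilon>.\<close>

theorem metric_approximation: "metric_approximation_property scale_dist X N"
  unfolding metric_approximation_property_def
proof (intro conjI banach_space allI impI)
  fix K :: "'n tempered_distribution set" and \<epsilon> :: real
  assume "compactin (Metric_space.mtopology X (norm_dist X N)) K \<and> 0 < \<epsilon>"
  then have K: "compactin ns.mtopology K" and \<epsilon>: "0 < \<epsilon>" by auto
  have "ns.mtotally_bounded K" by (rule ns.compactin_imp_mtotally_bounded[OF K])
  then obtain K0 where K0: "finite K0" "K0 \<subseteq> K" "K \<subseteq> (\<Union>x\<in>K0. ns.mball x (\<epsilon> / 4))"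
    unfolding ns.mtotally_bounded_def using \<epsilon> by (meson divide_pos_pos zero_less_numeral)
  have KX: "K \<subseteq> X" using K compactin_subset_topspace by fastforce
  obtain F B where F: "\<And>f h. F (f + h) = F f + F h" "\<And>c f. F (scale_dist c f) = scale_dist c (F f)"
    "\<And>f. f \<in> X \<Longrightarrow> F f \<in> X" "\<And>f. f \<in> X \<Longrightarrow> N (F f) \<le> N f" and B: "finite B" "B \<subseteq> X" "\<And>f. F f \<in> dist.span B"
    and close: "\<And>f. f \<in> K0 \<Longrightarrow> N (f - F f) \<le> \<epsilon> / 4"
  proof -
    have "0 < \<epsilon> / 4" using \<epsilon> by simp
    from finite_rank_near_identity[OF K0(1) order_trans[OF K0(2) KX] this]
    obtain F B where "(\<forall>f h. F (f + h) = F f + F h) \<and> (\<forall>c f. F (scale_dist c f) = scale_dist c (F f)) \<and>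
      (\<forall>f\<in>X. F f \<in> X \<and> N (F f) \<le> N f) \<and> finite B \<and> B \<subseteq> X \<and> (\<forall>f. F f \<in> dist.span B) \<and>
      (\<forall>f\<in>K0. N (f - F f) \<le> \<epsilon> / 4)" by (elim exE)
    then show thesis by (intro that[of F B]) auto
  qed
  have op: "ns.operator_on F" unfolding ns.operator_on_def using F by auto
  have 1: "ns.bounded_operator_on F"
    unfolding ns.bounded_operator_on_def using op F(4) by (intro conjI exI[of _ 1]) auto
  have 2: "ns.finite_rank_on F"
    unfolding ns.finite_rank_on_def using B by (intro exI[of _ B]) auto
  have 3: "ns.operator_norm_on F \<le> 1"
    unfolding ns.operator_norm_on_def
  proof (rule cSUP_least)
    show "X \<noteq> {}" using X_0 by blast
    show "N (F f) / N f \<le> 1" if "f \<in> X" for f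
      \<comment> \<open>At the zero vector the quotient is \<open>0\<close> by the convention for
        division by 0.\<close>
      using F(4)[OF that] by (cases "N f = 0") (auto simp: divide_le_eq less_le)
  qed
  have 4: "N (x - F x) < \<epsilon>" if x: "x \<in> K" for x
  proof -
    have xX: "x \<in> X" using x KX by blast
    obtain y where y: "y \<in> K0" "x \<in> ns.mball y (\<epsilon> / 4)" using x K0 by blast
    then have yX: "y \<in> X" and xy: "N (y - x) < \<epsilon> / 4" using xX by (auto simp: ns.in_mball norm_dist_def)
    have Fd: "F (y - x) = F y - F x"
      using F(1)[of "y - x" x] by (simp add: algebra_simps)
    have "N (x - F x) \<le> N (x - y) + N ((y - F y) + (F y - F x))"
      using N_add[OF X_diff[OF xX yX] X_add[OF X_diff[OF yX F(3)[OF yX]] X_diff[OF F(3)[OF yX] F(3)[OF xX]]]] by simp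
    also have "N ((y - F y) + (F y - F x)) \<le> N (y - F y) + N (F y - F x)"
      by (intro N_add X_diff yX F(3) xX)
    also have "N (F y - F x) \<le> N (y - x)" using F(4)[OF X_diff[OF yX xX]] by (simp add: Fd)
    also have "N (x - y) = N (y - x)" by (rule N_diff_commute)
    finally show ?thesis using xy close[OF y(1)] \<epsilon> by simp
  qed
  show "\<exists>F. normed_space_on.bounded_operator_on scale_dist X N F \<and> normed_space_on.finite_rank_on scale_dist X F \<and>
      normed_space_on.operator_norm_on X N F \<le> 1 \<and> (\<forall>x\<in>K. N (x - F x) < \<epsilon>)"
    using 1 2 3 4 by blast
qed

end

section \<open>Modulation and amalgam spaces\<close>

lemma poly_weight_le_pweight: "\<exists>S::nat. \<forall>u::(real^'n::finite) \<times> (real^'n). poly_weight s u \<le> pweight S u"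
proof -
  define S where "S = nat \<lceil>\<bar>s\<bar>\<rceil>"
  have "poly_weight s u \<le> pweight S u" for u :: "(real^'n) \<times> (real^'n)"
  proof -
    have n: "(norm (fst u))\<^sup>2 + (norm (snd u))\<^sup>2 = (norm u)\<^sup>2" by (cases u) (simp add: norm_Pair)
    have "poly_weight s u = (1 + (norm u)\<^sup>2) powr (s / 2)"
      using n by (simp add: poly_weight_def split_beta add.assoc)
    also have "\<dots> \<le> (1 + (norm u)\<^sup>2) powr (\<bar>s\<bar> / 2)" by (intro powr_mono) auto
    also have "\<dots> \<le> ((1 + norm u) powr 2) powr (\<bar>s\<bar> / 2)"
      by (intro powr_mono2) (auto simp: power2_sum add_pos_nonneg powr_numeral)
    also have "\<dots> = (1 + norm u) powr \<bar>s\<bar>" by (simp only: powr_powr) simp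
    also have "\<dots> \<le> (1 + norm u) powr real S" unfolding S_def by (intro powr_mono) auto
    also have "\<dots> = pweight S u" by (simp add: pweight_def powr_realpow add_pos_nonneg)
    finally show ?thesis .
  qed
  then show ?thesis by blast
qed

text \<open>The values at \<open>z + u\<close> lie between \<open>w z / pweight S u\<close> and
  \<open>pweight S u * w z\<close>, and the weight tends to 1 as u tends to 0. Continuity provides
  the Borel measurability used in \<open>bf_norm_mixn\<close>.\<close>

lemma moderate_continuous:
  fixes w :: "'a::real_normed_vector \<Rightarrow> real"
  assumes mod: "\<And>u z. w (u + z) \<le> pweight S u * w z"
  shows "continuous_on UNIV w"
proof (intro continuous_at_imp_continuous_on ballI)
  fix z
  have p: "((\<lambda>u::'a. pweight S u) \<longlongrightarrow> (1 + norm (0::'a)) ^ S) (at 0)"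
    unfolding pweight_def by (intro tendsto_intros)
  have "((\<lambda>u. w (z + u)) \<longlongrightarrow> w z) (at 0)"
  proof (rule tendsto_sandwich)
    have "w z \<le> pweight S u * w (z + u)" for u using mod[of "- u" "z + u"] by simp
    then have "w z / pweight S u \<le> w (z + u)" for u
      using pweight_pos[of S u] by (simp add: divide_le_eq mult.commute)
    then show "\<forall>\<^sub>F u in at 0. w z / pweight S u \<le> w (z + u)" by simp
    show "\<forall>\<^sub>F u in at 0. w (z + u) \<le> pweight S u * w z" using mod[of _ z] by (simp add: add.commute)
    show "((\<lambda>u::'a. w z / pweight S u) \<longlongrightarrow> w z) (at 0)"
      using tendsto_divide[OF tendsto_const p, of "w z"] by simp
    show "((\<lambda>u::'a. pweight S u * w z) \<longlongrightarrow> w z) (at 0)"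
      using tendsto_mult[OF p tendsto_const, of "w z"] by simp
  qed
  then show "isCont w z" by (simp add: isCont_iff)
qed

lemma ennpowr_cmod_weight:
  assumes "0 < (w::real)"
  shows "ennpowr (ennreal (cmod c) * ennreal w) p = ennreal (cmod c powr p * w powr p)"
  using assms by (simp add: ennreal_mult[symmetric] ennpowr_ennreal powr_mult less_imp_le)

lemma mixn_ennpowr:
  assumes "1 \<le> a" "1 \<le> b"
  shows "mixn a b w F = ennpowr (\<integral>\<^sup>+s. ennpowr (\<integral>\<^sup>+t. ennpowr (F (s, t) * ennreal (w (s, t))) a \<partial>lborel) (b / a) \<partial>lborel) (1 / b)"
  by (simp add: mixn_def Lp_def ennpowr_ennpowr)

text \<open>Both spaces are instances of \<open>bf_window\<close> with the given window: the amalgam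
  norm is a mixed norm directly, the modulation norm one with the coordinates of the weight and of
  the transform exchanged.\<close>

theorem corollary3p1:
  fixes p q :: real
    and w :: "(real^'n::finite) \<times> (real^'n) \<Rightarrow> real"
    and g :: "real^'n \<Rightarrow> complex"
  assumes "1 \<le> p" and "1 \<le> q"
    and "weight w" and "\<And>z. 0 < w z"
    and "submultiplicative w" and "polynomially_moderate w"
    and "g \<in> schwartz" and "g \<noteq> (\<lambda>_. 0)"
  shows "metric_approximation_property scale_dist
           (modulation_space g p q w) (modulation_norm g p q w)
       \<and> metric_approximation_property scale_dist
           (amalgam_space g p q w) (amalgam_norm g p q w)"
proof -
  obtain s where s: "\<And>u z. w (u + z) \<le> poly_weight s u * w z"
    using assms(6) unfolding polynomially_moderate_def moderate_def by blast
  obtain S where S: "\<And>u::(real^'n) \<times> (real^'n). poly_weight s u \<le> pweight S u"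
    using poly_weight_le_pweight by blast
  have mod: "w (u + z) \<le> pweight S u * w z" for u z
    using s[of u z] mult_right_mono[OF S[of u], of "w z"] assms(4)[of z] by linarith
  have cont: "continuous_on UNIV w" using mod by (rule moderate_continuous)
  \<comment> \<open>The modulation norm has position as its inner variable, whereas
    \<open>mixn\<close> puts the second coordinate inside; exchanging the coordinates of the weight
    keeps it moderate.\<close>
  define w' where "w' z = w (prod.swap z)" for z
  have "norm (prod.swap u) = norm u" for u :: "(real^'n) \<times> (real^'n)"
    by (cases u) (simp add: norm_Pair add.commute)
  then have mod': "w' (u + z) \<le> pweight S u * w' z" for u z
    using mod[of "prod.swap u" "prod.swap z"] by (cases u; cases z) (simp add: w'_def pweight_def norm_Pair add.commute)
  have cont': "continuous_on UNIV w'" using mod' by (rule moderate_continuous)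
  have pos': "0 < w' z" for z unfolding w'_def by (rule assms(4))
  obtain C where "bf_norm (mixn p q w') S (S + 2 * CARD('n)) C"
    using bf_norm_mixn[OF assms(1,2) cont' pos' mod'] by blast
  then interpret mo: bf_window "\<lambda>F. mixn p q w' (\<lambda>z. F (prod.swap z))" S "S + 2 * CARD('n)" C g
    by (intro bf_window.intro bf_norm_swap bf_window_axioms.intro assms)
  \<comment> \<open>For the amalgam norm the frequency is the inner variable with exponent q, which
    is already the order of \<open>mixn\<close>.\<close>
  obtain C' where "bf_norm (mixn q p w) S (S + 2 * CARD('n)) C'"
    using bf_norm_mixn[OF assms(2,1) cont assms(4) mod] by blast
  then interpret am: bf_window "mixn q p w" S "S + 2 * CARD('n)" C' g
    by (intro bf_window.intro bf_window_axioms.intro assms)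
  have "mo.nm f = modulation_ennorm g p q w f" for f
  proof -
    have "mo.nm f = mixn p q w' (\<lambda>z. ennreal (cmod (mo.V f (prod.swap z))))" by (rule mo.nm_def)
    then show ?thesis
      unfolding mixn_ennpowr[OF assms(1,2)] modulation_ennorm_def
      by (simp add: mo.V_def w'_def ennpowr_cmod_weight[OF assms(4)])
  qed
  then have mo: "mo.X = modulation_space g p q w" "mo.N = modulation_norm g p q w"
    by (auto simp: mo.X_def modulation_space_def mo.N_def modulation_norm_def fun_eq_iff)
  have "am.nm f = amalgam_ennorm g p q w f" for f
  proof -
    have "am.nm f = mixn q p w (\<lambda>z. ennreal (cmod (am.V f z)))" by (rule am.nm_def)
    then show ?thesis
      unfolding mixn_ennpowr[OF assms(2,1)] amalgam_ennorm_def
      by (simp add: am.V_def ennpowr_cmod_weight[OF assms(4)])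
  qed
  then have am: "am.X = amalgam_space g p q w" "am.N = amalgam_norm g p q w"
    by (auto simp: am.X_def amalgam_space_def am.N_def amalgam_norm_def fun_eq_iff)
  show ?thesis
    using mo.metric_approximation am.metric_approximation unfolding mo am by blast
qed

end
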